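(* Let $m,j,k\in\mathbb{Z}$ and fix $M$ sufficiently large. For any scalar functions $\phi^{(1)},\phi^{(2)},\phi^{(3)}$ of $(t,x)$ with frequency-localised pieces $\phi^{(1)}_j,\phi^{(2)}_k,\phi^{(3)}_m$, put $$A:=\|\phi^{(3)}_m\|_{\infty,2}+2^{j-m}\|L\phi^{(3)}_m\|_{\infty,2}+2^{-m}\|\partial_t\phi^{(3)}_m\|_{\infty,2}.$$ The following estimates hold. (1) If $j\lesssim k$ and $j\lesssim m$, then $$\|\phi^{(1)}_j\phi^{(2)}_k\phi^{(3)}_m\|_{1,2}\lesssim 2^{-j/M}\|\phi^{(1)}_j\|_{\frac{2M}{M-1},\infty}\Big(2^{\frac{3k}{2M}}\|\langle\Omega\rangle\phi^{(2)}_k\|_{\frac{2M}{M-1},2M}+2^{3k\frac{M-1}{4M}}\|\phi^{(2)}_k\|_{\frac{2M}{M-1},\frac{4M}{M-1}}\Big)A.$$ (2) If $j\lesssim m$, then $$\|\phi^{(1)}_j\phi^{(2)}_k\phi^{(3)}_m\|_{1,2}\lesssim 2^{-j/M}\Big(2^{\frac{3j}{2M}}\|\langle\Omega\rangle\phi^{(1)}_j\|_{\frac{2M}{M-1},2M}+2^{3j\frac{M-1}{4M}}\|\phi^{(1)}_j\|_{\frac{2M}{M-1},\frac{4M}{M-1}}\Big)\|\phi^{(2)}_k\|_{\frac{2M}{M-1},\infty}A.$$ (3) If $j\lesssim k$, then $$\|\phi^{(1)}_j\phi^{(2)}_k\phi^{(3)}_m\|_{1,2}\lesssim 2^{-j/M}\|\phi^{(1)}_j\|_{\frac{2M}{M-1},\infty}\big(2^{\frac{3k}{2M}}B_1+2^{3k\frac{M-1}{4M}}B_2\big)\|\phi^{(3)}_m\|_{\infty,2},$$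 where $$B_1=\|\langle\Omega\rangle\phi^{(2)}_k\|_{\frac{2M}{M-1},2M}+2^{j-k}\|\langle\Omega\rangle L\phi^{(2)}_k\|_{\frac{2M}{M-1},2M}+2^{-k}\|\langle\Omega\rangle\partial_t\phi^{(2)}_k\|_{\frac{2M}{M-1},2M},$$ $$B_2=\|\phi^{(2)}_k\|_{\frac{2M}{M-1},\frac{4M}{M-1}}+2^{j-k}\|L\phi^{(2)}_k\|_{\frac{2M}{M-1},\frac{4M}{M-1}}+2^{-k}\|\partial_t\phi^{(2)}_k\|_{\frac{2M}{M-1},\frac{4M}{M-1}}.$$ (4) If $j\lesssim k$, then $$\|\phi^{(1)}_j\phi^{(2)}_k\phi^{(3)}_m\|_{1,2}\lesssim 2^{-j/M}\Big(2^{\frac{3j}{2M}}\|\langle\Omega\rangle\phi^{(1)}_j\|_{\frac{2M}{M-1},2M}+2^{3j\frac{M-1}{4M}}\|\phi^{(1)}_j\|_{\frac{2M}{M-1},\frac{4M}{M-1}}\Big)B_3\,\|\phi^{(3)}_m\|_{\infty,2},$$ where $B_3=\|\phi^{(2)}_k\|_{\frac{2M}{M-1},\infty}+2^{j-k}\|L\phi^{(2)}_k\|_{\frac{2M}{M-1},\infty}+2^{-k}\|\partial_t\phi^{(2)}_k\|_{\frac{2M}{M-1},\infty}$.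
   Context: Functions are defined on a time interval times $\mathbb{R}^3$ and are regular enough for the quantities on the right to be finite. $\|u\|_{p,q}=\|u\|_{L^p_tL^q_x}$. Littlewood-Paley: $\chi:\mathbb{R}^3\to\mathbb{R}_+$ smooth (radial), supported in $\{|\xi|\le2\}$, equal to $1$ on $\{|\xi|\le1\}$; $\chi_k(\xi)=\chi(2^{-k}\xi)-\chi(2^{-(k-1)}\xi)$; $\phi_k=P_k\phi=\mathcal{F}_x^{-1}(\chi_k\hat\phi)$. Vector fields: $\Omega_{ab}=x_a\partial_{x_b}-x_b\partial_{x_a}$ ($a,b=1,2,3$), $L_n=x_n\partial_t+t\partial_{x_n}$ ($n=1,2,3$), $L_0:=1$, $L=(1,L_1,L_2,L_3)$, and a norm of $Lu$ is the maximum of the norms of $L_nu$, $n=0,\dots,3$. $L\phi_k$ means $L(P_k\phi)$. $\|\langle\Omega\rangle u\|=\|u\|+\max_{a,b}\|\Omega_{ab}u\|$. $j\lesssim k$ for integers means $j\le k+C$ for a fixed constant $C$. Implicit constants depend only on $M$ and on such $C$. *)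

theory Defs
  imports "HOL-Analysis.Analysis" "HOL-Probability.Essential_Supremum"
begin

section \<open>Mixed Lebesgue norms\<close>

text \<open>Norms take values in \<^typ>\<open>ennreal\<close>, so no finiteness is presupposed. In \<open>ennreal_rpow\<close>
  the exponent is always positive.\<close>

definition ennreal_rpow :: "ennreal \<Rightarrow> real \<Rightarrow> ennreal" where
  "ennreal_rpow x a = (if x = top then top else ennreal (enn2real x powr a))"

definition Lp_norm :: "ennreal \<Rightarrow> 'a measure \<Rightarrow> ('a \<Rightarrow> ennreal) \<Rightarrow> ennreal" where
  "Lp_norm p \<mu> f =
     (if p = \<infinity> then esssup \<mu> f
      else ennreal_rpow (\<integral>\<^sup>+ x. ennreal_rpow (f x) (enn2real p) \<partial>\<mu>) (1 / enn2real p))"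

definition mixed_norm ::
    "real set \<Rightarrow> ennreal \<Rightarrow> ennreal \<Rightarrow> (real \<Rightarrow> real^3 \<Rightarrow> complex) \<Rightarrow> ennreal" where
  "mixed_norm I p q u =
     Lp_norm p (lebesgue_on I) (\<lambda>t. Lp_norm q lebesgue (\<lambda>x. ennreal (norm (u t x))))"


section \<open>Derivatives and vector fields\<close>

definition partial :: "3 \<Rightarrow> (real^3 \<Rightarrow> 'b::real_normed_vector) \<Rightarrow> real^3 \<Rightarrow> 'b" where
  "partial a f x = vector_derivative (\<lambda>s. f (x + s *\<^sub>R axis a 1)) (at 0)"

definition dx :: "3 \<Rightarrow> (real \<Rightarrow> real^3 \<Rightarrow> complex) \<Rightarrow> real \<Rightarrow> real^3 \<Rightarrow> complex" where
  "dx a u t x = partial a (u t) x"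

text \<open>At an end point of the time interval the value of \<open>dt u\<close> is irrelevant: all norms ignore
  null sets of times.\<close>

definition dt :: "(real \<Rightarrow> real^3 \<Rightarrow> complex) \<Rightarrow> real \<Rightarrow> real^3 \<Rightarrow> complex" where
  "dt u t x = vector_derivative (\<lambda>s. u s x) (at t)"

definition Omega :: "3 \<Rightarrow> 3 \<Rightarrow> (real \<Rightarrow> real^3 \<Rightarrow> complex) \<Rightarrow> real \<Rightarrow> real^3 \<Rightarrow> complex" where
  "Omega a b u t x = (x $ a) *\<^sub>R dx b u t x - (x $ b) *\<^sub>R dx a u t x"

definition boost :: "3 \<Rightarrow> (real \<Rightarrow> real^3 \<Rightarrow> complex) \<Rightarrow> real \<Rightarrow> real^3 \<Rightarrow> complex" where
  "boost n u t x = (x $ n) *\<^sub>R dt u t x + t *\<^sub>R dx n u t x"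

text \<open>For a norm \<open>N\<close>, \<open>norm_L N u\<close> is \<open>N\<close> of \<open>L u\<close> (the outer \<open>max\<close> accounts for the component
  \<open>1\<close> of \<open>L\<close>), and \<open>norm_Omega N u\<close> is \<open>N\<close> of \<open>\<langle>\<Omega>\<rangle> u\<close>. Thus \<open>norm_L (norm_Omega N) u\<close> is \<open>N\<close> of
  \<open>\<langle>\<Omega>\<rangle> L u\<close>.\<close>

definition norm_L ::
    "((real \<Rightarrow> real^3 \<Rightarrow> complex) \<Rightarrow> ennreal) \<Rightarrow> (real \<Rightarrow> real^3 \<Rightarrow> complex) \<Rightarrow> ennreal" where
  "norm_L N u = max (N u) (MAX n. N (boost n u))"

definition norm_Omega ::
    "((real \<Rightarrow> real^3 \<Rightarrow> complex) \<Rightarrow> ennreal) \<Rightarrow> (real \<Rightarrow> real^3 \<Rightarrow> complex) \<Rightarrow> ennreal" where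
  "norm_Omega N u = N u + (MAX (a, b)\<in>UNIV. N (Omega a b u))"


section \<open>Littlewood--Paley projections\<close>

text \<open>Differentiability of all iterated partial derivatives, i.e. \<open>C\<^sup>\<infinity>\<close>.\<close>

definition smooth3 :: "(real^3 \<Rightarrow> real) \<Rightarrow> bool" where
  "smooth3 f \<longleftrightarrow> (\<forall>as x. foldr partial as f differentiable (at x))"

definition LP_cutoff :: "(real^3 \<Rightarrow> real) \<Rightarrow> bool" where
  "LP_cutoff chi \<longleftrightarrow>
     smooth3 chi \<and> (\<forall>\<xi>. chi \<xi> \<ge> 0) \<and> (\<forall>\<xi> \<eta>. norm \<xi> = norm \<eta> \<longrightarrow> chi \<xi> = chi \<eta>) \<and>
     (\<forall>\<xi>. norm \<xi> > 2 \<longrightarrow> chi \<xi> = 0) \<and> (\<forall>\<xi>. norm \<xi> \<le> 1 \<longrightarrow> chi \<xi> = 1)"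

definition LP_symbol :: "(real^3 \<Rightarrow> real) \<Rightarrow> int \<Rightarrow> real^3 \<Rightarrow> real" where
  "LP_symbol chi k \<xi> = chi ((2 powi (-k)) *\<^sub>R \<xi>) - chi ((2 powi (-(k - 1))) *\<^sub>R \<xi>)"

definition fourier :: "(real^3 \<Rightarrow> complex) \<Rightarrow> real^3 \<Rightarrow> complex" where
  "fourier f \<xi> = (\<integral>y. f y * cis (- (y \<bullet> \<xi>)) \<partial>lebesgue)"

definition inverse_fourier :: "(real^3 \<Rightarrow> complex) \<Rightarrow> real^3 \<Rightarrow> complex" where
  "inverse_fourier g x = of_real (1 / (2 * pi) ^ 3) * (\<integral>\<xi>. g \<xi> * cis (x \<bullet> \<xi>) \<partial>lebesgue)"

text \<open>Functions of polynomial growth in the mean; they act as tempered distributions.\<close>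

definition tempered :: "(real^3 \<Rightarrow> complex) \<Rightarrow> bool" where
  "tempered f \<longleftrightarrow>
     f \<in> borel_measurable lebesgue \<and> (\<exists>N::nat. integrable lebesgue (\<lambda>x. f x / of_real ((1 + norm x) ^ N)))"

text \<open>The Fourier transform of a tempered \<open>f\<close> as a distribution: it maps a test function \<open>\<psi>\<close> to the
  integral of \<open>f\<close> against the Fourier transform of \<open>\<psi>\<close>.\<close>

definition fourier_dist :: "(real^3 \<Rightarrow> complex) \<Rightarrow> (real^3 \<Rightarrow> complex) \<Rightarrow> complex" where
  "fourier_dist f \<psi> = (\<integral>y. f y * fourier \<psi> y \<partial>lebesgue)"

text \<open>The inverse Fourier transform of a compactly supported distribution \<open>T\<close> is the function
  \<open>x \<mapsto> (2\<pi>)\<^sup>-\<^sup>3 T(\<xi> \<mapsto> exp (i x\<cdot>\<xi>))\<close>; here \<open>T\<close> is the product of \<open>LP_symbol chi k\<close> and the Fourier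
  transform of \<open>f\<close>. For an integrable Borel function \<open>f\<close> all transforms are given by integrals, see
  \<open>LP_proj_integrable\<close> below.\<close>

definition LP_proj :: "(real^3 \<Rightarrow> real) \<Rightarrow> int \<Rightarrow> (real^3 \<Rightarrow> complex) \<Rightarrow> real^3 \<Rightarrow> complex" where
  "LP_proj chi k f x =
     of_real (1 / (2 * pi) ^ 3) * fourier_dist f (\<lambda>\<xi>. of_real (LP_symbol chi k \<xi>) * cis (x \<bullet> \<xi>))"

definition LP_piece ::
    "(real^3 \<Rightarrow> real) \<Rightarrow> int \<Rightarrow> (real \<Rightarrow> real^3 \<Rightarrow> complex) \<Rightarrow> real \<Rightarrow> real^3 \<Rightarrow> complex" where
  "LP_piece chi k \<phi> t = LP_proj chi k (\<phi> t)"


section \<open>Regularity classes\<close>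

definition tempered_on :: "real set \<Rightarrow> (real \<Rightarrow> real^3 \<Rightarrow> complex) \<Rightarrow> bool" where
  "tempered_on I \<phi> \<longleftrightarrow>
     (\<lambda>(t, x). \<phi> t x) \<in> borel_measurable (lebesgue_on (I \<times> UNIV)) \<and> (\<forall>t\<in>I. tempered (\<phi> t))"

text \<open>The derivatives of \<open>u\<close> involving \<open>t\<close> which occur in the norms exist, for almost every time.
  (Littlewood--Paley pieces are automatically smooth in \<open>x\<close>.)\<close>

definition time_regular :: "real set \<Rightarrow> (real \<Rightarrow> real^3 \<Rightarrow> complex) \<Rightarrow> bool" where
  "time_regular I u \<longleftrightarrow>
     (AE t in lebesgue_on I.
        (\<forall>x. (\<lambda>s. u s x) differentiable (at t)) \<and>
        (\<forall>x. dt u t differentiable (at x)) \<and>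
        (\<forall>a. continuous_on UNIV (dx a (dt u) t)))"


section \<open>The projections on integrable functions\<close>

lemma LP_symbol_continuous:
  assumes "LP_cutoff chi"
  shows "continuous_on UNIV (LP_symbol chi k)"
proof -
  have "chi differentiable (at x)" for x
    using assms unfolding LP_cutoff_def smooth3_def by (metis foldr.simps(1) id_apply)
  then have "continuous_on UNIV chi"
    by (simp add: continuous_at_imp_continuous_on differentiable_imp_continuous_within)
  then have *: "continuous_on UNIV (\<lambda>\<xi>. chi (c *\<^sub>R \<xi>))" for c
    by (rule continuous_on_compose2) (auto intro!: continuous_intros)
  show ?thesis
    unfolding LP_symbol_def by (intro continuous_on_diff *)
qed

lemma LP_symbol_support:
  assumes "LP_cutoff chi" "norm \<xi> > 2 powi (k + 1)"
  shows "LP_symbol chi k \<xi> = 0"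
proof -
  have 1: "2 powi (- k) * norm \<xi> > (2::real)"
  proof -
    have "2 powi (- k) * norm \<xi> > 2 powi (- k) * (2::real) powi (k + 1)"
      using assms(2) by (intro mult_strict_left_mono) auto
    also have "2 powi (- k) * (2::real) powi (k + 1) = 2"
      by (simp flip: power_int_add)
    finally show ?thesis .
  qed
  have "(2::real) powi (- (k - 1)) = 2 powi (- k) * 2"
    using power_int_add[of "2::real" "- k" 1] by (simp add: algebra_simps)
  then have 2: "2 powi (- (k - 1)) * norm \<xi> > (2::real)"
    using 1 by simp
  show ?thesis
    using assms(1) 1 2 unfolding LP_cutoff_def LP_symbol_def by simp
qed

lemma LP_symbol_integrable:
  assumes "LP_cutoff chi"
  shows "integrable lborel (LP_symbol chi k)"
proof -
  let ?B = "cball 0 (2 powi (k + 1)) :: (real^3) set"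
  have "integrable lborel (\<lambda>x. indicator ?B x *\<^sub>R LP_symbol chi k x)"
    using borel_integrable_compact[OF compact_cball continuous_on_subset[OF LP_symbol_continuous[OF assms]]]
    by simp
  also have "(\<lambda>x. indicator ?B x *\<^sub>R LP_symbol chi k x) = LP_symbol chi k"
    using LP_symbol_support[OF assms] by (auto simp: indicator_def fun_eq_iff not_le)
  finally show ?thesis .
qed

lemma LP_proj_integrable:
  assumes chi: "LP_cutoff chi" and f: "integrable lborel f"
  shows "LP_proj chi k f x =
    inverse_fourier (\<lambda>\<xi>. of_real (LP_symbol chi k \<xi>) * fourier f \<xi>) x"
proof -
  let ?s = "\<lambda>\<xi>. complex_of_real (LP_symbol chi k \<xi>)"
  have cis: "continuous_on UNIV cis"
    unfolding cis_conv_exp by (intro continuous_intros)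
  have [measurable]: "cis \<in> borel_measurable borel"
    using cis by (rule borel_measurable_continuous_onI)
  have [measurable]: "f \<in> borel_measurable borel" "LP_symbol chi k \<in> borel_measurable borel"
    using f LP_symbol_integrable[OF chi] by auto
  let ?F = "\<lambda>y \<xi>. f y * (?s \<xi> * cis (x \<bullet> \<xi>) * cis (- (\<xi> \<bullet> y)))"
  have fo: "fourier g \<xi> = (\<integral>y. g y * cis (- (y \<bullet> \<xi>)) \<partial>lborel)" if "g \<in> borel_measurable borel" for g \<xi>
    unfolding fourier_def using that by (subst integral_completion) auto
  have fo_meas [measurable]: "fourier g \<in> borel_measurable borel" if [measurable]: "g \<in> borel_measurable borel" for g
  proof -
    have "fourier g = (\<lambda>\<xi>. \<integral>y. g y * cis (- (y \<bullet> \<xi>)) \<partial>lborel)"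
      using that by (simp add: fo fun_eq_iff)
    then show ?thesis by simp
  qed
  have bound: "integrable (lborel \<Otimes>\<^sub>M lborel) (\<lambda>(y, \<xi>). f y * ?s \<xi>)"
  proof (rule lborel_pair.Fubini_integrable)
    show "integrable lborel (\<lambda>y. \<integral>\<xi>. norm (case (y, \<xi>) of (y, \<xi>) \<Rightarrow> f y * ?s \<xi>) \<partial>lborel)"
      using f by (simp add: norm_mult)
    show "AE y in lborel. integrable lborel (\<lambda>\<xi>. case (y, \<xi>) of (y, \<xi>) \<Rightarrow> f y * ?s \<xi>)"
      using LP_symbol_integrable[OF chi, of k] by simp
  qed measurable
  have int: "integrable (lborel \<Otimes>\<^sub>M lborel) (\<lambda>(y, \<xi>). ?F y \<xi>)"
    by (rule Bochner_Integration.integrable_bound[OF bound]) (auto simp: norm_mult)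
  have "fourier_dist f (\<lambda>\<xi>. ?s \<xi> * cis (x \<bullet> \<xi>)) =
      (\<integral>y. f y * fourier (\<lambda>\<xi>. ?s \<xi> * cis (x \<bullet> \<xi>)) y \<partial>lborel)"
    unfolding fourier_dist_def by (subst integral_completion) auto
  also have "\<dots> = (\<integral>y. (\<integral>\<xi>. ?F y \<xi> \<partial>lborel) \<partial>lborel)"
    by (subst fo) simp_all
  also have "\<dots> = (\<integral>\<xi>. (\<integral>y. ?F y \<xi> \<partial>lborel) \<partial>lborel)"
    by (rule lborel_pair.Fubini_integral[OF int, symmetric])
  also have "\<dots> = (\<integral>\<xi>. ?s \<xi> * fourier f \<xi> * cis (x \<bullet> \<xi>) \<partial>lborel)"
  proof (rule Bochner_Integration.integral_cong[OF refl])
    fix \<xi> :: "real^3"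
    have "(\<integral>y. ?F y \<xi> \<partial>lborel) = (\<integral>y. (?s \<xi> * cis (x \<bullet> \<xi>)) * (f y * cis (- (y \<bullet> \<xi>))) \<partial>lborel)"
      by (rule Bochner_Integration.integral_cong) (auto simp: inner_commute)
    also have "\<dots> = ?s \<xi> * fourier f \<xi> * cis (x \<bullet> \<xi>)"
      by (simp add: fo)
    finally show "(\<integral>y. ?F y \<xi> \<partial>lborel) = ?s \<xi> * fourier f \<xi> * cis (x \<bullet> \<xi>)" .
  qed
  also have "\<dots> = (\<integral>\<xi>. ?s \<xi> * fourier f \<xi> * cis (x \<bullet> \<xi>) \<partial>lebesgue)"
    by (subst integral_completion) auto
  finally show ?thesis
    by (simp add: LP_proj_def inverse_fourier_def)
qed

end

theory Submission
  imports Defs "HOL-Probability.Characteristic_Functions" "HOL-Probability.Sinc_Integral"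
begin

text \<open>
  Put \<open>b = 2\<^sup>-\<^sup>j\<close>, \<open>T = \<bar>t\<bar> / b\<close>, and split space at \<open>\<bar>x\<bar> = b T\<^sup>1\<^sup>/\<^sup>2\<close>. A piece of frequency \<open>1 / a\<close> is reproduced by
  averaging at scale \<open>a / 2\<close> and annihilated by averaging at scale \<open>4 a\<close>, so it is bounded pointwise
  by \<open>a\<close> times an average of its gradient. In the inner region \<open>t \<nabla> = L - x \<partial>\<^sub>t\<close> turns this into a
  gain of a power of \<open>T\<close>, at the cost of \<open>L\<close> and \<open>\<partial>\<^sub>t\<close>. In the outer region the values of a piece at
  \<open>x\<close> and at a rotated point differ by an integral of \<open>\<Omega>\<close>-derivatives; averaging over a short arc of
  rotations, which meets each ball of radius \<open>a\<close> only for angles \<open>O(a / \<bar>x\<bar>)\<close>, yields the decay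
  \<open>(a / \<bar>x\<bar>)\<^sup>1\<^sup>/\<^sup>1\<^sup>0\<close>. Altogether the \<open>L\<^sup>2\<close> norm in space of the product carries an extra factor
  \<open>min 1 T\<^sup>-\<^sup>1\<^sup>/\<^sup>2\<^sup>0\<close>. For \<open>M > 20\<close> its \<open>L\<^sup>M\<close> norm in time is a multiple of \<open>b\<^sup>1\<^sup>/\<^sup>M = 2\<^sup>-\<^sup>j\<^sup>/\<^sup>M\<close>, and
  Hoelder's inequality with \<open>1 / M + 2 (M - 1) / (2 M) = 1\<close> gives the estimates.
\<close>

section \<open>Powers and norms in the extended reals\<close>

text \<open>A product of two functions of time in L^(2M/(M-1)) lies in L^(M/(M-1)), which misses L^1
  by the exponent 1/M. Decay in T with any fixed power repairs this once M is large, and its scaling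
  in b produces 2^(-j/M). The four cases differ in which factor pays for the decay. In (1) and (2)
  the third factor pays inside the splitting radius, through L and dt in L^2, and the factor with
  <Omega> pays outside. In (3) the second factor pays in both regions. In (4) the second factor pays
  inside and the first outside. The exponent 1/10 is a lower bound of 1/(2r) for r = 4M/(M-1) <= 5:
  the arc has length (s / rho)^(1/2), with rho the distance of x to the axis of rotation, and
  averaging in L^r gains the power 1/r of that length. Splitting at b T^(1/2) halves 1/10 to 1/20,
  and M >= 40 makes the M-th power at most T^(-2). Omega is never commuted with P_k: the kernel is
  radial, so a rotated piece is reproduced by the same kernel. Sums of norms cost fixed numerical
  factors instead of using Minkowski's inequality.\<close>

lemma ennreal_rpow_ennreal: "x \<ge> 0 \<Longrightarrow> ennreal_rpow (ennreal x) a = ennreal (x powr a)"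
  by (simp add: ennreal_rpow_def)

lemma ennreal_rpow_top [simp]: "ennreal_rpow top a = top"
  by (simp add: ennreal_rpow_def)

lemma ennreal_rpow_0 [simp]: "ennreal_rpow 0 a = 0"
  by (simp add: ennreal_rpow_def)

lemma ennreal_rpow_1 [simp]: "ennreal_rpow x 1 = x"
  by (cases x) (simp_all add: ennreal_rpow_ennreal)

lemma ennreal_rpow_eq_0_iff [simp]: "ennreal_rpow x a = 0 \<longleftrightarrow> x = 0"
  by (cases x) (auto simp: ennreal_rpow_ennreal ennreal_eq_0_iff)

lemma ennreal_rpow_mono: "x \<le> y \<Longrightarrow> a \<ge> 0 \<Longrightarrow> ennreal_rpow x a \<le> ennreal_rpow y a"
  by (cases x; cases y) (auto simp: ennreal_rpow_ennreal powr_mono2 ennreal_leI top_unique)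

text \<open>No sign condition on \<open>a\<close>: 0 goes to 0 and \<open>top\<close> to
  \<open>top\<close> for every exponent, in accordance with the convention 0 * \<open>top\<close> =
  0.\<close>

lemma ennreal_rpow_mult: "ennreal_rpow (x * y) a = ennreal_rpow x a * ennreal_rpow y a"
proof (cases "x = top \<or> y = top")
  case True
  then show ?thesis
    by (cases "x = 0 \<or> y = 0") (auto simp: ennreal_mult_top ennreal_top_mult)
next
  case False
  then obtain x' y' where "x = ennreal x'" "y = ennreal y'" "x' \<ge> 0" "y' \<ge> 0"
    by (metis ennreal_cases)
  then show ?thesis
    by (simp add: ennreal_mult[symmetric] ennreal_rpow_ennreal powr_mult)
qed

lemma ennreal_rpow_rpow: "ennreal_rpow (ennreal_rpow x a) b = ennreal_rpow x (a * b)"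
  by (cases x) (simp_all add: ennreal_rpow_ennreal powr_powr)

lemma ennreal_rpow_add: "ennreal_rpow x (a + b) = ennreal_rpow x a * ennreal_rpow x b"
  by (cases x) (simp_all add: ennreal_rpow_ennreal powr_add ennreal_mult)

lemma ennreal_rpow_2: "ennreal_rpow x 2 = x * x"
  using ennreal_rpow_add[of x 1 1] by simp

lemma measurable_ennreal_rpow [measurable (raw)]:
  assumes [measurable]: "f \<in> borel_measurable M"
  shows "(\<lambda>x. ennreal_rpow (f x) a) \<in> borel_measurable M"
  unfolding ennreal_rpow_def by measurable

text \<open>Hoelder's inequality in interpolation form: a single exponent in (0, 1) replaces a
  conjugate pair. After normalising both integrals to 1 it is the weighted inequality of arithmetic
  and geometric means, integrated.\<close>

lemma nn_integral_Hoelder: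
  assumes [measurable]: "f \<in> borel_measurable M" "g \<in> borel_measurable M"
    and a: "0 < a" "a < 1"
  shows "(\<integral>\<^sup>+x. ennreal_rpow (f x) a * ennreal_rpow (g x) (1 - a) \<partial>M)
    \<le> ennreal_rpow (\<integral>\<^sup>+x. f x \<partial>M) a * ennreal_rpow (\<integral>\<^sup>+x. g x \<partial>M) (1 - a)"
proof -
  define F where "F = (\<integral>\<^sup>+x. f x \<partial>M)"
  define G where "G = (\<integral>\<^sup>+x. g x \<partial>M)"
  have *: "ennreal_rpow x a * ennreal_rpow y (1 - a) \<le> ennreal a * x + ennreal (1 - a) * y" for x y
  proof (cases "x = top \<or> y = top \<or> x = 0 \<or> y = 0")
    case True
    then show ?thesis
      using a by (auto simp: ennreal_mult_top)
  next
    case False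
    then obtain x' y' where xy: "x = ennreal x'" "y = ennreal y'" "x' > 0" "y' > 0"
      by (metis ennreal_cases less_eq_real_def ennreal_0)
    have "x' powr a * y' powr (1 - a) \<le> a * x' + (1 - a) * y'"
      by (rule Youngs_inequality_0) (use a xy in auto)
    then show ?thesis
      using xy a by (simp add: ennreal_rpow_ennreal ennreal_mult[symmetric] ennreal_plus[symmetric] del: ennreal_plus)
  qed
  show ?thesis
  proof (cases "F = 0 \<or> G = 0")
    case True
    then have "AE x in M. ennreal_rpow (f x) a * ennreal_rpow (g x) (1 - a) = 0"
    proof
      assume "F = 0"
      then have "AE x in M. f x = 0"
        unfolding F_def by (simp add: nn_integral_0_iff_AE)
      then show ?thesis by eventually_elim simp
    next
      assume "G = 0"
      then have "AE x in M. g x = 0"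
        unfolding G_def by (simp add: nn_integral_0_iff_AE)
      then show ?thesis by eventually_elim simp
    qed
    then have "(\<integral>\<^sup>+x. ennreal_rpow (f x) a * ennreal_rpow (g x) (1 - a) \<partial>M) = 0"
      by (subst nn_integral_0_iff_AE) auto
    then show ?thesis by simp
  next
    case nz: False
    show ?thesis
    proof (cases "F = top \<or> G = top")
      case True
      then have "ennreal_rpow F a * ennreal_rpow G (1 - a) = top"
        using nz by (auto simp: ennreal_mult_top ennreal_top_mult)
      then show ?thesis by (simp add: F_def G_def)
    next
      case False
      then obtain F' G' where FG: "F = ennreal F'" "G = ennreal G'" "F' > 0" "G' > 0"
        using nz by (metis ennreal_cases less_eq_real_def ennreal_0)
      \<comment> \<open>\<open>c\<close> collects the normalisation: the integrand is at most
        \<open>c\<close> times a convex combination of f / F and g / G, whose integral is a + (1 -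
        a) = 1.\<close>
      define c where "c = ennreal_rpow F a * ennreal_rpow G (1 - a)"
      have split: "x = F * (ennreal (1 / F') * x)" "y = G * (ennreal (1 / G') * y)" for x y
        using FG by (simp_all add: mult.assoc[symmetric] ennreal_mult[symmetric])
      have "(\<integral>\<^sup>+x. ennreal_rpow (f x) a * ennreal_rpow (g x) (1 - a) \<partial>M)
         \<le> (\<integral>\<^sup>+x. c * (ennreal a * (ennreal (1 / F') * f x) + ennreal (1 - a) * (ennreal (1 / G') * g x)) \<partial>M)"
      proof (rule nn_integral_mono)
        fix x
        have "ennreal_rpow (f x) a * ennreal_rpow (g x) (1 - a) =
          c * (ennreal_rpow (ennreal (1 / F') * f x) a * ennreal_rpow (ennreal (1 / G') * g x) (1 - a))"
          by (subst split(1)[of "f x"], subst split(2)[of "g x"])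
             (simp add: c_def ennreal_rpow_mult mult_ac)
        also have "\<dots> \<le> c * (ennreal a * (ennreal (1 / F') * f x) + ennreal (1 - a) * (ennreal (1 / G') * g x))"
          by (intro mult_left_mono *) simp
        finally show "ennreal_rpow (f x) a * ennreal_rpow (g x) (1 - a) \<le> \<dots>" .
      qed
      also have "\<dots> = c * (ennreal a * (ennreal (1 / F') * F) + ennreal (1 - a) * (ennreal (1 / G') * G))"
        unfolding F_def G_def by (simp add: nn_integral_cmult nn_integral_add)
      also have "\<dots> = c"
        using FG a by (simp add: ennreal_mult[symmetric] ennreal_plus[symmetric] del: ennreal_plus)
      finally show ?thesis by (simp add: c_def F_def G_def)
    qed
  qed
qed

text \<open>Jensen's inequality for the measure of density \<open>E\<close>, whose mass is at most
  \<open>m\<close>. It is Hoelder's inequality for the splitting h E = (h^q E)^(1/q) E^(1 - 1/q).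
  Below, \<open>E\<close> is an averaging kernel, the indicator of an interval of angles, or the
  average of a kernel over such an interval.\<close>

lemma nn_integral_weighted_Jensen:
  assumes [measurable]: "h \<in> borel_measurable M" "E \<in> borel_measurable M"
    and q: "1 < q" and m: "(\<integral>\<^sup>+x. E x \<partial>M) \<le> m"
  shows "(\<integral>\<^sup>+x. h x * E x \<partial>M) \<le>
    ennreal_rpow (\<integral>\<^sup>+x. ennreal_rpow (h x) q * E x \<partial>M) (1 / q) * ennreal_rpow m (1 - 1 / q)"
proof -
  have "h x * E x = ennreal_rpow (ennreal_rpow (h x) q * E x) (1 / q) * ennreal_rpow (E x) (1 - 1 / q)" for x
    using q ennreal_rpow_add[of "E x" "1 / q" "1 - 1 / q"]
    by (simp add: ennreal_rpow_mult ennreal_rpow_rpow mult_ac)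
  then have "(\<integral>\<^sup>+x. h x * E x \<partial>M) =
      (\<integral>\<^sup>+x. ennreal_rpow (ennreal_rpow (h x) q * E x) (1 / q) * ennreal_rpow (E x) (1 - 1 / q) \<partial>M)"
    by simp
  also have "\<dots> \<le> ennreal_rpow (\<integral>\<^sup>+x. ennreal_rpow (h x) q * E x \<partial>M) (1 / q)
      * ennreal_rpow (\<integral>\<^sup>+x. E x \<partial>M) (1 - 1 / q)"
    by (rule nn_integral_Hoelder) (use q in auto)
  also have "\<dots> \<le> ennreal_rpow (\<integral>\<^sup>+x. ennreal_rpow (h x) q * E x \<partial>M) (1 / q) * ennreal_rpow m (1 - 1 / q)"
    using q m by (intro mult_left_mono ennreal_rpow_mono) auto
  finally show ?thesis .
qed

text \<open>The L^p norm of a function with values in \<open>ennreal\<close>. It stays an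
  abbreviation so that the rules for \<open>ennreal_rpow\<close> and for integrals apply to it
  directly.\<close>

abbreviation LM :: "'a measure \<Rightarrow> real \<Rightarrow> ('a \<Rightarrow> ennreal) \<Rightarrow> ennreal" where
  "LM M p F \<equiv> ennreal_rpow (\<integral>\<^sup>+t. ennreal_rpow (F t) p \<partial>M) (1 / p)"

abbreviation Lq :: "real \<Rightarrow> (real^3 \<Rightarrow> ennreal) \<Rightarrow> ennreal" where
  "Lq \<equiv> LM lborel"

lemma Lp_norm_lebesgue: "0 < q \<Longrightarrow> Lp_norm (ennreal q) lebesgue h = Lq q h"
  by (simp add: Lp_norm_def nn_integral_completion)

lemma Lp_norm_ennreal:
  "0 < q \<Longrightarrow> Lp_norm (ennreal q) \<mu> h = ennreal_rpow (\<integral>\<^sup>+x. ennreal_rpow (h x) q \<partial>\<mu>) (1 / q)"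
  by (simp add: Lp_norm_def)

lemma LM_mono: "0 < p \<Longrightarrow> (\<And>x. h x \<le> g x) \<Longrightarrow> LM M p h \<le> LM M p g"
  by (intro ennreal_rpow_mono nn_integral_mono) auto

lemma LM_cmult:
  assumes "0 < q" "h \<in> borel_measurable M"
  shows "LM M q (\<lambda>x. c * h x) = c * LM M q h"
  using assms by (simp add: ennreal_rpow_mult nn_integral_cmult ennreal_rpow_rpow)

text \<open>One factor 2 comes from h + g <= 2 max(h, g), the other from F + G <= 2 max(F, G) <= 2^q
  max(F, G) for the two integrals; after the q-th root they multiply to 4.\<close>

lemma LM_add_le:
  assumes [measurable]: "h \<in> borel_measurable M" "g \<in> borel_measurable M" and q: "1 \<le> q"
  shows "LM M q (\<lambda>x. h x + g x) \<le> 4 * (LM M q h + LM M q g)"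
proof -
  have "ennreal_rpow (h x + g x) q \<le> ennreal_rpow 2 q * (ennreal_rpow (h x) q + ennreal_rpow (g x) q)" for x
  proof -
    have "h x + g x \<le> 2 * max (h x) (g x)"
      by (simp add: mult_2 add_mono)
    then have "ennreal_rpow (h x + g x) q \<le> ennreal_rpow (2 * max (h x) (g x)) q"
      using q by (intro ennreal_rpow_mono) auto
    also have "\<dots> \<le> ennreal_rpow 2 q * (ennreal_rpow (h x) q + ennreal_rpow (g x) q)"
      unfolding ennreal_rpow_mult by (intro mult_left_mono) (auto simp: max_def)
    finally show ?thesis .
  qed
  then have "(\<integral>\<^sup>+x. ennreal_rpow (h x + g x) q \<partial>M) \<le>
      (\<integral>\<^sup>+x. ennreal_rpow 2 q * (ennreal_rpow (h x) q + ennreal_rpow (g x) q) \<partial>M)"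
    by (rule nn_integral_mono)
  also have "\<dots> = ennreal_rpow 2 q *
      ((\<integral>\<^sup>+x. ennreal_rpow (h x) q \<partial>M) + (\<integral>\<^sup>+x. ennreal_rpow (g x) q \<partial>M))" (is "_ = _ * (?F + ?G)")
    by (simp add: nn_integral_cmult nn_integral_add)
  also have "\<dots> \<le> ennreal_rpow 2 q * (ennreal_rpow 2 q * max ?F ?G)"
  proof (intro mult_left_mono)
    have "(2::ennreal) \<le> ennreal_rpow 2 q"
      using q powr_mono[of 1 q 2] ennreal_rpow_ennreal[of 2 q] ennreal_leI by fastforce
    then have "2 * max ?F ?G \<le> ennreal_rpow 2 q * max ?F ?G"
      by (intro mult_right_mono) auto
    moreover have "?F + ?G \<le> 2 * max ?F ?G"
      by (simp add: mult_2 add_mono)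
    ultimately show "?F + ?G \<le> ennreal_rpow 2 q * max ?F ?G" by order
  qed simp
  finally have "LM M q (\<lambda>x. h x + g x) \<le> ennreal_rpow (ennreal_rpow 2 q * (ennreal_rpow 2 q * max ?F ?G)) (1 / q)"
    using q by (intro ennreal_rpow_mono) auto
  also have "\<dots> = 4 * ennreal_rpow (max ?F ?G) (1 / q)"
    using q by (simp add: ennreal_rpow_mult ennreal_rpow_rpow mult.assoc[symmetric])
  also have "\<dots> \<le> 4 * (LM M q h + LM M q g)"
    by (intro mult_left_mono) (auto simp: max_def)
  finally show ?thesis .
qed

lemma ennreal_le_numeral_mult: "(x::ennreal) \<le> numeral n * x"
proof -
  have "(1::ennreal) \<le> numeral n"
    using ennreal_leI[of 1 "numeral n"] by simp
  from mult_right_mono[OF this, of x] show ?thesis by simp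
qed

lemma LM_sum3_le:
  assumes [measurable]: "\<And>n::3. F n \<in> borel_measurable M" and p: "1 \<le> p"
  shows "LM M p (\<lambda>y. \<Sum>n\<in>UNIV. F n y) \<le> 16 * (\<Sum>n\<in>UNIV. LM M p (F n))"
proof -
  have "LM M p (\<lambda>y. F 1 y + F 2 y + F 3 y) \<le> 4 * (LM M p (\<lambda>y. F 1 y + F 2 y) + LM M p (F 3))"
    by (rule LM_add_le) (use p in auto)
  also have "\<dots> \<le> 4 * (4 * (LM M p (F 1) + LM M p (F 2)) + 4 * LM M p (F 3))"
    by (intro mult_left_mono add_mono LM_add_le ennreal_le_numeral_mult) (use p in auto)
  also have "\<dots> = 16 * (LM M p (F 1) + LM M p (F 2) + LM M p (F 3))"
    by (simp add: distrib_left mult.assoc[symmetric])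
  finally show ?thesis by (simp add: sum_3)
qed

section \<open>Translation, reflection and dilation of integrals\<close>

lemma nn_integral_translate:
  fixes f :: "real^3 \<Rightarrow> ennreal"
  assumes [measurable]: "f \<in> borel_measurable borel"
  shows "(\<integral>\<^sup>+x. f (x - y) \<partial>lborel) = (\<integral>\<^sup>+x. f x \<partial>lborel)"
proof -
  have "(\<integral>\<^sup>+x. f x \<partial>lborel) = (\<integral>\<^sup>+x. f x \<partial>distr lborel borel ((+) (- y)))"
    by (simp add: lborel_distr_plus)
  also have "\<dots> = (\<integral>\<^sup>+x. f (x - y) \<partial>lborel)"
    by (subst nn_integral_distr) auto
  finally show ?thesis by simp
qed

lemma nn_integral_reflect:
  fixes f :: "real^3 \<Rightarrow> ennreal"
  assumes [measurable]: "f \<in> borel_measurable borel"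
  shows "(\<integral>\<^sup>+y. f (x - y) \<partial>lborel) = (\<integral>\<^sup>+x. f x \<partial>lborel)"
proof -
  have "(\<integral>\<^sup>+x. f x \<partial>lborel) = (\<integral>\<^sup>+x. f x \<partial>density (distr lborel borel (\<lambda>y. x + (-1) *\<^sub>R y)) (\<lambda>_. ennreal (\<bar>-1\<bar> ^ DIM(real^3))))"
    by (subst lborel_affine[of "-1" x]) auto
  also have "\<dots> = (\<integral>\<^sup>+y. f (x - y) \<partial>lborel)"
    by (subst nn_integral_density) (auto simp: nn_integral_distr)
  finally show ?thesis by simp
qed

lemma nn_integral_scale:
  fixes f :: "real^3 \<Rightarrow> ennreal"
  assumes [measurable]: "f \<in> borel_measurable borel" and "c > 0"
  shows "(\<integral>\<^sup>+x. f x \<partial>lborel) = ennreal (c ^ 3) * (\<integral>\<^sup>+x. f (c *\<^sub>R x) \<partial>lborel)"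
  using \<open>c > 0\<close>
  by (subst lborel_affine[of c 0]) (simp_all add: nn_integral_density nn_integral_distr nn_integral_cmult)

section \<open>Differentiation along lines and under the integral sign\<close>

lemma vector_derivative_bound_on:
  fixes f :: "real \<Rightarrow> 'b::real_normed_vector"
  assumes "convex S" "\<And>s. s \<in> S \<Longrightarrow> (f has_vector_derivative f' s) (at s)" "\<And>s. s \<in> S \<Longrightarrow> norm (f' s) \<le> B"
    and "a \<in> S" "b \<in> S"
  shows "norm (f b - f a) \<le> B * \<bar>b - a\<bar>"
proof -
  have "norm (f b - f a) \<le> B * norm (b - a)"
  proof (rule differentiable_bound[OF assms(1)])
    show "(f has_derivative (\<lambda>h. h *\<^sub>R f' x)) (at x within S)" if "x \<in> S" for x
      using assms(2)[OF that] unfolding has_vector_derivative_def by (rule has_derivative_at_withinI)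
    show "onorm (\<lambda>h. h *\<^sub>R f' x) \<le> B" if "x \<in> S" for x
      by (rule onorm_bound)
         (use assms(3)[OF that] norm_ge_zero[of "f' x"] in \<open>linarith, auto simp: mult.commute[of B] intro: mult_left_mono\<close>)
  qed (use assms in auto)
  then show ?thesis by simp
qed

lemma vector_derivative_bound:
  fixes f :: "real \<Rightarrow> 'b::real_normed_vector"
  assumes "\<And>s. (f has_vector_derivative f' s) (at s)" "\<And>s. norm (f' s) \<le> B"
  shows "norm (f b - f a) \<le> B * \<bar>b - a\<bar>"
  using vector_derivative_bound_on[OF convex_UNIV, of f f' B a b] assms by auto

lemma has_vector_derivative_0_iff:
  fixes f :: "real \<Rightarrow> 'b::real_normed_vector"
  shows "(f has_vector_derivative D) (at 0) \<longleftrightarrow> ((\<lambda>s. (f s - f 0) /\<^sub>R s) \<longlongrightarrow> D) (at 0)"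
proof -
  have "(f has_vector_derivative D) (at 0) \<longleftrightarrow> ((\<lambda>s. (f s - f 0 - s *\<^sub>R D) /\<^sub>R \<bar>s\<bar>) \<longlongrightarrow> 0) (at 0)"
    by (simp add: has_vector_derivative_def has_derivative_within bounded_linear_scaleR_left)
       (simp add: divide_inverse scaleR_conv_of_real diff_diff_eq)
  also have "\<dots> \<longleftrightarrow> ((\<lambda>s. (f s - f 0) /\<^sub>R s - D) \<longlongrightarrow> 0) (at 0)"
  proof -
    have "norm ((f s - f 0 - s *\<^sub>R D) /\<^sub>R \<bar>s\<bar>) = norm ((f s - f 0) /\<^sub>R s - D)" if "s \<noteq> 0" for s
    proof -
      have "(f s - f 0) /\<^sub>R s - D = (f s - f 0 - s *\<^sub>R D) /\<^sub>R s"
        using that by (simp add: algebra_simps)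
      then show ?thesis using that by simp
    qed
    then have "\<forall>\<^sub>F s in at 0. norm ((f s - f 0 - s *\<^sub>R D) /\<^sub>R \<bar>s\<bar>) = norm ((f s - f 0) /\<^sub>R s - D)"
      by (simp add: eventually_at_filter)
    then show ?thesis
      by (subst (1 2) tendsto_norm_zero_iff[symmetric]) (rule tendsto_cong)
  qed
  also have "\<dots> \<longleftrightarrow> ((\<lambda>s. (f s - f 0) /\<^sub>R s) \<longlongrightarrow> D) (at 0)"
    by (rule LIM_zero_iff)
  finally show ?thesis .
qed

text \<open>Directional derivatives are stated throughout at parameter 0, for every base point; this
  rule moves them to an arbitrary point of the line.\<close>

lemma has_vector_derivative_shift:
  fixes s :: real
  assumes "((\<lambda>r. f (s + r)) has_vector_derivative D) (at 0)"
  shows "(f has_vector_derivative D) (at s)"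
proof -
  have "((\<lambda>r. r - s) has_vector_derivative 1) (at s)"
    by (auto intro!: derivative_eq_intros)
  from vector_diff_chain_at[OF this, of "\<lambda>r. f (s + r)" D] show ?thesis
    using assms by (simp add: comp_def)
qed

text \<open>Dominated convergence for the difference quotients along an arbitrary sequence tending
  to 0. The bound on the increments is asked for |s| < 1 only, because shifted kernels are dominated
  only for bounded shifts.\<close>

lemma has_vector_derivative_integral:
  fixes F :: "real \<Rightarrow> 'a \<Rightarrow> 'b::{banach, second_countable_topology}"
  assumes int: "\<And>s. integrable M (F s)"
    and deriv: "\<And>x. x \<in> space M \<Longrightarrow> ((\<lambda>s. F s x) has_vector_derivative F' x) (at 0)"
    and bound: "\<And>s x. x \<in> space M \<Longrightarrow> \<bar>s\<bar> < 1 \<Longrightarrow> norm (F s x - F 0 x) \<le> \<bar>s\<bar> * g x"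
    and g: "integrable M g" and [measurable]: "F' \<in> borel_measurable M"
  shows "((\<lambda>s. \<integral>x. F s x \<partial>M) has_vector_derivative (\<integral>x. F' x \<partial>M)) (at 0)"
  unfolding has_vector_derivative_0_iff tendsto_at_iff_sequentially comp_def
proof safe
  fix X :: "nat \<Rightarrow> real" assume X: "\<forall>i. X i \<in> UNIV - {0}" "X \<longlonglongrightarrow> 0"
  \<comment> \<open>The terms with |X i| >= 1, finitely many, are replaced by a nonzero number below
    1, so that the domination holds for every index.\<close>
  define Y where "Y i = (if \<bar>X i\<bar> < 1 then X i else 1/2)" for i
  have Y: "Y i \<noteq> 0" "\<bar>Y i\<bar> < 1" for i using X by (auto simp: Y_def)
  have "\<forall>\<^sub>F i in sequentially. \<bar>X i\<bar> < 1"
    using X(2) by (metis order_tendstoD(2) tendsto_rabs_zero zero_less_one)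
  then have ev: "\<forall>\<^sub>F i in sequentially. Y i = X i"
    by eventually_elim (simp add: Y_def)
  have "Y \<longlonglongrightarrow> 0"
    using X(2) tendsto_cong[OF ev] by blast
  then have Y0: "filterlim Y (at 0) sequentially"
    using Y by (simp add: filterlim_at)
  have "(\<lambda>i. \<integral>x. (F (Y i) x - F 0 x) /\<^sub>R Y i \<partial>M) \<longlonglongrightarrow> (\<integral>x. F' x \<partial>M)"
  proof (rule integral_dominated_convergence[where w = g])
    show "AE x in M. (\<lambda>i. (F (Y i) x - F 0 x) /\<^sub>R Y i) \<longlonglongrightarrow> F' x"
      using deriv[unfolded has_vector_derivative_0_iff] filterlim_compose[OF _ Y0] by (intro AE_I2) blast
    show "AE x in M. norm ((F (Y i) x - F 0 x) /\<^sub>R Y i) \<le> g x" for i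
      using bound[OF _ Y(2)] Y by (intro AE_I2) (simp add: divide_simps mult.commute)
  qed (use int g in auto)
  then have "(\<lambda>i. ((\<integral>x. F (Y i) x \<partial>M) - (\<integral>x. F 0 x \<partial>M)) /\<^sub>R Y i) \<longlonglongrightarrow> (\<integral>x. F' x \<partial>M)"
    using int by simp
  then show "(\<lambda>i. ((\<integral>x. F (X i) x \<partial>M) - (\<integral>x. F 0 x \<partial>M)) /\<^sub>R X i) \<longlonglongrightarrow> (\<integral>x. F' x \<partial>M)"
    by (rule Lim_transform_eventually) (use ev in eventually_elim, simp)
qed

section \<open>Fourier integrals of compactly supported functions\<close>

text \<open>Compactly supported symbols with continuity only; where a derivative is needed, it is
  supplied as a second bump. The class is stable under multiplication by \<open>cis\<close> and by
  coordinates.\<close>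

definition bump :: "real \<Rightarrow> (real^3 \<Rightarrow> complex) \<Rightarrow> bool" where
  "bump B h \<longleftrightarrow> continuous_on UNIV h \<and> (\<forall>\<xi>. norm \<xi> > B \<longrightarrow> h \<xi> = 0)"

text \<open>The inverse Fourier integral without the factor (2 pi)^(-3), which is put back in
  \<open>kap\<close> and \<open>LPk\<close>.\<close>

definition kern :: "(real^3 \<Rightarrow> complex) \<Rightarrow> real^3 \<Rightarrow> complex" where
  "kern h z = (\<integral>\<xi>. h \<xi> * cis (z \<bullet> \<xi>) \<partial>lborel)"

lemma measurable_cis [measurable]: "cis \<in> borel_measurable borel"
  by (intro borel_measurable_continuous_onI continuous_intros)

lemma bump_measurable [measurable_dest]: "bump B h \<Longrightarrow> h \<in> borel_measurable borel"
  unfolding bump_def by (auto intro: borel_measurable_continuous_onI)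

lemma bump_bounded:
  assumes "bump B h" obtains C where "C \<ge> 0" "\<And>\<xi>. norm (h \<xi>) \<le> C * indicator (cball 0 B) \<xi>"
proof -
  have "continuous_on (cball 0 B) h"
    using assms continuous_on_subset unfolding bump_def by blast
  then have "bounded (h ` cball 0 B)"
    by (intro compact_imp_bounded compact_continuous_image compact_cball)
  then obtain C where "\<forall>y\<in>h ` cball 0 B. norm y \<le> C"
    unfolding bounded_iff by blast
  then have C: "norm (h x) \<le> C" if "x \<in> cball 0 B" for x
    using that by blast
  show ?thesis
  proof (rule that[of "max C 0"])
    fix \<xi> show "norm (h \<xi>) \<le> max C 0 * indicator (cball 0 B) \<xi>"
    proof (cases "norm \<xi> \<le> B")
      case True
      then have "norm (h \<xi>) \<le> C" by (intro C) (simp add: mem_cball)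
      with True show ?thesis by (simp add: max.coboundedI1)
    next
      case False
      then show ?thesis using assms by (simp add: bump_def)
    qed
  qed simp
qed

lemma integrable_indicator_cball: "integrable lborel (\<lambda>\<xi>. C * indicator (cball (0::real^3) B) \<xi> :: real)"
  by (intro integrable_mult_right integrable_real_indicator) (use emeasure_lborel_cball_finite[of "0::real^3" B] in auto)

lemma bump_integrable:
  assumes "bump B h" shows "integrable lborel h"
proof -
  note [measurable] = bump_measurable[OF assms]
  obtain C where C: "\<And>\<xi>. norm (h \<xi>) \<le> C * indicator (cball 0 B) \<xi>"
    using bump_bounded[OF assms] by metis
  show ?thesis
  proof (rule Bochner_Integration.integrable_bound[OF integrable_indicator_cball[of C B]])
    show "AE \<xi> in lborel. norm (h \<xi>) \<le> norm (C * indicator (cball 0 B) \<xi> :: real)"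
      by (intro AE_I2 order_trans[OF C]) simp
  qed measurable
qed

lemma bump_mult: "bump B h \<Longrightarrow> continuous_on UNIV g \<Longrightarrow> bump B (\<lambda>\<xi>. g \<xi> * h \<xi>)"
  by (auto simp: bump_def intro!: continuous_intros)

lemma bump_add: "bump B h \<Longrightarrow> bump B g \<Longrightarrow> bump B (\<lambda>\<xi>. h \<xi> + g \<xi>)"
  by (auto simp: bump_def intro!: continuous_intros)

lemma kern_integrable:
  assumes "bump B h" shows "integrable lborel (\<lambda>\<xi>. h \<xi> * cis (z \<bullet> \<xi>))"
proof -
  have "continuous_on UNIV (\<lambda>\<xi>. cis (z \<bullet> \<xi>))"
    by (intro continuous_intros)
  from bump_integrable[OF bump_mult[OF assms this]] show ?thesis
    by (simp only: mult.commute)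
qed

lemma norm_kern_le: "norm (kern h z) \<le> (\<integral>\<xi>. norm (h \<xi>) \<partial>lborel)"
  unfolding kern_def by (rule order_trans[OF integral_norm_bound]) (simp add: norm_mult)

lemma continuous_kern:
  assumes h: "bump B h" shows "continuous_on UNIV (kern h)"
  unfolding continuous_on_sequentially comp_def kern_def
proof safe
  fix X :: "nat \<Rightarrow> real^3" and z assume X: "X \<longlonglongrightarrow> z"
  note [measurable] = bump_measurable[OF h]
  show "(\<lambda>n. \<integral>\<xi>. h \<xi> * cis (X n \<bullet> \<xi>) \<partial>lborel) \<longlonglongrightarrow> (\<integral>\<xi>. h \<xi> * cis (z \<bullet> \<xi>) \<partial>lborel)"
  proof (rule integral_dominated_convergence[where w = "\<lambda>\<xi>. norm (h \<xi>)"])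
    show "AE \<xi> in lborel. (\<lambda>n. h \<xi> * cis (X n \<bullet> \<xi>)) \<longlonglongrightarrow> h \<xi> * cis (z \<bullet> \<xi>)"
      unfolding cis_conv_exp using X by (intro AE_I2 tendsto_intros)
  qed (use bump_integrable[OF h] in \<open>auto simp: norm_mult\<close>)
qed

lemma cis_line_has_derivative:
  "((\<lambda>s. cis (c + s * d)) has_vector_derivative \<i> * of_real d * cis (c + s * d)) (at s)"
proof -
  have "((\<lambda>s. \<i> * of_real (c + s * d)) has_vector_derivative \<i> * of_real d) (at s)"
    by (intro has_vector_derivative_mult_right has_vector_derivative_of_real)
       (auto intro!: derivative_eq_intros)
  from field_vector_diff_chain_at[OF this DERIV_exp] show ?thesis
    by (simp add: cis_conv_exp comp_def)
qed

lemma kern_has_derivative: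
  assumes h: "bump B h"
  shows "((\<lambda>s. kern h (z + s *\<^sub>R e)) has_vector_derivative
    (\<Sum>b\<in>UNIV. e $ b *\<^sub>R kern (\<lambda>\<xi>. \<i> * of_real (\<xi> $ b) * h \<xi>) z)) (at 0)"
proof -
  note [measurable] = bump_measurable[OF h]
  have b: "bump B (\<lambda>\<xi>. \<i> * of_real (\<xi> $ b) * h \<xi>)" for b
    by (intro bump_mult h continuous_intros)
  have norm_bump: "integrable lborel (\<lambda>\<xi>. norm (e \<bullet> \<xi>) * norm (h \<xi>))"
  proof -
    have "integrable lborel (\<lambda>\<xi>. of_real (e \<bullet> \<xi>) * h \<xi>)"
      by (rule bump_integrable, rule bump_mult[OF h]) (intro continuous_intros)
    then show ?thesis
      by (drule_tac integrable_norm) (simp add: norm_mult)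
  qed
  have D: "((\<lambda>s. h \<xi> * cis (c + s * d)) has_vector_derivative \<i> * of_real d * h \<xi> * cis (c + s * d)) (at s)" for \<xi> s c d
    using has_vector_derivative_mult_right[OF cis_line_has_derivative, of "h \<xi>" c d s] by (simp add: mult.left_commute mult.assoc)
  have "((\<lambda>s. \<integral>\<xi>. h \<xi> * cis ((z + s *\<^sub>R e) \<bullet> \<xi>) \<partial>lborel) has_vector_derivative
      (\<integral>\<xi>. \<i> * of_real (e \<bullet> \<xi>) * h \<xi> * cis (z \<bullet> \<xi>) \<partial>lborel)) (at 0)"
  proof (rule has_vector_derivative_integral[where g = "\<lambda>\<xi>. norm (e \<bullet> \<xi>) * norm (h \<xi>)"])
    fix \<xi>
    show "((\<lambda>s. h \<xi> * cis ((z + s *\<^sub>R e) \<bullet> \<xi>)) has_vector_derivative \<i> * of_real (e \<bullet> \<xi>) * h \<xi> * cis (z \<bullet> \<xi>)) (at 0)"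
      using D[of \<xi> "z \<bullet> \<xi>" "e \<bullet> \<xi>" 0] by (simp add: inner_add_left)
    show "norm (h \<xi> * cis ((z + s *\<^sub>R e) \<bullet> \<xi>) - h \<xi> * cis ((z + 0 *\<^sub>R e) \<bullet> \<xi>)) \<le> \<bar>s\<bar> * (norm (e \<bullet> \<xi>) * norm (h \<xi>))" for s
      using vector_derivative_bound[OF D[of \<xi> "z \<bullet> \<xi>" "e \<bullet> \<xi>"], of "norm (e \<bullet> \<xi>) * norm (h \<xi>)" s 0]
      by (simp add: inner_add_left norm_mult mult_ac)
  qed (use kern_integrable[OF h] norm_bump in auto)
  also have "(\<integral>\<xi>. \<i> * of_real (e \<bullet> \<xi>) * h \<xi> * cis (z \<bullet> \<xi>) \<partial>lborel) =
      (\<integral>\<xi>. (\<Sum>b\<in>UNIV. e $ b *\<^sub>R ((\<i> * of_real (\<xi> $ b) * h \<xi>) * cis (z \<bullet> \<xi>))) \<partial>lborel)"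
    by (intro Bochner_Integration.integral_cong refl)
       (simp add: inner_vec_def sum_distrib_left sum_distrib_right scaleR_conv_of_real mult_ac)
  also have "\<dots> = (\<Sum>b\<in>UNIV. e $ b *\<^sub>R kern (\<lambda>\<xi>. \<i> * of_real (\<xi> $ b) * h \<xi>) z)"
    unfolding kern_def by (subst Bochner_Integration.integral_sum) (use kern_integrable[OF b] in auto)
  finally show ?thesis unfolding kern_def .
qed

lemma integral_translate:
  fixes f :: "real^3 \<Rightarrow> 'b::{banach, second_countable_topology}"
  assumes [measurable]: "f \<in> borel_measurable borel"
  shows "(\<integral>x. f (y + x) \<partial>lborel) = (\<integral>x. f x \<partial>lborel)"
proof -
  have "(\<integral>x. f x \<partial>lborel) = (\<integral>x. f x \<partial>distr lborel borel ((+) y))"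
    by (simp add: lborel_distr_plus)
  also have "\<dots> = (\<integral>x. f (y + x) \<partial>lborel)"
    by (subst integral_distr) auto
  finally show ?thesis by simp
qed

lemma integral_scale:
  fixes f :: "real^3 \<Rightarrow> complex"
  assumes [measurable]: "f \<in> borel_measurable borel" and "c > 0"
  shows "(\<integral>x. f x \<partial>lborel) = of_real (c ^ 3) * (\<integral>x. f (c *\<^sub>R x) \<partial>lborel)"
proof -
  have "(\<integral>x. f x \<partial>lborel) = (\<integral>x. f x \<partial>density (distr lborel borel (\<lambda>y. 0 + c *\<^sub>R y)) (\<lambda>_. ennreal (\<bar>c\<bar> ^ DIM(real^3))))"
    by (subst lborel_affine[of c 0]) (use assms in auto)
  also have "\<dots> = (\<integral>x. c ^ 3 *\<^sub>R f (c *\<^sub>R x) \<partial>lborel)"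
    using \<open>c > 0\<close> by (subst integral_density) (auto simp: integral_distr)
  finally show ?thesis by (simp add: scaleR_conv_of_real)
qed

text \<open>By translation invariance the integral of the shifted function is constant in the shift;
  differentiating it at 0 under the integral sign gives the integral of h'.\<close>

lemma integral_partial_eq_0:
  assumes h: "bump B h" and h': "bump B h'"
    and deriv: "\<And>\<xi>. ((\<lambda>s. h (\<xi> + s *\<^sub>R axis a 1)) has_vector_derivative h' \<xi>) (at 0)"
  shows "(\<integral>\<xi>. h' \<xi> \<partial>lborel) = 0"
proof -
  note [measurable] = bump_measurable[OF h] bump_measurable[OF h']
  obtain C where C: "C \<ge> 0" "\<And>\<xi>. norm (h' \<xi>) \<le> C * indicator (cball 0 B) \<xi>"
    using bump_bounded[OF h'] by metis
  have C': "norm (h' \<xi>) \<le> C" for \<xi>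
    by (rule order_trans[OF C(2)]) (use C(1) in \<open>auto simp: indicator_def\<close>)
  have D: "((\<lambda>s. h (\<xi> + s *\<^sub>R axis a 1)) has_vector_derivative h' (\<xi> + s *\<^sub>R axis a 1)) (at s)" for \<xi> s
    using deriv[of "\<xi> + s *\<^sub>R axis a 1"]
    by - (rule has_vector_derivative_shift, simp add: algebra_simps)
  have "((\<lambda>s. \<integral>\<xi>. h (\<xi> + s *\<^sub>R axis a 1) \<partial>lborel) has_vector_derivative (\<integral>\<xi>. h' \<xi> \<partial>lborel)) (at 0)"
  \<comment> \<open>For |s| < 1 the shifted function still vanishes outside the ball of radius B +
    1; inside, the mean value inequality gives the bound with the supremum C of h'.\<close>
  proof (rule has_vector_derivative_integral[where g = "\<lambda>\<xi>. C * indicator (cball 0 (B + 1)) \<xi>"])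
    show "integrable lborel (\<lambda>\<xi>. h (\<xi> + s *\<^sub>R axis a 1))" for s
    proof -
      have "bump (B + \<bar>s\<bar>) (\<lambda>\<xi>. h (\<xi> + s *\<^sub>R axis a 1))"
        unfolding bump_def
      proof safe
        show "continuous_on UNIV (\<lambda>\<xi>. h (\<xi> + s *\<^sub>R axis a 1))"
          by (rule continuous_on_compose2[of UNIV h]) (use h in \<open>auto simp: bump_def intro!: continuous_intros\<close>)
        fix \<xi> :: "real^3" assume "norm \<xi> > B + \<bar>s\<bar>"
        then have "norm (\<xi> + s *\<^sub>R axis a 1) > B"
          using norm_triangle_ineq4[of "\<xi> + s *\<^sub>R axis a 1" "s *\<^sub>R axis a 1"] by (simp add: norm_axis_1)
        then show "h (\<xi> + s *\<^sub>R axis a 1) = 0" using h by (simp add: bump_def)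
      qed
      then show ?thesis by (rule bump_integrable)
    qed
    show "((\<lambda>s. h (\<xi> + s *\<^sub>R axis a 1)) has_vector_derivative h' \<xi>) (at 0)" for \<xi> by (rule deriv)
    show "norm (h (\<xi> + s *\<^sub>R axis a 1) - h (\<xi> + 0 *\<^sub>R axis a 1)) \<le> \<bar>s\<bar> * (C * indicator (cball 0 (B + 1)) \<xi>)"
      if "\<bar>s\<bar> < 1" for \<xi> s
    proof (cases "\<xi> \<in> cball 0 (B + 1)")
      case True
      then show ?thesis
        using vector_derivative_bound[OF D[of \<xi>] C', of s 0] by (simp add: mult.commute)
    next
      case False
      then have "norm \<xi> > B + 1" by simp
      moreover have "norm (\<xi> + s *\<^sub>R axis a 1) > B"
        using norm_triangle_ineq4[of "\<xi> + s *\<^sub>R axis a 1" "s *\<^sub>R axis a 1"] \<open>norm \<xi> > B + 1\<close> that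
        by (simp add: norm_axis_1)
      ultimately show ?thesis using h C by (simp add: bump_def)
    qed
    show "integrable lborel (\<lambda>\<xi>. C * indicator (cball (0::real^3) (B + 1)) \<xi> :: real)"
      by (rule integrable_indicator_cball)
  qed measurable
  moreover have "(\<lambda>s. \<integral>\<xi>. h (\<xi> + s *\<^sub>R axis a 1) \<partial>lborel) = (\<lambda>s. \<integral>\<xi>. h \<xi> \<partial>lborel)"
    using integral_translate[of h "_ *\<^sub>R axis a 1"] by (simp add: add.commute)
  ultimately have "((\<lambda>s::real. \<integral>\<xi>. h \<xi> \<partial>lborel) has_vector_derivative (\<integral>\<xi>. h' \<xi> \<partial>lborel)) (at 0)"
    by simp
  then show ?thesis
    using has_vector_derivative_const vector_derivative_unique_at by blast
qed

text \<open>Integration by parts: the integral of the axis derivative of cis(z . xi) h(xi) vanishes.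
  A factor z_a thus turns into a derivative of the symbol, which is the source of the decay of all
  kernels.\<close>

lemma kern_by_parts:
  assumes h: "bump B h" and h': "bump B h'"
    and deriv: "\<And>\<xi>. ((\<lambda>s. h (\<xi> + s *\<^sub>R axis a 1)) has_vector_derivative h' \<xi>) (at 0)"
  shows "of_real (z $ a) * kern h z = \<i> * kern h' z"
proof -
  have D: "((\<lambda>s. cis (z \<bullet> (\<xi> + s *\<^sub>R axis a 1))) has_vector_derivative \<i> * of_real (z $ a) * cis (z \<bullet> \<xi>)) (at 0)" for \<xi>
  proof -
    from cis_line_has_derivative[of "z \<bullet> \<xi>" "z $ a" 0] show ?thesis
      by (simp add: inner_add_right inner_axis mult.commute)
  qed
  let ?H = "\<lambda>\<xi>. cis (z \<bullet> \<xi>) * h \<xi>"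
  let ?H' = "\<lambda>\<xi>. cis (z \<bullet> \<xi>) * h' \<xi> + \<i> * of_real (z $ a) * cis (z \<bullet> \<xi>) * h \<xi>"
  have b: "bump B ?H" "bump B ?H'"
    by (intro bump_add bump_mult h h' continuous_intros)+
  have "(\<integral>\<xi>. ?H' \<xi> \<partial>lborel) = 0"
    by (rule integral_partial_eq_0[OF b, of a])
       (use has_vector_derivative_mult[OF D deriv] in simp)
  moreover have "(\<integral>\<xi>. ?H' \<xi> \<partial>lborel) = kern h' z + \<i> * of_real (z $ a) * kern h z"
  proof -
    have "(\<integral>\<xi>. ?H' \<xi> \<partial>lborel) = (\<integral>\<xi>. h' \<xi> * cis (z \<bullet> \<xi>) + \<i> * of_real (z $ a) * (h \<xi> * cis (z \<bullet> \<xi>)) \<partial>lborel)"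
      by (simp add: mult_ac)
    also have "\<dots> = kern h' z + \<i> * of_real (z $ a) * kern h z"
      unfolding kern_def using kern_integrable[OF h] kern_integrable[OF h'] by simp
    finally show ?thesis .
  qed
  ultimately have "\<i> * of_real (z $ a) * kern h z = - kern h' z"
    by (simp add: eq_neg_iff_add_eq_0 add.commute)
  then have "\<i> * (\<i> * of_real (z $ a) * kern h z) = - (\<i> * kern h' z)" by simp
  then show ?thesis by (simp add: mult.assoc[symmetric])
qed

section \<open>Fourier inversion\<close>

text \<open>\<open>lborel\<close> is the image of a product of copies of \<open>lborel\<close> on
  the line, so Fubini's theorem for finite products applies. It reduces the Gaussian and the weight
  in \<open>integrable_decay\<close> to dimension one.\<close>

lemma integral_lborel_prod:
  fixes f :: "'a::euclidean_space \<Rightarrow> real \<Rightarrow> complex"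
  assumes int: "\<And>b. b \<in> Basis \<Longrightarrow> integrable lborel (f b)"
  shows "(\<integral>x. (\<Prod>b\<in>Basis. f b (x \<bullet> b)) \<partial>lborel) = (\<Prod>b\<in>Basis. (\<integral>x. f b x \<partial>lborel))"
    and "integrable lborel (\<lambda>x. \<Prod>b\<in>Basis. f b (x \<bullet> b))"
proof -
  interpret product_sigma_finite "\<lambda>_::'a. lborel :: real measure" ..
  have [measurable]: "f b \<in> borel_measurable borel" if "b \<in> Basis" for b
    using int[OF that] by auto
  have [measurable]: "(\<lambda>x. \<Prod>b\<in>Basis. f b (x \<bullet> b)) \<in> borel_measurable borel"
    by (rule borel_measurable_prod) measurable
  have eq: "(\<Prod>b\<in>Basis. f b ((\<Sum>c\<in>Basis. g c *\<^sub>R c) \<bullet> b)) = (\<Prod>b\<in>Basis. f b (g b))" for g :: "'a \<Rightarrow> real"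
    by (intro prod.cong refl) simp
  show "(\<integral>x. (\<Prod>b\<in>Basis. f b (x \<bullet> b)) \<partial>lborel) = (\<Prod>b\<in>Basis. (\<integral>x. f b x \<partial>lborel))"
    by (subst lborel_eq, subst integral_distr) (simp_all only: eq product_integral_prod[OF finite_Basis int], measurable)
  show "integrable lborel (\<lambda>x. \<Prod>b\<in>Basis. f b (x \<bullet> b))"
    by (subst lborel_eq, subst integrable_distr_eq) (simp_all only: eq product_integrable_prod[OF finite_Basis int], measurable)
qed

definition gauss3 :: "real^3 \<Rightarrow> real" where
  "gauss3 z = (\<Prod>b\<in>Basis. std_normal_density (z \<bullet> b))"

lemma gauss3_eq: "gauss3 z = exp (- (norm z)\<^sup>2 / 2) / sqrt (2 * pi) ^ 3"
proof -
  have "(\<Sum>b\<in>Basis. - (z \<bullet> b)\<^sup>2 / 2) = - (norm z)\<^sup>2 / 2"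
    unfolding power2_norm_eq_inner euclidean_inner[of z z] by (simp add: power2_eq_square sum_negf sum_divide_distrib)
  then show ?thesis
    unfolding gauss3_def std_normal_density_def
    by (simp only: prod.distrib exp_sum[OF finite_Basis, symmetric]) (simp add: power_divide)
qed

lemma gauss3_nonneg: "gauss3 z \<ge> 0"
  by (simp add: gauss3_eq)

lemma gauss3_le: "gauss3 z \<le> 1 / sqrt (2 * pi) ^ 3"
  by (simp add: gauss3_eq divide_right_mono)

lemma continuous_gauss3: "continuous_on S gauss3"
  unfolding gauss3_eq by (intro continuous_intros) auto

lemma measurable_gauss3 [measurable]: "gauss3 \<in> borel_measurable borel"
  by (intro borel_measurable_continuous_onI continuous_gauss3)

lemma integral_std_normal_cis:
  "(\<integral>x. of_real (std_normal_density x) * cis (x * s) \<partial>lborel) = of_real (exp (- s\<^sup>2 / 2))"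
proof -
  have "char std_normal_distribution s = (\<integral>x. std_normal_density x *\<^sub>R iexp (s * x) \<partial>lborel)"
    unfolding char_def by (rule integral_density) auto
  then show ?thesis
    by (simp add: char_std_normal_distribution cis_conv_exp scaleR_conv_of_real mult.commute)
qed

lemma cis_sum: "finite A \<Longrightarrow> cis (\<Sum>b\<in>A. f b) = (\<Prod>b\<in>A. cis (f b))"
  by (induction rule: finite_induct) (simp_all add: cis_mult[symmetric])

lemma std_normal_cis_integrable: "integrable lborel (\<lambda>x. of_real (std_normal_density x) * cis (x * s))"
proof -
  have "integrable lborel std_normal_density"
    using integrable_std_normal_moment[of 0] by simp
  then show ?thesis
    by (rule Bochner_Integration.integrable_bound) (auto simp: norm_mult)
qed

text \<open>The Gaussian is its own Fourier transform up to the factor (2 pi)^(3/2); in each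
  coordinate this is the characteristic function of the standard normal distribution.\<close>

lemma integral_gauss3_cis:
  "(\<integral>z. of_real (gauss3 z) * cis (z \<bullet> t) \<partial>lborel) = of_real (sqrt (2 * pi) ^ 3 * gauss3 t)" (is ?A)
  "integrable lborel (\<lambda>z. of_real (gauss3 z) * cis (z \<bullet> t))" (is ?B)
proof -
  have eq: "of_real (gauss3 z) * cis (z \<bullet> t) =
      (\<Prod>b\<in>Basis. of_real (std_normal_density (z \<bullet> b)) * cis ((z \<bullet> b) * (t \<bullet> b)))" for z
    unfolding gauss3_def euclidean_inner[of z t] by (simp add: prod.distrib cis_sum of_real_prod)
  show ?B
    unfolding eq by (rule integral_lborel_prod) (rule std_normal_cis_integrable)
  have "(\<integral>z. of_real (gauss3 z) * cis (z \<bullet> t) \<partial>lborel) = (\<Prod>b\<in>Basis. of_real (exp (- (t \<bullet> b)\<^sup>2 / 2)))"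
    unfolding eq by (subst integral_lborel_prod) (auto intro: std_normal_cis_integrable simp: integral_std_normal_cis)
  also have "\<dots> = of_real (exp (\<Sum>b\<in>Basis. - (t \<bullet> b)\<^sup>2 / 2))"
    by (simp add: exp_sum)
  also have "(\<Sum>b\<in>Basis. - (t \<bullet> b)\<^sup>2 / 2) = - (norm t)\<^sup>2 / 2"
    unfolding power2_norm_eq_inner euclidean_inner[of t t] by (simp add: power2_eq_square sum_negf sum_divide_distrib)
  finally show ?A by (simp add: gauss3_eq)
qed

lemma gauss3_integrable: "integrable lborel gauss3"
  using integral_gauss3_cis(2)[of 0] by (simp add: complex_of_real_integrable_eq)

lemma integral_gauss3: "(\<integral>z. gauss3 z \<partial>lborel) = 1"
proof -
  have "complex_of_real (\<integral>z. gauss3 z \<partial>lborel) = of_real 1"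
    using integral_gauss3_cis(1)[of 0] by (simp add: gauss3_eq del: of_real_1)
  then show ?thesis by (simp only: of_real_eq_iff)
qed

text \<open>Gauss summation: gauss3(z / r) is inserted into the integral and r tends to infinity.
  Directly, the limit is gauss3(0) times the wanted integral, by dominated convergence since
  \<open>kern h\<close> is integrable. After Fubini's theorem the same quantity is an average of h
  around \<eta> against a Gaussian of width 1 / r, which tends to a multiple of h at \<eta>.\<close>

lemma Fourier_inversion:
  assumes h: "bump B h" and int: "integrable lborel (kern h)"
  shows "(\<integral>z. kern h z * cis (- (z \<bullet> \<eta>)) \<partial>lborel) = of_real ((2 * pi) ^ 3) * h \<eta>"
proof -
  note [measurable] = bump_measurable[OF h]
  have [measurable]: "kern h \<in> borel_measurable borel" using int by auto
  define J where "J n = (\<integral>z. kern h z * cis (- (z \<bullet> \<eta>)) * of_real (gauss3 (z /\<^sub>R real (Suc n))) \<partial>lborel)" for n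
  let ?c = "sqrt (2 * pi) ^ 3"
  have "(\<lambda>n. 1 / real (Suc n)) \<longlonglongrightarrow> 0"
    by (rule LIMSEQ_Suc) (rule lim_1_over_n)
  then have eps: "(\<lambda>n. inverse (real (Suc n))) \<longlonglongrightarrow> 0" by (simp add: divide_inverse)
  have J1: "J \<longlonglongrightarrow> (\<integral>z. kern h z * cis (- (z \<bullet> \<eta>)) * of_real (gauss3 0) \<partial>lborel)"
    unfolding J_def
  proof (rule integral_dominated_convergence[where w = "\<lambda>z. norm (kern h z) * (1 / ?c)"])
    show "AE z in lborel. (\<lambda>n. kern h z * cis (- (z \<bullet> \<eta>)) * of_real (gauss3 (z /\<^sub>R real (Suc n))))
        \<longlonglongrightarrow> kern h z * cis (- (z \<bullet> \<eta>)) * of_real (gauss3 0)"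
    proof (intro AE_I2 tendsto_mult tendsto_const tendsto_of_real)
      fix z :: "real^3"
      have "(\<lambda>n. z /\<^sub>R real (Suc n)) \<longlonglongrightarrow> 0"
        using tendsto_scaleR[OF eps tendsto_const[of z]] by simp
      then show "(\<lambda>n. gauss3 (z /\<^sub>R real (Suc n))) \<longlonglongrightarrow> gauss3 0"
        using continuous_gauss3[of UNIV] continuous_on_tendsto_compose[of UNIV gauss3] by auto
    qed
    show "AE z in lborel. norm (kern h z * cis (- (z \<bullet> \<eta>)) * of_real (gauss3 (z /\<^sub>R real (Suc n))))
        \<le> norm (kern h z) * (1 / ?c)" for n
      using mult_left_mono[OF gauss3_le norm_ge_zero] gauss3_nonneg
      by (intro AE_I2) (simp add: norm_mult del: of_nat_Suc times_divide_eq_right)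
  qed (use int in auto)
  \<comment> \<open>The Fourier transform turns the width r into 1 / r; translating by \<eta> and
    dilating by 1 / r then cancels the Jacobian r^3.\<close>
  have J2: "J n = of_real ?c * (\<integral>\<sigma>. h (\<eta> + \<sigma> /\<^sub>R real (Suc n)) * of_real (gauss3 \<sigma>) \<partial>lborel)" for n
  proof -
    define r where "r = real (Suc n)"
    have r: "r > 0" by (simp add: r_def)
    let ?F = "\<lambda>z \<xi>. h \<xi> * (of_real (gauss3 (z /\<^sub>R r)) * cis (z \<bullet> (\<xi> - \<eta>)))"
    have gint: "integrable lborel (\<lambda>z. gauss3 (z /\<^sub>R r))"
    proof -
      have "(\<integral>\<^sup>+z. ennreal (gauss3 (z /\<^sub>R r)) \<partial>lborel) = ennreal (r ^ 3) * (\<integral>\<^sup>+z. ennreal (gauss3 z) \<partial>lborel)"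
        by (subst nn_integral_scale[OF _ r]) (use r in auto)
      also have "\<dots> < \<infinity>"
        using gauss3_integrable gauss3_nonneg by (subst nn_integral_eq_integral) (auto simp: ennreal_mult_less_top)
      finally show ?thesis
        using gauss3_nonneg by (intro integrableI_bounded) auto
    qed
    have "integrable (lborel \<Otimes>\<^sub>M lborel) (\<lambda>(z, \<xi>). h \<xi> * of_real (gauss3 (z /\<^sub>R r)))"
    proof (rule lborel_pair.Fubini_integrable)
      show "integrable lborel (\<lambda>z. \<integral>\<xi>. norm (case (z, \<xi>) of (z, \<xi>) \<Rightarrow> h \<xi> * complex_of_real (gauss3 (z /\<^sub>R r))) \<partial>lborel)"
        using gint gauss3_nonneg by (simp add: norm_mult)
      show "AE z in lborel. integrable lborel (\<lambda>\<xi>. case (z, \<xi>) of (z, \<xi>) \<Rightarrow> h \<xi> * complex_of_real (gauss3 (z /\<^sub>R r)))"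
        using bump_integrable[OF h] by simp
    qed measurable
    then have Fint: "integrable (lborel \<Otimes>\<^sub>M lborel) (\<lambda>(z, \<xi>). ?F z \<xi>)"
      by (rule Bochner_Integration.integrable_bound) (auto simp: norm_mult)
    have "J n = (\<integral>z. (\<integral>\<xi>. ?F z \<xi> \<partial>lborel) \<partial>lborel)"
      unfolding J_def kern_def r_def[symmetric]
    proof (intro Bochner_Integration.integral_cong refl)
      fix z
      have "(\<integral>\<xi>. ?F z \<xi> \<partial>lborel) = (\<integral>\<xi>. (h \<xi> * cis (z \<bullet> \<xi>)) * (cis (- (z \<bullet> \<eta>)) * of_real (gauss3 (z /\<^sub>R r))) \<partial>lborel)"
        by (intro Bochner_Integration.integral_cong refl) (simp add: inner_diff_right cis_mult mult_ac)
      then show "(\<integral>\<xi>. h \<xi> * cis (z \<bullet> \<xi>) \<partial>lborel) * cis (- (z \<bullet> \<eta>)) * of_real (gauss3 (z /\<^sub>R r)) = (\<integral>\<xi>. ?F z \<xi> \<partial>lborel)"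
        unfolding integral_mult_left_zero by (simp only: mult.assoc)
    qed
    also have "\<dots> = (\<integral>\<xi>. (\<integral>z. ?F z \<xi> \<partial>lborel) \<partial>lborel)"
      by (rule lborel_pair.Fubini_integral[OF Fint, symmetric])
    also have "\<dots> = (\<integral>\<xi>. h \<xi> * of_real (r ^ 3 * (?c * gauss3 (r *\<^sub>R (\<xi> - \<eta>)))) \<partial>lborel)"
    proof (intro Bochner_Integration.integral_cong refl)
      fix \<xi>
      have "(\<integral>z. of_real (gauss3 (z /\<^sub>R r)) * cis (z \<bullet> (\<xi> - \<eta>)) \<partial>lborel) =
          of_real (r ^ 3) * (\<integral>z. of_real (gauss3 z) * cis (z \<bullet> (r *\<^sub>R (\<xi> - \<eta>))) \<partial>lborel)"
        by (subst integral_scale[OF _ r]) (use r in auto)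
      then show "(\<integral>z. ?F z \<xi> \<partial>lborel) = h \<xi> * of_real (r ^ 3 * (?c * gauss3 (r *\<^sub>R (\<xi> - \<eta>))))"
        by (simp add: integral_gauss3_cis del: inner_scaleR_right)
    qed
    also have "\<dots> = (\<integral>\<xi>. h (\<eta> + \<xi>) * of_real (r ^ 3 * (?c * gauss3 (r *\<^sub>R \<xi>))) \<partial>lborel)"
      by (subst integral_translate[of _ \<eta>, symmetric]) auto
    also have "\<dots> = of_real ((1 / r) ^ 3) * (\<integral>\<xi>. h (\<eta> + \<xi> /\<^sub>R r) * of_real (r ^ 3 * (?c * gauss3 \<xi>)) \<partial>lborel)"
      by (subst integral_scale[of _ "1 / r"]) (use r in \<open>auto simp: divide_inverse\<close>)
    also have "\<dots> = of_real ((1 / r) ^ 3) * (\<integral>\<xi>. of_real (r ^ 3) * (of_real ?c * (h (\<eta> + \<xi> /\<^sub>R r) * of_real (gauss3 \<xi>))) \<partial>lborel)"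
      by (simp add: mult_ac)
    also have "\<dots> = of_real ((1 / r) ^ 3 * r ^ 3 * ?c) * (\<integral>\<xi>. h (\<eta> + \<xi> /\<^sub>R r) * of_real (gauss3 \<xi>) \<partial>lborel)"
      by (simp only: integral_mult_right_zero of_real_mult mult.assoc)
    also have "(1 / r) ^ 3 * r ^ 3 * ?c = ?c"
      using r by (simp add: power_divide)
    finally show ?thesis by (simp add: r_def)
  qed
  have J3: "(\<lambda>n. \<integral>\<sigma>. h (\<eta> + \<sigma> /\<^sub>R real (Suc n)) * of_real (gauss3 \<sigma>) \<partial>lborel) \<longlonglongrightarrow>
      (\<integral>\<sigma>. h \<eta> * of_real (gauss3 \<sigma>) \<partial>lborel)"
  proof -
    obtain C where C: "C \<ge> 0" "\<And>\<xi>. norm (h \<xi>) \<le> C * indicator (cball 0 B) \<xi>"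
      using bump_bounded[OF h] by metis
    have C': "norm (h \<xi>) \<le> C" for \<xi>
      by (rule order_trans[OF C(2)]) (use C(1) in \<open>auto simp: indicator_def\<close>)
    show ?thesis
    proof (rule integral_dominated_convergence[where w = "\<lambda>\<sigma>. C * gauss3 \<sigma>"])
      show "AE \<sigma> in lborel. (\<lambda>n. h (\<eta> + \<sigma> /\<^sub>R real (Suc n)) * of_real (gauss3 \<sigma>)) \<longlonglongrightarrow> h \<eta> * of_real (gauss3 \<sigma>)"
      proof (intro AE_I2 tendsto_mult tendsto_const)
        fix \<sigma> :: "real^3"
        have "(\<lambda>n. \<eta> + \<sigma> /\<^sub>R real (Suc n)) \<longlonglongrightarrow> \<eta> + 0 *\<^sub>R \<sigma>"
          by (intro tendsto_intros eps)
        then show "(\<lambda>n. h (\<eta> + \<sigma> /\<^sub>R real (Suc n))) \<longlonglongrightarrow> h \<eta>"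
          using h continuous_on_tendsto_compose[of UNIV h] by (auto simp: bump_def)
      qed
      show "AE \<sigma> in lborel. norm (h (\<eta> + \<sigma> /\<^sub>R real (Suc n)) * of_real (gauss3 \<sigma>)) \<le> C * gauss3 \<sigma>" for n
        using gauss3_nonneg C' by (intro AE_I2) (simp add: norm_mult mult_right_mono del: of_nat_Suc)
    qed (use gauss3_integrable in auto)
  qed
  have "J \<longlonglongrightarrow> of_real ?c * (\<integral>\<sigma>. h \<eta> * of_real (gauss3 \<sigma>) \<partial>lborel)"
    unfolding ext[of J, OF J2] by (rule tendsto_mult_left[OF J3])
  \<comment> \<open>The value gauss3(0) = 1 / \<open>?c\<close> on one side and the factor
    \<open>?c\<close> on the other combine to the square of \<open>?c\<close>, which is (2
    pi)^3.\<close>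
  from LIMSEQ_unique[OF J1 this]
  have "(\<integral>z. kern h z * cis (- (z \<bullet> \<eta>)) * of_real (gauss3 0) \<partial>lborel) =
      of_real ?c * (\<integral>\<sigma>. h \<eta> * of_real (gauss3 \<sigma>) \<partial>lborel)" .
  then have "(\<integral>z. kern h z * cis (- (z \<bullet> \<eta>)) \<partial>lborel) * of_real (1 / ?c) = of_real ?c * h \<eta>"
    using gauss3_eq[of 0] by (simp add: integral_gauss3)
  then have "(\<integral>z. kern h z * cis (- (z \<bullet> \<eta>)) \<partial>lborel) = of_real (?c * ?c) * h \<eta>"
    by (simp add: field_simps)
  also have "?c * ?c = (2 * pi) ^ 3"
    by (simp flip: power_mult_distrib)
  finally show ?thesis .
qed

section \<open>Rapidly decreasing kernels\<close>

text \<open>The exponent 6 is 2 for each of the three coordinates: (1 + |y|)^6 dominates the product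
  of the 1 + y_b^2, and 1 / (1 + s^2) is integrable on the line. This fixes the decay of
  \<open>avk\<close>.\<close>

lemma integrable_decay: "integrable lborel (\<lambda>y::real^3. 1 / (1 + norm y) ^ 6)"
proof (rule Bochner_Integration.integrable_bound)
  let ?g = "\<lambda>y::real^3. \<Prod>b\<in>Basis. complex_of_real (inverse (1 + (y \<bullet> b)\<^sup>2))"
  have "integrable lborel (\<lambda>x::real. inverse (1 + x\<^sup>2))"
    using integrable_inverse_1_plus_square by (simp add: set_integrable_def)
  then show "integrable lborel ?g"
    by (intro integral_lborel_prod(2)) (simp only: complex_of_real_integrable_eq)
  show "AE y in lborel. norm (1 / (1 + norm y) ^ 6) \<le> norm (?g y)"
  proof (rule AE_I2)
    fix y :: "real^3"
    have "(\<Prod>b\<in>Basis. 1 + (y \<bullet> b)\<^sup>2) \<le> (\<Prod>b\<in>(Basis :: (real^3) set). (1 + norm y) ^ 2)"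
    proof (rule prod_mono)
      fix b :: "real^3" assume "b \<in> Basis"
      then have "\<bar>y \<bullet> b\<bar> \<le> norm y" by (rule Basis_le_norm)
      then have "(y \<bullet> b)\<^sup>2 \<le> (norm y)\<^sup>2" by (metis abs_le_square_iff abs_norm_cancel)
      then show "0 \<le> 1 + (y \<bullet> b)\<^sup>2 \<and> 1 + (y \<bullet> b)\<^sup>2 \<le> (1 + norm y) ^ 2"
        using norm_ge_zero[of y] zero_le_power2[of "y \<bullet> b"] by (simp add: power2_sum del: norm_ge_zero)
    qed
    also have "\<dots> = (1 + norm y) ^ 6"
      by (simp flip: power_mult)
    finally have "inverse ((1 + norm y) ^ 6) \<le> inverse (\<Prod>b\<in>Basis. 1 + (y \<bullet> b)\<^sup>2)"
      by (intro le_imp_inverse_le prod_pos) (auto intro: add_pos_nonneg)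
    also have "\<dots> = norm (?g y)"
    proof -
      have "inverse (\<Prod>b\<in>Basis. 1 + (y \<bullet> b)\<^sup>2) = (\<Prod>b\<in>Basis. inverse (1 + (y \<bullet> b)\<^sup>2))"
        using prod_inversef[of "\<lambda>b. 1 + (y \<bullet> b)\<^sup>2" Basis] by (simp add: comp_def)
      moreover have "(\<Prod>b\<in>Basis. inverse (1 + (y \<bullet> b)\<^sup>2)) \<ge> 0"
        by (intro prod_nonneg) (auto intro: add_nonneg_nonneg)
      ultimately show ?thesis
        by (simp only: of_real_prod[symmetric] norm_of_real abs_of_nonneg)
    qed
    finally show "norm (1 / (1 + norm y) ^ 6) \<le> norm (?g y)"
      by (simp add: divide_inverse)
  qed
qed measurable

text \<open>It suffices to compare boxes. The preimage of a box is its image under the inverse map,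
  which is again orthogonal and preserves Lebesgue measure.\<close>

lemma lborel_distr_orthogonal:
  fixes R :: "real^3 \<Rightarrow> real^3"
  assumes R: "orthogonal_transformation R"
  shows "distr lborel borel R = lborel"
proof (rule lborel_eqI[symmetric])
  have lin: "linear R" using R by (rule orthogonal_transformation_linear)
  have [measurable]: "R \<in> borel_measurable borel"
    using lin by (intro borel_measurable_continuous_onI linear_continuous_on linear_conv_bounded_linear[THEN iffD1])
  have R': "orthogonal_transformation (inv R)"
    using R by (rule orthogonal_transformation_inv)
  fix l u :: "real^3" assume lu: "\<And>b. b \<in> Basis \<Longrightarrow> l \<bullet> b \<le> u \<bullet> b"
  have vim: "R -` box l u = inv R ` box l u"
    using orthogonal_transformation_bij[OF R] by (simp add: bij_vimage_eq_inv_image)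
  have "emeasure (distr lborel borel R) (box l u) = emeasure lborel (R -` box l u)"
    by (subst emeasure_distr) auto
  also have "\<dots> = emeasure lebesgue (R -` box l u)"
    using measurable_sets[of R borel borel "box l u"] by simp
  also have "\<dots> = emeasure lebesgue (inv R ` box l u)" by (simp add: vim)
  also have "\<dots> = ennreal (measure lebesgue (inv R ` box l u))"
    by (intro emeasure_eq_measure2 measurable_orthogonal_image[OF R'] lmeasurable_box)
  also have "\<dots> = ennreal (measure lebesgue (box l u))"
    by (simp add: measure_orthogonal_image[OF R' lmeasurable_box])
  also have "\<dots> = (\<Prod>b\<in>Basis. (u - l) \<bullet> b)"
    using lu by (simp add: measure_lborel_box_eq)
  finally show "emeasure (distr lborel borel R) (box l u) = (\<Prod>b\<in>Basis. (u - l) \<bullet> b)" .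
qed simp

lemma orthogonal_measurable:
  fixes R :: "real^3 \<Rightarrow> real^3"
  shows "orthogonal_transformation R \<Longrightarrow> R \<in> borel_measurable borel"
  by (intro borel_measurable_continuous_onI linear_continuous_on linear_conv_bounded_linear[THEN iffD1]
      orthogonal_transformation_linear)

lemma integral_orthogonal:
  fixes f :: "real^3 \<Rightarrow> 'b::{banach, second_countable_topology}" and R :: "real^3 \<Rightarrow> real^3"
  assumes R: "orthogonal_transformation R" and [measurable]: "f \<in> borel_measurable borel"
  shows "(\<integral>x. f (R x) \<partial>lborel) = (\<integral>x. f x \<partial>lborel)"
proof -
  note [measurable] = orthogonal_measurable[OF R]
  have "(\<integral>x. f x \<partial>lborel) = (\<integral>x. f x \<partial>distr lborel borel R)"
    by (simp add: lborel_distr_orthogonal[OF R])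
  then show ?thesis by (subst (asm) integral_distr) auto
qed

lemma nn_integral_orthogonal:
  fixes f :: "real^3 \<Rightarrow> ennreal" and R :: "real^3 \<Rightarrow> real^3"
  assumes R: "orthogonal_transformation R" and [measurable]: "f \<in> borel_measurable borel"
  shows "(\<integral>\<^sup>+x. f (R x) \<partial>lborel) = (\<integral>\<^sup>+x. f x \<partial>lborel)"
proof -
  note [measurable] = orthogonal_measurable[OF R]
  have "(\<integral>\<^sup>+x. f x \<partial>lborel) = (\<integral>\<^sup>+x. f x \<partial>distr lborel borel R)"
    by (simp add: lborel_distr_orthogonal[OF R])
  then show ?thesis by (subst (asm) nn_integral_distr) auto
qed

text \<open>A kernel together with its gradient, both decaying faster than every power.
  Differentiability is asked along lines, the form in which derivatives pass under a convolution
  integral.\<close>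

definition rapid :: "(real^3 \<Rightarrow> complex) \<Rightarrow> (3 \<Rightarrow> real^3 \<Rightarrow> complex) \<Rightarrow> bool" where
  "rapid K dK \<longleftrightarrow> continuous_on UNIV K \<and> (\<forall>b. continuous_on UNIV (dK b)) \<and>
     (\<forall>z e. ((\<lambda>s. K (z + s *\<^sub>R e)) has_vector_derivative (\<Sum>b\<in>UNIV. e $ b *\<^sub>R dK b z)) (at 0)) \<and>
     (\<forall>n. \<exists>C. \<forall>z. norm (K z) * (1 + norm z) ^ n \<le> C \<and> (\<forall>b. norm (dK b z) * (1 + norm z) ^ n \<le> C))"

lemma rapid_scale:
  assumes K: "rapid K dK" and c: "c > 0"
  shows "rapid (\<lambda>z. K (c *\<^sub>R z)) (\<lambda>b z. c *\<^sub>R dK b (c *\<^sub>R z))"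
  unfolding rapid_def
proof (intro conjI allI)
  have *: "continuous_on UNIV (\<lambda>z. f (c *\<^sub>R z))" if "continuous_on UNIV f" for f :: "real^3 \<Rightarrow> complex"
    by (rule continuous_on_compose2[OF that]) (auto intro!: continuous_intros)
  show "continuous_on UNIV (\<lambda>z. K (c *\<^sub>R z))" "\<And>b. continuous_on UNIV (\<lambda>z. c *\<^sub>R dK b (c *\<^sub>R z))"
    using K by (auto simp: rapid_def intro!: * continuous_on_scaleR[OF continuous_on_const])
  show "((\<lambda>s. K (c *\<^sub>R (z + s *\<^sub>R e))) has_vector_derivative (\<Sum>b\<in>UNIV. e $ b *\<^sub>R c *\<^sub>R dK b (c *\<^sub>R z))) (at 0)" for z e
  proof -
    have "((\<lambda>s. K (c *\<^sub>R z + s *\<^sub>R (c *\<^sub>R e))) has_vector_derivative (\<Sum>b\<in>UNIV. (c *\<^sub>R e) $ b *\<^sub>R dK b (c *\<^sub>R z))) (at 0)"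
      using K unfolding rapid_def by blast
    then show ?thesis by (simp add: scaleR_add_right mult.commute)
  qed
  show "\<exists>C. \<forall>z. norm (K (c *\<^sub>R z)) * (1 + norm z) ^ n \<le> C \<and> (\<forall>b. norm (c *\<^sub>R dK b (c *\<^sub>R z)) * (1 + norm z) ^ n \<le> C)" for n
  proof -
    obtain C where C: "\<And>z. norm (K z) * (1 + norm z) ^ n \<le> C" "\<And>b z. norm (dK b z) * (1 + norm z) ^ n \<le> C"
      using K unfolding rapid_def by blast
    define d where "d = max 1 (1 / c)"
    have d: "1 + norm z \<le> d * (1 + norm (c *\<^sub>R z))" for z :: "real^3"
    proof -
      have "1 \<le> d * 1" "norm z \<le> d * norm (c *\<^sub>R z)"
      proof -
        have "1 / c * (c * norm z) \<le> d * (c * norm z)"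
          using c by (intro mult_right_mono) (auto simp: d_def)
        then show "norm z \<le> d * norm (c *\<^sub>R z)" using c by simp
      qed (simp add: d_def)
      then show ?thesis by (simp add: algebra_simps)
    qed
    have dn: "(1 + norm z) ^ n \<le> d ^ n * (1 + norm (c *\<^sub>R z)) ^ n" for z :: "real^3"
      using power_mono[OF d, of z n] by (simp add: power_mult_distrib)
    have X: "norm w * (1 + norm z) ^ n \<le> d ^ n * C" if "norm w * (1 + norm (c *\<^sub>R z)) ^ n \<le> C" for w :: complex and z :: "real^3"
    proof -
      have "norm w * (1 + norm z) ^ n \<le> norm w * (d ^ n * (1 + norm (c *\<^sub>R z)) ^ n)"
        by (intro mult_left_mono dn) simp
      also have "\<dots> = d ^ n * (norm w * (1 + norm (c *\<^sub>R z)) ^ n)" by (simp add: mult_ac)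
      also have "\<dots> \<le> d ^ n * C" by (intro mult_left_mono that) (simp add: d_def)
      finally show ?thesis .
    qed
    have "C \<ge> 0" using C(1)[of 0] order_trans[OF norm_ge_zero] by fastforce
    show ?thesis
    proof (intro exI[of _ "max 1 c * (d ^ n * C)"] allI conjI)
      fix z
      have nn: "0 \<le> d ^ n * C" using \<open>C \<ge> 0\<close> by (simp add: d_def)
      then show "norm (K (c *\<^sub>R z)) * (1 + norm z) ^ n \<le> max 1 c * (d ^ n * C)"
        using X[OF C(1), of z] mult_right_mono[of 1 "max 1 c" "d ^ n * C"] by simp
      fix b
      have "c * (norm (dK b (c *\<^sub>R z)) * (1 + norm z) ^ n) \<le> max 1 c * (d ^ n * C)"
        by (intro mult_mono X C) (use c nn in auto)
      then show "norm (c *\<^sub>R dK b (c *\<^sub>R z)) * (1 + norm z) ^ n \<le> max 1 c * (d ^ n * C)"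
        using c by (simp add: mult.assoc)
    qed
  qed
qed

lemma rapid_cmult:
  assumes K: "rapid K dK"
  shows "rapid (\<lambda>z. w * K z) (\<lambda>b z. w * dK b z)"
  unfolding rapid_def
proof (intro conjI allI)
  have "continuous_on UNIV K" "\<And>b. continuous_on UNIV (dK b)"
    using K by (auto simp: rapid_def)
  then show "continuous_on UNIV (\<lambda>z. w * K z)" "\<And>b. continuous_on UNIV (\<lambda>z. w * dK b z)"
    by (auto intro!: continuous_intros)
  show "((\<lambda>s. w * K (z + s *\<^sub>R e)) has_vector_derivative (\<Sum>b\<in>UNIV. e $ b *\<^sub>R (w * dK b z))) (at 0)" for z e
  proof -
    have "((\<lambda>s. w * K (z + s *\<^sub>R e)) has_vector_derivative w * (\<Sum>b\<in>UNIV. e $ b *\<^sub>R dK b z)) (at 0)"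
      by (rule has_vector_derivative_mult_right) (use K in \<open>simp add: rapid_def\<close>)
    then show ?thesis by (simp add: sum_distrib_left)
  qed
  fix n
  obtain C where C: "\<And>z. norm (K z) * (1 + norm z) ^ n \<le> C" "\<And>b z. norm (dK b z) * (1 + norm z) ^ n \<le> C"
    using K unfolding rapid_def by blast
  show "\<exists>C. \<forall>z. norm (w * K z) * (1 + norm z) ^ n \<le> C \<and> (\<forall>b. norm (w * dK b z) * (1 + norm z) ^ n \<le> C)"
    using mult_left_mono[OF C(1) norm_ge_zero[of w]] mult_left_mono[OF C(2) norm_ge_zero[of w]]
    by (intro exI[of _ "norm w * C"]) (simp add: norm_mult mult.assoc)
qed

lemma rapid_diff:
  assumes K: "rapid K dK" and L: "rapid L dL"
  shows "rapid (\<lambda>z. K z - L z) (\<lambda>b z. dK b z - dL b z)"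
  unfolding rapid_def
proof (intro conjI allI)
  have "continuous_on UNIV K" "\<And>b. continuous_on UNIV (dK b)" "continuous_on UNIV L" "\<And>b. continuous_on UNIV (dL b)"
    using K L by (auto simp: rapid_def)
  then show "continuous_on UNIV (\<lambda>z. K z - L z)" "\<And>b. continuous_on UNIV (\<lambda>z. dK b z - dL b z)"
    by (auto intro!: continuous_intros)
  show "((\<lambda>s. K (z + s *\<^sub>R e) - L (z + s *\<^sub>R e)) has_vector_derivative (\<Sum>b\<in>UNIV. e $ b *\<^sub>R (dK b z - dL b z))) (at 0)" for z e
  proof -
    have "((\<lambda>s. K (z + s *\<^sub>R e) - L (z + s *\<^sub>R e)) has_vector_derivative
        (\<Sum>b\<in>UNIV. e $ b *\<^sub>R dK b z) - (\<Sum>b\<in>UNIV. e $ b *\<^sub>R dL b z)) (at 0)"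
      by (rule has_vector_derivative_diff) (use K L in \<open>simp_all add: rapid_def\<close>)
    then show ?thesis by (simp add: sum_subtractf scaleR_diff_right)
  qed
  fix n
  obtain C where C: "\<And>z. norm (K z) * (1 + norm z) ^ n \<le> C" "\<And>b z. norm (dK b z) * (1 + norm z) ^ n \<le> C"
    using K unfolding rapid_def by blast
  obtain D where D: "\<And>z. norm (L z) * (1 + norm z) ^ n \<le> D" "\<And>b z. norm (dL b z) * (1 + norm z) ^ n \<le> D"
    using L unfolding rapid_def by blast
  have X: "norm (u - v) * (1 + norm z) ^ n \<le> C + D"
    if "norm u * (1 + norm z) ^ n \<le> C" "norm v * (1 + norm z) ^ n \<le> D" for u v :: complex and z :: "real^3"
  proof -
    have "norm (u - v) * (1 + norm z) ^ n \<le> (norm u + norm v) * (1 + norm z) ^ n"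
      by (intro mult_right_mono norm_triangle_ineq4) simp
    then show ?thesis using that by (simp add: distrib_right)
  qed
  show "\<exists>C. \<forall>z. norm (K z - L z) * (1 + norm z) ^ n \<le> C \<and> (\<forall>b. norm (dK b z - dL b z) * (1 + norm z) ^ n \<le> C)"
    using X C D by (intro exI[of _ "C + D"]) blast
qed

section \<open>The kernel of the low frequency cut-off\<close>

lemma power_le_sum_coords:
  fixes z :: "real^3"
  shows "(1 + norm z) ^ n \<le> 4 ^ n * (1 + (\<Sum>a\<in>UNIV. \<bar>z $ a\<bar> ^ n))"
proof -
  define m where "m = Max (insert 1 (range (\<lambda>a. \<bar>z $ a\<bar>)))"
  have m: "1 \<le> m" "\<And>a. \<bar>z $ a\<bar> \<le> m"
    unfolding m_def by (intro Max_ge; simp)+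
  have m3: "m \<in> insert 1 (range (\<lambda>a. \<bar>z $ a\<bar>))"
    unfolding m_def by (rule Max_in) auto
  have "norm z \<le> (\<Sum>a\<in>UNIV. \<bar>z $ a\<bar>)" by (rule norm_le_l1_cart)
  also have "\<dots> \<le> (\<Sum>a\<in>(UNIV::3 set). m)" by (intro sum_mono m)
  also have "\<dots> = 3 * m" by simp
  finally have "1 + norm z \<le> 4 * m" using m(1) by simp
  then have "(1 + norm z) ^ n \<le> (4 * m) ^ n" by (intro power_mono) auto
  also have "\<dots> = 4 ^ n * m ^ n" by (simp add: power_mult_distrib)
  also have "m ^ n \<le> 1 + (\<Sum>a\<in>UNIV. \<bar>z $ a\<bar> ^ n)"
    using m3
  proof
    assume "m = 1" then show ?thesis by (simp add: sum_nonneg)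
  next
    assume "m \<in> range (\<lambda>a. \<bar>z $ a\<bar>)"
    then obtain a where "m = \<bar>z $ a\<bar>" by auto
    moreover have "\<bar>z $ a\<bar> ^ n \<le> (\<Sum>a\<in>UNIV. \<bar>z $ a\<bar> ^ n)"
      by (rule member_le_sum) auto
    ultimately show ?thesis by simp
  qed
  finally show ?thesis by simp
qed

text \<open>Integration by parts yields powers of single coordinates. They suffice, because the
  largest of 1 and the |z_a| is at least a quarter of 1 + |z|.\<close>

lemma decay_from_coords:
  assumes "\<And>n a. \<exists>C. \<forall>z::real^3. \<bar>z $ a\<bar> ^ n * norm (F z :: complex) \<le> C"
  shows "\<exists>C. \<forall>z. norm (F z) * (1 + norm z) ^ n \<le> C"
proof -
  obtain C where C: "\<And>a z. \<bar>z $ a\<bar> ^ n * norm (F z) \<le> C a" using assms[of _ n] by metis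
  obtain C0 where C0: "\<And>z. norm (F z) \<le> C0" using assms[of _ 0] by auto
  show ?thesis
  proof (intro exI allI)
    fix z
    have "norm (F z) * (1 + norm z) ^ n \<le> norm (F z) * (4 ^ n * (1 + (\<Sum>a\<in>UNIV. \<bar>z $ a\<bar> ^ n)))"
      by (intro mult_left_mono power_le_sum_coords) simp
    also have "\<dots> = 4 ^ n * (norm (F z) + (\<Sum>a\<in>UNIV. \<bar>z $ a\<bar> ^ n * norm (F z)))"
      by (simp add: algebra_simps sum_distrib_left)
    also have "\<dots> \<le> 4 ^ n * (C0 + (\<Sum>a\<in>UNIV. C a))"
      by (intro mult_left_mono add_mono sum_mono C C0) simp
    finally show "norm (F z) * (1 + norm z) ^ n \<le> 4 ^ n * (C0 + (\<Sum>a\<in>UNIV. C a))" .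
  qed
qed

locale LP =
  fixes chi :: "real^3 \<Rightarrow> real"
  assumes cutoff: "LP_cutoff chi"
begin

text \<open>Made complex so that every iterated derivative of the cut-off is a symbol for
  \<open>kern\<close>; the list of indices is what the inductions below extend.\<close>

definition D :: "3 list \<Rightarrow> real^3 \<Rightarrow> complex" where
  "D as \<xi> = of_real (foldr partial as chi \<xi>)"

lemma D_Nil: "D [] = (\<lambda>\<xi>. of_real (chi \<xi>))"
  by (simp add: D_def fun_eq_iff)

lemma D_deriv: "((\<lambda>s. D as (\<xi> + s *\<^sub>R axis a 1)) has_vector_derivative D (a # as) \<xi>) (at 0)"
proof -
  let ?f = "foldr partial as chi"
  have "?f differentiable (at (\<xi> + 0 *\<^sub>R axis a 1))"
    using cutoff unfolding LP_cutoff_def smooth3_def by blast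
  moreover have "((\<lambda>s::real. \<xi> + s *\<^sub>R axis a 1) has_vector_derivative axis a 1) (at 0)"
    by (auto intro!: derivative_eq_intros)
  then have "(\<lambda>s::real. \<xi> + s *\<^sub>R axis a 1) differentiable (at 0)"
    by (rule differentiableI_vector)
  ultimately have "(?f \<circ> (\<lambda>s. \<xi> + s *\<^sub>R axis a 1)) differentiable (at 0)"
    by (intro differentiable_chain_at)
  then have "((\<lambda>s. ?f (\<xi> + s *\<^sub>R axis a 1)) has_vector_derivative partial a ?f \<xi>) (at 0)"
    by (simp add: vector_derivative_works comp_def partial_def)
  then show ?thesis
    unfolding D_def foldr.simps comp_apply
    by (rule bounded_linear.has_vector_derivative[OF bounded_linear_of_real])
qed

text \<open>The region |\<xi>| > 2 is open, so each further derivative there is taken of a function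
  that vanishes locally.\<close>

lemma D_support: "norm \<xi> > 2 \<Longrightarrow> foldr partial as chi \<xi> = 0"
proof (induction as arbitrary: \<xi>)
  case Nil
  then show ?case using cutoff unfolding LP_cutoff_def foldr.simps id_apply by blast
next
  case (Cons a as)
  let ?f = "\<lambda>s. foldr partial as chi (\<xi> + s *\<^sub>R axis a 1)"
  have "((\<lambda>s. norm (\<xi> + s *\<^sub>R axis a 1)) \<longlongrightarrow> norm (\<xi> + 0 *\<^sub>R axis a 1)) (at 0)"
    by (intro tendsto_intros)
  then have "\<forall>\<^sub>F s in at 0. norm (\<xi> + s *\<^sub>R axis a 1) > 2"
    by (rule order_tendstoD(1)) (use Cons.prems in simp)
  then have "\<forall>\<^sub>F s in at 0. ?f s = 0"
    by eventually_elim (rule Cons.IH)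
  moreover have "?f 0 = 0" using Cons.IH[of \<xi>] Cons.prems by simp
  ultimately have "((\<lambda>s. (?f s - ?f 0) /\<^sub>R s) \<longlongrightarrow> 0) (at 0)"
    by (intro tendsto_eventually) (auto elim!: eventually_mono)
  then have "(?f has_vector_derivative 0) (at 0)"
    by (simp add: has_vector_derivative_0_iff)
  then show ?case
    unfolding foldr.simps comp_apply partial_def[of a "foldr partial as chi" \<xi>] by (rule vector_derivative_at)
qed

lemma D_bump: "bump 2 (D as)"
proof -
  have "foldr partial as chi differentiable (at x)" for x
    using cutoff unfolding LP_cutoff_def smooth3_def by blast
  then have "continuous_on UNIV (foldr partial as chi)"
    by (simp add: continuous_at_imp_continuous_on differentiable_imp_continuous_within)
  then show ?thesis
    unfolding bump_def D_def by (auto intro: continuous_intros D_support)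
qed

text \<open>Each factor z_a is traded for one more derivative of the cut-off, so the list is
  arbitrary in the induction; it ends with the trivial bound of a Fourier integral by the L^1 norm
  of its symbol.\<close>

lemma kern_D_decay: "\<exists>C. \<forall>z. \<bar>z $ a\<bar> ^ n * norm (kern (D as) z) \<le> C"
proof (induction n arbitrary: as)
  case 0
  then show ?case using norm_kern_le by auto
next
  case (Suc n)
  have "norm (of_real (z $ a) * kern (D as) z) = norm (\<i> * kern (D (a # as)) z)" for z
    by (subst kern_by_parts[OF D_bump D_bump D_deriv]) simp
  then have "\<bar>z $ a\<bar> * norm (kern (D as) z) = norm (kern (D (a # as)) z)" for z
    by (simp add: norm_mult)
  then have "\<bar>z $ a\<bar> ^ Suc n * norm (kern (D as) z) = \<bar>z $ a\<bar> ^ n * norm (kern (D (a # as)) z)" for z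
    by (metis mult.commute mult.left_commute power_Suc)
  then show ?case using Suc[of "a # as"] by (simp only:)
qed

text \<open>The same induction for the gradient of the kernel, whose symbol carries a factor
  \<xi>_b. The product rule leaves one term without this factor, which \<open>kern_D_decay\<close>
  controls.\<close>

lemma kern_coord_D_decay: "\<exists>C. \<forall>z. \<bar>z $ a\<bar> ^ n * norm (kern (\<lambda>\<xi>. of_real (\<xi> $ b) * D as \<xi>) z) \<le> C"
proof (induction n arbitrary: as)
  case 0
  then show ?case using norm_kern_le by auto
next
  case (Suc n)
  let ?d = "\<lambda>as \<xi>. of_real (\<xi> $ b) * D as \<xi>"
  let ?\<delta> = "complex_of_real (axis a 1 $ b)"
  have b: "bump 2 (?d as)" for as by (intro bump_mult D_bump continuous_intros)
  have b': "bump 2 (\<lambda>\<xi>. ?\<delta> * D as \<xi>)" by (intro bump_mult D_bump continuous_intros)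
  have dv: "((\<lambda>s. ?d as (\<xi> + s *\<^sub>R axis a 1)) has_vector_derivative ?d (a # as) \<xi> + ?\<delta> * D as \<xi>) (at 0)" for \<xi>
  proof -
    have "((\<lambda>s. complex_of_real ((\<xi> + s *\<^sub>R axis a 1) $ b)) has_vector_derivative ?\<delta>) (at 0)"
      by (rule has_vector_derivative_of_real) (auto intro!: derivative_eq_intros)
    from has_vector_derivative_mult[OF this D_deriv] show ?thesis by simp
  qed
  have "kern (\<lambda>\<xi>. ?d (a # as) \<xi> + ?\<delta> * D as \<xi>) z = kern (?d (a # as)) z + ?\<delta> * kern (D as) z" for z
    unfolding kern_def using kern_integrable[OF b, of "a # as" z] kern_integrable[OF D_bump, of as z]
    by (simp add: distrib_right mult.assoc)
  then have "norm (of_real (z $ a) * kern (?d as) z) = norm (\<i> * (kern (?d (a # as)) z + ?\<delta> * kern (D as) z))" for z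
    by (subst kern_by_parts[OF b bump_add[OF b b'] dv]) simp
  then have eq: "\<bar>z $ a\<bar> * norm (kern (?d as) z) = norm (kern (?d (a # as)) z + ?\<delta> * kern (D as) z)" for z
    by (simp add: norm_mult)
  have le: "\<bar>z $ a\<bar> * norm (kern (?d as) z) \<le> norm (kern (?d (a # as)) z) + norm (kern (D as) z)" for z
  proof -
    have "norm (?\<delta> * kern (D as) z) \<le> norm (kern (D as) z)"
      by (simp add: axis_def norm_mult)
    then show ?thesis unfolding eq by (rule order_trans[OF norm_triangle_ineq add_left_mono])
  qed
  obtain C1 where C1: "\<And>z. \<bar>z $ a\<bar> ^ n * norm (kern (?d (a # as)) z) \<le> C1" using Suc[of "a # as"] by blast
  obtain C2 where C2: "\<And>z. \<bar>z $ a\<bar> ^ n * norm (kern (D as) z) \<le> C2" using kern_D_decay by blast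
  show ?case
  proof (intro exI[of _ "C1 + C2"] allI)
    fix z :: "real^3"
    have "\<bar>z $ a\<bar> ^ Suc n * norm (kern (?d as) z) \<le> \<bar>z $ a\<bar> ^ n * (norm (kern (?d (a # as)) z) + norm (kern (D as) z))"
      using mult_left_mono[OF le, of "\<bar>z $ a\<bar> ^ n" z] by (simp add: mult_ac)
    also have "\<dots> \<le> C1 + C2" using C1[of z] C2[of z] by (simp add: distrib_left)
    finally show "\<bar>z $ a\<bar> ^ Suc n * norm (kern (?d as) z) \<le> C1 + C2" .
  qed
qed

text \<open>The inverse Fourier transform of \<open>chi\<close>, that is, the kernel of the
  projection to low frequencies; \<open>dkap\<close> is its gradient.\<close>

definition kap :: "real^3 \<Rightarrow> complex" where
  "kap z = of_real (1 / (2 * pi) ^ 3) * kern (D []) z"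

definition dkap :: "3 \<Rightarrow> real^3 \<Rightarrow> complex" where
  "dkap b z = of_real (1 / (2 * pi) ^ 3) * kern (\<lambda>\<xi>. \<i> * of_real (\<xi> $ b) * D [] \<xi>) z"

lemma kap_rapid: "rapid kap dkap"
proof -
  have kern_i: "kern (\<lambda>\<xi>. \<i> * of_real (\<xi> $ b) * D [] \<xi>) z = \<i> * kern (\<lambda>\<xi>. of_real (\<xi> $ b) * D [] \<xi>) z" for b z
    unfolding kern_def by (simp add: mult.assoc)
  have b: "bump 2 (\<lambda>\<xi>. \<i> * of_real (\<xi> $ b) * D [] \<xi>)" for b
    by (intro bump_mult D_bump continuous_intros)
  have "rapid (kern (D [])) (\<lambda>b. kern (\<lambda>\<xi>. \<i> * of_real (\<xi> $ b) * D [] \<xi>))"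
    unfolding rapid_def
  proof (intro conjI allI)
    fix n
    have "\<exists>C. \<forall>z. norm (kern (D []) z) * (1 + norm z) ^ n \<le> C"
      by (rule decay_from_coords) (rule kern_D_decay)
    then obtain C where C: "\<And>z. norm (kern (D []) z) * (1 + norm z) ^ n \<le> C" by blast
    have "\<exists>C. \<forall>z. norm (kern (\<lambda>\<xi>. \<i> * of_real (\<xi> $ b) * D [] \<xi>) z) * (1 + norm z) ^ n \<le> C" for b
      by (rule decay_from_coords) (simp only: kern_i norm_mult, simp add: kern_coord_D_decay)
    then obtain C' where C': "\<And>b z. norm (kern (\<lambda>\<xi>. \<i> * of_real (\<xi> $ b) * D [] \<xi>) z) * (1 + norm z) ^ n \<le> C' b" by metis
    have "C' b \<le> (\<Sum>b\<in>UNIV. \<bar>C' b\<bar>)" for b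
      by (rule order_trans[OF abs_ge_self member_le_sum[of b UNIV "\<lambda>b. \<bar>C' b\<bar>"]]) auto
    then have "norm (kern (\<lambda>\<xi>. \<i> * of_real (\<xi> $ b) * D [] \<xi>) z) * (1 + norm z) ^ n \<le> \<bar>C\<bar> + (\<Sum>b\<in>UNIV. \<bar>C' b\<bar>)" for b z
      using C'[where b=b and z=z] by (smt (verit))
    moreover have "norm (kern (D []) z) * (1 + norm z) ^ n \<le> \<bar>C\<bar> + (\<Sum>b\<in>UNIV. \<bar>C' b\<bar>)" for z
    proof -
      have "(\<Sum>b\<in>UNIV. \<bar>C' b\<bar>) \<ge> 0" by (simp add: sum_nonneg)
      then show ?thesis using C[of z] by linarith
    qed
    ultimately show "\<exists>C. \<forall>z. norm (kern (D []) z) * (1 + norm z) ^ n \<le> C \<and>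
        (\<forall>b. norm (kern (\<lambda>\<xi>. \<i> * of_real (\<xi> $ b) * D [] \<xi>) z) * (1 + norm z) ^ n \<le> C)"
      by blast
  qed (use continuous_kern[OF D_bump] continuous_kern[OF b] kern_has_derivative[OF D_bump] in auto)
  from rapid_cmult[OF this] show ?thesis
    unfolding kap_def[abs_def] dkap_def[abs_def] .
qed

text \<open>\<open>chi\<close> is radial, and orthogonal maps preserve the inner product and the
  measure. Averaging against \<open>kap\<close> therefore commutes with rotations, which is what
  \<open>localized_rot\<close> rests on.\<close>

lemma kap_orthogonal:
  assumes R: "orthogonal_transformation R" shows "kap (R z) = kap z"
proof -
  note [measurable] = bump_measurable[OF D_bump[of "[]"]] 
  have "kern (D []) (R z) = (\<integral>\<xi>. D [] (R \<xi>) * cis (R z \<bullet> R \<xi>) \<partial>lborel)"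
    unfolding kern_def by (rule integral_orthogonal[OF R, symmetric]) simp
  also have "\<dots> = kern (D []) z"
    unfolding kern_def
  proof (intro Bochner_Integration.integral_cong refl)
    fix \<xi>
    have "chi (R \<xi>) = chi \<xi>"
      using cutoff orthogonal_transformation_norm[OF R, of \<xi>] unfolding LP_cutoff_def by blast
    then show "D [] (R \<xi>) * cis (R z \<bullet> R \<xi>) = D [] \<xi> * cis (z \<bullet> \<xi>)"
      using R by (simp add: D_def orthogonal_transformation_def)
  qed
  finally show ?thesis by (simp add: kap_def)
qed

end

lemma rapid_measurable:
  assumes "rapid K dK"
  shows "K \<in> borel_measurable borel" "dK b \<in> borel_measurable borel"
  using assms by (auto simp: rapid_def intro: borel_measurable_continuous_onI)

lemma rapid_bound:
  assumes "rapid K dK"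
  obtains C where "C \<ge> 0" "\<And>z. norm (K z) \<le> C / (1 + norm z) ^ n" "\<And>b z. norm (dK b z) \<le> C / (1 + norm z) ^ n"
proof -
  obtain C where C: "\<And>z. norm (K z) * (1 + norm z) ^ n \<le> C" "\<And>b z. norm (dK b z) * (1 + norm z) ^ n \<le> C"
    using assms unfolding rapid_def by blast
  have p: "(1 + norm z) ^ n > 0" for z :: "real^3"
    by (intro zero_less_power add_pos_nonneg) auto
  have "C \<ge> 0" using order_trans[OF _ C(1)[of 0]] by simp
  with C p show ?thesis by (intro that[of C]) (simp_all add: pos_le_divide_eq)
qed

lemma rapid_integrable:
  assumes "rapid K dK" shows "integrable lborel K"
proof -
  obtain C where C: "C \<ge> 0" "\<And>z. norm (K z) \<le> C / (1 + norm z) ^ 6"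
    using rapid_bound[OF assms, of 6] by metis
  show ?thesis
    by (rule Bochner_Integration.integrable_bound[OF integrable_mult_right[OF integrable_decay, of C]])
       (use C rapid_measurable[OF assms] in auto)
qed

context LP
begin

lemma kap_integrable: "integrable lborel kap"
  using rapid_integrable[OF kap_rapid] .

text \<open>Fourier inversion for the symbol \<open>chi\<close>, with the constants absorbed in
  \<open>kap\<close>. Averaging against \<open>kap\<close> at scale s therefore multiplies the
  frequency \<xi> by the value of \<open>chi\<close> at s \<xi>.\<close>

lemma kap_inversion: "(\<integral>z. kap z * cis (- (z \<bullet> \<eta>)) \<partial>lborel) = of_real (chi \<eta>)"
proof -
  have "integrable lborel (\<lambda>z. of_real ((2 * pi) ^ 3) * kap z)"
    using kap_integrable by simp
  then have "integrable lborel (kern (D []))" by (simp add: kap_def)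
  from Fourier_inversion[OF D_bump this, of \<eta>] show ?thesis
    by (simp add: kap_def D_Nil mult.assoc)
qed

end

section \<open>Convolution of a tempered function with a rapidly decreasing kernel\<close>

definition decaying :: "(real^3 \<Rightarrow> complex) \<Rightarrow> bool" where
  "decaying K \<longleftrightarrow> continuous_on UNIV K \<and> (\<forall>n. \<exists>C. \<forall>z. norm (K z) \<le> C / (1 + norm z) ^ n)"

lemma rapid_decaying:
  assumes K: "rapid K dK" shows "decaying K" "decaying (dK b)"
proof -
  have "\<exists>C. \<forall>z. norm (K z) \<le> C / (1 + norm z) ^ n" "\<exists>C. \<forall>z. norm (dK b z) \<le> C / (1 + norm z) ^ n" for n
    by (rule rapid_bound[OF K, of n]; blast)+
  then show "decaying K" "decaying (dK b)"
    using K by (auto simp: decaying_def rapid_def)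
qed

text \<open>A Borel representative with a fixed growth exponent. Fubini's theorem is applied to
  \<open>lborel\<close>, whereas \<open>tempered\<close> speaks of Lebesgue measurable functions; a
  convolution does not distinguish functions that agree almost everywhere.\<close>

definition tempB :: "nat \<Rightarrow> (real^3 \<Rightarrow> complex) \<Rightarrow> bool" where
  "tempB N f \<longleftrightarrow> f \<in> borel_measurable borel \<and> integrable lborel (\<lambda>x. f x / of_real ((1 + norm x) ^ N))"

lemma complex_completion_ex_borel:
  fixes g :: "'a \<Rightarrow> complex"
  assumes [measurable]: "g \<in> borel_measurable (completion M)"
  shows "\<exists>g'\<in>borel_measurable M. AE x in M. g x = g' x"
proof -
  have "(\<lambda>x. Re (g x)) \<in> borel_measurable (completion M)" "(\<lambda>x. Im (g x)) \<in> borel_measurable (completion M)"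
    by measurable
  then obtain r i where [measurable]: "r \<in> borel_measurable M" "i \<in> borel_measurable M"
    and ae: "AE x in M. Re (g x) = r x" "AE x in M. Im (g x) = i x"
    using completion_ex_borel_measurable_real by metis
  have 1: "(\<lambda>x. Complex (r x) (i x)) \<in> borel_measurable M"
    by (simp add: borel_measurable_complex_iff)
  have 2: "AE x in M. g x = Complex (r x) (i x)"
    using ae by eventually_elim (simp add: complex_eq_iff)
  show ?thesis by (rule bexI[OF _ 1]) (rule 2)
qed

lemma tempered_ex_tempB:
  assumes "tempered f"
  obtains g N where "tempB N g" "AE x in lborel. f x = g x"
proof -
  obtain N where f: "f \<in> borel_measurable lebesgue" "integrable lebesgue (\<lambda>x. f x / of_real ((1 + norm x) ^ N))"
    using assms unfolding tempered_def by blast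
  obtain g where [measurable]: "g \<in> borel_measurable borel" and ae: "AE x in lborel. f x = g x"
    using complex_completion_ex_borel[OF f(1)] by auto
  have "integrable lebesgue (\<lambda>x. g x / of_real ((1 + norm x) ^ N))"
  proof (rule integrable_cong_AE_imp[OF f(2)])
    show "AE x in lebesgue. f x / of_real ((1 + norm x) ^ N) = g x / of_real ((1 + norm x) ^ N)"
      using AE_completion[OF ae] by eventually_elim simp
  qed (rule measurable_completion, measurable)
  then have "integrable lborel (\<lambda>x. g x / of_real ((1 + norm x) ^ N))"
    by (subst (asm) integrable_completion) measurable
  with ae show ?thesis by (intro that[of N g]) (auto simp: tempB_def)
qed

text \<open>Peetre's inequality: it converts decay of a kernel at x - y into decay in y, at the
  price of growth in x.\<close>

lemma norm_shift_le:
  fixes x y :: "'a::real_normed_vector"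
  shows "1 + norm y \<le> (1 + norm x) * (1 + norm (x - y))"
proof -
  have "norm y \<le> norm x + norm (x - y)" using norm_triangle_sub[of y x] by (simp add: norm_minus_commute)
  moreover have "0 \<le> norm x * norm (x - y)" by simp
  moreover have "(1 + norm x) * (1 + norm (x - y)) = 1 + norm x + norm (x - y) + norm x * norm (x - y)"
    by (simp add: algebra_simps)
  ultimately show ?thesis by linarith
qed

lemma decaying_shift_bound:
  assumes "decaying K"
  obtains C where "C \<ge> 0" "\<And>x y. norm (K (x - y)) \<le> C * (1 + norm x) ^ N / (1 + norm y) ^ N"
proof -
  obtain C where C: "\<And>z. norm (K z) \<le> C / (1 + norm z) ^ N" using assms unfolding decaying_def by blast
  have C0: "C \<ge> 0" using order_trans[OF _ C[of 0]] by simp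
  show ?thesis
  proof (rule that[OF C0])
    fix x y :: "real^3"
    have p: "(1 + norm z) ^ N > 0" for z :: "real^3" by (intro zero_less_power add_pos_nonneg) auto
    have "(1 + norm y) ^ N \<le> (1 + norm x) ^ N * (1 + norm (x - y)) ^ N"
      using power_mono[OF norm_shift_le[of y x], of N] by (simp add: power_mult_distrib)
    then have "C / (1 + norm (x - y)) ^ N \<le> C * (1 + norm x) ^ N / (1 + norm y) ^ N"
      using C0 p by (simp add: divide_simps) (metis mult.assoc mult.commute mult_left_mono)
    then show "norm (K (x - y)) \<le> C * (1 + norm x) ^ N / (1 + norm y) ^ N"
      using C[of "x - y"] by linarith
  qed
qed

lemma decaying_measurable: "decaying K \<Longrightarrow> K \<in> borel_measurable borel"
  by (auto simp: decaying_def intro: borel_measurable_continuous_onI)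

lemma tempB_measurable: "tempB N f \<Longrightarrow> f \<in> borel_measurable borel"
  by (simp add: tempB_def)

definition cv :: "(real^3 \<Rightarrow> complex) \<Rightarrow> (real^3 \<Rightarrow> complex) \<Rightarrow> real^3 \<Rightarrow> complex" where
  "cv f K x = (\<integral>y. f y * K (x - y) \<partial>lborel)"

lemma tempB_integrable_bound:
  assumes "tempB N f"
  shows "integrable lborel (\<lambda>y. norm (f y) * (c / (1 + norm y) ^ N))"
proof -
  have "integrable lborel (\<lambda>y. c * norm (f y / of_real ((1 + norm y) ^ N)))"
    using assms by (intro integrable_mult_right integrable_norm) (simp add: tempB_def)
  moreover have "norm (of_real ((1 + norm y) ^ N) :: complex) = (1 + norm y) ^ N" for y :: "real^3"
    by (simp only: norm_of_real) (simp add: add_nonneg_nonneg)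
  ultimately show ?thesis by (simp add: norm_divide mult.commute del: of_real_power)
qed

lemma cv_integrable:
  assumes f: "tempB N f" and K: "decaying K"
  shows "integrable lborel (\<lambda>y. f y * K (x - y))"
proof -
  note [measurable] = tempB_measurable[OF f] decaying_measurable[OF K]
  obtain C where C: "C \<ge> 0" "\<And>x y. norm (K (x - y)) \<le> C * (1 + norm x) ^ N / (1 + norm y) ^ N"
    using decaying_shift_bound[OF K] by metis
  show ?thesis
  proof (rule Bochner_Integration.integrable_bound[OF tempB_integrable_bound[OF f, of "C * (1 + norm x) ^ N"]])
    have "norm (f y * K (x - y)) \<le> norm (f y) * (C * (1 + norm x) ^ N / (1 + norm y) ^ N)" for y
      unfolding norm_mult by (intro mult_left_mono C) simp
    then show "AE y in lborel. norm (f y * K (x - y)) \<le> norm (norm (f y) * (C * (1 + norm x) ^ N / (1 + norm y) ^ N))"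
      by (intro AE_I2) (simp only: real_norm_def order_trans[OF _ abs_ge_self])
  qed measurable
qed

text \<open>The bound is for the integral of absolute values, because it also provides the majorant
  for Fubini's theorem in \<open>cv_smear\<close>.\<close>

lemma cv_growth:
  assumes f: "tempB N f" and K: "decaying K"
  obtains C where "C \<ge> 0" "\<And>x. (\<integral>y. norm (f y * K (x - y)) \<partial>lborel) \<le> C * (1 + norm x) ^ N"
proof -
  obtain C where C: "C \<ge> 0" "\<And>x y. norm (K (x - y)) \<le> C * (1 + norm x) ^ N / (1 + norm y) ^ N"
    using decaying_shift_bound[OF K] by metis
  let ?I = "\<integral>y. norm (f y) * (1 / (1 + norm y) ^ N) \<partial>lborel"
  show ?thesis
  proof (rule that[of "C * ?I"])
    show "0 \<le> C * ?I" using C(1) by (intro mult_nonneg_nonneg integral_nonneg) (auto intro!: divide_nonneg_nonneg)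
    fix x
    have "(\<integral>y. norm (f y * K (x - y)) \<partial>lborel) \<le> (\<integral>y. norm (f y) * (C * (1 + norm x) ^ N / (1 + norm y) ^ N) \<partial>lborel)"
      unfolding norm_mult
      by (intro integral_mono tempB_integrable_bound[OF f] mult_left_mono C integrable_norm[OF cv_integrable[OF f K], unfolded norm_mult] norm_ge_zero)
    also have "\<dots> = (\<integral>y. (C * (1 + norm x) ^ N) * (norm (f y) * (1 / (1 + norm y) ^ N)) \<partial>lborel)"
      by (intro Bochner_Integration.integral_cong refl) simp
    also have "\<dots> = C * (1 + norm x) ^ N * ?I" by (rule integral_mult_right_zero)
    finally show "(\<integral>y. norm (f y * K (x - y)) \<partial>lborel) \<le> C * ?I * (1 + norm x) ^ N"
      by (simp add: mult_ac)
  qed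
qed

lemma norm_cv_le: "norm (cv f K x) \<le> (\<integral>y. norm (f y * K (x - y)) \<partial>lborel)"
  unfolding cv_def by (rule integral_norm_bound)

lemma continuous_cv:
  assumes f: "tempB N f" and K: "decaying K"
  shows "continuous_on UNIV (cv f K)"
  unfolding continuous_on_sequentially comp_def cv_def
proof safe
  fix X :: "nat \<Rightarrow> real^3" and x assume X: "X \<longlonglongrightarrow> x"
  note [measurable] = tempB_measurable[OF f] decaying_measurable[OF K]
  obtain C where C: "C \<ge> 0" "\<And>x y. norm (K (x - y)) \<le> C * (1 + norm x) ^ N / (1 + norm y) ^ N"
    using decaying_shift_bound[OF K] by metis
  obtain B where B: "\<And>n. norm (X n) \<le> B"
    using convergent_imp_Bseq[of X] X unfolding convergent_def Bseq_def by blast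
  show "(\<lambda>n. \<integral>y. f y * K (X n - y) \<partial>lborel) \<longlonglongrightarrow> (\<integral>y. f y * K (x - y) \<partial>lborel)"
  proof (rule integral_dominated_convergence[where w = "\<lambda>y. norm (f y) * (C * (1 + B) ^ N / (1 + norm y) ^ N)"])
    show "AE y in lborel. (\<lambda>n. f y * K (X n - y)) \<longlonglongrightarrow> f y * K (x - y)"
    proof (intro AE_I2 tendsto_mult tendsto_const)
      fix y
      have "(\<lambda>n. X n - y) \<longlonglongrightarrow> x - y" by (intro tendsto_intros X)
      then show "(\<lambda>n. K (X n - y)) \<longlonglongrightarrow> K (x - y)"
        using K continuous_on_tendsto_compose[of UNIV K] by (auto simp: decaying_def)
    qed
    show "AE y in lborel. norm (f y * K (X n - y)) \<le> norm (f y) * (C * (1 + B) ^ N / (1 + norm y) ^ N)" for n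
    proof (rule AE_I2)
      fix y
      have "norm (K (X n - y)) \<le> C * (1 + norm (X n)) ^ N / (1 + norm y) ^ N" by (rule C)
      also have "\<dots> \<le> C * (1 + B) ^ N / (1 + norm y) ^ N"
        using C(1) B[of n] by (intro divide_right_mono mult_left_mono power_mono) auto
      finally show "norm (f y * K (X n - y)) \<le> norm (f y) * (C * (1 + B) ^ N / (1 + norm y) ^ N)"
        unfolding norm_mult by (rule mult_left_mono) simp
    qed
  qed (use tempB_integrable_bound[OF f] in measurable)
qed

text \<open>For |s| <= 1 the derivative of K along the segment, seen from y, is at most a constant
  times (1 + |y|)^(-N) by Peetre's inequality, and |f| times this weight is integrable.\<close>

lemma cv_has_derivative:
  assumes f: "tempB N f" and K: "rapid K dK"
  shows "((\<lambda>s. cv f K (x + s *\<^sub>R e)) has_vector_derivative (\<Sum>b\<in>UNIV. e $ b *\<^sub>R cv f (dK b) x)) (at 0)"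
proof -
  note [measurable] = tempB_measurable[OF f] rapid_measurable[OF K]
  note d = rapid_decaying(1)[OF K] rapid_decaying(2)[OF K]
  have "\<forall>b. \<exists>C\<ge>0. \<forall>x y. norm (dK b (x - y)) \<le> C * (1 + norm x) ^ N / (1 + norm y) ^ N"
    using decaying_shift_bound[OF d(2)] by metis
  then obtain C where C: "\<And>b. C b \<ge> 0" "\<And>b x y. norm (dK b (x - y)) \<le> C b * (1 + norm x) ^ N / (1 + norm y) ^ N"
    by metis
  define E where "E = (\<Sum>b\<in>UNIV. \<bar>e $ b\<bar> * (C b * (1 + (norm x + norm e)) ^ N))"
  have dv: "((\<lambda>s. K (x + s *\<^sub>R e - y)) has_vector_derivative (\<Sum>b\<in>UNIV. e $ b *\<^sub>R dK b (x + s *\<^sub>R e - y))) (at s)" for s y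
  proof (rule has_vector_derivative_shift)
    have "((\<lambda>r. K ((x + s *\<^sub>R e - y) + r *\<^sub>R e)) has_vector_derivative (\<Sum>b\<in>UNIV. e $ b *\<^sub>R dK b (x + s *\<^sub>R e - y))) (at 0)"
      using K unfolding rapid_def by blast
    then show "((\<lambda>r. K (x + (s + r) *\<^sub>R e - y)) has_vector_derivative (\<Sum>b\<in>UNIV. e $ b *\<^sub>R dK b (x + s *\<^sub>R e - y))) (at 0)"
      by (simp add: algebra_simps)
  qed
  have bd: "norm (\<Sum>b\<in>UNIV. e $ b *\<^sub>R dK b (x + s *\<^sub>R e - y)) \<le> E / (1 + norm y) ^ N" if "\<bar>s\<bar> \<le> 1" for s y
  proof -
    have n: "norm (x + s *\<^sub>R e) \<le> norm x + norm e"
      using norm_triangle_ineq[of x "s *\<^sub>R e"] that mult_right_mono[of "\<bar>s\<bar>" 1 "norm e"] by simp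
    have "norm (e $ b *\<^sub>R dK b (x + s *\<^sub>R e - y)) \<le> \<bar>e $ b\<bar> * (C b * (1 + (norm x + norm e)) ^ N) / (1 + norm y) ^ N" for b
    proof -
      have "norm (dK b (x + s *\<^sub>R e - y)) \<le> C b * (1 + norm (x + s *\<^sub>R e)) ^ N / (1 + norm y) ^ N" by (rule C)
      also have "\<dots> \<le> C b * (1 + (norm x + norm e)) ^ N / (1 + norm y) ^ N"
        using C(1) n by (intro divide_right_mono mult_left_mono power_mono) auto
      finally show ?thesis
        using mult_left_mono[of _ _ "\<bar>e $ b\<bar>"] by fastforce
    qed
    then show ?thesis
      unfolding E_def sum_divide_distrib by (intro sum_norm_le) blast
  qed
  have "((\<lambda>s. \<integral>y. f y * K (x + s *\<^sub>R e - y) \<partial>lborel) has_vector_derivative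
      (\<integral>y. f y * (\<Sum>b\<in>UNIV. e $ b *\<^sub>R dK b (x - y)) \<partial>lborel)) (at 0)"
  proof (rule has_vector_derivative_integral[where g = "\<lambda>y. norm (f y) * (E / (1 + norm y) ^ N)"])
    show "((\<lambda>s. f y * K (x + s *\<^sub>R e - y)) has_vector_derivative f y * (\<Sum>b\<in>UNIV. e $ b *\<^sub>R dK b (x - y))) (at 0)" for y
      using has_vector_derivative_mult_right[OF dv[of y 0], of "f y"] by simp
    show "norm (f y * K (x + s *\<^sub>R e - y) - f y * K (x + 0 *\<^sub>R e - y)) \<le> \<bar>s\<bar> * (norm (f y) * (E / (1 + norm y) ^ N))"
      if "\<bar>s\<bar> < 1" for y s
    proof -
      have "norm (K (x + s *\<^sub>R e - y) - K (x + 0 *\<^sub>R e - y)) \<le> E / (1 + norm y) ^ N * \<bar>s - 0\<bar>"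
        by (rule vector_derivative_bound_on[of "{-1..1}", OF _ dv bd]) (use that in auto)
      from mult_left_mono[OF this norm_ge_zero[of "f y"]] show ?thesis
        by (simp add: right_diff_distrib[symmetric] norm_mult mult_ac)
    qed
  qed (use cv_integrable[OF f d(1)] tempB_integrable_bound[OF f] in auto)
  also have "(\<integral>y. f y * (\<Sum>b\<in>UNIV. e $ b *\<^sub>R dK b (x - y)) \<partial>lborel) =
      (\<integral>y. (\<Sum>b\<in>UNIV. e $ b *\<^sub>R (f y * dK b (x - y))) \<partial>lborel)"
    by (intro Bochner_Integration.integral_cong refl) (simp add: sum_distrib_left)
  also have "\<dots> = (\<Sum>b\<in>UNIV. e $ b *\<^sub>R cv f (dK b) x)"
    unfolding cv_def by (subst Bochner_Integration.integral_sum) (use cv_integrable[OF f d(2)] in auto)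
  finally show ?thesis unfolding cv_def .
qed

lemma integrable_growth_kernel:
  assumes h: "continuous_on UNIV h" "\<And>x. norm (h x) \<le> C * (1 + norm x) ^ N" and C: "C \<ge> 0" and K: "decaying K" and s: "s \<ge> 0"
  shows "integrable lborel (\<lambda>z. (h (x - s *\<^sub>R z) :: complex) * K z)"
proof -
  note [measurable] = decaying_measurable[OF K] borel_measurable_continuous_onI[OF h(1)]
  \<comment> \<open>N powers of decay absorb the growth of h, and 6 more make the product
    integrable.\<close>
  obtain D where D: "\<And>z. norm (K z) \<le> D / (1 + norm z) ^ (N + 6)" using K unfolding decaying_def by blast
  let ?B = "C * ((1 + norm x) * (1 + s)) ^ N * D"
  show ?thesis
  proof (rule Bochner_Integration.integrable_bound[OF integrable_mult_right[OF integrable_decay, of ?B]])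
    show "AE z in lborel. norm (h (x - s *\<^sub>R z) * K z) \<le> norm (?B * (1 / (1 + norm z) ^ 6))"
    proof (rule AE_I2)
      fix z :: "real^3"
      have "1 + norm (x - s *\<^sub>R z) \<le> 1 + (norm x + s * norm z)"
        using norm_triangle_ineq4[of x "s *\<^sub>R z"] s by simp
      also have "\<dots> \<le> (1 + norm x) * (1 + s) * (1 + norm z)"
        using s by (simp add: algebra_simps)
      finally have "(1 + norm (x - s *\<^sub>R z)) ^ N \<le> ((1 + norm x) * (1 + s)) ^ N * (1 + norm z) ^ N"
        using power_mono[of "1 + norm (x - s *\<^sub>R z)" "(1 + norm x) * (1 + s) * (1 + norm z)" N] by (simp add: power_mult_distrib)
      then have "norm (h (x - s *\<^sub>R z)) \<le> C * (((1 + norm x) * (1 + s)) ^ N * (1 + norm z) ^ N)"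
        using h(2)[of "x - s *\<^sub>R z"] C mult_left_mono order_trans by meson
      then have "norm (h (x - s *\<^sub>R z)) * norm (K z) \<le> C * (((1 + norm x) * (1 + s)) ^ N * (1 + norm z) ^ N) * (D / (1 + norm z) ^ (N + 6))"
        using C s by (intro mult_mono D) auto
      also have "\<dots> = ?B * (1 / (1 + norm z) ^ 6)"
      proof -
        have "1 + norm z \<noteq> 0" using norm_ge_zero[of z] by linarith
        then show ?thesis by (simp add: power_add)
      qed
      finally show "norm (h (x - s *\<^sub>R z) * K z) \<le> norm (?B * (1 / (1 + norm z) ^ 6))"
        unfolding norm_mult[of "h _"] real_norm_def by (rule order_trans[OF _ abs_ge_self])
    qed
  qed measurable
qed

text \<open>Fubini's theorem. Through it, identities for the averaged kernel \<open>LPk\<close>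
  become identities for the pieces of an arbitrary tempered function.\<close>

lemma cv_smear:
  assumes f: "tempB N f" and K: "decaying K" and L: "decaying L" and s: "s \<ge> 0"
  shows "(\<integral>z. cv f K (x - s *\<^sub>R z) * L z \<partial>lborel) = cv f (\<lambda>w. \<integral>z. K (w - s *\<^sub>R z) * L z \<partial>lborel) x"
    and "integrable lborel (\<lambda>z. cv f K (x - s *\<^sub>R z) * L z)"
proof -
  note [measurable] = tempB_measurable[OF f] decaying_measurable[OF K] decaying_measurable[OF L]
  obtain C where C: "C \<ge> 0" "\<And>x. (\<integral>y. norm (f y * K (x - y)) \<partial>lborel) \<le> C * (1 + norm x) ^ N"
    using cv_growth[OF f K] by metis
  show "integrable lborel (\<lambda>z. cv f K (x - s *\<^sub>R z) * L z)"
    by (rule integrable_growth_kernel[OF continuous_cv[OF f K] order_trans[OF norm_cv_le C(2)] C(1) L s])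
  let ?F = "\<lambda>z y. f y * K (x - s *\<^sub>R z - y) * L z"
  \<comment> \<open>\<open>?G\<close> is the convolution of |f| with |K|. It is continuous by
    \<open>continuous_cv\<close> and of polynomial growth by \<open>cv_growth\<close>, so the
    iterated integral of absolute values is finite.\<close>
  let ?G = "\<lambda>x. complex_of_real (\<integral>y. norm (f y * K (x - y)) \<partial>lborel)"
  have "decaying (\<lambda>z. of_real (norm (K z)))"
    using K by (auto simp: decaying_def intro!: continuous_intros)
  moreover have "tempB N (\<lambda>y. of_real (norm (f y)))"
    unfolding tempB_def
  proof
    have "integrable lborel (\<lambda>y. complex_of_real (norm (f y) * (1 / (1 + norm y) ^ N)))"
      by (rule integrable_of_real) (rule tempB_integrable_bound[OF f])
    then show "integrable lborel (\<lambda>y. complex_of_real (norm (f y)) / of_real ((1 + norm y) ^ N))"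
      by simp
  qed measurable
  ultimately have "continuous_on UNIV (cv (\<lambda>y. of_real (norm (f y))) (\<lambda>z. of_real (norm (K z))))"
    by (intro continuous_cv)
  also have "cv (\<lambda>y. of_real (norm (f y))) (\<lambda>z. of_real (norm (K z))) = ?G"
    unfolding cv_def by (simp add: fun_eq_iff norm_mult flip: integral_complex_of_real)
  finally have Gc: "continuous_on UNIV ?G" .
  have G: "norm (?G x) \<le> C * (1 + norm x) ^ N" for x
    using C(2)[of x] by (simp add: abs_of_nonneg integral_nonneg)
  have "integrable lborel (\<lambda>z. norm (?G (x - s *\<^sub>R z) * L z))"
    by (intro integrable_norm integrable_growth_kernel[OF Gc G C(1) L s])
  then have Gi: "integrable lborel (\<lambda>z. (\<integral>y. norm (f y * K (x - s *\<^sub>R z - y)) \<partial>lborel) * norm (L z))"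
    by (simp add: norm_mult abs_of_nonneg integral_nonneg)
  have Fi: "integrable (lborel \<Otimes>\<^sub>M lborel) (\<lambda>(z, y). ?F z y)"
  proof (rule lborel_pair.Fubini_integrable)
    show "integrable lborel (\<lambda>z. \<integral>y. norm (case (z, y) of (z, y) \<Rightarrow> ?F z y) \<partial>lborel)"
    proof -
      have "norm (?F z y) = norm (f y * K (x - s *\<^sub>R z - y)) * norm (L z)" for z y
        by (rule norm_mult)
      then show ?thesis using Gi by (simp only: prod.case integral_mult_left_zero)
    qed
    show "AE z in lborel. integrable lborel (\<lambda>y. case (z, y) of (z, y) \<Rightarrow> ?F z y)"
      using cv_integrable[OF f K] by simp
  qed measurable
  have "(\<integral>z. cv f K (x - s *\<^sub>R z) * L z \<partial>lborel) = (\<integral>z. (\<integral>y. ?F z y \<partial>lborel) \<partial>lborel)"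
    unfolding cv_def by simp
  also have "\<dots> = (\<integral>y. (\<integral>z. ?F z y \<partial>lborel) \<partial>lborel)"
    by (rule lborel_pair.Fubini_integral[OF Fi, symmetric])
  also have "\<dots> = cv f (\<lambda>w. \<integral>z. K (w - s *\<^sub>R z) * L z \<partial>lborel) x"
    unfolding cv_def
  proof (intro Bochner_Integration.integral_cong refl)
    fix y
    have "(\<integral>z. ?F z y \<partial>lborel) = (\<integral>z. f y * (K (x - y - s *\<^sub>R z) * L z) \<partial>lborel)"
      by (intro Bochner_Integration.integral_cong refl) (simp add: algebra_simps)
    then show "(\<integral>z. ?F z y \<partial>lborel) = f y * (\<integral>z. K (x - y - s *\<^sub>R z) * L z \<partial>lborel)" by simp
  qed
  finally show "(\<integral>z. cv f K (x - s *\<^sub>R z) * L z \<partial>lborel) = cv f (\<lambda>w. \<integral>z. K (w - s *\<^sub>R z) * L z \<partial>lborel) x" .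
qed

text \<open>Bridge from the Lebesgue integrals in the definition of the projections to Borel
  convolutions, by passing to a representative.\<close>

lemma lebesgue_integral_eq_cv:
  assumes ae: "AE x in lborel. f x = g x" and K: "decaying K" and f: "f \<in> borel_measurable lebesgue" and g: "g \<in> borel_measurable borel"
  shows "(\<integral>y. f y * K (x - y) \<partial>lebesgue) = cv g K x"
proof -
  note [measurable] = g decaying_measurable[OF K]
  have "(\<lambda>y. K (x - y)) \<in> borel_measurable lebesgue"
    by (rule measurable_completion) measurable
  then have "(\<integral>y. f y * K (x - y) \<partial>lebesgue) = (\<integral>y. g y * K (x - y) \<partial>lebesgue)"
    using AE_completion[OF ae] f g
    by (intro integral_cong_AE borel_measurable_times) (auto simp: measurable_completion)
  also have "\<dots> = cv g K x"
    unfolding cv_def by (rule integral_completion) measurable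
  finally show ?thesis .
qed

section \<open>Littlewood--Paley pieces\<close>

context LP
begin

definition symb :: "int \<Rightarrow> real^3 \<Rightarrow> complex" where
  "symb k \<xi> = of_real (LP_symbol chi k \<xi>)"

definition LPk :: "int \<Rightarrow> real^3 \<Rightarrow> complex" where
  "LPk k z = of_real (1 / (2 * pi) ^ 3) * kern (symb k) z"

text \<open>The symbol of P_k is a difference of two dilates of \<open>chi\<close>, hence its kernel
  is a difference of two dilates of \<open>kap\<close>; this is the gradient of that
  difference.\<close>

definition dLPk :: "int \<Rightarrow> 3 \<Rightarrow> real^3 \<Rightarrow> complex" where
  "dLPk k b z = of_real ((2 powi k) ^ 3) * (2 powi k *\<^sub>R dkap b (2 powi k *\<^sub>R z)) -
     of_real ((2 powi (k - 1)) ^ 3) * (2 powi (k - 1) *\<^sub>R dkap b (2 powi (k - 1) *\<^sub>R z))"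

lemma symb_bump: "bump (2 powi (k + 1)) (symb k)"
  unfolding bump_def symb_def
  using LP_symbol_continuous[OF cutoff] LP_symbol_support[OF cutoff]
  by (auto intro!: continuous_intros)

lemma scaled_bump:
  assumes "c > 0" shows "bump (2 * c) (\<lambda>\<xi>. D [] (\<xi> /\<^sub>R c))"
  unfolding bump_def
proof safe
  show "continuous_on UNIV (\<lambda>\<xi>. D [] (\<xi> /\<^sub>R c))"
    by (rule continuous_on_compose2[of UNIV "D []"]) (use D_bump in \<open>auto simp: bump_def intro!: continuous_intros\<close>)
  fix \<xi> :: "real^3" assume "norm \<xi> > 2 * c"
  then have "norm (\<xi> /\<^sub>R c) > 2" using assms by (simp add: field_simps)
  then show "D [] (\<xi> /\<^sub>R c) = 0" using D_bump[of "[]"] by (simp add: bump_def)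
qed

lemma kern_scaled:
  assumes c: "c > 0" shows "kern (\<lambda>\<xi>. D [] (\<xi> /\<^sub>R c)) z = of_real (c ^ 3) * kern (D []) (c *\<^sub>R z)"
proof -
  note [measurable] = bump_measurable[OF D_bump[of "[]"]]
  show ?thesis
    unfolding kern_def by (subst integral_scale[OF _ c]) (use c in auto)
qed

lemma LPk_rapid: "rapid (LPk k) (dLPk k)"
proof -
  let ?a = "2 powi k :: real" and ?b = "2 powi (k - 1) :: real"
  have s: "symb k = (\<lambda>\<xi>. D [] (\<xi> /\<^sub>R ?a) - D [] (\<xi> /\<^sub>R ?b))"
    by (rule ext) (simp only: symb_def LP_symbol_def D_Nil power_int_minus of_real_diff)
  have "kern (symb k) z = kern (\<lambda>\<xi>. D [] (\<xi> /\<^sub>R ?a)) z - kern (\<lambda>\<xi>. D [] (\<xi> /\<^sub>R ?b)) z" for z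
    unfolding s kern_def using kern_integrable[OF scaled_bump[of ?a], of z] kern_integrable[OF scaled_bump[of ?b], of z]
    by (simp add: left_diff_distrib)
  then have "LPk k = (\<lambda>z. of_real (?a ^ 3) * kap (?a *\<^sub>R z) - of_real (?b ^ 3) * kap (?b *\<^sub>R z))"
    by (simp add: LPk_def kap_def kern_scaled fun_eq_iff right_diff_distrib mult.left_commute)
  moreover have "dLPk k = (\<lambda>b z. of_real (?a ^ 3) * (?a *\<^sub>R dkap b (?a *\<^sub>R z)) - of_real (?b ^ 3) * (?b *\<^sub>R dkap b (?b *\<^sub>R z)))"
    by (simp add: dLPk_def fun_eq_iff)
  ultimately show ?thesis
    by (simp only:) (intro rapid_diff rapid_cmult rapid_scale kap_rapid; simp)
qed

lemma LPk_decaying: "decaying (LPk k)" "decaying (dLPk k b)" "decaying kap"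
  using rapid_decaying[OF LPk_rapid] rapid_decaying[OF kap_rapid] by auto

text \<open>After Fubini's theorem the integral over z is the Fourier transform of
  \<open>kap\<close>, which \<open>kap_inversion\<close> evaluates; averaging becomes a multiplier
  on the symbol.\<close>

lemma LPk_smear:
  assumes s: "s \<ge> 0"
  shows "(\<integral>z. LPk k (w - s *\<^sub>R z) * kap z \<partial>lborel) =
    of_real (1 / (2 * pi) ^ 3) * (\<integral>\<xi>. symb k \<xi> * cis (w \<bullet> \<xi>) * of_real (chi (s *\<^sub>R \<xi>)) \<partial>lborel)"
proof -
  note [measurable] = bump_measurable[OF symb_bump[of k]] decaying_measurable[OF LPk_decaying(3)]
  let ?F = "\<lambda>z \<xi>. symb k \<xi> * cis ((w - s *\<^sub>R z) \<bullet> \<xi>) * kap z"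
  have "integrable (lborel \<Otimes>\<^sub>M lborel) (\<lambda>(z, \<xi>). kap z * symb k \<xi>)"
  proof (rule lborel_pair.Fubini_integrable)
    show "integrable lborel (\<lambda>z. \<integral>\<xi>. norm (case (z, \<xi>) of (z, \<xi>) \<Rightarrow> kap z * symb k \<xi>) \<partial>lborel)"
      using kap_integrable by (simp add: norm_mult)
    show "AE z in lborel. integrable lborel (\<lambda>\<xi>. case (z, \<xi>) of (z, \<xi>) \<Rightarrow> kap z * symb k \<xi>)"
      using bump_integrable[OF symb_bump] by simp
  qed measurable
  then have Fi: "integrable (lborel \<Otimes>\<^sub>M lborel) (\<lambda>(z, \<xi>). ?F z \<xi>)"
    by (rule Bochner_Integration.integrable_bound) (auto simp: norm_mult)
  have "(\<integral>z. LPk k (w - s *\<^sub>R z) * kap z \<partial>lborel) = (\<integral>z. of_real (1 / (2 * pi) ^ 3) * (\<integral>\<xi>. ?F z \<xi> \<partial>lborel) \<partial>lborel)"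
    unfolding LPk_def kern_def by (simp only: integral_mult_left_zero) (simp only: mult.assoc)
  also have "\<dots> = of_real (1 / (2 * pi) ^ 3) * (\<integral>z. (\<integral>\<xi>. ?F z \<xi> \<partial>lborel) \<partial>lborel)"
    by (rule integral_mult_right_zero)
  also have "(\<integral>z. (\<integral>\<xi>. ?F z \<xi> \<partial>lborel) \<partial>lborel) = (\<integral>\<xi>. (\<integral>z. ?F z \<xi> \<partial>lborel) \<partial>lborel)"
    by (rule lborel_pair.Fubini_integral[OF Fi, symmetric])
  also have "\<dots> = (\<integral>\<xi>. symb k \<xi> * cis (w \<bullet> \<xi>) * of_real (chi (s *\<^sub>R \<xi>)) \<partial>lborel)"
  proof (intro Bochner_Integration.integral_cong refl)
    fix \<xi>
    have "(\<integral>z. ?F z \<xi> \<partial>lborel) = (\<integral>z. (symb k \<xi> * cis (w \<bullet> \<xi>)) * (kap z * cis (- (z \<bullet> (s *\<^sub>R \<xi>)))) \<partial>lborel)"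
      by (intro Bochner_Integration.integral_cong refl) (simp add: inner_diff_left cis_mult mult_ac)
    then show "(\<integral>z. ?F z \<xi> \<partial>lborel) = symb k \<xi> * cis (w \<bullet> \<xi>) * of_real (chi (s *\<^sub>R \<xi>))"
      by (simp only: integral_mult_right_zero kap_inversion)
  qed
  finally show ?thesis .
qed

lemma chi_eq: "norm \<xi> \<le> 1 \<Longrightarrow> chi \<xi> = 1" "norm \<xi> > 2 \<Longrightarrow> chi \<xi> = 0"
  using cutoff unfolding LP_cutoff_def by blast+

text \<open>For |\<xi>| <= 2^(k-1), the sphere included, both dilates of \<open>chi\<close> equal 1
  and cancel. The strict lower bound is what moves 4 * 2^(-k) \<xi> out of the closed ball of radius
  2, beyond which \<open>chi\<close> is 0.\<close>

lemma symb_nonzero: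
  assumes "symb k \<xi> \<noteq> 0"
  shows "norm \<xi> \<le> 2 powi (k + 1)" "2 powi (k - 1) < norm \<xi>"
proof -
  show "norm \<xi> \<le> 2 powi (k + 1)"
    using LP_symbol_support[OF cutoff, of k \<xi>] assms by (force simp: symb_def not_less[symmetric])
  show "2 powi (k - 1) < norm \<xi>"
  proof (rule ccontr)
    assume "\<not> ?thesis"
    then have le: "norm \<xi> \<le> 2 powi (k - 1)" by simp
    have "norm (2 powi (- (k - 1)) *\<^sub>R \<xi>) \<le> 2 powi (- (k - 1)) * 2 powi (k - 1)"
      using le by (simp add: mult_left_mono)
    also have "\<dots> = 1" by (simp flip: power_int_add)
    finally have 1: "norm (2 powi (- (k - 1)) *\<^sub>R \<xi>) \<le> 1" .
    have "norm (2 powi (- k) *\<^sub>R \<xi>) \<le> norm (2 powi (- (k - 1)) *\<^sub>R \<xi>)"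
      by (simp add: mult_right_mono power_int_increasing)
    with 1 have "norm (2 powi (- k) *\<^sub>R \<xi>) \<le> 1" by linarith
    with 1 assms show False by (simp add: symb_def LP_symbol_def chi_eq)
  qed
qed

text \<open>Origin of the scales a / 2 and 4 a, with a = 2^(-k): where the symbol is nonzero,
  |\<xi>| lies between 2^(k-1) and 2^(k+1), so \<open>chi\<close> is 1 at (a / 2) \<xi> and 0 at 4 a
  \<xi>.\<close>

lemma LPk_reproduce:
  "(\<integral>z. LPk k (w - (2 powi (- k) / 2) *\<^sub>R z) * kap z \<partial>lborel) = LPk k w"
  "(\<integral>z. LPk k (w - (4 * 2 powi (- k)) *\<^sub>R z) * kap z \<partial>lborel) = 0"
proof -
  have r1: "symb k \<xi> * cis (w \<bullet> \<xi>) * of_real (chi ((2 powi (- k) / 2) *\<^sub>R \<xi>)) = symb k \<xi> * cis (w \<bullet> \<xi>)" for \<xi>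
  proof (cases "symb k \<xi> = 0")
    case False
    have "norm ((2 powi (- k) / 2) *\<^sub>R \<xi>) \<le> 2 powi (- k) / 2 * 2 powi (k + 1)"
      using symb_nonzero(1)[OF False] by (simp add: divide_right_mono mult_left_mono)
    also have "\<dots> = 1" by (simp add: power_int_add power_int_minus)
    finally show ?thesis by (simp add: chi_eq)
  qed simp
  show "(\<integral>z. LPk k (w - (2 powi (- k) / 2) *\<^sub>R z) * kap z \<partial>lborel) = LPk k w"
    by (subst LPk_smear) (simp, simp only: r1 LPk_def kern_def)
  have r2: "symb k \<xi> * cis (w \<bullet> \<xi>) * of_real (chi ((4 * 2 powi (- k)) *\<^sub>R \<xi>)) = 0" for \<xi>
  proof (cases "symb k \<xi> = 0")
    case False
    have "(2::real) = 4 * 2 powi (- k) * 2 powi (k - 1)"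
      by (simp add: power_int_diff power_int_minus)
    also have "\<dots> < norm ((4 * 2 powi (- k)) *\<^sub>R \<xi>)"
      using symb_nonzero(2)[OF False] by simp
    finally show ?thesis by (simp add: chi_eq)
  qed simp
  show "(\<integral>z. LPk k (w - (4 * 2 powi (- k)) *\<^sub>R z) * kap z \<partial>lborel) = 0"
    by (subst LPk_smear) (simp, simp only: r2, simp)
qed

lemma LP_proj_eq_lebesgue: "LP_proj chi k f x = (\<integral>y. f y * LPk k (x - y) \<partial>lebesgue)"
proof -
  note [measurable] = bump_measurable[OF symb_bump[of k]]
  have "fourier (\<lambda>\<xi>. of_real (LP_symbol chi k \<xi>) * cis (x \<bullet> \<xi>)) y = kern (symb k) (x - y)" for y
  proof -
    have "fourier (\<lambda>\<xi>. symb k \<xi> * cis (x \<bullet> \<xi>)) y = (\<integral>\<xi>. symb k \<xi> * cis (x \<bullet> \<xi>) * cis (- (\<xi> \<bullet> y)) \<partial>lborel)"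
      unfolding fourier_def by (subst integral_completion) auto
    also have "\<dots> = kern (symb k) (x - y)"
      unfolding kern_def by (intro Bochner_Integration.integral_cong refl)
        (simp add: inner_diff_left cis_mult mult.assoc inner_commute[of _ y])
    finally show ?thesis by (simp add: symb_def)
  qed
  then have "LP_proj chi k f x = of_real (1 / (2 * pi) ^ 3) * (\<integral>y. f y * kern (symb k) (x - y) \<partial>lebesgue)"
    by (simp add: LP_proj_def fourier_dist_def)
  also have "\<dots> = (\<integral>y. of_real (1 / (2 * pi) ^ 3) * (f y * kern (symb k) (x - y)) \<partial>lebesgue)"
    by (rule integral_mult_right_zero[symmetric])
  also have "\<dots> = (\<integral>y. f y * LPk k (x - y) \<partial>lebesgue)"
    unfolding LPk_def by (simp only: mult.left_commute)
  finally show ?thesis .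
qed

text \<open>The properties of a function of frequency \<open>1 / a\<close> that enter the estimates: it is
  reproduced by the kernel at scale \<open>a / 2\<close> and annihilated by the kernel at scale \<open>4 a\<close>.\<close>

definition localized :: "real \<Rightarrow> (real^3 \<Rightarrow> complex) \<Rightarrow> bool" where
  "localized a v \<longleftrightarrow> a > 0 \<and> continuous_on UNIV v \<and>
     (\<forall>x. integrable lborel (\<lambda>z. v (x - (a / 2) *\<^sub>R z) * kap z) \<and> v x = (\<integral>z. v (x - (a / 2) *\<^sub>R z) * kap z \<partial>lborel))"

text \<open>Annihilation and the gradient are kept apart from \<open>localized\<close>, because
  differences of rotated pieces are shown to be \<open>localized\<close> and
  \<open>Bernstein\<close> is applied to them in that form.\<close>

definition localized1 :: "real \<Rightarrow> (real^3 \<Rightarrow> complex) \<Rightarrow> bool" where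
  "localized1 a v \<longleftrightarrow> localized a v \<and>
     (\<forall>x. integrable lborel (\<lambda>z. v (x - (4 * a) *\<^sub>R z) * kap z) \<and> (\<integral>z. v (x - (4 * a) *\<^sub>R z) * kap z \<partial>lborel) = 0) \<and>
     (\<forall>b. continuous_on UNIV (partial b v)) \<and>
     (\<forall>x e. ((\<lambda>s. v (x + s *\<^sub>R e)) has_vector_derivative (\<Sum>b\<in>UNIV. e $ b *\<^sub>R partial b v x)) (at 0))"

text \<open>A piece is the convolution of a Borel representative with \<open>LPk\<close>, so
  reproduction, annihilation and differentiation are inherited from the kernel.\<close>

lemma LP_proj_props:
  assumes "tempered f"
  shows "localized1 (2 powi (- k)) (LP_proj chi k f)"
    and "partial b (LP_proj chi k f) x = (\<integral>y. f y * dLPk k b (x - y) \<partial>lebesgue)"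
proof -
  obtain g N where g: "tempB N g" and ae: "AE x in lborel. f x = g x"
    by (rule tempered_ex_tempB[OF assms])
  have fm: "f \<in> borel_measurable lebesgue" using assms by (simp add: tempered_def)
  note eq = lebesgue_integral_eq_cv[OF ae _ fm tempB_measurable[OF g]]
  have v: "LP_proj chi k f = cv g (LPk k)"
    using eq[OF LPk_decaying(1)] by (auto simp: LP_proj_eq_lebesgue)
  note dv = cv_has_derivative[OF g LPk_rapid, of k]
  have p: "partial b (cv g (LPk k)) = cv g (dLPk k b)" for b
  proof
    fix x
    have "((\<lambda>s. cv g (LPk k) (x + s *\<^sub>R axis b 1)) has_vector_derivative cv g (dLPk k b) x) (at 0)"
      using dv[of x "axis b 1"] by (simp add: axis_def if_distrib[of "\<lambda>c. c *\<^sub>R _"] cong: if_cong)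
    then show "partial b (cv g (LPk k)) x = cv g (dLPk k b) x"
      unfolding partial_def by (rule vector_derivative_at)
  qed
  show "partial b (LP_proj chi k f) x = (\<integral>y. f y * dLPk k b (x - y) \<partial>lebesgue)"
    unfolding v p by (rule eq[OF LPk_decaying(2), symmetric])
  note sm = cv_smear[OF g LPk_decaying(1) LPk_decaying(3)]
  show "localized1 (2 powi (- k)) (LP_proj chi k f)"
    unfolding localized1_def localized_def v p
  proof (intro conjI allI)
    show "cv g (LPk k) x = (\<integral>z. cv g (LPk k) (x - (2 powi - k / 2) *\<^sub>R z) * kap z \<partial>lborel)" for x
      by (subst sm(1)) (simp_all only: LPk_reproduce, simp_all)
    show "(\<integral>z. cv g (LPk k) (x - (4 * 2 powi - k) *\<^sub>R z) * kap z \<partial>lborel) = 0" for x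
      by (subst sm(1)) (simp_all only: LPk_reproduce, simp_all add: cv_def)
  qed (use sm(2) continuous_cv[OF g LPk_decaying(1)] continuous_cv[OF g LPk_decaying(2)] dv in auto)
qed

end

section \<open>Averages at a fixed scale\<close>

text \<open>A common majorant for kernels at scale a, normalised so that its mass does not depend on
  a.\<close>

definition avk :: "real \<Rightarrow> real^3 \<Rightarrow> ennreal" where
  "avk a y = ennreal (1 / a ^ 3 * (1 / (1 + norm y / a) ^ 6))"

definition smear :: "real \<Rightarrow> (real^3 \<Rightarrow> ennreal) \<Rightarrow> real^3 \<Rightarrow> ennreal" where
  "smear a h x = (\<integral>\<^sup>+y. h (x - y) * avk a y \<partial>lborel)"

text \<open>The mass of \<open>avk\<close>, raised to at least 1 so that its powers with exponents
  in [0, 1] are again at most \<open>c0\<close>.\<close>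

definition c0 :: ennreal where
  "c0 = max 1 (\<integral>\<^sup>+y. avk 1 y \<partial>lborel)"

lemma measurable_avk [measurable]: "avk a \<in> borel_measurable borel"
  unfolding avk_def by measurable

lemma measurable_smear [measurable (raw)]:
  assumes [measurable]: "h \<in> borel_measurable borel"
  shows "smear a h \<in> borel_measurable borel"
  unfolding smear_def by measurable

lemma c0_less_top: "c0 < top"
proof -
  have "(\<integral>\<^sup>+y. avk 1 y \<partial>lborel) < top"
    using integrable_decay unfolding avk_def integrable_iff_bounded by simp
  then show ?thesis by (simp add: c0_def)
qed

lemma c0_ge_1: "1 \<le> c0"
  by (simp add: c0_def)

lemma c0_real: obtains c where "c0 = ennreal c" "c \<ge> 1"
proof -
  obtain c where c: "c0 = ennreal c" "c \<ge> 0" using c0_less_top by (cases c0) auto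
  then have "ennreal 1 \<le> ennreal c" using c0_ge_1 by simp
  then have "1 \<le> c" using c(2) by (simp only: ennreal_le_iff)
  with c that show ?thesis by blast
qed

lemma nn_integral_avk:
  assumes a: "a > 0" shows "(\<integral>\<^sup>+y. avk a y \<partial>lborel) \<le> c0"
proof -
  have "(\<integral>\<^sup>+y. avk a y \<partial>lborel) = ennreal (a ^ 3) * (\<integral>\<^sup>+y. avk a (a *\<^sub>R y) \<partial>lborel)"
    by (rule nn_integral_scale[OF _ a]) measurable
  also have "\<dots> = (\<integral>\<^sup>+y. ennreal (a ^ 3) * avk a (a *\<^sub>R y) \<partial>lborel)"
    by (rule nn_integral_cmult[symmetric]) measurable
  also have "\<dots> = (\<integral>\<^sup>+y. avk 1 y \<partial>lborel)"
    using a by (intro nn_integral_cong) (simp add: avk_def ennreal_mult'[symmetric])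
  finally show ?thesis by (simp add: c0_def)
qed

lemma avk_le:
  assumes "a > 0" shows "avk a y \<le> ennreal (1 / a ^ 3)"
proof -
  have "1 \<le> (1 + norm y / a) ^ 6" using assms by (intro one_le_power) simp
  then show ?thesis
    unfolding avk_def using assms by (intro ennreal_leI mult_left_le) (auto simp: divide_le_eq_1)
qed

lemma ennreal_rpow_c0:
  assumes "0 \<le> e" "e \<le> 1" shows "ennreal_rpow c0 e \<le> c0"
proof -
  obtain c where c: "c0 = ennreal c" "c \<ge> 1"
    by (rule c0_real)
  have "c powr e \<le> c powr 1" using c(2) assms by (intro powr_mono) auto
  then have "ennreal (c powr e) \<le> ennreal c" using c(2) by (intro ennreal_leI) simp
  then show ?thesis
    unfolding c(1) using c(2) by (subst ennreal_rpow_ennreal) auto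
qed

text \<open>Jensen's inequality for the kernel, followed by the pointwise bound a^(-3) on it; the
  q-th root gives the Bernstein factor a^(-3/q).\<close>

lemma smear_le_Lq:
  assumes [measurable]: "h \<in> borel_measurable borel" and q: "1 < q" and a: "a > 0"
  shows "smear a h x \<le> c0 * ennreal (a powr (- 3 / q)) * Lq q h"
proof -
  have "smear a h x \<le> ennreal_rpow (\<integral>\<^sup>+y. ennreal_rpow (h (x - y)) q * avk a y \<partial>lborel) (1 / q) * ennreal_rpow c0 (1 - 1 / q)"
    unfolding smear_def by (rule nn_integral_weighted_Jensen) (use q nn_integral_avk[OF a] in auto)
  also have "\<dots> \<le> ennreal_rpow (\<integral>\<^sup>+y. ennreal_rpow (h (x - y)) q * ennreal (1 / a ^ 3) \<partial>lborel) (1 / q) * c0"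
    using q avk_le[OF a]
    by (intro mult_mono ennreal_rpow_mono nn_integral_mono ennreal_rpow_c0 mult_left_mono) auto
  also have "(\<integral>\<^sup>+y. ennreal_rpow (h (x - y)) q * ennreal (1 / a ^ 3) \<partial>lborel) = ennreal (1 / a ^ 3) * (\<integral>\<^sup>+y. ennreal_rpow (h y) q \<partial>lborel)"
    by (subst nn_integral_multc, measurable)
       (subst nn_integral_reflect[of "\<lambda>y. ennreal_rpow (h y) q"], auto simp: mult.commute)
  also have "ennreal_rpow (ennreal (1 / a ^ 3) * (\<integral>\<^sup>+y. ennreal_rpow (h y) q \<partial>lborel)) (1 / q) = ennreal (a powr (- 3 / q)) * Lq q h"
  proof -
    have "(1 / a ^ 3) powr (1 / q) = a powr (- 3 / q)"
    proof -
      have "1 / a ^ 3 = a powr (- 3)"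
        using a by (simp add: powr_minus powr_numeral divide_inverse)
      then show ?thesis by (simp add: powr_powr)
    qed
    then show ?thesis using a by (simp add: ennreal_rpow_mult ennreal_rpow_ennreal)
  qed
  finally show ?thesis by (simp add: mult_ac)
qed

lemma smear_le_sup:
  assumes "\<And>x. h x \<le> H" and a: "a > 0"
  shows "smear a h x \<le> c0 * H"
proof -
  have "smear a h x \<le> (\<integral>\<^sup>+y. H * avk a y \<partial>lborel)"
    unfolding smear_def by (intro nn_integral_mono mult_right_mono assms) simp
  also have "\<dots> = H * (\<integral>\<^sup>+y. avk a y \<partial>lborel)" by (rule nn_integral_cmult) measurable
  also have "\<dots> \<le> H * c0" by (intro mult_left_mono nn_integral_avk a) simp
  finally show ?thesis by (simp add: mult.commute)
qed

text \<open>Young's inequality for an L^1 kernel acting on L^2: Jensen's inequality at each point,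
  then Fubini's theorem and translation invariance.\<close>

lemma Lq_2_smear:
  assumes [measurable]: "h \<in> borel_measurable borel" and a: "a > 0"
  shows "Lq 2 (smear a h) \<le> c0 * Lq 2 h"
proof -
  have pw: "ennreal_rpow (smear a h x) 2 \<le> c0 * (\<integral>\<^sup>+y. ennreal_rpow (h (x - y)) 2 * avk a y \<partial>lborel)" for x
  proof -
    have "smear a h x \<le> ennreal_rpow (\<integral>\<^sup>+y. ennreal_rpow (h (x - y)) 2 * avk a y \<partial>lborel) (1 / 2) * ennreal_rpow c0 (1 - 1 / 2)"
      unfolding smear_def by (rule nn_integral_weighted_Jensen) (use nn_integral_avk[OF a] in auto)
    then have "ennreal_rpow (smear a h x) 2 \<le> ennreal_rpow (\<dots>) 2"
      by (intro ennreal_rpow_mono) auto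
    then show ?thesis by (simp add: ennreal_rpow_mult ennreal_rpow_rpow mult.commute)
  qed
  have "(\<integral>\<^sup>+x. ennreal_rpow (smear a h x) 2 \<partial>lborel) \<le> (\<integral>\<^sup>+x. c0 * (\<integral>\<^sup>+y. ennreal_rpow (h (x - y)) 2 * avk a y \<partial>lborel) \<partial>lborel)"
    by (intro nn_integral_mono pw)
  also have "\<dots> = c0 * (\<integral>\<^sup>+x. (\<integral>\<^sup>+y. ennreal_rpow (h (x - y)) 2 * avk a y \<partial>lborel) \<partial>lborel)"
    by (rule nn_integral_cmult) measurable
  also have "(\<integral>\<^sup>+x. (\<integral>\<^sup>+y. ennreal_rpow (h (x - y)) 2 * avk a y \<partial>lborel) \<partial>lborel) =
      (\<integral>\<^sup>+y. (\<integral>\<^sup>+x. ennreal_rpow (h (x - y)) 2 * avk a y \<partial>lborel) \<partial>lborel)"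
    by (rule lborel_pair.Fubini') measurable
  also have "\<dots> = (\<integral>\<^sup>+y. (\<integral>\<^sup>+x. ennreal_rpow (h x) 2 \<partial>lborel) * avk a y \<partial>lborel)"
  proof (intro nn_integral_cong)
    fix y
    have "(\<integral>\<^sup>+x. ennreal_rpow (h (x - y)) 2 * avk a y \<partial>lborel) = (\<integral>\<^sup>+x. ennreal_rpow (h (x - y)) 2 \<partial>lborel) * avk a y"
      by (rule nn_integral_multc) measurable
    also have "(\<integral>\<^sup>+x. ennreal_rpow (h (x - y)) 2 \<partial>lborel) = (\<integral>\<^sup>+x. ennreal_rpow (h x) 2 \<partial>lborel)"
      by (rule nn_integral_translate[of "\<lambda>x. ennreal_rpow (h x) 2"]) measurable
    finally show "(\<integral>\<^sup>+x. ennreal_rpow (h (x - y)) 2 * avk a y \<partial>lborel) = (\<integral>\<^sup>+x. ennreal_rpow (h x) 2 \<partial>lborel) * avk a y" .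
  qed
  also have "\<dots> = (\<integral>\<^sup>+x. ennreal_rpow (h x) 2 \<partial>lborel) * (\<integral>\<^sup>+y. avk a y \<partial>lborel)"
    by (rule nn_integral_cmult) measurable
  also have "c0 * \<dots> \<le> c0 * ((\<integral>\<^sup>+x. ennreal_rpow (h x) 2 \<partial>lborel) * c0)"
    by (intro mult_left_mono nn_integral_avk a) auto
  finally have "Lq 2 (smear a h) \<le> ennreal_rpow (c0 * ((\<integral>\<^sup>+x. ennreal_rpow (h x) 2 \<partial>lborel) * c0)) (1 / 2)"
    by (intro ennreal_rpow_mono) auto
  also have "\<dots> = ennreal_rpow (c0 * c0) (1 / 2) * Lq 2 h"
    by (simp add: ennreal_rpow_mult mult_ac)
  also have "ennreal_rpow (c0 * c0) (1 / 2) = c0"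
    using ennreal_rpow_rpow[of c0 2 "1/2"] by (simp add: ennreal_rpow_2)
  finally show ?thesis .
qed

lemma smear_cmult:
  assumes [measurable]: "h \<in> borel_measurable borel"
  shows "smear a (\<lambda>x. c * h x) x = c * smear a h x"
  unfolding smear_def mult.assoc by (rule nn_integral_cmult) measurable

section \<open>Pointwise bounds by averages of the function and of its gradient\<close>

abbreviation nv :: "(real^3 \<Rightarrow> complex) \<Rightarrow> real^3 \<Rightarrow> ennreal" where
  "nv v x \<equiv> ennreal (norm (v x))"

lemma decay_scale_le:
  assumes "0 < s" "s \<le> m * a" "0 < a" "1 \<le> m"
  shows "1 / (1 + norm (y::real^3) / s) ^ n \<le> m ^ n * (1 / (1 + norm y / a) ^ n)"
proof -
  have "norm y / a \<le> m * (norm y / s)"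
    using assms mult_right_mono[of s "m * a" "norm y"] by (simp add: field_simps)
  then have "1 + norm y / a \<le> m * (1 + norm y / s)"
    using assms by (simp add: algebra_simps)
  then have "(1 + norm y / a) ^ n \<le> m ^ n * (1 + norm y / s) ^ n"
    using assms power_mono[of "1 + norm y / a" "m * (1 + norm y / s)" n] by (simp add: power_mult_distrib add_nonneg_nonneg)
  moreover have "(1 + norm y / a) ^ n > 0" "(1 + norm y / s) ^ n > 0"
    using assms by (auto intro!: zero_less_power add_pos_nonneg)
  ultimately show ?thesis by (simp add: field_simps)
qed

lemma has_bochner_integral_norm_le:
  fixes f :: "'a \<Rightarrow> 'b::{banach, second_countable_topology}"
  assumes "has_bochner_integral M f I" shows "ennreal (norm I) \<le> (\<integral>\<^sup>+x. ennreal (norm (f x)) \<partial>M)"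
  using assms integral_norm_bound_ennreal[of M f] by (auto simp: has_bochner_integral_iff)

context LP
begin

text \<open>The rapid decay of \<open>kap\<close> dominates reproduction at scale a / 2 by the
  average at scale a; the factor 8 compensates the volume of the dilation by a / 2.\<close>

lemma localized_bound:
  obtains C where "C \<ge> 0" "\<And>a v x. localized a v \<Longrightarrow> nv v x \<le> ennreal C * smear a (nv v) x"
proof -
  obtain C where C: "C \<ge> 0" "\<And>z. norm (kap z) \<le> C / (1 + norm z) ^ 6"
    using rapid_bound[OF kap_rapid, of 6] by metis
  show ?thesis
  proof (rule that[of "8 * C"])
    fix a v x assume v: "localized a v"
    then have a: "a > 0" and [measurable]: "v \<in> borel_measurable borel"
      by (auto simp: localized_def intro: borel_measurable_continuous_onI)
    have int: "integrable lborel (\<lambda>z. v (x - (a / 2) *\<^sub>R z) * kap z)" "v x = (\<integral>z. v (x - (a / 2) *\<^sub>R z) * kap z \<partial>lborel)"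
      using v unfolding localized_def by blast+
    have "nv v x \<le> (\<integral>\<^sup>+z. ennreal (norm (v (x - (a / 2) *\<^sub>R z) * kap z)) \<partial>lborel)"
      unfolding int(2) by (rule integral_norm_bound_ennreal[OF int(1)])
    also have "\<dots> \<le> (\<integral>\<^sup>+z. ennreal (8 * C) * (ennreal ((a / 2) ^ 3) * (nv v (x - (a / 2) *\<^sub>R z) * avk a ((a / 2) *\<^sub>R z))) \<partial>lborel)"
    proof (intro nn_integral_mono)
      fix z :: "real^3"
      have "norm (kap z) \<le> C * (1 / (1 + norm z) ^ 6)" using C(2)[of z] by simp
      also have "\<dots> \<le> C * (1 / (1 + norm ((a / 2) *\<^sub>R z) / a) ^ 6)"
      proof (intro mult_left_mono divide_left_mono power_mono mult_pos_pos)
        show "1 + norm ((a / 2) *\<^sub>R z) / a \<le> 1 + norm z" using a by simp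
      qed (use a C(1) in \<open>auto intro!: zero_less_power add_pos_nonneg add_nonneg_nonneg simp: add_nonneg_eq_0_iff\<close>)
      also have "\<dots> = 8 * C * ((a / 2) ^ 3 * (1 / a ^ 3 * (1 / (1 + norm ((a / 2) *\<^sub>R z) / a) ^ 6)))"
        using a by (simp add: power_divide)
      finally have "norm (v (x - (a / 2) *\<^sub>R z) * kap z) \<le>
          norm (v (x - (a / 2) *\<^sub>R z)) * (8 * C * ((a / 2) ^ 3 * (1 / a ^ 3 * (1 / (1 + norm ((a / 2) *\<^sub>R z) / a) ^ 6))))"
        unfolding norm_mult by (rule mult_left_mono) simp
      also have "\<dots> = (8 * C) * ((a / 2) ^ 3 * (norm (v (x - (a / 2) *\<^sub>R z)) * (1 / a ^ 3 * (1 / (1 + norm ((a / 2) *\<^sub>R z) / a) ^ 6))))"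
        by (simp only: mult_ac)
      finally show "ennreal (norm (v (x - (a / 2) *\<^sub>R z) * kap z)) \<le>
          ennreal (8 * C) * (ennreal ((a / 2) ^ 3) * (nv v (x - (a / 2) *\<^sub>R z) * avk a ((a / 2) *\<^sub>R z)))"
        unfolding avk_def using a C(1)
        by (subst ennreal_mult[symmetric], simp, simp)+ (rule ennreal_leI)
    qed
    also have "\<dots> = ennreal (8 * C) * (ennreal ((a / 2) ^ 3) * (\<integral>\<^sup>+z. nv v (x - (a / 2) *\<^sub>R z) * avk a ((a / 2) *\<^sub>R z) \<partial>lborel))"
      by (subst nn_integral_cmult, measurable)+
    also have "ennreal ((a / 2) ^ 3) * (\<integral>\<^sup>+z. nv v (x - (a / 2) *\<^sub>R z) * avk a ((a / 2) *\<^sub>R z) \<partial>lborel) = smear a (nv v) x"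
      unfolding smear_def by (rule nn_integral_scale[of "\<lambda>y. nv v (x - y) * avk a y" "a / 2", symmetric]) (use a in auto)
    finally show "nv v x \<le> ennreal (8 * C) * smear a (nv v) x" .
  qed (use C in simp)
qed

lemma Bernstein:
  assumes q: "1 < q"
  obtains C where "C \<ge> 0"
    "\<And>a v x. localized a v \<Longrightarrow> nv v x \<le> ennreal C * (ennreal (a powr (- 3 / q)) * Lq q (nv v))"
proof -
  obtain C where C: "C \<ge> 0" "\<And>a v x. localized a v \<Longrightarrow> nv v x \<le> ennreal C * smear a (nv v) x"
    by (rule localized_bound) (rule that)
  obtain c where c: "c0 = ennreal c" "c \<ge> 1" by (rule c0_real)
  show ?thesis
  proof (rule that[of "C * c"])
    fix a v x assume v: "localized a v"
    then have a: "a > 0" and [measurable]: "v \<in> borel_measurable borel"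
      by (auto simp: localized_def intro: borel_measurable_continuous_onI)
    have "nv v x \<le> ennreal C * smear a (nv v) x" by (rule C(2)[OF v])
    also have "\<dots> \<le> ennreal C * (c0 * ennreal (a powr (- 3 / q)) * Lq q (nv v))"
      by (intro mult_left_mono smear_le_Lq q a) auto
    finally show "nv v x \<le> ennreal (C * c) * (ennreal (a powr (- 3 / q)) * Lq q (nv v))"
      using C(1) c by (simp add: ennreal_mult mult.assoc)
  qed (use C c in simp)
qed

text \<open>A piece is its average at scale a / 2 minus its vanishing average at scale 4 a. Along
  each ray the difference of the two values is the integral of the gradient over the scales s in
  between. The decay exponent 8 leaves two powers above the 6 of \<open>avk\<close>, which
  \<open>inner_region_bound\<close> spends.\<close>

lemma gradient_bound:
  obtains C where "C \<ge> 0"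
    "\<And>a v x. localized1 a v \<Longrightarrow> nv v x \<le> ennreal C *
       (\<integral>\<^sup>+y. ennreal (norm y) * ennreal (\<Sum>b\<in>UNIV. norm (partial b v (x - y))) * ennreal (1 / a ^ 3 * (1 / (1 + norm y / a) ^ 8)) \<partial>lborel)"
proof -
  obtain C where C: "C \<ge> 0" "\<And>z. norm (kap z) \<le> C / (1 + norm z) ^ 8"
    using rapid_bound[OF kap_rapid, of 8] by metis
  \<comment> \<open>4^8 compares the decay at scale s <= 4 a with that at scale a, and 8 * 2 = 16
    comes from a^4 <= (2 s)^4 for s >= a / 2. The later factor 4 is the length of the range of s, at
    most 4 a, times the 1 / a in the bound for each s.\<close>
  define D where "D = C * 4 ^ 8 * 8 * 2"
  have D: "D \<ge> 0" using C by (simp add: D_def)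
  show ?thesis
  proof (rule that[of "D * 4"])
    fix a v x assume v: "localized1 a v"
    then have a: "a > 0" and [measurable]: "v \<in> borel_measurable borel"
      and [measurable]: "\<And>b. partial b v \<in> borel_measurable borel"
      by (auto simp: localized1_def localized_def intro: borel_measurable_continuous_onI)
    note [measurable] = decaying_measurable[OF LPk_decaying(3)]
    define G where "G y = (\<Sum>b\<in>UNIV. norm (partial b v y))" for y
    have [measurable]: "G \<in> borel_measurable borel" unfolding G_def by measurable
    have G0: "G y \<ge> 0" for y by (simp add: G_def sum_nonneg)
    let ?w = "\<lambda>y. 1 / a ^ 3 * (1 / (1 + norm y / a) ^ 8) :: real"
    define J where "J = (\<integral>\<^sup>+y. ennreal (norm y) * ennreal (G (x - y)) * ennreal (?w y) \<partial>lborel)"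
    have int: "integrable lborel (\<lambda>z. v (x - (a / 2) *\<^sub>R z) * kap z)" "v x = (\<integral>z. v (x - (a / 2) *\<^sub>R z) * kap z \<partial>lborel)"
      "integrable lborel (\<lambda>z. v (x - (4 * a) *\<^sub>R z) * kap z)" "(\<integral>z. v (x - (4 * a) *\<^sub>R z) * kap z \<partial>lborel) = 0"
      using v unfolding localized1_def localized_def by blast+
    have "v x = (\<integral>z. (v (x - (a / 2) *\<^sub>R z) - v (x - (4 * a) *\<^sub>R z)) * kap z \<partial>lborel)"
      unfolding left_diff_distrib using int by simp
    then have "nv v x \<le> (\<integral>\<^sup>+z. ennreal (norm ((v (x - (a / 2) *\<^sub>R z) - v (x - (4 * a) *\<^sub>R z)) * kap z)) \<partial>lborel)"
      using int by (simp only: left_diff_distrib) (rule integral_norm_bound_ennreal, simp)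
    also have "\<dots> \<le> (\<integral>\<^sup>+z. (\<integral>\<^sup>+s. indicator {a / 2..4 * a} s * (ennreal (norm z) * ennreal (G (x - s *\<^sub>R z)) * ennreal (norm (kap z))) \<partial>lborel) \<partial>lborel)"
    proof (intro nn_integral_mono)
      fix z :: "real^3"
      let ?f = "\<lambda>s. \<Sum>b\<in>UNIV. (- z) $ b *\<^sub>R partial b v (x - s *\<^sub>R z)"
      have dv: "((\<lambda>s. v (x - s *\<^sub>R z)) has_vector_derivative ?f s) (at s)" for s
      proof (rule has_vector_derivative_shift)
        have "((\<lambda>r. v ((x - s *\<^sub>R z) + r *\<^sub>R (- z))) has_vector_derivative ?f s) (at 0)"
          using v unfolding localized1_def by blast
        then show "((\<lambda>r. v (x - (s + r) *\<^sub>R z)) has_vector_derivative ?f s) (at 0)"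
          by (simp add: algebra_simps)
      qed
      have "continuous_on {a / 2..4 * a} (\<lambda>s. partial b v (x - s *\<^sub>R z))" for b
      proof -
        have "continuous_on UNIV (partial b v)" using v unfolding localized1_def by blast
        then show ?thesis by (rule continuous_on_compose2) (auto intro!: continuous_intros)
      qed
      then have cont: "continuous_on {a / 2..4 * a} ?f"
        by (intro continuous_on_sum continuous_on_scaleR continuous_on_const)
      have "has_bochner_integral lborel (\<lambda>s. indicator {a / 2..4 * a} s *\<^sub>R ?f s) (v (x - (4 * a) *\<^sub>R z) - v (x - (a / 2) *\<^sub>R z))"
        by (rule has_bochner_integral_FTC_Icc) (use a dv cont in \<open>auto intro: has_vector_derivative_at_within\<close>)
      from has_bochner_integral_norm_le[OF this]
      have "ennreal (norm (v (x - (4 * a) *\<^sub>R z) - v (x - (a / 2) *\<^sub>R z))) \<le>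
          (\<integral>\<^sup>+s. ennreal (norm (indicator {a / 2..4 * a} s *\<^sub>R ?f s)) \<partial>lborel)" .
      also have "\<dots> \<le> (\<integral>\<^sup>+s. indicator {a / 2..4 * a} s * (ennreal (norm z) * ennreal (G (x - s *\<^sub>R z))) \<partial>lborel)"
      proof (intro nn_integral_mono)
        fix s
        have "norm (?f s) \<le> (\<Sum>b\<in>UNIV. norm z * norm (partial b v (x - s *\<^sub>R z)))"
          by (rule sum_norm_le) (auto intro!: mult_right_mono component_le_norm_cart)
        also have "\<dots> = norm z * G (x - s *\<^sub>R z)" by (simp add: G_def sum_distrib_left)
        finally show "ennreal (norm (indicator {a / 2..4 * a} s *\<^sub>R ?f s)) \<le> indicator {a / 2..4 * a} s * (ennreal (norm z) * ennreal (G (x - s *\<^sub>R z)))"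
          by (auto simp: indicator_def ennreal_mult'[symmetric] intro: ennreal_leI)
      qed
      finally have "ennreal (norm (v (x - (a / 2) *\<^sub>R z) - v (x - (4 * a) *\<^sub>R z))) * ennreal (norm (kap z)) \<le> \<dots> * ennreal (norm (kap z))"
        by (intro mult_right_mono) (simp_all add: norm_minus_commute)
      also have "\<dots> = (\<integral>\<^sup>+s. indicator {a / 2..4 * a} s * (ennreal (norm z) * ennreal (G (x - s *\<^sub>R z))) * ennreal (norm (kap z)) \<partial>lborel)"
        by (rule nn_integral_multc[symmetric]) measurable
      finally show "ennreal (norm ((v (x - (a / 2) *\<^sub>R z) - v (x - (4 * a) *\<^sub>R z)) * kap z)) \<le>
          (\<integral>\<^sup>+s. indicator {a / 2..4 * a} s * (ennreal (norm z) * ennreal (G (x - s *\<^sub>R z)) * ennreal (norm (kap z))) \<partial>lborel)"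
        by (simp add: norm_mult ennreal_mult mult.assoc)
    qed
    \<comment> \<open>With the scale s outside, the substitution y = s z is available for each
      s.\<close>
    also have "\<dots> = (\<integral>\<^sup>+s. (\<integral>\<^sup>+z. indicator {a / 2..4 * a} s * (ennreal (norm z) * ennreal (G (x - s *\<^sub>R z)) * ennreal (norm (kap z))) \<partial>lborel) \<partial>lborel)"
      by (rule lborel_pair.Fubini') measurable
    also have "\<dots> \<le> (\<integral>\<^sup>+s. indicator {a / 2..4 * a} s * (ennreal (D / a) * J) \<partial>lborel)"
    proof (intro nn_integral_mono)
      fix s :: real
      show "(\<integral>\<^sup>+z. indicator {a / 2..4 * a} s * (ennreal (norm z) * ennreal (G (x - s *\<^sub>R z)) * ennreal (norm (kap z))) \<partial>lborel)
          \<le> indicator {a / 2..4 * a} s * (ennreal (D / a) * J)"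
      proof (cases "s \<in> {a / 2..4 * a}")
        case True
        then have s: "s > 0" "a / 2 \<le> s" "s \<le> 4 * a" using a by auto
        have "(\<integral>\<^sup>+z. ennreal (norm z) * ennreal (G (x - s *\<^sub>R z)) * ennreal (norm (kap z)) \<partial>lborel)
            \<le> (\<integral>\<^sup>+z. ennreal (D / a) * (ennreal (s ^ 3) * (ennreal (norm (s *\<^sub>R z)) * ennreal (G (x - s *\<^sub>R z)) * ennreal (?w (s *\<^sub>R z)))) \<partial>lborel)"
        proof (intro nn_integral_mono)
          fix z :: "real^3"
          have "norm (kap z) \<le> C * (1 / (1 + norm (s *\<^sub>R z) / s) ^ 8)" using C(2)[of z] s by simp
          also have "\<dots> \<le> C * (4 ^ 8 * (1 / (1 + norm (s *\<^sub>R z) / a) ^ 8))"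
            by (intro mult_left_mono decay_scale_le) (use s a C in auto)
          also have "\<dots> = C * 4 ^ 8 * a ^ 3 * ?w (s *\<^sub>R z)"
            using a by simp
          finally have k: "norm (kap z) \<le> C * 4 ^ 8 * a ^ 3 * ?w (s *\<^sub>R z)" .
          have w0: "?w (s *\<^sub>R z) \<ge> 0" using a by (simp add: add_nonneg_nonneg)
          have "a ^ 4 \<le> (2 * s) ^ 4" using s a by (intro power_mono) auto
          then have "a * (a ^ 3) \<le> 16 * (s * s ^ 3)" by (simp add: power_mult_distrib eval_nat_numeral)
          then have as: "a ^ 3 \<le> 16 / a * s * s ^ 3" using a by (simp add: field_simps)
          have "norm z * G (x - s *\<^sub>R z) * norm (kap z) \<le> norm z * G (x - s *\<^sub>R z) * (C * 4 ^ 8 * (16 / a * s * s ^ 3) * ?w (s *\<^sub>R z))"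
            using order_trans[OF k mult_right_mono[OF mult_left_mono[OF as, of "C * 4 ^ 8"] w0]] C G0
            by (intro mult_left_mono) auto
          also have "\<dots> = (D / a) * (s ^ 3 * (norm (s *\<^sub>R z) * G (x - s *\<^sub>R z) * ?w (s *\<^sub>R z)))"
            using s by (simp add: D_def)
          finally have le: "norm z * G (x - s *\<^sub>R z) * norm (kap z) \<le> (D / a) * (s ^ 3 * (norm (s *\<^sub>R z) * G (x - s *\<^sub>R z) * ?w (s *\<^sub>R z)))" .
          have "ennreal (norm z) * ennreal (G (x - s *\<^sub>R z)) * ennreal (norm (kap z)) = ennreal (norm z * G (x - s *\<^sub>R z) * norm (kap z))"
            using G0 by (simp add: ennreal_mult)
          also have "\<dots> \<le> ennreal ((D / a) * (s ^ 3 * (norm (s *\<^sub>R z) * G (x - s *\<^sub>R z) * ?w (s *\<^sub>R z))))"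
            by (rule ennreal_leI[OF le])
          also have "\<dots> = ennreal (D / a) * (ennreal (s ^ 3) * (ennreal (norm (s *\<^sub>R z)) * ennreal (G (x - s *\<^sub>R z)) * ennreal (?w (s *\<^sub>R z))))"
            using G0 w0 D a s by (simp only: ennreal_mult mult_nonneg_nonneg divide_nonneg_nonneg norm_ge_zero zero_le_power less_imp_le)
          finally show "ennreal (norm z) * ennreal (G (x - s *\<^sub>R z)) * ennreal (norm (kap z)) \<le> \<dots>" .
        qed
        also have "\<dots> = ennreal (D / a) * (ennreal (s ^ 3) * (\<integral>\<^sup>+z. ennreal (norm (s *\<^sub>R z)) * ennreal (G (x - s *\<^sub>R z)) * ennreal (?w (s *\<^sub>R z)) \<partial>lborel))"
          by (subst nn_integral_cmult, measurable)+
        also have "ennreal (s ^ 3) * (\<integral>\<^sup>+z. ennreal (norm (s *\<^sub>R z)) * ennreal (G (x - s *\<^sub>R z)) * ennreal (?w (s *\<^sub>R z)) \<partial>lborel) = J"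
          unfolding J_def by (rule nn_integral_scale[symmetric, OF _ s(1)]) measurable
        finally show ?thesis using True by simp
      qed simp
    qed
    also have "\<dots> = (\<integral>\<^sup>+s. indicator {a / 2..4 * a} s \<partial>lborel) * (ennreal (D / a) * J)"
      by (rule nn_integral_multc) measurable
    also have "(\<integral>\<^sup>+s. indicator {a / 2..4 * a} s \<partial>lborel) = ennreal (4 * a - a / 2)"
      using a by (simp add: nn_integral_indicator)
    also have "ennreal (4 * a - a / 2) * (ennreal (D / a) * J) \<le> ennreal (4 * a) * (ennreal (D / a) * J)"
      using a by (intro mult_right_mono ennreal_leI) auto
    also have "\<dots> = ennreal (D * 4) * J"
    proof -
      have "ennreal (4 * a) * ennreal (D / a) = ennreal (4 * a * (D / a))"
        using a D by (intro ennreal_mult[symmetric]) auto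
      also have "4 * a * (D / a) = D * 4" using a by simp
      finally show ?thesis by (simp add: mult.assoc[symmetric])
    qed
    finally show "nv v x \<le> ennreal (D * 4) *
       (\<integral>\<^sup>+y. ennreal (norm y) * ennreal (\<Sum>b\<in>UNIV. norm (partial b v (x - y))) * ennreal (?w y) \<partial>lborel)"
      unfolding J_def G_def .
  qed (use D in simp)
qed

text \<open>The hypothesis on the gradient is the shape of t \<nabla> = L - x dt after division by
  t. With d = 1 + |y| / a, the weights |y| and |x - y| are at most a d and (R + a) d, and the two
  powers of d lower the decay of the kernel from 8 to 6.\<close>

lemma inner_region_bound:
  obtains C where "C \<ge> 0"
    "\<And>a v x R P Q. \<lbrakk>localized1 a v; P \<in> borel_measurable borel; Q \<in> borel_measurable borel; norm x \<le> R;
       \<And>y. ennreal (\<Sum>b\<in>UNIV. norm (partial b v y)) \<le> P y + ennreal (norm y) * Q y\<rbrakk> \<Longrightarrow>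
     nv v x \<le> ennreal C * smear a (\<lambda>y. ennreal a * P y + ennreal (a * (R + a)) * Q y) x"
proof -
  obtain C where C: "C \<ge> 0"
    "\<And>a v x. localized1 a v \<Longrightarrow> nv v x \<le> ennreal C *
       (\<integral>\<^sup>+y. ennreal (norm y) * ennreal (\<Sum>b\<in>UNIV. norm (partial b v (x - y))) * ennreal (1 / a ^ 3 * (1 / (1 + norm y / a) ^ 8)) \<partial>lborel)"
    by (rule gradient_bound) (rule that)
  show ?thesis
  proof (rule that[OF C(1)])
    fix a v R and x :: "real^3" and P Q :: "real^3 \<Rightarrow> ennreal"
    assume v: "localized1 a v" and R: "norm x \<le> R"
      and PQ: "\<And>y. ennreal (\<Sum>b\<in>UNIV. norm (partial b v y)) \<le> P y + ennreal (norm y) * Q y"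
    have a: "a > 0" using v by (simp add: localized1_def localized_def)
    have R0: "R \<ge> 0" using R norm_ge_zero[of x] by linarith
    have "ennreal (norm y) * ennreal (\<Sum>b\<in>UNIV. norm (partial b v (x - y))) * ennreal (1 / a ^ 3 * (1 / (1 + norm y / a) ^ 8))
        \<le> (ennreal a * P (x - y) + ennreal (a * (R + a)) * Q (x - y)) * avk a y" for y :: "real^3"
    proof -
      define d where "d = 1 + norm y / a"
      have d: "d \<ge> 1" using a by (simp add: d_def)
      have y: "norm y \<le> a * d" using a by (simp add: d_def algebra_simps)
      have xy: "norm (x - y) \<le> (R + a) * d"
      proof -
        have "norm (x - y) \<le> R + norm y" using norm_triangle_ineq4[of x y] R by linarith
        also have "\<dots> \<le> R * d + a * d" using y mult_left_mono[OF d R0] by simp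
        finally show ?thesis by (simp add: algebra_simps)
      qed
      have "ennreal (norm y) * ennreal (\<Sum>b\<in>UNIV. norm (partial b v (x - y))) \<le> ennreal (a * d) * (P (x - y) + ennreal ((R + a) * d) * Q (x - y))"
        by (intro mult_mono order_trans[OF PQ] add_left_mono mult_right_mono ennreal_leI y xy) auto
      also have "\<dots> = ennreal a * ennreal d * P (x - y) + ennreal (a * (R + a)) * ennreal (d ^ 2) * Q (x - y)"
      proof -
        have e1: "ennreal (a * d) = ennreal a * ennreal d" using a d by (intro ennreal_mult) auto
        have "ennreal (a * d) * ennreal ((R + a) * d) = ennreal (a * d * ((R + a) * d))"
          using a d R0 by (intro ennreal_mult[symmetric]) auto
        also have "a * d * ((R + a) * d) = a * (R + a) * d ^ 2" by (simp add: power2_eq_square)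
        also have "ennreal \<dots> = ennreal (a * (R + a)) * ennreal (d ^ 2)" using a R0 by (intro ennreal_mult) auto
        finally have e2: "ennreal (a * d) * ennreal ((R + a) * d) = ennreal (a * (R + a)) * ennreal (d ^ 2)" .
        show ?thesis
          by (simp only: distrib_left[of "ennreal (a * d)"] mult.assoc[symmetric] e2) (simp only: e1)
      qed
      also have "\<dots> \<le> ennreal a * ennreal (d ^ 2) * P (x - y) + ennreal (a * (R + a)) * ennreal (d ^ 2) * Q (x - y)"
        using d by (intro add_right_mono mult_right_mono mult_left_mono ennreal_leI) (auto simp: power2_eq_square)
      also have "\<dots> = ennreal (d ^ 2) * (ennreal a * P (x - y) + ennreal (a * (R + a)) * Q (x - y))"
        by (simp add: distrib_left mult_ac)
      finally have "ennreal (norm y) * ennreal (\<Sum>b\<in>UNIV. norm (partial b v (x - y))) * ennreal (1 / a ^ 3 * (1 / d ^ 8))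
          \<le> ennreal (d ^ 2) * (ennreal a * P (x - y) + ennreal (a * (R + a)) * Q (x - y)) * ennreal (1 / a ^ 3 * (1 / d ^ 8))"
        by (intro mult_right_mono) auto
      also have "\<dots> = (ennreal a * P (x - y) + ennreal (a * (R + a)) * Q (x - y)) * (ennreal (d ^ 2) * ennreal (1 / a ^ 3 * (1 / d ^ 8)))"
        by (simp only: mult_ac)
      also have "ennreal (d ^ 2) * ennreal (1 / a ^ 3 * (1 / d ^ 8)) = avk a y"
      proof -
        have "d ^ 2 * (1 / a ^ 3 * (1 / d ^ 8)) = 1 / a ^ 3 * (1 / d ^ 6)"
        proof -
          have "d ^ 2 * d ^ 6 = d ^ 8" by (simp flip: power_add)
          then have "d ^ 2 / d ^ 8 = 1 / d ^ 6" using d by (intro frac_eq_eq[THEN iffD2]) auto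
          then show ?thesis by (metis mult.left_commute times_divide_eq_right mult_1_right)
        qed
        then show ?thesis using d by (simp add: avk_def d_def ennreal_mult'[symmetric])
      qed
      finally show ?thesis unfolding d_def .
    qed
    then have "(\<integral>\<^sup>+y. ennreal (norm y) * ennreal (\<Sum>b\<in>UNIV. norm (partial b v (x - y))) * ennreal (1 / a ^ 3 * (1 / (1 + norm y / a) ^ 8)) \<partial>lborel)
        \<le> smear a (\<lambda>y. ennreal a * P y + ennreal (a * (R + a)) * Q y) x"
      unfolding smear_def by (intro nn_integral_mono)
    then show "nv v x \<le> ennreal C * smear a (\<lambda>y. ennreal a * P y + ennreal (a * (R + a)) * Q y) x"
      by (rule order_trans[OF C(2)[OF v] mult_left_mono]) simp
  qed
qed

end

section \<open>Decay away from the origin\<close>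

text \<open>On the segment from x to y the derivative of v minus its linear part is small by
  continuity of the partial derivatives. The total derivative serves the chain rule along
  circles.\<close>

lemma has_derivative_from_partials:
  fixes v :: "real^3 \<Rightarrow> complex"
  assumes dv: "\<And>x e. ((\<lambda>s. v (x + s *\<^sub>R e)) has_vector_derivative (\<Sum>b\<in>UNIV. e $ b *\<^sub>R g b x)) (at 0)"
    and g: "\<And>b. continuous_on UNIV (g b)"
  shows "(v has_derivative (\<lambda>h. \<Sum>b\<in>UNIV. h $ b *\<^sub>R g b x)) (at x)"
  unfolding has_derivative_at_alt
proof (intro conjI allI impI)
  show "bounded_linear (\<lambda>h. \<Sum>b\<in>UNIV. h $ b *\<^sub>R g b x)"
    by (intro linear_conv_bounded_linear[THEN iffD1] linearI)
       (simp_all add: scaleR_add_left sum.distrib scaleR_sum_right)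
  fix e :: real assume e: "e > 0"
  define G where "G y = (\<Sum>b\<in>UNIV. norm (g b y - g b x))" for y
  have "continuous_on UNIV G"
    unfolding G_def by (intro continuous_intros g)
  then have "isCont G x" by (simp add: continuous_on_eq_continuous_at)
  moreover have "G x = 0" by (simp add: G_def)
  ultimately obtain d where d: "d > 0" "\<And>y. dist y x < d \<Longrightarrow> \<bar>G y\<bar> < e"
    using e unfolding continuous_at_eps_delta by (auto simp: dist_real_def)
  show "\<exists>d>0. \<forall>y. norm (y - x) < d \<longrightarrow> norm (v y - v x - (\<Sum>b\<in>UNIV. (y - x) $ b *\<^sub>R g b x)) \<le> e * norm (y - x)"
  proof (intro exI[of _ d] conjI allI impI d(1))
    fix y assume y: "norm (y - x) < d"
    define h where "h = y - x"
    let ?L = "\<Sum>b\<in>UNIV. h $ b *\<^sub>R g b x"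
    have "norm ((v (x + 1 *\<^sub>R h) - 1 *\<^sub>R ?L) - (v (x + 0 *\<^sub>R h) - 0 *\<^sub>R ?L)) \<le> e * norm h * \<bar>1 - 0\<bar>"
    proof (rule vector_derivative_bound_on[of "{0..1}"])
      fix s :: real assume s: "s \<in> {0..1}"
      have "((\<lambda>r. v (x + (s + r) *\<^sub>R h)) has_vector_derivative (\<Sum>b\<in>UNIV. h $ b *\<^sub>R g b (x + s *\<^sub>R h))) (at 0)"
        using dv[of "x + s *\<^sub>R h" h] by (simp add: algebra_simps)
      then have "((\<lambda>s. v (x + s *\<^sub>R h)) has_vector_derivative (\<Sum>b\<in>UNIV. h $ b *\<^sub>R g b (x + s *\<^sub>R h))) (at s)"
        by (rule has_vector_derivative_shift)
      moreover have "((\<lambda>s. s *\<^sub>R ?L) has_vector_derivative ?L) (at s)"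
        by (auto intro!: derivative_eq_intros)
      ultimately show "((\<lambda>s. v (x + s *\<^sub>R h) - s *\<^sub>R ?L) has_vector_derivative
          (\<Sum>b\<in>UNIV. h $ b *\<^sub>R g b (x + s *\<^sub>R h)) - ?L) (at s)"
        by (rule has_vector_derivative_diff)
      have "norm ((\<Sum>b\<in>UNIV. h $ b *\<^sub>R g b (x + s *\<^sub>R h)) - ?L) = norm (\<Sum>b\<in>UNIV. h $ b *\<^sub>R (g b (x + s *\<^sub>R h) - g b x))"
        by (simp add: sum_subtractf scaleR_diff_right)
      also have "\<dots> \<le> (\<Sum>b\<in>UNIV. norm h * norm (g b (x + s *\<^sub>R h) - g b x))"
        by (rule sum_norm_le) (auto intro!: mult_right_mono component_le_norm_cart)
      also have "\<dots> = norm h * G (x + s *\<^sub>R h)" by (simp add: G_def sum_distrib_left)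
      also have "\<dots> \<le> norm h * e"
      proof (rule mult_left_mono)
        have "\<bar>s\<bar> * norm h \<le> 1 * norm h" using s by (intro mult_right_mono) auto
        then have "dist (x + s *\<^sub>R h) x < d" using y by (simp add: dist_norm h_def)
        then show "G (x + s *\<^sub>R h) \<le> e" using d(2) by fastforce
      qed simp
      finally show "norm ((\<Sum>b\<in>UNIV. h $ b *\<^sub>R g b (x + s *\<^sub>R h)) - ?L) \<le> e * norm h"
        by (simp add: mult.commute)
    qed auto
    then show "norm (v y - v x - (\<Sum>b\<in>UNIV. (y - x) $ b *\<^sub>R g b x)) \<le> e * norm (y - x)"
      by (simp add: h_def algebra_simps)
  qed
qed

text \<open>The rotation by \<theta> in the plane of the axes a and b, for distinct a and b, written
  as the identity plus terms that vanish at angle 0. The explicit formula makes it jointly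
  continuous in \<theta> and x.\<close>

definition rot :: "3 \<Rightarrow> 3 \<Rightarrow> real \<Rightarrow> real^3 \<Rightarrow> real^3" where
  "rot a b \<theta> x = x + (cos \<theta> - 1) *\<^sub>R (x $ a *\<^sub>R axis a 1 + x $ b *\<^sub>R axis b 1) + sin \<theta> *\<^sub>R (x $ a *\<^sub>R axis b 1 - x $ b *\<^sub>R axis a 1)"

lemma rot_nth:
  assumes "a \<noteq> b"
  shows "rot a b \<theta> x $ a = cos \<theta> * x $ a - sin \<theta> * x $ b"
    and "rot a b \<theta> x $ b = sin \<theta> * x $ a + cos \<theta> * x $ b"
    and "i \<noteq> a \<Longrightarrow> i \<noteq> b \<Longrightarrow> rot a b \<theta> x $ i = x $ i"
  using assms by (auto simp: rot_def axis_def algebra_simps)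

lemma rot_0 [simp]: "rot a b 0 x = x"
  by (simp add: rot_def)

lemma continuous_rot: "continuous_on UNIV (\<lambda>p. rot a b (fst p) (snd p))"
  unfolding rot_def by (intro continuous_intros)

lemma measurable_rot [measurable]:
  assumes [measurable]: "f \<in> borel_measurable M" "g \<in> borel_measurable M"
  shows "(\<lambda>x. rot a b (f x) (g x)) \<in> borel_measurable M"
  using measurable_compose[OF _ borel_measurable_continuous_onI[OF continuous_rot], of "\<lambda>x. (f x, g x)" M]
  by (simp add: borel_prod[symmetric])

lemma sum_two:
  fixes f :: "3 \<Rightarrow> 'b::comm_monoid_add"
  assumes "a \<noteq> b" "\<And>i. i \<noteq> a \<Longrightarrow> i \<noteq> b \<Longrightarrow> f i = 0"
  shows "sum f UNIV = f a + f b"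
proof -
  have "sum f UNIV = sum f {a, b}"
    by (rule sum.mono_neutral_right) (use assms(2) in auto)
  then show ?thesis using assms(1) by simp
qed

lemma orthogonal_rot:
  assumes ab: "a \<noteq> b" shows "orthogonal_transformation (rot a b \<theta>)"
  unfolding orthogonal_transformation
proof
  show "linear (rot a b \<theta>)"
    by (rule linearI) (simp_all add: rot_def vec_eq_iff algebra_simps)
  show "\<forall>v. norm (rot a b \<theta> v) = norm v"
  proof
    fix x :: "real^3"
    have "(\<Sum>i\<in>UNIV. (rot a b \<theta> x $ i)\<^sup>2 - (x $ i)\<^sup>2) = ((rot a b \<theta> x $ a)\<^sup>2 - (x $ a)\<^sup>2) + ((rot a b \<theta> x $ b)\<^sup>2 - (x $ b)\<^sup>2)"
      by (rule sum_two[OF ab]) (simp add: rot_nth(3)[OF ab])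
    also have "\<dots> = ((sin \<theta>)\<^sup>2 + (cos \<theta>)\<^sup>2 - 1) * ((x $ a)\<^sup>2 + (x $ b)\<^sup>2)"
    proof -
      have "(c * p - s * q)\<^sup>2 - p\<^sup>2 + ((s * p + c * q)\<^sup>2 - q\<^sup>2) = (s\<^sup>2 + c\<^sup>2 - 1) * (p\<^sup>2 + q\<^sup>2)" for c s p q :: real
        by algebra
      then show ?thesis unfolding rot_nth(1,2)[OF ab] .
    qed
    also have "\<dots> = 0" by simp
    finally have "(\<Sum>i\<in>UNIV. (rot a b \<theta> x $ i)\<^sup>2) = (\<Sum>i\<in>UNIV. (x $ i)\<^sup>2)"
      by (simp add: sum_subtractf)
    then show "norm (rot a b \<theta> x) = norm x" by (simp add: norm_vec_def L2_set_def)
  qed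
qed

text \<open>The derivative of v along the rotations \<open>rot a b\<close>; at a fixed time this is
  \<open>Omega a b\<close>.\<close>

definition rotd :: "3 \<Rightarrow> 3 \<Rightarrow> (real^3 \<Rightarrow> complex) \<Rightarrow> real^3 \<Rightarrow> complex" where
  "rotd a b v x = x $ a *\<^sub>R partial b v x - x $ b *\<^sub>R partial a v x"

text \<open>In the direction e of the unit tangent at angle 0 the arc has coordinate \<rho> sin
  \<theta>, so its distance to y is at least |\<rho> sin \<theta> - c|. This coordinate moves with
  speed at least \<rho> / 2, hence the arc spends only an angle of order s / \<rho> within distance
  s of y.\<close>

lemma rot_avk_bound:
  assumes ab: "a \<noteq> b" and s: "s > 0" and \<rho>: "\<rho> > 0" "\<rho>\<^sup>2 = (x $ a)\<^sup>2 + (x $ b)\<^sup>2" and T: "T \<le> 1"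
  shows "(\<integral>\<^sup>+\<theta>. avk s (rot a b \<theta> x - y) * indicator {0..T} \<theta> \<partial>lborel) \<le> ennreal (1 / s ^ 3 * (2 * pi * (s / \<rho>)))"
proof -
  define e where "e = (1 / \<rho>) *\<^sub>R (x $ a *\<^sub>R axis b 1 - x $ b *\<^sub>R axis a 1 :: real^3)"
  have ze: "z \<bullet> e = (z $ b * x $ a - z $ a * x $ b) / \<rho>" for z
    by (simp add: e_def inner_diff_right inner_axis divide_inverse mult.commute)
  have "e \<bullet> e = ((x $ a)\<^sup>2 + (x $ b)\<^sup>2) / \<rho>\<^sup>2"
    unfolding ze using ab \<rho>(1) by (simp add: e_def axis_def field_simps power2_eq_square)
  also have "\<dots> = 1" using \<rho>(1) unfolding \<rho>(2)[symmetric] by simp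
  finally have e1: "norm e = 1" by (simp add: norm_eq_sqrt_inner)
  define c where "c = y \<bullet> e"
  have pe: "rot a b \<theta> x \<bullet> e = \<rho> * sin \<theta>" for \<theta>
  proof -
    have "rot a b \<theta> x \<bullet> e = sin \<theta> * ((x $ a)\<^sup>2 + (x $ b)\<^sup>2) / \<rho>"
      unfolding ze rot_nth(1,2)[OF ab] by (simp add: algebra_simps power2_eq_square)
    also have "\<dots> = \<rho> * sin \<theta>" using \<rho>(1) unfolding \<rho>(2)[symmetric] by (simp add: power2_eq_square)
    finally show ?thesis .
  qed
  have dist: "\<bar>\<rho> * sin \<theta> - c\<bar> \<le> norm (rot a b \<theta> x - y)" for \<theta>
    using Cauchy_Schwarz_ineq2[of "rot a b \<theta> x - y" e] by (simp add: e1 inner_diff_left pe c_def)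
  \<comment> \<open>The decay is lowered from the sixth to the second power, and a factor 2 cos
    \<theta> >= 1 is inserted; the integrand becomes the exact derivative of an arctangent, whose
    total variation is at most pi.\<close>
  let ?f = "\<lambda>\<theta>. 1 / s ^ 3 * (2 * cos \<theta> / (1 + ((\<rho> * sin \<theta> - c) / s)\<^sup>2))"
  let ?F = "\<lambda>\<theta>. 1 / s ^ 3 * (2 * (s / \<rho>) * arctan ((\<rho> * sin \<theta> - c) / s))"
  \<comment> \<open>1 < pi / 3 because pi > 3, whence the limit 1 on the angles.\<close>
  have cos: "cos \<theta> \<ge> 1 / 2" if "\<theta> \<in> {0..1}" for \<theta> :: real
  proof -
    have "cos (pi / 3) \<le> cos \<theta>"
      by (rule cos_monotone_0_pi_le) (use that pi_gt3 in auto)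
    then show ?thesis by (simp add: cos_60)
  qed
  have "(\<integral>\<^sup>+\<theta>. avk s (rot a b \<theta> x - y) * indicator {0..T} \<theta> \<partial>lborel) \<le> (\<integral>\<^sup>+\<theta>. ennreal (?f \<theta>) * indicator {0..1} \<theta> \<partial>lborel)"
  proof (intro nn_integral_mono)
    fix \<theta>
    show "avk s (rot a b \<theta> x - y) * indicator {0..T} \<theta> \<le> ennreal (?f \<theta>) * indicator {0..1} \<theta>"
    proof (cases "\<theta> \<in> {0..T}")
      case True
      then have \<theta>: "\<theta> \<in> {0..1}" using T by auto
      define u where "u = norm (rot a b \<theta> x - y) / s"
      have u: "u \<ge> 0" using s by (simp add: u_def)
      let ?w = "(\<rho> * sin \<theta> - c) / s"
      have "\<bar>?w\<bar> \<le> u" using dist[of \<theta>] s by (simp add: u_def divide_right_mono)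
      then have "?w\<^sup>2 \<le> u\<^sup>2" using u by (metis abs_le_square_iff abs_of_nonneg)
      also have "1 + u\<^sup>2 \<le> (1 + u) ^ 2" using u by (simp add: power2_sum)
      also have "(1 + u) ^ 2 \<le> (1 + u) ^ 6" using u by (intro power_increasing) auto
      finally have le: "1 + ?w\<^sup>2 \<le> (1 + u) ^ 6" by simp
      have "1 / (1 + u) ^ 6 \<le> 1 / (1 + ?w\<^sup>2)"
      proof (rule divide_left_mono[OF le])
        show "0 < (1 + u) ^ 6 * (1 + ?w\<^sup>2)"
          using u by (intro mult_pos_pos zero_less_power add_pos_nonneg) auto
      qed simp
      also have "\<dots> \<le> 2 * cos \<theta> / (1 + ?w\<^sup>2)"
        using cos[OF \<theta>] by (intro divide_right_mono) auto
      finally have "1 / s ^ 3 * (1 / (1 + u) ^ 6) \<le> ?f \<theta>"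
        using s by (intro mult_left_mono) auto
      then show ?thesis using True \<theta> by (simp add: avk_def u_def ennreal_leI)
    qed simp
  qed
  also have "\<dots> = ennreal (?F 1 - ?F 0)"
  proof (rule nn_integral_FTC_Icc[where F = ?F and f = ?f])
    fix \<theta> :: real assume "\<theta> \<in> {0..1}"
    then show "?f \<theta> \<ge> 0" using cos[of \<theta>] s by (intro mult_nonneg_nonneg divide_nonneg_nonneg) auto
    have "(?F has_real_derivative 1 / s ^ 3 * (2 * (s / \<rho>) * (inverse (1 + ((\<rho> * sin \<theta> - c) / s)\<^sup>2) * ((\<rho> * cos \<theta> - 0) / s)))) (at \<theta>)"
      using s by (intro DERIV_cmult DERIV_chain2[OF DERIV_arctan] DERIV_cdivide DERIV_diff DERIV_const DERIV_sin)
    also have "1 / s ^ 3 * (2 * (s / \<rho>) * (inverse (1 + ((\<rho> * sin \<theta> - c) / s)\<^sup>2) * ((\<rho> * cos \<theta> - 0) / s))) = ?f \<theta>"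
    proof -
      have "s / \<rho> * (X * ((\<rho> * Y - 0) / s)) = Y * X" for X Y
        using s \<rho>(1) by simp
      then show ?thesis by (simp only: mult.assoc divide_inverse[of "2 * cos \<theta>"])
    qed
    finally show "(?F has_real_derivative ?f \<theta>) (at \<theta>)" .
  qed auto
  also have "\<dots> \<le> ennreal (1 / s ^ 3 * (2 * pi * (s / \<rho>)))"
  proof (rule ennreal_leI)
    have "arctan ((\<rho> * sin 1 - c) / s) - arctan ((\<rho> * sin 0 - c) / s) \<le> pi"
      using arctan_bounded[of "(\<rho> * sin 1 - c) / s"] arctan_bounded[of "(\<rho> * sin 0 - c) / s"] by linarith
    then have "1 / s ^ 3 * (2 * (s / \<rho>) * (arctan ((\<rho> * sin 1 - c) / s) - arctan ((\<rho> * sin 0 - c) / s))) \<le> 1 / s ^ 3 * (2 * (s / \<rho>) * pi)"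
      using s \<rho>(1) by (intro mult_left_mono) auto
    then show "?F 1 - ?F 0 \<le> 1 / s ^ 3 * (2 * pi * (s / \<rho>))" by (simp add: right_diff_distrib mult_ac)
  qed
  finally show ?thesis .
qed

context LP
begin

text \<open>\<open>kap\<close> is radial and R is linear and preserves the measure, so v composed
  with R is reproduced by the same average, and so is the difference.\<close>

lemma localized_rot:
  assumes v: "localized a v" and R: "orthogonal_transformation R"
  shows "localized a (\<lambda>x. v (R x) - v x)"
  unfolding localized_def
proof (intro conjI allI)
  note [measurable] = decaying_measurable[OF LPk_decaying(3)] orthogonal_measurable[OF R]
  have vc: "continuous_on UNIV v" using v unfolding localized_def by blast
  then have [measurable]: "v \<in> borel_measurable borel" by (rule borel_measurable_continuous_onI)
  have Rl: "linear R" using R by (rule orthogonal_transformation_linear)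
  have Rc: "continuous_on UNIV R"
    using Rl by (intro linear_continuous_on linear_conv_bounded_linear[THEN iffD1])
  show "a > 0" using v unfolding localized_def by blast
  show "continuous_on UNIV (\<lambda>x. v (R x) - v x)"
    by (intro continuous_on_diff vc continuous_on_compose2[OF vc Rc]) auto
  fix x
  have i: "integrable lborel (\<lambda>z. v (x - (a / 2) *\<^sub>R z) * kap z)" "v x = (\<integral>z. v (x - (a / 2) *\<^sub>R z) * kap z \<partial>lborel)" for x
    using v unfolding localized_def by blast+
  have eq: "v (R x - (a / 2) *\<^sub>R R z) * kap (R z) = v (R (x - (a / 2) *\<^sub>R z)) * kap z" for z
    using Rl by (simp add: linear_diff linear_scale kap_orthogonal[OF R])
  have "integrable (distr lborel borel R) (\<lambda>z. v (R x - (a / 2) *\<^sub>R z) * kap z)"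
    using i(1)[of "R x"] by (simp add: lborel_distr_orthogonal[OF R])
  then have "integrable lborel (\<lambda>z. v (R x - (a / 2) *\<^sub>R R z) * kap (R z))"
    by (subst (asm) integrable_distr_eq) auto
  then have i1: "integrable lborel (\<lambda>z. v (R (x - (a / 2) *\<^sub>R z)) * kap z)"
    by (simp only: eq)
  have "v (R x) = (\<integral>z. v (R x - (a / 2) *\<^sub>R R z) * kap (R z) \<partial>lborel)"
    by (subst integral_orthogonal[OF R, of "\<lambda>z. v (R x - (a / 2) *\<^sub>R z) * kap z"]) (simp_all add: i(2)[symmetric])
  then have i2: "v (R x) = (\<integral>z. v (R (x - (a / 2) *\<^sub>R z)) * kap z \<partial>lborel)"
    by (simp only: eq)
  show "integrable lborel (\<lambda>z. (v (R (x - (a / 2) *\<^sub>R z)) - v (x - (a / 2) *\<^sub>R z)) * kap z)"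
    unfolding left_diff_distrib by (intro Bochner_Integration.integrable_diff i1 i)
  show "v (R x) - v x = (\<integral>z. (v (R (x - (a / 2) *\<^sub>R z)) - v (x - (a / 2) *\<^sub>R z)) * kap z \<partial>lborel)"
    unfolding left_diff_distrib by (subst Bochner_Integration.integral_diff[OF i1 i(1)]) (simp only: i2[symmetric] i(2)[symmetric])
qed

lemma rotd_continuous:
  assumes "localized1 s v" shows "continuous_on UNIV (rotd a b v)"
  unfolding rotd_def using assms unfolding localized1_def by (intro continuous_intros) blast+

lemma rot_difference_pointwise:
  assumes v: "localized1 s v" and ab: "a \<noteq> b" and \<theta>: "\<theta> \<ge> 0"
  shows "ennreal (norm (v (rot a b \<theta> x) - v x)) \<le> (\<integral>\<^sup>+\<tau>. nv (rotd a b v) (rot a b \<tau> x) * indicator {0..\<theta>} \<tau> \<partial>lborel)"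
proof -
  have vd: "(v has_derivative (\<lambda>h. \<Sum>c\<in>UNIV. h $ c *\<^sub>R partial c v y)) (at y)" for y
    by (rule has_derivative_from_partials) (use v in \<open>unfold localized1_def, blast+\<close>)
  have dv: "((\<lambda>\<tau>. v (rot a b \<tau> x)) has_vector_derivative rotd a b v (rot a b \<tau> x)) (at \<tau>)" for \<tau>
  proof -
    let ?r = "- sin \<tau> *\<^sub>R (x $ a *\<^sub>R axis a 1 + x $ b *\<^sub>R axis b 1) + cos \<tau> *\<^sub>R (x $ a *\<^sub>R axis b 1 - x $ b *\<^sub>R axis a 1)"
    have "((\<lambda>\<tau>. rot a b \<tau> x) has_vector_derivative ?r) (at \<tau>)"
      unfolding rot_def by (auto intro!: derivative_eq_intros simp: algebra_simps)
    then have "((v \<circ> (\<lambda>\<tau>. rot a b \<tau> x)) has_derivative (\<lambda>h. \<Sum>c\<in>UNIV. h $ c *\<^sub>R partial c v (rot a b \<tau> x)) \<circ> (\<lambda>h. h *\<^sub>R ?r)) (at \<tau>)"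
      unfolding has_vector_derivative_def by (rule diff_chain_at) (rule vd)
    moreover have "(\<lambda>h. \<Sum>c\<in>UNIV. h $ c *\<^sub>R partial c v (rot a b \<tau> x)) \<circ> (\<lambda>h. h *\<^sub>R ?r) = (\<lambda>h. h *\<^sub>R rotd a b v (rot a b \<tau> x))"
    proof
      fix h
      have "(\<Sum>c\<in>UNIV. ?r $ c *\<^sub>R partial c v (rot a b \<tau> x)) = ?r $ a *\<^sub>R partial a v (rot a b \<tau> x) + ?r $ b *\<^sub>R partial b v (rot a b \<tau> x)"
        by (rule sum_two[OF ab]) (auto simp: axis_def)
      also have "?r $ a = - rot a b \<tau> x $ b" using ab by (simp add: rot_nth[OF ab] axis_def)
      also have "?r $ b = rot a b \<tau> x $ a" using ab by (simp add: rot_nth[OF ab] axis_def)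
      finally have "(\<Sum>c\<in>UNIV. ?r $ c *\<^sub>R partial c v (rot a b \<tau> x)) = rotd a b v (rot a b \<tau> x)"
        by (simp add: rotd_def)
      moreover have "(\<Sum>c\<in>UNIV. (h *\<^sub>R ?r) $ c *\<^sub>R partial c v (rot a b \<tau> x)) = h *\<^sub>R (\<Sum>c\<in>UNIV. ?r $ c *\<^sub>R partial c v (rot a b \<tau> x))"
        by (simp only: scaleR_sum_right vector_scaleR_component scaleR_scaleR real_scaleR_def)
      ultimately show "((\<lambda>h. \<Sum>c\<in>UNIV. h $ c *\<^sub>R partial c v (rot a b \<tau> x)) \<circ> (\<lambda>h. h *\<^sub>R ?r)) h = h *\<^sub>R rotd a b v (rot a b \<tau> x)"
        by (simp only: comp_apply)
    qed
    ultimately show ?thesis by (simp only: has_vector_derivative_def comp_def)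
  qed
  have "continuous_on {0..\<theta>} (\<lambda>\<tau>. rot a b \<tau> x)" unfolding rot_def by (intro continuous_intros)
  then have cont: "continuous_on {0..\<theta>} (\<lambda>\<tau>. rotd a b v (rot a b \<tau> x))"
    by (rule continuous_on_compose2[OF rotd_continuous[OF v]]) auto
  have "has_bochner_integral lborel (\<lambda>\<tau>. indicator {0..\<theta>} \<tau> *\<^sub>R rotd a b v (rot a b \<tau> x)) (v (rot a b \<theta> x) - v (rot a b 0 x))"
    by (rule has_bochner_integral_FTC_Icc) (use \<theta> dv cont in \<open>auto intro: has_vector_derivative_at_within\<close>)
  from has_bochner_integral_norm_le[OF this]
  have "ennreal (norm (v (rot a b \<theta> x) - v x)) \<le> (\<integral>\<^sup>+\<tau>. ennreal (norm (indicator {0..\<theta>} \<tau> *\<^sub>R rotd a b v (rot a b \<tau> x))) \<partial>lborel)"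
    by simp
  also have "\<dots> = (\<integral>\<^sup>+\<tau>. nv (rotd a b v) (rot a b \<tau> x) * indicator {0..\<theta>} \<tau> \<partial>lborel)"
    by (intro nn_integral_cong) (auto simp: indicator_def)
  finally show ?thesis .
qed

text \<open>Jensen's inequality over the angles gives \<theta>^(1 - 1/q); Fubini's theorem and the
  rotation invariance of the L^q norm give the remaining \<theta>^(1/q).\<close>

lemma Lq_rot_difference:
  assumes v: "localized1 s v" and ab: "a \<noteq> b" and \<theta>: "\<theta> > 0" and q: "1 < q"
  shows "Lq q (nv (\<lambda>x. v (rot a b \<theta> x) - v x)) \<le> ennreal \<theta> * Lq q (nv (rotd a b v))"
proof -
  have [measurable]: "rotd a b v \<in> borel_measurable borel"
    by (rule borel_measurable_continuous_onI[OF rotd_continuous[OF v]])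
  let ?W = "nv (rotd a b v)"
  let ?k = "ennreal_rpow (ennreal_rpow (ennreal \<theta>) (1 - 1 / q)) q"
  have pw: "ennreal_rpow (ennreal (norm (v (rot a b \<theta> x) - v x))) q \<le>
      (\<integral>\<^sup>+\<tau>. ennreal_rpow (?W (rot a b \<tau> x)) q * indicator {0..\<theta>} \<tau> \<partial>lborel) * ?k" for x
  proof -
    have "ennreal (norm (v (rot a b \<theta> x) - v x)) \<le> (\<integral>\<^sup>+\<tau>. ?W (rot a b \<tau> x) * indicator {0..\<theta>} \<tau> \<partial>lborel)"
      by (rule rot_difference_pointwise[OF v ab]) (use \<theta> in simp)
    also have "\<dots> \<le> ennreal_rpow (\<integral>\<^sup>+\<tau>. ennreal_rpow (?W (rot a b \<tau> x)) q * indicator {0..\<theta>} \<tau> \<partial>lborel) (1 / q) * ennreal_rpow (ennreal \<theta>) (1 - 1 / q)"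
      by (rule nn_integral_weighted_Jensen) (use q \<theta> in \<open>auto simp: nn_integral_indicator\<close>)
    finally have "ennreal_rpow (ennreal (norm (v (rot a b \<theta> x) - v x))) q \<le> ennreal_rpow (\<dots>) q"
      using q by (intro ennreal_rpow_mono) auto
    then show ?thesis using q by (simp add: ennreal_rpow_mult ennreal_rpow_rpow)
  qed
  have "(\<integral>\<^sup>+x. ennreal_rpow (ennreal (norm (v (rot a b \<theta> x) - v x))) q \<partial>lborel) \<le>
      (\<integral>\<^sup>+x. (\<integral>\<^sup>+\<tau>. ennreal_rpow (?W (rot a b \<tau> x)) q * indicator {0..\<theta>} \<tau> \<partial>lborel) * ?k \<partial>lborel)"
    by (intro nn_integral_mono pw)
  also have "\<dots> = (\<integral>\<^sup>+x. (\<integral>\<^sup>+\<tau>. ennreal_rpow (?W (rot a b \<tau> x)) q * indicator {0..\<theta>} \<tau> \<partial>lborel) \<partial>lborel) * ?k"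
    by (rule nn_integral_multc) measurable
  also have "(\<integral>\<^sup>+x. (\<integral>\<^sup>+\<tau>. ennreal_rpow (?W (rot a b \<tau> x)) q * indicator {0..\<theta>} \<tau> \<partial>lborel) \<partial>lborel) =
      (\<integral>\<^sup>+\<tau>. (\<integral>\<^sup>+x. ennreal_rpow (?W (rot a b \<tau> x)) q * indicator {0..\<theta>} \<tau> \<partial>lborel) \<partial>lborel)"
    by (rule lborel_pair.Fubini') measurable
  also have "\<dots> = (\<integral>\<^sup>+\<tau>. (\<integral>\<^sup>+x. ennreal_rpow (?W x) q \<partial>lborel) * indicator {0..\<theta>} \<tau> \<partial>lborel)"
  proof (intro nn_integral_cong)
    fix \<tau>
    have "(\<integral>\<^sup>+x. ennreal_rpow (?W (rot a b \<tau> x)) q * indicator {0..\<theta>} \<tau> \<partial>lborel) = (\<integral>\<^sup>+x. ennreal_rpow (?W (rot a b \<tau> x)) q \<partial>lborel) * indicator {0..\<theta>} \<tau>"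
      by (rule nn_integral_multc) measurable
    then show "(\<integral>\<^sup>+x. ennreal_rpow (?W (rot a b \<tau> x)) q * indicator {0..\<theta>} \<tau> \<partial>lborel) = (\<integral>\<^sup>+x. ennreal_rpow (?W x) q \<partial>lborel) * indicator {0..\<theta>} \<tau>"
      by (simp add: nn_integral_orthogonal[OF orthogonal_rot[OF ab], of "\<lambda>x. ennreal_rpow (?W x) q"])
  qed
  also have "\<dots> = (\<integral>\<^sup>+x. ennreal_rpow (?W x) q \<partial>lborel) * ennreal \<theta>"
    using \<theta> by (simp add: nn_integral_cmult)
  finally have "Lq q (nv (\<lambda>x. v (rot a b \<theta> x) - v x)) \<le> ennreal_rpow ((\<integral>\<^sup>+x. ennreal_rpow (?W x) q \<partial>lborel) * ennreal \<theta> * ?k) (1 / q)"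
    using q by (intro ennreal_rpow_mono) auto
  also have "\<dots> = Lq q ?W * (ennreal_rpow (ennreal \<theta>) (1 / q) * ennreal_rpow (ennreal \<theta>) (1 - 1 / q))"
    using q by (simp add: ennreal_rpow_mult ennreal_rpow_rpow mult.assoc)
  also have "ennreal_rpow (ennreal \<theta>) (1 / q) * ennreal_rpow (ennreal \<theta>) (1 - 1 / q) = ennreal \<theta>"
    by (simp add: ennreal_rpow_add[symmetric])
  finally show ?thesis by (simp add: mult.commute)
qed

end

text \<open>The planes (1, 2) and (2, 3) together contain all coordinates, so one of them carries at
  least half of |x|^2; a quarter suffices and makes the radius |x| / 2.\<close>

lemma plane_exists:
  fixes x :: "real^3"
  obtains a b :: 3 where "a \<noteq> b" "(norm x / 2)\<^sup>2 \<le> (x $ a)\<^sup>2 + (x $ b)\<^sup>2"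
proof -
  have n: "(norm x)\<^sup>2 = (x $ 1)\<^sup>2 + (x $ 2)\<^sup>2 + (x $ 3)\<^sup>2"
    by (simp add: norm_vec_def L2_set_def sum_3)
  have "(norm x / 2)\<^sup>2 \<le> (x $ 1)\<^sup>2 + (x $ 2)\<^sup>2 \<or> (norm x / 2)\<^sup>2 \<le> (x $ 2)\<^sup>2 + (x $ 3)\<^sup>2"
  proof (rule ccontr)
    assume "\<not> ?thesis"
    then have "4 * ((x $ 1)\<^sup>2 + (x $ 2)\<^sup>2) < (norm x)\<^sup>2" "4 * ((x $ 2)\<^sup>2 + (x $ 3)\<^sup>2) < (norm x)\<^sup>2"
      by (auto simp: power_divide not_le)
    moreover have False if "4 * (p + q) < p + q + r" "4 * (q + r) < p + q + r" "0 \<le> p" "0 \<le> q" "0 \<le> r" for p q r :: real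
      using that by argo
    ultimately show False unfolding n by (meson zero_le_power2)
  qed
  then show ?thesis using that[of 1 2] that[of 2 3] by auto
qed

context LP
begin

text \<open>The scale-invariant Sobolev quantity at a fixed time. For s = 2^(-k), q = 2M and r =
  4M/(M-1) the weights are 2^(3k/(2M)) and 2^(3k(M-1)/(4M)), those of the estimates.\<close>

definition sob :: "real \<Rightarrow> real \<Rightarrow> real \<Rightarrow> (real^3 \<Rightarrow> complex) \<Rightarrow> ennreal" where
  "sob q r s v = ennreal (s powr (- 3 / q)) * (Lq q (nv v) + (MAX (a, b)\<in>UNIV. Lq q (nv (rotd a b v)))) +
     ennreal (s powr (- 3 / r)) * Lq r (nv v)"

text \<open>Fubini's theorem turns the average into an integral of |v| against \<open>P\<close>, the
  kernel averaged over the arc. \<open>P\<close> is bounded pointwise by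
  \<open>rot_avk_bound\<close> and has mass at most T \<open>c0\<close>; Jensen's inequality in L^r
  combines the two with exponents 1/r and 1 - 1/r.\<close>

lemma rot_average:
  assumes v: "localized1 s v" and ab: "a \<noteq> b" and r: "1 < r"
    and \<rho>: "\<rho> > 0" "\<rho>\<^sup>2 = (x $ a)\<^sup>2 + (x $ b)\<^sup>2" and T: "0 < T" "T \<le> 1"
  shows "(\<integral>\<^sup>+\<theta>. smear s (nv v) (rot a b \<theta> x) * indicator {0..T} \<theta> \<partial>lborel)
    \<le> ennreal ((1 / s ^ 3 * (2 * pi * (s / \<rho>))) powr (1 / r) * T powr (1 - 1 / r)) * c0 * Lq r (nv v)"
proof -
  have s: "s > 0" using v by (simp add: localized1_def localized_def)
  have [measurable]: "v \<in> borel_measurable borel"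
    using v by (auto simp: localized1_def localized_def intro: borel_measurable_continuous_onI)
  define P where "P y = (\<integral>\<^sup>+\<theta>. avk s (rot a b \<theta> x - y) * indicator {0..T} \<theta> \<partial>lborel)" for y
  have [measurable]: "P \<in> borel_measurable borel" unfolding P_def by measurable
  have refl: "smear s (nv v) z = (\<integral>\<^sup>+y. nv v y * avk s (z - y) \<partial>lborel)" for z
    unfolding smear_def using nn_integral_reflect[of "\<lambda>y. nv v y * avk s (z - y)" z] by simp
  have "(\<integral>\<^sup>+\<theta>. smear s (nv v) (rot a b \<theta> x) * indicator {0..T} \<theta> \<partial>lborel) =
      (\<integral>\<^sup>+\<theta>. (\<integral>\<^sup>+y. nv v y * avk s (rot a b \<theta> x - y) * indicator {0..T} \<theta> \<partial>lborel) \<partial>lborel)"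
    unfolding refl by (intro nn_integral_cong nn_integral_multc[symmetric]) measurable
  also have "\<dots> = (\<integral>\<^sup>+y. (\<integral>\<^sup>+\<theta>. nv v y * avk s (rot a b \<theta> x - y) * indicator {0..T} \<theta> \<partial>lborel) \<partial>lborel)"
    by (rule lborel_pair.Fubini') measurable
  also have "\<dots> = (\<integral>\<^sup>+y. nv v y * P y \<partial>lborel)"
    unfolding P_def mult.assoc by (intro nn_integral_cong nn_integral_cmult) measurable
  also have "\<dots> \<le> ennreal_rpow (\<integral>\<^sup>+y. ennreal_rpow (nv v y) r * P y \<partial>lborel) (1 / r) * ennreal_rpow (ennreal T * c0) (1 - 1 / r)"
  proof (rule nn_integral_weighted_Jensen)
    have "(\<integral>\<^sup>+y. P y \<partial>lborel) = (\<integral>\<^sup>+\<theta>. (\<integral>\<^sup>+y. avk s (rot a b \<theta> x - y) * indicator {0..T} \<theta> \<partial>lborel) \<partial>lborel)"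
      unfolding P_def by (rule lborel_pair.Fubini') measurable
    also have "\<dots> = (\<integral>\<^sup>+\<theta>. (\<integral>\<^sup>+y. avk s y \<partial>lborel) * indicator {0..T} \<theta> \<partial>lborel)"
    proof (intro nn_integral_cong)
      fix \<theta>
      have "(\<integral>\<^sup>+y. avk s (rot a b \<theta> x - y) * indicator {0..T} \<theta> \<partial>lborel) = (\<integral>\<^sup>+y. avk s (rot a b \<theta> x - y) \<partial>lborel) * indicator {0..T} \<theta>"
        by (rule nn_integral_multc) measurable
      then show "(\<integral>\<^sup>+y. avk s (rot a b \<theta> x - y) * indicator {0..T} \<theta> \<partial>lborel) = (\<integral>\<^sup>+y. avk s y \<partial>lborel) * indicator {0..T} \<theta>"
        by (simp add: nn_integral_reflect[of "avk s"])
    qed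
    also have "\<dots> = (\<integral>\<^sup>+y. avk s y \<partial>lborel) * ennreal T" using T by (simp add: nn_integral_cmult)
    also have "\<dots> \<le> c0 * ennreal T" by (intro mult_right_mono nn_integral_avk s) simp
    finally show "(\<integral>\<^sup>+y. P y \<partial>lborel) \<le> ennreal T * c0" by (simp add: mult.commute)
  qed (use r in auto)
  also have "\<dots> \<le> ennreal_rpow (\<integral>\<^sup>+y. ennreal_rpow (nv v y) r * ennreal (1 / s ^ 3 * (2 * pi * (s / \<rho>))) \<partial>lborel) (1 / r) * (ennreal_rpow (ennreal T) (1 - 1 / r) * c0)"
    unfolding ennreal_rpow_mult[of "ennreal T"]
    using r rot_avk_bound[OF ab s \<rho> T(2)] ennreal_rpow_c0[of "1 - 1 / r"]
    by (intro mult_mono ennreal_rpow_mono nn_integral_mono mult_left_mono) (auto simp: P_def)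
  also have "(\<integral>\<^sup>+y. ennreal_rpow (nv v y) r * ennreal (1 / s ^ 3 * (2 * pi * (s / \<rho>))) \<partial>lborel) =
      (\<integral>\<^sup>+y. ennreal_rpow (nv v y) r \<partial>lborel) * ennreal (1 / s ^ 3 * (2 * pi * (s / \<rho>)))"
    by (rule nn_integral_multc) measurable
  also have "ennreal_rpow ((\<integral>\<^sup>+y. ennreal_rpow (nv v y) r \<partial>lborel) * ennreal (1 / s ^ 3 * (2 * pi * (s / \<rho>)))) (1 / r) * (ennreal_rpow (ennreal T) (1 - 1 / r) * c0)
      = ennreal ((1 / s ^ 3 * (2 * pi * (s / \<rho>))) powr (1 / r) * T powr (1 - 1 / r)) * c0 * Lq r (nv v)"
  proof -
    have "ennreal_rpow (ennreal (1 / s ^ 3 * (2 * pi * (s / \<rho>)))) (1 / r) = ennreal ((1 / s ^ 3 * (2 * pi * (s / \<rho>))) powr (1 / r))"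
      using s \<rho>(1) by (intro ennreal_rpow_ennreal) auto
    moreover have "ennreal_rpow (ennreal T) (1 - 1 / r) = ennreal (T powr (1 - 1 / r))"
      using T by (intro ennreal_rpow_ennreal) auto
    ultimately show ?thesis
      unfolding ennreal_rpow_mult[of _ "ennreal (1 / s ^ 3 * (2 * pi * (s / \<rho>)))"]
      by (simp only: ennreal_mult powr_ge_zero) (simp only: mult_ac)
  qed
  finally show ?thesis .
qed

text \<open>On an arc of length T the rotated difference costs the factor T, through <Omega> in L^q,
  and the averaged value gains (s / (\<rho> T))^(1/r). The choice T^2 = s / \<rho> makes this gain
  T^(1/r), and since r <= 5 both factors are at most T^(1/5) = (s / \<rho>)^(1/10).\<close>

lemma radial_decay:
  assumes q: "1 < q" and r: "1 < r" "r \<le> 5"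
  obtains C where "C \<ge> 0"
    "\<And>s v x. localized1 s v \<Longrightarrow> x \<noteq> 0 \<Longrightarrow> nv v x \<le> ennreal (C * (s / norm x) powr (1 / 10)) * sob q r s v"
proof -
  obtain C1 where C1: "C1 \<ge> 0"
    "\<And>a v x. localized a v \<Longrightarrow> nv v x \<le> ennreal C1 * (ennreal (a powr (- 3 / q)) * Lq q (nv v))"
    by (rule Bernstein[OF q]) (rule that)
  obtain C2 where C2: "C2 \<ge> 0" "\<And>a v x. localized a v \<Longrightarrow> nv v x \<le> ennreal C2 * smear a (nv v) x"
    by (rule localized_bound) (rule that)
  obtain c where c: "c0 = ennreal c" "c \<ge> 1" by (rule c0_real)
  \<comment> \<open>The 2 pays for passing from s / \<rho> to s / |x| and, in the case s > \<rho>,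
    for the factor g being only known to be at least 1/2; 2 pi bounds the power (2 pi)^(1/r) left by
    \<open>rot_avk_bound\<close>.\<close>
  define C where "C = 2 * (C1 + C2 * c * (2 * pi))"
  have CC: "2 * C1 \<le> C" "0 \<le> C" using C1(1) C2(1) c(2) by (simp_all add: C_def)
  show ?thesis
  proof (rule that[OF CC(2)])
    fix s v and x :: "real^3"
    assume v: "localized1 s v" and x: "x \<noteq> 0"
    have vl: "localized s v" using v by (simp only: localized1_def)
    have s: "s > 0" using vl by (simp add: localized_def)
    define g where "g = (s / norm x) powr (1 / 10)"
    obtain a b where ab: "a \<noteq> b" and le: "(norm x / 2)\<^sup>2 \<le> (x $ a)\<^sup>2 + (x $ b)\<^sup>2" by (rule plane_exists)
    define \<rho> where "\<rho> = sqrt ((x $ a)\<^sup>2 + (x $ b)\<^sup>2)"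
    have \<rho>2: "\<rho>\<^sup>2 = (x $ a)\<^sup>2 + (x $ b)\<^sup>2" by (simp add: \<rho>_def)
    have \<rho>x: "norm x / 2 \<le> \<rho>" unfolding \<rho>_def by (rule real_le_rsqrt[OF le])
    have \<rho>: "\<rho> > 0" using \<rho>x x by (smt (verit) zero_less_norm_iff half_gt_zero)
    define W where "W = Lq q (nv (rotd a b v))"
    define H where "H = ennreal (s powr (- 3 / q)) * W"
    define V where "V = ennreal (s powr (- 3 / r)) * Lq r (nv v)"
    have sob_q: "ennreal (s powr (- 3 / q)) * Lq q (nv v) \<le> sob q r s v"
      unfolding sob_def distrib_left by (simp add: add_increasing2 add.assoc)
    have W_le: "W \<le> (MAX (a, b)\<in>UNIV. Lq q (nv (rotd a b v)))"
      unfolding W_def by (rule Max_ge) (auto intro!: image_eqI[of _ _ "(a, b)"])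
    have HV: "H + V \<le> sob q r s v"
      unfolding sob_def H_def V_def by (intro add_right_mono mult_left_mono add_increasing[OF zero_le W_le]) simp
    show "nv v x \<le> ennreal (C * g) * sob q r s v"
    proof (cases "s \<le> \<rho>")
      case False
      then have "1 / 2 \<le> s / norm x" using \<rho>x x by (simp add: field_simps)
      then have "(1 / 2) powr (1 / 10) \<le> g" unfolding g_def by (intro powr_mono2) auto
      moreover have "(1 / 2 :: real) powr 1 \<le> (1 / 2) powr (1 / 10)" by (intro powr_mono') auto
      ultimately have g: "1 / 2 \<le> g" by simp
      have "C1 = 2 * C1 * (1 / 2)" by simp
      also have "\<dots> \<le> C * g" using CC g C1(1) by (intro mult_mono) auto
      finally have "C1 \<le> C * g" .
      have "nv v x \<le> ennreal C1 * (ennreal (s powr (- 3 / q)) * Lq q (nv v))" by (rule C1(2)[OF vl])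
      also have "\<dots> \<le> ennreal (C * g) * sob q r s v"
        by (intro mult_mono ennreal_leI \<open>C1 \<le> C * g\<close> sob_q) auto
      finally show ?thesis .
    next
      case True
      define T where "T = sqrt (s / \<rho>)"
      have T: "0 < T" "T \<le> 1" using True s \<rho> by (auto simp: T_def)
      have T2: "s / \<rho> = T\<^sup>2" using s \<rho> by (simp add: T_def)
      have bd: "nv v x \<le> ennreal C1 * (ennreal T * H) + ennreal C2 * smear s (nv v) (rot a b \<theta> x)" if "\<theta> \<in> {0..T}" for \<theta>
      proof (cases "\<theta> = 0")
        case True
        then show ?thesis using C2(2)[OF vl, of x] by (simp add: add_increasing)
      next
        case False
        then have \<theta>: "\<theta> > 0" "\<theta> \<le> T" using that by auto
        have "norm (v x) \<le> norm (v (rot a b \<theta> x) - v x) + norm (v (rot a b \<theta> x))"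
          using norm_triangle_ineq4[of "v (rot a b \<theta> x)" "v (rot a b \<theta> x) - v x"] by simp
        then have "nv v x \<le> ennreal (norm (v (rot a b \<theta> x) - v x)) + nv v (rot a b \<theta> x)"
          by (simp add: ennreal_plus[symmetric] ennreal_leI del: ennreal_plus)
        also have "\<dots> \<le> ennreal C1 * (ennreal T * H) + ennreal C2 * smear s (nv v) (rot a b \<theta> x)"
        proof (rule add_mono)
          have "ennreal (norm (v (rot a b \<theta> x) - v x)) \<le> ennreal C1 * (ennreal (s powr (- 3 / q)) * Lq q (nv (\<lambda>x. v (rot a b \<theta> x) - v x)))"
            using C1(2)[OF localized_rot[OF vl orthogonal_rot[OF ab]]] .
          also have "\<dots> \<le> ennreal C1 * (ennreal (s powr (- 3 / q)) * (ennreal T * W))"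
            unfolding W_def using \<theta>
            by (intro mult_left_mono order_trans[OF Lq_rot_difference[OF v ab \<theta>(1) q]] mult_right_mono ennreal_leI) auto
          finally show "ennreal (norm (v (rot a b \<theta> x) - v x)) \<le> ennreal C1 * (ennreal T * H)"
            by (simp add: H_def mult.left_commute)
        qed (rule C2(2)[OF vl])
        finally show ?thesis .
      qed
      have [measurable]: "v \<in> borel_measurable borel"
        using vl by (auto simp: localized_def intro: borel_measurable_continuous_onI)
      define K where "K = (1 / s ^ 3 * (2 * pi * (s / \<rho>))) powr (1 / r) * T powr (1 - 1 / r)"
      have K: "K \<le> T * (2 * pi * g * 2 * s powr (- 3 / r))"
      proof -
        have s3: "(1 / s ^ 3) powr (1 / r) = s powr (- 3 / r)"
        proof -
          have "1 / s ^ 3 = s powr (- 3)" using s by (simp add: powr_minus powr_numeral divide_inverse)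
          then show ?thesis by (simp add: powr_powr)
        qed
        have "(2 * pi) powr (1 / r) \<le> (2 * pi) powr 1"
          using r pi_gt3 by (intro powr_mono) auto
        then have p: "(2 * pi) powr (1 / r) \<le> 2 * pi" by simp
        have "T\<^sup>2 = T powr 2" using T by simp
        then have "(T\<^sup>2) powr (1 / r) * T powr (1 - 1 / r) = T powr (2 / r + (1 - 1 / r))"
          by (simp only: powr_powr powr_add) simp
        also have "2 / r + (1 - 1 / r) = 1 + 1 / r" by (simp add: field_simps) (use r in \<open>simp add: add_divide_distrib[symmetric] divide_eq_eq\<close>)?
        also have "T powr (1 + 1 / r) = T * T powr (1 / r)" using T by (simp add: powr_add)
        finally have TT: "(T\<^sup>2) powr (1 / r) * T powr (1 - 1 / r) = T * T powr (1 / r)" .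
        have "T powr (1 / r) \<le> T powr (1 / 5)"
          using T r by (intro powr_mono') (auto simp: field_simps)
        also have "T powr (1 / 5) = (s / \<rho>) powr (1 / 10)"
          using s \<rho> by (simp add: T_def powr_half_sqrt[symmetric] powr_powr)
        also have "\<dots> \<le> (2 * (s / norm x)) powr (1 / 10)"
          using \<rho>x \<rho> s x by (intro powr_mono2) (auto simp: field_simps)
        also have "\<dots> = 2 powr (1 / 10) * g" unfolding g_def by (rule powr_mult)
        also have "\<dots> \<le> 2 powr 1 * g" by (intro mult_right_mono powr_mono) (auto simp: g_def)
        finally have Tg: "T powr (1 / r) \<le> 2 * g" by simp
        have "K = (2 * pi) powr (1 / r) * s powr (- 3 / r) * ((T\<^sup>2) powr (1 / r) * T powr (1 - 1 / r))"
          unfolding K_def T2 powr_mult[of "1 / s ^ 3"] powr_mult[of "2 * pi" "T\<^sup>2"] s3 by (simp only: mult_ac)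
        also have "\<dots> \<le> (2 * pi) * s powr (- 3 / r) * (T * (2 * g))"
          unfolding TT using T by (intro mult_mono p order_refl Tg mult_nonneg_nonneg) (auto simp: g_def)
        finally show ?thesis by (simp add: mult_ac)
      qed
      have Tg1: "T \<le> 2 * g"
      proof -
        have "T \<le> T powr (1 / 5)" using T powr_mono'[of "1/5" 1 T] by simp
        also have "T powr (1 / 5) = (s / \<rho>) powr (1 / 10)"
          using s \<rho> by (simp add: T_def powr_half_sqrt[symmetric] powr_powr)
        also have "\<dots> \<le> (2 * (s / norm x)) powr (1 / 10)"
          using \<rho>x \<rho> s x by (intro powr_mono2) (auto simp: field_simps)
        also have "\<dots> = 2 powr (1 / 10) * g" unfolding g_def by (rule powr_mult)
        also have "\<dots> \<le> 2 powr 1 * g" by (intro mult_right_mono powr_mono) (auto simp: g_def)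
        finally show ?thesis by simp
      qed
      have [measurable]: "(\<lambda>\<theta>. smear s (nv v) (rot a b \<theta> x)) \<in> borel_measurable borel"
        by (rule measurable_compose[where N = borel]) measurable
      have "ennreal T * nv v x = (\<integral>\<^sup>+\<theta>. nv v x * indicator {0..T} \<theta> \<partial>lborel)"
        using T by (simp add: nn_integral_cmult mult.commute)
      also have "\<dots> \<le> (\<integral>\<^sup>+\<theta>. ennreal C1 * (ennreal T * H) * indicator {0..T} \<theta> + ennreal C2 * (smear s (nv v) (rot a b \<theta> x) * indicator {0..T} \<theta>) \<partial>lborel)"
        using bd by (intro nn_integral_mono) (auto simp: indicator_def)
      also have "\<dots> = ennreal C1 * (ennreal T * H) * ennreal T + ennreal C2 * (\<integral>\<^sup>+\<theta>. smear s (nv v) (rot a b \<theta> x) * indicator {0..T} \<theta> \<partial>lborel)"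
        using T by (subst nn_integral_add, measurable) (simp add: nn_integral_cmult)
      also have "\<dots> \<le> ennreal C1 * (ennreal T * H) * ennreal T + ennreal C2 * (ennreal K * c0 * Lq r (nv v))"
        unfolding K_def by (intro add_left_mono mult_left_mono rot_average v ab r \<rho> \<rho>2 T) auto
      also have "\<dots> \<le> ennreal C1 * (ennreal (2 * g) * H) * ennreal T + ennreal C2 * (ennreal (T * (2 * pi * g * 2 * s powr (- 3 / r))) * c0 * Lq r (nv v))"
        by (intro add_mono mult_left_mono mult_right_mono ennreal_leI K Tg1) auto
      also have "\<dots> = ennreal T * (ennreal (2 * C1 * g) * H + ennreal (2 * (C2 * c * (2 * pi)) * g) * V)"
      proof -
        have g0: "g \<ge> 0" by (simp add: g_def)
        have 1: "ennreal C1 * (ennreal (2 * g) * H) * ennreal T = ennreal T * (ennreal (2 * C1 * g) * H)"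
        proof -
          have "ennreal (2 * C1 * g) = ennreal C1 * ennreal (2 * g)"
            using C1(1) g0 by (simp add: ennreal_mult[symmetric] mult_ac)
          then show ?thesis by (simp add: mult_ac)
        qed
        have "ennreal (T * (2 * pi * g * 2 * s powr (- 3 / r))) = ennreal T * (ennreal (2 * pi * g * 2) * ennreal (s powr (- 3 / r)))"
          using T g0 by (simp add: ennreal_mult[symmetric])
        moreover have "ennreal (2 * (C2 * c * (2 * pi)) * g) = ennreal C2 * (ennreal (2 * pi * g * 2) * ennreal c)"
          using C2(1) c(2) g0 by (simp add: ennreal_mult[symmetric] mult_ac)
        ultimately have 2: "ennreal C2 * (ennreal (T * (2 * pi * g * 2 * s powr (- 3 / r))) * c0 * Lq r (nv v)) = ennreal T * (ennreal (2 * (C2 * c * (2 * pi)) * g) * V)"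
          unfolding c(1) V_def by (simp only: mult_ac)
        show ?thesis unfolding 1 2 distrib_left ..
      qed
      finally have "ennreal T * nv v x \<le> ennreal T * (ennreal (2 * C1 * g) * H + ennreal (2 * (C2 * c * (2 * pi)) * g) * V)" .
      then have "nv v x \<le> ennreal (2 * C1 * g) * H + ennreal (2 * (C2 * c * (2 * pi)) * g) * V"
        using T by (subst (asm) ennreal_mult_le_mult_iff) auto
      also have "\<dots> \<le> ennreal (C * g) * H + ennreal (C * g) * V"
        using C1(1) C2(1) c(2) by (intro add_mono mult_right_mono ennreal_leI) (auto simp: C_def g_def)
      also have "\<dots> = ennreal (C * g) * (H + V)" by (simp add: distrib_left)
      also have "\<dots> \<le> ennreal (C * g) * sob q r s v" by (intro mult_left_mono HV) simp
      finally show ?thesis .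
    qed
  qed
qed

end

section \<open>Measurability in time\<close>

text \<open>\<open>lebesgue_on I\<close> is complete: subsets of null sets are measurable, so a
  change on a null set of times is harmless.\<close>

lemma measurable_lebesgue_on_cong_AE:
  assumes f: "f \<in> borel_measurable (lebesgue_on I)" and I: "I \<in> sets lebesgue"
    and ae: "AE t in lebesgue_on I. f t = g t"
  shows "g \<in> borel_measurable (lebesgue_on I)"
proof (rule measurableI)
  fix A :: "'b set" assume A: "A \<in> sets borel"
  obtain N where N: "N \<in> null_sets (lebesgue_on I)" "{t \<in> space (lebesgue_on I). f t \<noteq> g t} \<subseteq> N"
    using ae by (auto simp: eventually_ae_filter)
  have sub: "B \<in> sets (lebesgue_on I)" if "B \<subseteq> N" for B
  proof -
    have Nn: "N \<in> null_sets lebesgue" "N \<subseteq> I"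
      using N(1) null_sets_restrict_space[OF I] by auto
    have "B \<in> null_sets lebesgue" by (rule null_sets_completion_subset[OF that Nn(1)])
    then show ?thesis using that \<open>N \<subseteq> I\<close> I by (auto simp: sets_restrict_space_iff)
  qed
  have "g -` A \<inter> space (lebesgue_on I) = ((f -` A \<inter> space (lebesgue_on I)) - N) \<union> (g -` A \<inter> space (lebesgue_on I) \<inter> N)"
    using N(2) by auto
  also have "\<dots> \<in> sets (lebesgue_on I)"
    using measurable_sets[OF f A] N(1) sub[of "g -` A \<inter> space (lebesgue_on I) \<inter> N"] by (intro sets.Un sets.Diff) auto
  finally show "g -` A \<inter> space (lebesgue_on I) \<in> sets (lebesgue_on I)" .
qed simp

lemma borel_imp_lebesgue_on: "f \<in> borel_measurable borel \<Longrightarrow> f \<in> borel_measurable (lebesgue_on I)"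
  by (intro measurable_restrict_space1 measurable_completion) simp

lemma AE_lborel_imp_lebesgue_on:
  assumes "I \<in> sets lebesgue" "AE t in lborel. P t" shows "AE t in lebesgue_on I. P t"
  using AE_completion[OF assms(2)] assms(1) by (subst AE_restrict_space_iff) auto

lemma interval_sets_lebesgue: "is_interval (I :: real set) \<Longrightarrow> I \<in> sets lebesgue"
  by (simp add: real_interval_borel_measurable)

text \<open>Joint measurability is assumed for the completed measure on space-time. A Borel function
  agrees with \<phi> almost everywhere there, hence, for almost every time, at almost every point;
  its integral over y is measurable in time by Fubini's theorem.\<close>

lemma tempered_integral_measurable:
  assumes IB: "I \<in> sets borel" and \<phi>: "tempered_on I \<phi>" and K: "decaying K"
  shows "(\<lambda>t. \<integral>y. \<phi> t y * K (x - y) \<partial>lebesgue) \<in> borel_measurable (lebesgue_on I)"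
proof -
  note [measurable] = decaying_measurable[OF K]
  have I: "I \<in> sets lebesgue" using IB by simp
  define \<Phi> where "\<Phi> p = (if p \<in> I \<times> UNIV then (case p of (t, x) \<Rightarrow> \<phi> t x) else 0)" for p
  have IU: "I \<times> (UNIV :: (real^3) set) \<in> sets lebesgue"
  proof -
    have "I \<times> (UNIV :: (real^3) set) \<in> sets (borel \<Otimes>\<^sub>M borel)"
      using IB by (intro pair_measureI) auto
    then have "I \<times> (UNIV :: (real^3) set) \<in> sets lborel" unfolding borel_prod by simp
    then show ?thesis by (rule sets_completionI_sets)
  qed
  have "(\<lambda>(t, x). \<phi> t x) \<in> borel_measurable (lebesgue_on (I \<times> UNIV))"
    using \<phi> by (simp add: tempered_on_def)
  then have "\<Phi> \<in> borel_measurable lebesgue"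
    unfolding \<Phi>_def using IU by (subst (asm) measurable_restrict_space_iff) auto
  from complex_completion_ex_borel[OF this]
  obtain \<Psi> where \<Psi>[measurable]: "\<Psi> \<in> borel_measurable borel" and ae: "AE p in lborel. \<Phi> p = \<Psi> p"
    by auto
  have [measurable]: "\<Psi> \<in> borel_measurable (borel \<Otimes>\<^sub>M borel)"
    using \<Psi> by (simp add: borel_prod)
  have "AE t in lborel. AE y in lborel. \<Phi> (t, y) = \<Psi> (t, y)"
    using ae unfolding lborel_prod[symmetric] by (rule lborel_pair.AE_pair)
  then have aeI: "AE t in lebesgue_on I. AE y in lborel. \<Phi> (t, y) = \<Psi> (t, y)"
    by (rule AE_lborel_imp_lebesgue_on[OF I])
  have "(\<lambda>t. cv (\<lambda>y. \<Psi> (t, y)) K x) \<in> borel_measurable borel"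
    unfolding cv_def by measurable
  then show ?thesis
  proof (rule measurable_lebesgue_on_cong_AE[OF borel_imp_lebesgue_on I])
    show "AE t in lebesgue_on I. cv (\<lambda>y. \<Psi> (t, y)) K x = (\<integral>y. \<phi> t y * K (x - y) \<partial>lebesgue)"
      using aeI AE_space
    proof eventually_elim
      case (elim t)
      then have t: "t \<in> I" by simp
      have "AE y in lborel. \<phi> t y = \<Psi> (t, y)" using elim(1) t by (simp add: \<Phi>_def)
      then show ?case
        by (rule lebesgue_integral_eq_cv[OF _ K, symmetric])
           (use \<phi> t in \<open>auto simp: tempered_on_def tempered_def\<close>)
    qed
  qed
qed

text \<open>Caratheodory's condition.\<close>

definition Car :: "real set \<Rightarrow> (real \<Rightarrow> real^3 \<Rightarrow> complex) \<Rightarrow> bool" where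
  "Car I f \<longleftrightarrow> (\<forall>x. (\<lambda>t. f t x) \<in> borel_measurable (lebesgue_on I)) \<and>
     (AE t in lebesgue_on I. continuous_on UNIV (f t))"

text \<open>Lattice points of mesh 1 / (n + 1), a countable set to which continuity in x reduces
  suprema and joint measurability; \<open>gridix\<close> rounds x down to the lattice.\<close>

definition gridpt :: "nat \<Rightarrow> int \<times> int \<times> int \<Rightarrow> real^3" where
  "gridpt n i = (\<chi> c. of_int (if c = 1 then fst i else if c = 2 then fst (snd i) else snd (snd i)) / real (Suc n))"

definition gridix :: "nat \<Rightarrow> real^3 \<Rightarrow> int \<times> int \<times> int" where
  "gridix n x = (\<lfloor>real (Suc n) * x $ 1\<rfloor>, \<lfloor>real (Suc n) * x $ 2\<rfloor>, \<lfloor>real (Suc n) * x $ 3\<rfloor>)"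

lemma gridpt_tendsto: "(\<lambda>n. gridpt n (gridix n x)) \<longlonglongrightarrow> x"
proof (rule vec_tendstoI)
  fix c :: 3
  have lim: "(\<lambda>n. of_int \<lfloor>real (Suc n) * y\<rfloor> / real (Suc n)) \<longlonglongrightarrow> y" for y :: real
  proof (rule tendsto_sandwich)
    have "(\<lambda>n. 1 / real (Suc n)) \<longlonglongrightarrow> 0" by (rule LIMSEQ_Suc) (rule lim_1_over_n)
    from tendsto_diff[OF tendsto_const[of y] this] show "(\<lambda>n. y - 1 / real (Suc n)) \<longlonglongrightarrow> y" by simp
    show "\<forall>\<^sub>F n in sequentially. y - 1 / real (Suc n) \<le> of_int \<lfloor>real (Suc n) * y\<rfloor> / real (Suc n)"
    proof (intro always_eventually allI)
      fix n
      have "real (Suc n) * y - 1 \<le> of_int \<lfloor>real (Suc n) * y\<rfloor>" by linarith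
      then have "(real (Suc n) * y - 1) / real (Suc n) \<le> of_int \<lfloor>real (Suc n) * y\<rfloor> / real (Suc n)"
        by (intro divide_right_mono) auto
      then show "y - 1 / real (Suc n) \<le> of_int \<lfloor>real (Suc n) * y\<rfloor> / real (Suc n)"
        by (simp add: diff_divide_distrib del: of_nat_Suc)
    qed
    show "\<forall>\<^sub>F n in sequentially. of_int \<lfloor>real (Suc n) * y\<rfloor> / real (Suc n) \<le> y"
      by (intro always_eventually allI) (simp add: pos_divide_le_eq mult.commute[of y] del: of_nat_Suc)
  qed simp
  show "(\<lambda>n. gridpt n (gridix n x) $ c) \<longlonglongrightarrow> x $ c"
    using lim[of "x $ c"] exhaust_3[of c] by (auto simp: gridpt_def gridix_def)
qed

text \<open>Rounding x to the lattice gives functions that see x only through countably many values,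
  hence jointly measurable ones; they converge by continuity in x.\<close>

lemma continuous_joint_measurable:
  fixes f :: "'a \<Rightarrow> real^3 \<Rightarrow> complex"
  assumes [measurable]: "\<And>x. (\<lambda>t. f t x) \<in> borel_measurable M" and c: "\<And>t. t \<in> space M \<Longrightarrow> continuous_on UNIV (f t)"
  shows "(\<lambda>(t, x). f t x) \<in> borel_measurable (M \<Otimes>\<^sub>M borel)"
proof (rule borel_measurable_LIMSEQ_metric)
  fix n
  have [measurable]: "gridix n \<in> measurable borel (count_space UNIV)"
  proof -
    have "(\<lambda>x::real^3. \<lfloor>real (Suc n) * x $ c\<rfloor>) \<in> measurable borel (count_space UNIV)" for c
      by measurable
    then have "gridix n \<in> measurable borel (count_space UNIV \<Otimes>\<^sub>M (count_space UNIV \<Otimes>\<^sub>M count_space UNIV))"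
      unfolding gridix_def by (intro measurable_Pair)
    then show ?thesis by (simp add: pair_measure_countable)
  qed
  show "(\<lambda>p. f (fst p) (gridpt n (gridix n (snd p)))) \<in> borel_measurable (M \<Otimes>\<^sub>M borel)"
    by (rule measurable_compose_countable[of "\<lambda>i p. f (fst p) (gridpt n i)" _ _ "\<lambda>p. gridix n (snd p)"]) measurable
next
  fix p assume "p \<in> space (M \<Otimes>\<^sub>M (borel :: (real^3) measure))"
  then have "continuous_on UNIV (f (fst p))" by (intro c) (auto simp: space_pair_measure)
  then show "(\<lambda>n. f (fst p) (gridpt n (gridix n (snd p)))) \<longlonglongrightarrow> (case p of (t, x) \<Rightarrow> f t x)"
    using continuous_on_tendsto_compose[of UNIV "f (fst p)", OF _ gridpt_tendsto[of "snd p"]]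
    by (auto simp: case_prod_beta)
qed

text \<open>A closed set of full Lebesgue measure is the whole space.\<close>

lemma continuous_le_AE:
  fixes h :: "real^3 \<Rightarrow> complex"
  assumes h: "continuous_on UNIV h" and ae: "AE x in lebesgue. nv h x \<le> c"
  shows "nv h x \<le> c"
proof (cases c)
  case (real r)
  have "closed {x. norm (h x) \<le> r}"
    by (intro closed_Collect_le continuous_intros h)
  moreover have "AE x in lebesgue. x \<in> {x. norm (h x) \<le> r}"
    using ae real by simp
  ultimately have "x \<in> {x. norm (h x) \<le> r}" by (rule mem_closed_if_AE_lebesgue)
  then show ?thesis using real by (simp add: ennreal_leI)
qed simp

lemma nv_le_esssup:
  assumes "continuous_on UNIV h" shows "nv h x \<le> Lp_norm \<infinity> lebesgue (nv h)"
  unfolding Lp_norm_def by (simp, rule continuous_le_AE[OF assms esssup_AE])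

text \<open>Continuity turns the essential supremum into a supremum over countably many points,
  which preserves measurability in time.\<close>

lemma esssup_eq_SUP_grid:
  assumes h: "continuous_on UNIV h"
  shows "Lp_norm \<infinity> lebesgue (nv h) = (SUP ni. nv h (gridpt (fst ni) (snd ni)))"
proof (rule antisym)
  have m: "nv h \<in> borel_measurable lebesgue"
    using borel_measurable_continuous_onI[OF h] by (intro measurable_completion) simp
  have "nv h x \<le> (SUP ni. nv h (gridpt (fst ni) (snd ni)))" for x
  proof (rule LIMSEQ_le_const2)
    show "(\<lambda>n. nv h (gridpt n (gridix n x))) \<longlonglongrightarrow> nv h x"
      using continuous_on_tendsto_compose[of UNIV h, OF h gridpt_tendsto[of x]]
      by (intro tendsto_ennrealI tendsto_norm) auto
    show "\<exists>N. \<forall>n\<ge>N. nv h (gridpt n (gridix n x)) \<le> (SUP ni. nv h (gridpt (fst ni) (snd ni)))"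
      by (intro exI[of _ 0] allI impI SUP_upper2[of "(_, _)"]) auto
  qed
  then show "Lp_norm \<infinity> lebesgue (nv h) \<le> (SUP ni. nv h (gridpt (fst ni) (snd ni)))"
    unfolding Lp_norm_def using m by (simp add: esssup_I)
  show "(SUP ni. nv h (gridpt (fst ni) (snd ni))) \<le> Lp_norm \<infinity> lebesgue (nv h)"
    by (intro SUP_least nv_le_esssup h)
qed

lemma Car_norm_measurable:
  assumes I: "I \<in> sets lebesgue" and f: "Car I f" and q: "q = \<infinity> \<or> (\<exists>q'>0. q = ennreal q')"
  shows "(\<lambda>t. Lp_norm q lebesgue (nv (f t))) \<in> borel_measurable (lebesgue_on I)"
proof -
  obtain N where N: "N \<in> null_sets (lebesgue_on I)" "{t \<in> space (lebesgue_on I). \<not> continuous_on UNIV (f t)} \<subseteq> N"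
    using f by (auto simp: Car_def eventually_ae_filter)
  \<comment> \<open>On the null set \<open>N\<close>, which contains all times where continuity in x
    fails, the function is replaced by 0, so that continuity holds at every time.\<close>
  define h where "h t = (if t \<in> N then (\<lambda>x. 0) else f t)" for t
  have hc: "continuous_on UNIV (h t)" if "t \<in> space (lebesgue_on I)" for t
    using N(2) that by (auto simp: h_def)
  have [measurable]: "(\<lambda>t. f t x) \<in> borel_measurable (lebesgue_on I)" for x
    using f by (simp add: Car_def)
  have [measurable]: "N \<in> sets (lebesgue_on I)" using N(1) by auto
  have "(\<lambda>t. if t \<in> N then 0 else f t x) \<in> borel_measurable (lebesgue_on I)" for x by measurable
  then have hm [measurable]: "(\<lambda>t. h t x) \<in> borel_measurable (lebesgue_on I)" for x
    by (simp add: h_def if_distrib[of "\<lambda>f. f x"] cong: if_cong)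
  have "(\<lambda>t. Lp_norm q lebesgue (nv (h t))) \<in> borel_measurable (lebesgue_on I)"
  proof (cases "q = \<infinity>")
    case True
    have "(\<lambda>t. SUP ni. nv (h t) (gridpt (fst ni) (snd ni))) \<in> borel_measurable (lebesgue_on I)"
      by measurable
    then show ?thesis
      unfolding True by (rule measurable_cong[THEN iffD1, rotated]) (rule esssup_eq_SUP_grid[OF hc, symmetric])
  next
    case False
    then obtain q' where q': "q' > 0" "q = ennreal q'" using q by auto
    have [measurable]: "(\<lambda>(t, x). h t x) \<in> borel_measurable (lebesgue_on I \<Otimes>\<^sub>M lborel)"
      using continuous_joint_measurable[OF hm hc] by (simp cong: measurable_cong_sets)
    show ?thesis
      unfolding q'(2) Lp_norm_lebesgue[OF q'(1)] by measurable
  qed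
  then show ?thesis
  proof (rule measurable_lebesgue_on_cong_AE[OF _ I])
    have "AE t in lebesgue_on I. t \<notin> N" by (rule AE_not_in[OF N(1)])
    then show "AE t in lebesgue_on I. Lp_norm q lebesgue (nv (h t)) = Lp_norm q lebesgue (nv (f t))"
      by eventually_elim (simp add: h_def)
  qed
qed

text \<open>The derivative is the limit of forward quotients with steps 1 / (n + 1), computed with a
  Borel representative k of h. For almost every t neither t nor any t + 1 / (n + 1) lies in the
  exceptional null set, and t is interior to I, so eventually the quotients of h and k
  agree.\<close>

lemma measurable_time_derivative:
  fixes h :: "real \<Rightarrow> complex"
  assumes I: "is_interval I" and h: "h \<in> borel_measurable (lebesgue_on I)"
    and diff: "AE t in lebesgue_on I. h differentiable (at t)"
  shows "(\<lambda>t. vector_derivative h (at t)) \<in> borel_measurable (lebesgue_on I)"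
proof -
  have Is: "I \<in> sets lebesgue" by (rule interval_sets_lebesgue[OF I])
  have "(\<lambda>t. if t \<in> I then h t else 0) \<in> borel_measurable lebesgue"
    using h Is by (subst (asm) measurable_restrict_space_iff) auto
  from complex_completion_ex_borel[OF this]
  obtain k where [measurable]: "k \<in> borel_measurable borel" and ae: "AE t in lborel. (if t \<in> I then h t else 0) = k t"
    by auto
  obtain N where N: "N \<in> null_sets lborel" "{t. (if t \<in> I then h t else 0) \<noteq> k t} \<subseteq> N"
    using ae by (auto simp: eventually_ae_filter)
  have [measurable]: "N \<in> sets borel" using N(1) by auto
  have "AE t in lborel. t + 1 / real (Suc n) \<notin> N" for n
  proof -
    have "AE t in lborel. 1 / real (Suc n) + 1 * t \<notin> N"
      by (rule AE_borel_affine) (use AE_not_in[OF N(1)] in auto)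
    then show ?thesis by (simp add: add.commute)
  qed
  then have a1: "AE t in lborel. \<forall>n. t + 1 / real (Suc n) \<notin> N" by (simp add: AE_all_countable)
  have a2: "AE t in lborel. t \<notin> N" by (rule AE_not_in[OF N(1)])
  have "negligible (frontier I)" using I by (simp add: negligible_convex_frontier is_interval_convex)
  then have a3: "AE t in lebesgue_on I. t \<notin> frontier I"
    using Is by (subst AE_restrict_space_iff) (auto simp: negligible_iff_null_sets dest: AE_not_in)
  let ?d = "\<lambda>n t. (k (t + 1 / real (Suc n)) - k t) /\<^sub>R (1 / real (Suc n))"
  have "(\<lambda>t. lim (\<lambda>n. ?d n t)) \<in> borel_measurable borel" by measurable
  then show ?thesis
  proof (rule measurable_lebesgue_on_cong_AE[OF borel_imp_lebesgue_on Is])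
    show "AE t in lebesgue_on I. lim (\<lambda>n. ?d n t) = vector_derivative h (at t)"
      using AE_lborel_imp_lebesgue_on[OF Is a1] AE_lborel_imp_lebesgue_on[OF Is a2] a3 diff AE_space
    proof eventually_elim
      case (elim t)
      then have t: "t \<in> interior I" by (auto simp: frontier_def closure_subset[THEN subsetD])
      have "(h has_vector_derivative vector_derivative h (at t)) (at t)"
        using elim(4) by (simp add: vector_derivative_works)
      moreover have s: "((\<lambda>r. t + r) has_vector_derivative 1) (at (0::real))"
        by (auto intro!: derivative_eq_intros)
      ultimately have "((\<lambda>r. h (t + r)) has_vector_derivative vector_derivative h (at t)) (at 0)"
        using vector_diff_chain_at[OF s, of h "vector_derivative h (at t)"] by (simp add: comp_def)
      then have lim: "((\<lambda>r. (h (t + r) - h t) /\<^sub>R r) \<longlongrightarrow> vector_derivative h (at t)) (at 0)"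
        by (simp add: has_vector_derivative_0_iff)
      have z: "(\<lambda>n. 1 / real (Suc n)) \<longlonglongrightarrow> 0" by (rule LIMSEQ_Suc) (rule lim_1_over_n)
      then have "filterlim (\<lambda>n. 1 / real (Suc n)) (at 0) sequentially"
        by (intro filterlim_atI) auto
      from filterlim_compose[OF lim this]
      have l1: "(\<lambda>n. (h (t + 1 / real (Suc n)) - h t) /\<^sub>R (1 / real (Suc n))) \<longlonglongrightarrow> vector_derivative h (at t)" .
      have "(\<lambda>n. t + 1 / real (Suc n)) \<longlonglongrightarrow> t" using tendsto_add[OF tendsto_const[of t] z] by simp
      then have "\<forall>\<^sub>F n in sequentially. t + 1 / real (Suc n) \<in> interior I"
        using t by (rule topological_tendstoD[OF _ open_interior])
      then have "\<forall>\<^sub>F n in sequentially. (h (t + 1 / real (Suc n)) - h t) /\<^sub>R (1 / real (Suc n)) = ?d n t"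
      proof eventually_elim
        case (elim n)
        then have "t + 1 / real (Suc n) \<in> I" using interior_subset by blast
        moreover have "t + 1 / real (Suc n) \<notin> N" "t \<notin> N" "t \<in> I" using \<open>\<forall>n. t + 1 / real (Suc n) \<notin> N\<close> \<open>t \<notin> N\<close> t interior_subset by auto
        ultimately have "h (t + 1 / real (Suc n)) = k (t + 1 / real (Suc n))" "h t = k t"
          using N(2) by (smt (verit) mem_Collect_eq subsetD)+
        then show ?case by simp
      qed
      then have "(\<lambda>n. ?d n t) \<longlonglongrightarrow> vector_derivative h (at t)" by (rule Lim_transform_eventually[OF l1])
      then show ?case by (rule limI)
    qed
  qed
qed

context LP
begin

section \<open>Measurability of the pieces and of their derivatives\<close>

lemma piece_localized1:
  assumes "tempered_on I \<phi>" "t \<in> I" shows "localized1 (2 powi (- k)) (LP_piece chi k \<phi> t)"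
  unfolding LP_piece_def using assms by (intro LP_proj_props) (simp add: tempered_on_def)

lemma Car_piece:
  assumes I: "I \<in> sets borel" and \<phi>: "tempered_on I \<phi>"
  shows "Car I (LP_piece chi k \<phi>)" "Car I (dx b (LP_piece chi k \<phi>))"
proof -
  have "continuous_on UNIV (LP_piece chi k \<phi> t)" "continuous_on UNIV (dx b (LP_piece chi k \<phi>) t)" if "t \<in> I" for t
    using piece_localized1[OF \<phi> that, of k] unfolding localized1_def localized_def dx_def[abs_def] by blast+
  then have "AE t in lebesgue_on I. continuous_on UNIV (LP_piece chi k \<phi> t)" "AE t in lebesgue_on I. continuous_on UNIV (dx b (LP_piece chi k \<phi>) t)"
    by (auto intro!: AE_I2)
  moreover have "(\<lambda>t. LP_piece chi k \<phi> t x) \<in> borel_measurable (lebesgue_on I)" for x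
    unfolding LP_piece_def LP_proj_eq_lebesgue by (rule tempered_integral_measurable[OF I \<phi> LPk_decaying(1)])
  moreover have "(\<lambda>t. dx b (LP_piece chi k \<phi>) t x) \<in> borel_measurable (lebesgue_on I)" for x
    using tempered_integral_measurable[OF I \<phi> LPk_decaying(2)[of k b], of x]
  proof (rule measurable_cong[THEN iffD1, rotated])
    fix t assume "t \<in> space (lebesgue_on I)"
    then have "tempered (\<phi> t)" using \<phi> by (simp add: tempered_on_def)
    then show "(\<integral>y. \<phi> t y * dLPk k b (x - y) \<partial>lebesgue) = dx b (LP_piece chi k \<phi>) t x"
      by (simp add: dx_def LP_piece_def LP_proj_props(2))
  qed
  ultimately show "Car I (LP_piece chi k \<phi>)" "Car I (dx b (LP_piece chi k \<phi>))"
    unfolding Car_def by blast+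
qed

lemma Car_dt:
  assumes I: "is_interval I" and u: "Car I u" and reg: "time_regular I u"
  shows "Car I (dt u)"
  unfolding Car_def
proof (intro conjI allI)
  fix x
  have "AE t in lebesgue_on I. (\<lambda>s. u s x) differentiable (at t)"
    using reg unfolding time_regular_def by eventually_elim blast
  then show "(\<lambda>t. dt u t x) \<in> borel_measurable (lebesgue_on I)"
    unfolding dt_def using u by (intro measurable_time_derivative I) (auto simp: Car_def)
next
  show "AE t in lebesgue_on I. continuous_on UNIV (dt u t)"
    using reg unfolding time_regular_def
    by eventually_elim (simp add: continuous_at_imp_continuous_on differentiable_imp_continuous_within)
qed

end

lemma Car_boost:
  assumes "Car I (dt u)" "Car I (dx n u)" shows "Car I (boost n u)"
proof -
  have [measurable]: "(\<lambda>t. dt u t x) \<in> borel_measurable (lebesgue_on I)" "(\<lambda>t. dx n u t x) \<in> borel_measurable (lebesgue_on I)" for x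
    using assms by (auto simp: Car_def)
  have [measurable]: "(\<lambda>t::real. t) \<in> borel_measurable (lebesgue_on I)"
    by (rule borel_imp_lebesgue_on) simp
  have "AE t in lebesgue_on I. continuous_on UNIV (dt u t)" "AE t in lebesgue_on I. continuous_on UNIV (dx n u t)"
    using assms by (auto simp: Car_def)
  then have "AE t in lebesgue_on I. continuous_on UNIV (boost n u t)"
    by eventually_elim (auto simp: boost_def[abs_def] intro!: continuous_intros)
  moreover have "(\<lambda>t. boost n u t x) \<in> borel_measurable (lebesgue_on I)" for x
    unfolding boost_def by measurable
  ultimately show ?thesis unfolding Car_def by blast
qed

lemma Car_Omega:
  assumes "Car I (dx a u)" "Car I (dx b u)" shows "Car I (Omega a b u)"
proof -
  have [measurable]: "(\<lambda>t. dx a u t x) \<in> borel_measurable (lebesgue_on I)" "(\<lambda>t. dx b u t x) \<in> borel_measurable (lebesgue_on I)" for x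
    using assms by (auto simp: Car_def)
  have "AE t in lebesgue_on I. continuous_on UNIV (dx a u t)" "AE t in lebesgue_on I. continuous_on UNIV (dx b u t)"
    using assms by (auto simp: Car_def)
  then have "AE t in lebesgue_on I. continuous_on UNIV (Omega a b u t)"
    by eventually_elim (auto simp: Omega_def[abs_def] intro!: continuous_intros)
  moreover have "(\<lambda>t. Omega a b u t x) \<in> borel_measurable (lebesgue_on I)" for x
    unfolding Omega_def by measurable
  ultimately show ?thesis unfolding Car_def by blast
qed

section \<open>The estimates at a fixed time\<close>

text \<open>The outer decay \<open>(b / \<bar>x\<bar>)\<^sup>1\<^sup>/\<^sup>1\<^sup>0\<close> at the splitting radius \<open>b T\<^sup>1\<^sup>/\<^sup>2\<close>; the inner gain \<open>T\<^sup>-\<^sup>1\<^sup>/\<^sup>2\<close> is better.\<close>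

definition gdec :: "real \<Rightarrow> real" where
  "gdec T = (if T < 1 then 1 else T powr (- 1 / 20))"

lemma gdec_nonneg: "0 \<le> gdec T"
  by (simp add: gdec_def)

lemma powr_minus_half:
  assumes "0 \<le> (T::real)" shows "T powr (- 1 / 2) = 1 / sqrt T"
proof -
  have "T powr (- 1 / 2) = T powr (- (1 / 2))" by (simp only: minus_divide_left)
  also have "\<dots> = inverse (T powr (1 / 2))" by (rule powr_minus)
  also have "\<dots> = 1 / sqrt T" by (simp only: powr_half_sqrt[OF assms] inverse_eq_divide)
  finally show ?thesis .
qed

lemma gdec_ge:
  assumes "1 \<le> T" shows "1 / sqrt T \<le> gdec T" "1 / T \<le> 1 / sqrt T"
proof -
  have "1 / sqrt T = T powr (- 1 / 2)"
    using assms by (intro powr_minus_half[symmetric]) simp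
  also have "\<dots> \<le> T powr (- 1 / 20)" using assms by (intro powr_mono) auto
  finally show "1 / sqrt T \<le> gdec T" using assms by (simp add: gdec_def)
  have "sqrt T * 1 \<le> sqrt T * sqrt T" using assms by (intro mult_left_mono) auto
  then show "1 / T \<le> 1 / sqrt T" using assms by (intro divide_left_mono) auto
qed

text \<open>The part of A, or of its analogue for another factor, that contains the boosts
  \<open>B n\<close> and the time derivative v', before a norm is taken. With a = 2^(-m) and b =
  2^(-j) the weight c = a / b is 2^(j-m).\<close>

definition Lfun :: "real \<Rightarrow> real \<Rightarrow> (3 \<Rightarrow> real^3 \<Rightarrow> complex) \<Rightarrow> (real^3 \<Rightarrow> complex) \<Rightarrow> real^3 \<Rightarrow> ennreal" where
  "Lfun c a B v' y = ennreal c * (\<Sum>n\<in>UNIV. nv (B n) y) + ennreal a * nv v' y"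

lemma Lq_Lfun_le:
  assumes [measurable]: "\<And>n. B n \<in> borel_measurable borel" "v' \<in> borel_measurable borel" and p: "1 \<le> p"
  shows "Lq p (Lfun c a B v') \<le> 64 * (ennreal c * (\<Sum>n\<in>UNIV. Lq p (nv (B n))) + ennreal a * Lq p (nv v'))"
proof -
  have "Lq p (Lfun c a B v') \<le> 4 * (Lq p (\<lambda>y. ennreal c * (\<Sum>n\<in>UNIV. nv (B n) y)) + Lq p (\<lambda>y. ennreal a * nv v' y))"
    unfolding Lfun_def by (rule LM_add_le) (use p in auto)
  also have "\<dots> = 4 * (ennreal c * Lq p (\<lambda>y. \<Sum>n\<in>UNIV. nv (B n) y) + ennreal a * Lq p (nv v'))"
    using p by (subst (1 2) LM_cmult) auto
  also have "\<dots> \<le> 4 * (ennreal c * (16 * (\<Sum>n\<in>UNIV. Lq p (nv (B n)))) + 16 * (ennreal a * Lq p (nv v')))"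
  proof (intro mult_left_mono add_mono LM_sum3_le p)
    have "1 * (ennreal a * Lq p (nv v')) \<le> 16 * (ennreal a * Lq p (nv v'))" by (rule mult_right_mono) auto
    then show "ennreal a * Lq p (nv v') \<le> 16 * (ennreal a * Lq p (nv v'))" by simp
  qed auto
  also have "\<dots> = 64 * (ennreal c * (\<Sum>n\<in>UNIV. Lq p (nv (B n))) + ennreal a * Lq p (nv v'))"
    by (simp add: distrib_left mult.assoc[symmetric]) (simp add: mult.assoc mult.left_commute mult.commute)
  finally show ?thesis .
qed

context LP
begin

text \<open>The boosts give t \<nabla>v = B - x v'. For |x| <= R = b T^(1/2) the weights a / |t| and
  a (R + a) / |t| are, up to multiples of \<kappa>, at most T^(-1) a / b and T^(-1/2) a. The number
  \<kappa> stands for the implicit constant in the comparison of frequencies: the scale a exceeds b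
  at most by this factor.\<close>

lemma inner_time_bound:
  obtains C where "C \<ge> 0"
    "\<And>a b \<kappa> t v v' B x. \<lbrakk>localized1 a v; a \<le> \<kappa> * b; b > 0; 1 \<le> \<kappa>; continuous_on UNIV v'; \<And>n. continuous_on UNIV (B n);
       1 \<le> \<bar>t\<bar> / b; norm x \<le> b * sqrt (\<bar>t\<bar> / b); \<And>n y. B n y = y $ n *\<^sub>R v' y + t *\<^sub>R partial n v y\<rbrakk> \<Longrightarrow>
     nv v x \<le> ennreal (C * (\<kappa> * gdec (\<bar>t\<bar> / b))) * smear a (Lfun (a / b) a B v') x"
proof -
  obtain C where C: "C \<ge> 0"
    "\<And>a v x R P Q. \<lbrakk>localized1 a v; P \<in> borel_measurable borel; Q \<in> borel_measurable borel; norm x \<le> R;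
       \<And>y. ennreal (\<Sum>b\<in>UNIV. norm (partial b v y)) \<le> P y + ennreal (norm y) * Q y\<rbrakk> \<Longrightarrow>
     nv v x \<le> ennreal C * smear a (\<lambda>y. ennreal a * P y + ennreal (a * (R + a)) * Q y) x"
    by (rule inner_region_bound) (erule that, blast)
  show ?thesis
  proof (rule that[of "6 * C"])
    fix a b \<kappa> t v v' B and x :: "real^3"
    assume v: "localized1 a v" and ab: "a \<le> \<kappa> * b" and b: "b > 0" and \<kappa>: "1 \<le> \<kappa>"
      and c: "continuous_on UNIV v'" "\<And>n. continuous_on UNIV (B n)"
      and T1: "1 \<le> \<bar>t\<bar> / b" and x: "norm x \<le> b * sqrt (\<bar>t\<bar> / b)"
      and B: "\<And>n y. B n y = y $ n *\<^sub>R v' y + t *\<^sub>R partial n v y"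
    have a: "a > 0" using v by (simp add: localized1_def localized_def)
    have [measurable]: "v' \<in> borel_measurable borel" "B n \<in> borel_measurable borel" for n
      using c by (auto intro: borel_measurable_continuous_onI)
    define T where "T = \<bar>t\<bar> / b"
    have t: "\<bar>t\<bar> = b * T" "T \<ge> 1" using b T1 by (simp_all add: T_def)
    have t0: "\<bar>t\<bar> > 0" using t b by simp
    have g: "1 / sqrt T \<le> gdec T" "1 / T \<le> 1 / sqrt T" using gdec_ge[OF t(2)] .
    define R where "R = b * sqrt T"
    define P where "P y = ennreal (1 / \<bar>t\<bar>) * (\<Sum>n\<in>UNIV. nv (B n) y)" for y
    \<comment> \<open>The 3 counts the coordinates over which the bound |y| |v'| / |t| is
      summed.\<close>
    define Q where "Q y = ennreal (3 / \<bar>t\<bar>) * nv v' y" for y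
    have [measurable]: "P \<in> borel_measurable borel" "Q \<in> borel_measurable borel" unfolding P_def Q_def by measurable
    have PQ: "ennreal (\<Sum>n\<in>UNIV. norm (partial n v y)) \<le> P y + ennreal (norm y) * Q y" for y
    proof -
      have "norm (partial n v y) \<le> 1 / \<bar>t\<bar> * norm (B n y) + norm y * (1 / \<bar>t\<bar> * norm (v' y))" for n
      proof -
        have "\<bar>t\<bar> * norm (partial n v y) = norm (B n y - y $ n *\<^sub>R v' y)" unfolding B by simp
        also have "\<dots> \<le> norm (B n y) + norm y * norm (v' y)"
          by (rule order_trans[OF norm_triangle_ineq4]) (auto intro!: mult_right_mono component_le_norm_cart)
        finally show ?thesis using t0 by (simp add: field_simps)
      qed
      then have "(\<Sum>n\<in>UNIV. norm (partial n v y)) \<le> (\<Sum>n\<in>(UNIV::3 set). 1 / \<bar>t\<bar> * norm (B n y) + norm y * (1 / \<bar>t\<bar> * norm (v' y)))"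
        by (rule sum_mono)
      also have "\<dots> = 1 / \<bar>t\<bar> * (\<Sum>n\<in>UNIV. norm (B n y)) + norm y * (3 / \<bar>t\<bar> * norm (v' y))"
        by (simp add: sum.distrib sum_divide_distrib)
      finally have "ennreal (\<Sum>n\<in>UNIV. norm (partial n v y)) \<le> ennreal (1 / \<bar>t\<bar> * (\<Sum>n\<in>UNIV. norm (B n y)) + norm y * (3 / \<bar>t\<bar> * norm (v' y)))"
        by (rule ennreal_leI)
      also have "\<dots> = P y + ennreal (norm y) * Q y"
        unfolding P_def Q_def
        by (subst ennreal_plus) (auto simp: ennreal_mult[symmetric] sum_nonneg sum_ennreal intro!: divide_nonneg_nonneg)
      finally show ?thesis .
    qed
    have k1: "a * (1 / \<bar>t\<bar>) \<le> 6 * (\<kappa> * gdec T) * (a / b)"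
    proof -
      have "1 / T \<le> gdec T" using g by linarith
      also have "\<dots> \<le> 6 * \<kappa> * gdec T" using \<kappa> gdec_nonneg[of T] mult_right_mono[of 1 "6 * \<kappa>" "gdec T"] by simp
      finally have "(a / b) * (1 / T) \<le> (a / b) * (6 * \<kappa> * gdec T)" using a b by (intro mult_left_mono) auto
      then show ?thesis unfolding t(1) by (simp add: mult_ac)
    qed
    \<comment> \<open>In R + a, the radius R contributes T^(-1/2) and the scale a contributes
      \<kappa> / T; each is at most \<kappa> times \<open>gdec T\<close>.\<close>
    have k2: "a * (R + a) * (3 / \<bar>t\<bar>) \<le> 6 * (\<kappa> * gdec T) * a"
    proof -
      have "(R + a) * (3 / \<bar>t\<bar>) \<le> (b * sqrt T + \<kappa> * b) * (3 / (b * T))"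
        unfolding R_def t(1) using ab b t by (intro mult_right_mono) auto
      also have "\<dots> = 3 * (sqrt T / T + \<kappa> * (1 / T))" using b t by (simp add: field_simps)
      also have "sqrt T / T = 1 / sqrt T" using t by (simp add: real_div_sqrt field_simps)
      also have "3 * (1 / sqrt T + \<kappa> * (1 / T)) \<le> 3 * (\<kappa> * gdec T + \<kappa> * gdec T)"
      proof (intro mult_left_mono add_mono)
        show "1 / sqrt T \<le> \<kappa> * gdec T"
          using g(1) \<kappa> gdec_nonneg[of T] mult_right_mono[of 1 \<kappa> "gdec T"] by linarith
      qed (use g \<kappa> in auto)
      finally have "(R + a) * (3 / \<bar>t\<bar>) \<le> 6 * (\<kappa> * gdec T)" by simp
      from mult_left_mono[OF this less_imp_le[OF a]] show ?thesis by (simp add: mult_ac)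
    qed
    have "nv v x \<le> ennreal C * smear a (\<lambda>y. ennreal a * P y + ennreal (a * (R + a)) * Q y) x"
      by (rule C(2)[OF v _ _ _ PQ]) (use x in \<open>auto simp: R_def T_def\<close>)
    also have "\<dots> \<le> ennreal C * smear a (\<lambda>y. ennreal (6 * (\<kappa> * gdec T)) * Lfun (a / b) a B v' y) x"
      unfolding smear_def
    proof (intro mult_left_mono nn_integral_mono mult_right_mono)
      fix y :: "real^3" 
      let ?z = "x - y"
      have R0: "R \<ge> 0" using b t by (simp add: R_def)
      have "ennreal a * P ?z + ennreal (a * (R + a)) * Q ?z =
          ennreal (a * (1 / \<bar>t\<bar>)) * (\<Sum>n\<in>UNIV. nv (B n) ?z) + ennreal (a * (R + a) * (3 / \<bar>t\<bar>)) * nv v' ?z"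
        unfolding P_def Q_def mult.assoc[symmetric] using a R0 t0 by (simp only: ennreal_mult mult_nonneg_nonneg divide_nonneg_nonneg less_imp_le add_nonneg_nonneg zero_le_one zero_le_numeral)
      also have "\<dots> \<le> ennreal (6 * (\<kappa> * gdec T) * (a / b)) * (\<Sum>n\<in>UNIV. nv (B n) ?z) + ennreal (6 * (\<kappa> * gdec T) * a) * nv v' ?z"
        by (intro add_mono mult_right_mono ennreal_leI k1 k2) (auto simp: sum_nonneg)
      also have "\<dots> = ennreal (6 * (\<kappa> * gdec T)) * Lfun (a / b) a B v' ?z"
      proof -
        have k: "6 * (\<kappa> * gdec T) \<ge> 0" using \<kappa> gdec_nonneg[of T] by simp
        have "ennreal (6 * (\<kappa> * gdec T) * (a / b)) = ennreal (6 * (\<kappa> * gdec T)) * ennreal (a / b)"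
          "ennreal (6 * (\<kappa> * gdec T) * a) = ennreal (6 * (\<kappa> * gdec T)) * ennreal a"
          by (rule ennreal_mult[OF k], use a b in simp)+
        then show ?thesis unfolding Lfun_def distrib_left by (simp only: mult.assoc)
      qed
      finally show "ennreal a * P ?z + ennreal (a * (R + a)) * Q ?z \<le> ennreal (6 * (\<kappa> * gdec T)) * Lfun (a / b) a B v' ?z" .
    qed auto
    also have "\<dots> = ennreal (6 * C * (\<kappa> * gdec T)) * smear a (Lfun (a / b) a B v') x"
    proof -
      have "Lfun (a / b) a B v' \<in> borel_measurable borel" unfolding Lfun_def by measurable
      then have "smear a (\<lambda>y. ennreal (6 * (\<kappa> * gdec T)) * Lfun (a / b) a B v' y) x = ennreal (6 * (\<kappa> * gdec T)) * smear a (Lfun (a / b) a B v') x"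
        by (rule smear_cmult)
      moreover have "ennreal (6 * C * (\<kappa> * gdec T)) = ennreal C * ennreal (6 * (\<kappa> * gdec T))"
        using C(1) \<kappa> gdec_nonneg[of T] by (subst ennreal_mult[symmetric]) (auto simp: mult_ac)
      ultimately show ?thesis by (simp only: mult.assoc)
    qed
    finally show "nv v x \<le> ennreal (6 * C * (\<kappa> * gdec (\<bar>t\<bar> / b))) * smear a (Lfun (a / b) a B v') x"
      unfolding T_def .
  qed (use C in simp)
qed

text \<open>Outside the splitting radius a / |x| is at most \<kappa> T^(-1/2), and the power 1/10
  from \<open>radial_decay\<close> turns this into \<open>gdec T\<close>. For T < 1 the factor
  \<open>gdec T\<close> is 1 and the first bound applies.\<close>

lemma sob_bounds:
  assumes q: "1 < q" and r: "1 < r" "r \<le> 5"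
  obtains C where "C \<ge> 0"
    "\<And>a v x. localized1 a v \<Longrightarrow> nv v x \<le> ennreal C * sob q r a v"
    "\<And>a b \<kappa> T v x. \<lbrakk>localized1 a v; a \<le> \<kappa> * b; b > 0; 1 \<le> \<kappa>; T < 1 \<or> b * sqrt T \<le> norm x\<rbrakk> \<Longrightarrow>
      nv v x \<le> ennreal (C * (\<kappa> * gdec T)) * sob q r a v"
proof -
  obtain C1 where C1: "C1 \<ge> 0"
    "\<And>a v x. localized a v \<Longrightarrow> nv v x \<le> ennreal C1 * (ennreal (a powr (- 3 / q)) * Lq q (nv v))"
    by (rule Bernstein[OF q]) (rule that)
  obtain C2 where C2: "C2 \<ge> 0"
    "\<And>s v x. localized1 s v \<Longrightarrow> x \<noteq> 0 \<Longrightarrow> nv v x \<le> ennreal (C2 * (s / norm x) powr (1 / 10)) * sob q r s v"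
    by (rule radial_decay[OF q r]) (rule that)
  define C where "C = max C1 C2"
  have sobq: "ennreal (a powr (- 3 / q)) * Lq q (nv v) \<le> sob q r a v" for a v
    unfolding sob_def distrib_left by (simp add: add_increasing2 add.assoc)
  have A: "nv v x \<le> ennreal C * sob q r a v" if "localized1 a v" for a v x
  proof -
    have "nv v x \<le> ennreal C1 * (ennreal (a powr (- 3 / q)) * Lq q (nv v))"
      using that by (intro C1(2)) (simp only: localized1_def)
    also have "\<dots> \<le> ennreal C * sob q r a v" by (intro mult_mono ennreal_leI sobq) (auto simp: C_def)
    finally show ?thesis .
  qed
  show ?thesis
  proof (rule that[of C])
    show "C \<ge> 0" using C1(1) by (simp add: C_def)
    show "nv v x \<le> ennreal C * sob q r a v" if "localized1 a v" for a v x by (rule A[OF that])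
    fix a b \<kappa> T v and x :: "real^3"
    assume v: "localized1 a v" and ab: "a \<le> \<kappa> * b" and b: "b > 0" and \<kappa>: "1 \<le> \<kappa>" and T: "T < 1 \<or> b * sqrt T \<le> norm x"
    show "nv v x \<le> ennreal (C * (\<kappa> * gdec T)) * sob q r a v"
    proof (cases "T < 1")
      case True
      have "C * 1 \<le> C * (\<kappa> * gdec T)" using True \<kappa> C1(1) by (intro mult_left_mono) (auto simp: gdec_def C_def)
      then have "ennreal C * sob q r a v \<le> ennreal (C * (\<kappa> * gdec T)) * sob q r a v"
        by (intro mult_right_mono ennreal_leI) auto
      then show ?thesis using A[OF v, of x] by (rule order_trans[rotated])
    next
      case False
      then have T1: "T \<ge> 1" and x: "b * sqrt T \<le> norm x" using T by auto
      have a: "a > 0" using v by (simp add: localized1_def localized_def)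
      have bT: "b * sqrt T > 0" using b T1 by simp
      then have x0: "norm x > 0" using x by linarith
      have "a / norm x \<le> (\<kappa> * b) / (b * sqrt T)"
        using ab a bT x x0 b \<kappa> by (intro frac_le) auto
      also have "\<dots> = \<kappa> * T powr (- 1 / 2)"
        using b T1 powr_minus_half[of T] by simp
      finally have "(a / norm x) powr (1 / 10) \<le> (\<kappa> * T powr (- 1 / 2)) powr (1 / 10)"
        using a x0 by (intro powr_mono2) auto
      also have "\<dots> = \<kappa> powr (1 / 10) * T powr (- 1 / 20)"
        by (simp add: powr_mult powr_powr)
      also have "\<dots> \<le> \<kappa> powr 1 * T powr (- 1 / 20)"
        using \<kappa> by (intro mult_right_mono powr_mono) auto
      finally have le: "(a / norm x) powr (1 / 10) \<le> \<kappa> * gdec T" using \<kappa> T1 by (simp add: gdec_def)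
      have "nv v x \<le> ennreal (C2 * (a / norm x) powr (1 / 10)) * sob q r a v"
        using x0 by (intro C2(2)[OF v]) auto
      also have "\<dots> \<le> ennreal (C * (\<kappa> * gdec T)) * sob q r a v"
        using C2(1) C1(1) le by (intro mult_right_mono ennreal_leI mult_mono) (auto simp: C_def)
      finally show ?thesis .
    qed
  qed
qed

text \<open>For (1) and (2): inside the splitting radius w gains by \<open>inner_time_bound\<close>
  while f h is bounded by D; outside, f h gains by hypothesis. One pointwise bound by |w| plus an
  average covers both regions, so the integral is not cut.\<close>

lemma trilinear_L2:
  obtains C where "C \<ge> 0"
    "\<And>a b \<kappa> t w w' B f h D. \<lbrakk>localized1 a w; a \<le> \<kappa> * b; b > 0; 1 \<le> \<kappa>; continuous_on UNIV w'; \<And>n. continuous_on UNIV (B n);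
       \<And>n y. B n y = y $ n *\<^sub>R w' y + t *\<^sub>R partial n w y;
       \<And>x. nv f x * nv h x \<le> D;
       \<And>x. 1 \<le> \<bar>t\<bar> / b \<Longrightarrow> b * sqrt (\<bar>t\<bar> / b) \<le> norm x \<Longrightarrow> nv f x * nv h x \<le> ennreal (\<kappa> * gdec (\<bar>t\<bar> / b)) * D\<rbrakk> \<Longrightarrow>
     Lq 2 (nv (\<lambda>x. f x * h x * w x)) \<le> ennreal (C * (\<kappa> * gdec (\<bar>t\<bar> / b))) * D *
       (Lq 2 (nv w) + ennreal (a / b) * (\<Sum>n\<in>UNIV. Lq 2 (nv (B n))) + ennreal a * Lq 2 (nv w'))"
proof -
  obtain C where C: "C \<ge> 0"
    "\<And>a b \<kappa> t v v' B x. \<lbrakk>localized1 a v; a \<le> \<kappa> * b; b > 0; 1 \<le> \<kappa>; continuous_on UNIV v'; \<And>n. continuous_on UNIV (B n);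
       1 \<le> \<bar>t\<bar> / b; norm x \<le> b * sqrt (\<bar>t\<bar> / b); \<And>n y. B n y = y $ n *\<^sub>R v' y + t *\<^sub>R partial n v y\<rbrakk> \<Longrightarrow>
     nv v x \<le> ennreal (C * (\<kappa> * gdec (\<bar>t\<bar> / b))) * smear a (Lfun (a / b) a B v') x"
    by (rule inner_time_bound) (erule that, blast)
  obtain c where c: "c0 = ennreal c" "c \<ge> 1" by (rule c0_real)
  define C' where "C' = max 1 C"
  have C': "C' \<ge> 1" "C \<le> C'" by (auto simp: C'_def)
  show ?thesis
  \<comment> \<open>256 = 4 * 64 comes from \<open>LM_add_le\<close> and \<open>Lq_Lfun_le\<close>,
    and c from \<open>Lq_2_smear\<close>.\<close>
  proof (rule that[of "C' * (256 * c)"])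
    show "0 \<le> C' * (256 * c)" using C' c by simp
    fix a b \<kappa> t w w' B f h D
    assume w: "localized1 a w" and ab: "a \<le> \<kappa> * b" and b: "b > 0" and \<kappa>: "1 \<le> \<kappa>"
      and cont: "continuous_on UNIV w'" "\<And>n. continuous_on UNIV (B n)"
      and B: "\<And>n y. B n y = y $ n *\<^sub>R w' y + t *\<^sub>R partial n w y"
      and D: "\<And>x. nv f x * nv h x \<le> D"
        "\<And>x. 1 \<le> \<bar>t\<bar> / b \<Longrightarrow> b * sqrt (\<bar>t\<bar> / b) \<le> norm x \<Longrightarrow> nv f x * nv h x \<le> ennreal (\<kappa> * gdec (\<bar>t\<bar> / b)) * D"
    define T where "T = \<bar>t\<bar> / b"
    define k where "k = \<kappa> * gdec T"
    have k: "k \<ge> 0" using \<kappa> gdec_nonneg[of T] by (simp add: k_def)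
    have a: "a > 0" using w by (simp add: localized1_def localized_def)
    have [measurable]: "w' \<in> borel_measurable borel" "B n \<in> borel_measurable borel" "w \<in> borel_measurable borel" for n
      using cont w by (auto simp: localized1_def localized_def intro: borel_measurable_continuous_onI)
    let ?L = "Lfun (a / b) a B w'"
    have [measurable]: "?L \<in> borel_measurable borel" unfolding Lfun_def by measurable
    have pw: "nv (\<lambda>x. f x * h x * w x) x \<le> ennreal (C' * k) * D * (nv w x + smear a ?L x)" for x
    proof -
      have eq: "nv (\<lambda>x. f x * h x * w x) x = nv f x * nv h x * nv w x"
        by (simp add: norm_mult ennreal_mult)
      show ?thesis
      proof (cases "T < 1 \<or> b * sqrt T \<le> norm x")
        case True
        have "nv f x * nv h x \<le> ennreal k * D"
        proof (cases "T < 1")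
          case True
          then have "1 \<le> k" using \<kappa> by (simp add: k_def gdec_def)
          then have "1 * D \<le> ennreal k * D" by (intro mult_right_mono) (auto simp: ennreal_1[symmetric] ennreal_leI simp del: ennreal_1)
          then show ?thesis using D(1)[of x] by (simp add: order_trans)
        next
          case False
          then show ?thesis using True D(2)[of x] by (simp add: T_def k_def)
        qed
        also have "\<dots> \<le> ennreal (C' * k) * D"
          using C'(1) k by (intro mult_right_mono ennreal_leI) (auto simp: mult_le_cancel_right1)
        finally show ?thesis unfolding eq by (rule mult_mono) simp_all
      next
        case False
        then have "nv w x \<le> ennreal (C * k) * smear a ?L x"
          unfolding k_def T_def by (intro C(2)[OF w ab b \<kappa> cont _ _ B]) auto
        also have "\<dots> \<le> ennreal (C' * k) * (nv w x + smear a ?L x)"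
          using C' k by (intro mult_mono ennreal_leI mult_right_mono) auto
        finally have "nv f x * nv h x * nv w x \<le> D * (ennreal (C' * k) * (nv w x + smear a ?L x))"
          by (intro mult_mono D) auto
        then show ?thesis unfolding eq by (simp add: mult_ac)
      qed
    qed
    have "Lq 2 (nv (\<lambda>x. f x * h x * w x)) \<le> Lq 2 (\<lambda>x. ennreal (C' * k) * D * (nv w x + smear a ?L x))"
      by (rule LM_mono) (use pw in auto)
    also have "\<dots> = ennreal (C' * k) * D * Lq 2 (\<lambda>x. nv w x + smear a ?L x)"
      by (rule LM_cmult) auto
    also have "\<dots> \<le> ennreal (C' * k) * D * (4 * (Lq 2 (nv w) + c0 * (64 * (ennreal (a / b) * (\<Sum>n\<in>UNIV. Lq 2 (nv (B n))) + ennreal a * Lq 2 (nv w')))))"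
    proof (rule mult_left_mono)
      have "Lq 2 (\<lambda>x. nv w x + smear a ?L x) \<le> 4 * (Lq 2 (nv w) + Lq 2 (smear a ?L))"
        by (rule LM_add_le) auto
      also have "\<dots> \<le> 4 * (Lq 2 (nv w) + c0 * (64 * (ennreal (a / b) * (\<Sum>n\<in>UNIV. Lq 2 (nv (B n))) + ennreal a * Lq 2 (nv w'))))"
        by (intro mult_left_mono add_left_mono order_trans[OF Lq_2_smear[OF _ a]] Lq_Lfun_le) auto
      finally show "Lq 2 (\<lambda>x. nv w x + smear a ?L x) \<le> \<dots>" .
    qed simp
    also have "\<dots> \<le> ennreal (C' * k) * D * (ennreal (256 * c) * (Lq 2 (nv w) + ennreal (a / b) * (\<Sum>n\<in>UNIV. Lq 2 (nv (B n))) + ennreal a * Lq 2 (nv w')))"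
    proof (rule mult_left_mono)
      let ?S = "ennreal (a / b) * (\<Sum>n\<in>UNIV. Lq 2 (nv (B n))) + ennreal a * Lq 2 (nv w')"
      have e4: "(4::ennreal) \<le> ennreal (256 * c)"
        using c(2) ennreal_leI[of 4 "256 * c"] by simp
      have e256: "4 * (c0 * (64 * ?S)) = ennreal (256 * c) * ?S"
        unfolding c(1) using c(2) by (simp add: ennreal_mult mult_ac)
      have "4 * (Lq 2 (nv w) + c0 * (64 * ?S)) = 4 * Lq 2 (nv w) + ennreal (256 * c) * ?S"
        unfolding distrib_left[of 4] e256 ..
      also have "\<dots> \<le> ennreal (256 * c) * Lq 2 (nv w) + ennreal (256 * c) * ?S"
        by (intro add_right_mono mult_right_mono e4) simp
      finally show "4 * (Lq 2 (nv w) + c0 * (64 * ?S)) \<le> ennreal (256 * c) * (Lq 2 (nv w) + ennreal (a / b) * (\<Sum>n\<in>UNIV. Lq 2 (nv (B n))) + ennreal a * Lq 2 (nv w'))"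
        by (simp add: distrib_left add.assoc)
    qed simp
    also have "\<dots> = ennreal (C' * (256 * c) * k) * D * (Lq 2 (nv w) + ennreal (a / b) * (\<Sum>n\<in>UNIV. Lq 2 (nv (B n))) + ennreal a * Lq 2 (nv w'))"
    proof -
      have "ennreal (C' * (256 * c) * k) = ennreal (C' * k) * ennreal (256 * c)"
        using C' c k by (subst ennreal_mult[symmetric]) (auto simp: mult_ac)
      then show ?thesis by (simp only: mult_ac)
    qed
    finally show "Lq 2 (nv (\<lambda>x. f x * h x * w x)) \<le> ennreal (C' * (256 * c) * (\<kappa> * gdec (\<bar>t\<bar> / b))) * D *
       (Lq 2 (nv w) + ennreal (a / b) * (\<Sum>n\<in>UNIV. Lq 2 (nv (B n))) + ennreal a * Lq 2 (nv w'))"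
      unfolding k_def T_def .
  qed
qed

text \<open>For (3): one factor gains in both regions, outside through \<open>sob\<close>, inside
  through an average of boosts and time derivative, which \<open>smear_le_Lq\<close> bounds by L^q
  norms at the Bernstein cost a^(-3/q).\<close>

lemma pointwise_Lq:
  assumes q: "1 < q" and r: "1 < r" "r \<le> 5"
  obtains C where "C \<ge> 0"
    "\<And>a b \<kappa> t v v' B x. \<lbrakk>localized1 a v; a \<le> \<kappa> * b; b > 0; 1 \<le> \<kappa>; continuous_on UNIV v'; \<And>n. continuous_on UNIV (B n);
       \<And>n y. B n y = y $ n *\<^sub>R v' y + t *\<^sub>R partial n v y\<rbrakk> \<Longrightarrow>
     nv v x \<le> ennreal (C * (\<kappa> * gdec (\<bar>t\<bar> / b))) * (sob q r a v +
       ennreal (a powr (- 3 / q)) * (ennreal (a / b) * (\<Sum>n\<in>UNIV. Lq q (nv (B n))) + ennreal a * Lq q (nv v')))"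
proof -
  obtain C1 where C1: "C1 \<ge> 0"
    "\<And>a b \<kappa> t v v' B x. \<lbrakk>localized1 a v; a \<le> \<kappa> * b; b > 0; 1 \<le> \<kappa>; continuous_on UNIV v'; \<And>n. continuous_on UNIV (B n);
       1 \<le> \<bar>t\<bar> / b; norm x \<le> b * sqrt (\<bar>t\<bar> / b); \<And>n y. B n y = y $ n *\<^sub>R v' y + t *\<^sub>R partial n v y\<rbrakk> \<Longrightarrow>
     nv v x \<le> ennreal (C1 * (\<kappa> * gdec (\<bar>t\<bar> / b))) * smear a (Lfun (a / b) a B v') x"
    by (rule inner_time_bound) (erule that, blast)
  obtain C2 where C2: "C2 \<ge> 0"
    "\<And>a v x. localized1 a v \<Longrightarrow> nv v x \<le> ennreal C2 * sob q r a v"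
    "\<And>a b \<kappa> T v x. \<lbrakk>localized1 a v; a \<le> \<kappa> * b; b > 0; 1 \<le> \<kappa>; T < 1 \<or> b * sqrt T \<le> norm x\<rbrakk> \<Longrightarrow>
      nv v x \<le> ennreal (C2 * (\<kappa> * gdec T)) * sob q r a v"
    by (rule sob_bounds[OF q r]) (erule that, blast+)
  obtain c where c: "c0 = ennreal c" "c \<ge> 1" by (rule c0_real)
  define C where "C = C2 + C1 * (64 * c)"
  show ?thesis
  proof (rule that[of C])
    show "C \<ge> 0" using C1(1) C2(1) c(2) by (simp add: C_def)
    fix a b \<kappa> t v v' B and x :: "real^3"
    assume v: "localized1 a v" and ab: "a \<le> \<kappa> * b" and b: "b > 0" and \<kappa>: "1 \<le> \<kappa>"
      and cont: "continuous_on UNIV v'" "\<And>n. continuous_on UNIV (B n)"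
      and B: "\<And>n y. B n y = y $ n *\<^sub>R v' y + t *\<^sub>R partial n v y"
    have a: "a > 0" using v by (simp add: localized1_def localized_def)
    have [measurable]: "v' \<in> borel_measurable borel" "B n \<in> borel_measurable borel" for n
      using cont by (auto intro: borel_measurable_continuous_onI)
    define k where "k = \<kappa> * gdec (\<bar>t\<bar> / b)"
    have k: "k \<ge> 0" using \<kappa> gdec_nonneg[of "\<bar>t\<bar> / b"] by (simp add: k_def)
    let ?S = "ennreal (a / b) * (\<Sum>n\<in>UNIV. Lq q (nv (B n))) + ennreal a * Lq q (nv v')"
    show "nv v x \<le> ennreal (C * (\<kappa> * gdec (\<bar>t\<bar> / b))) * (sob q r a v + ennreal (a powr (- 3 / q)) * ?S)"
      unfolding k_def[symmetric]
    proof (cases "\<bar>t\<bar> / b < 1 \<or> b * sqrt (\<bar>t\<bar> / b) \<le> norm x")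
      case True
      have "nv v x \<le> ennreal (C2 * k) * sob q r a v"
        unfolding k_def by (rule C2(3)[OF v ab b \<kappa> True])
      also have "\<dots> \<le> ennreal (C * k) * (sob q r a v + ennreal (a powr (- 3 / q)) * ?S)"
        using C1(1) c(2) k by (intro mult_mono ennreal_leI mult_right_mono) (auto simp: C_def)
      finally show "nv v x \<le> ennreal (C * k) * (sob q r a v + ennreal (a powr (- 3 / q)) * ?S)" .
    next
      case False
      have m: "Lfun (a / b) a B v' \<in> borel_measurable borel" unfolding Lfun_def by measurable
      have "nv v x \<le> ennreal (C1 * k) * smear a (Lfun (a / b) a B v') x"
        unfolding k_def using False by (intro C1(2)[OF v ab b \<kappa> cont _ _ B]) auto
      also have "\<dots> \<le> ennreal (C1 * k) * (c0 * ennreal (a powr (- 3 / q)) * (64 * ?S))"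
        using q by (intro mult_left_mono order_trans[OF smear_le_Lq[OF m q a]] Lq_Lfun_le) auto
      also have "\<dots> = ennreal (C1 * (64 * c) * k) * (ennreal (a powr (- 3 / q)) * ?S)"
      proof -
        have "ennreal (C1 * (64 * c) * k) = ennreal (C1 * k) * (ennreal c * 64)"
          using C1(1) c(2) k by (simp add: ennreal_mult mult_ac)
        then show ?thesis unfolding c(1) by (simp only: mult_ac)
      qed
      also have "\<dots> \<le> ennreal (C * k) * (sob q r a v + ennreal (a powr (- 3 / q)) * ?S)"
        using C2(1) k by (intro mult_mono ennreal_leI mult_right_mono) (auto simp: C_def)
      finally show "nv v x \<le> ennreal (C * k) * (sob q r a v + ennreal (a powr (- 3 / q)) * ?S)" .
    qed
  qed
qed

text \<open>For (4): u gains outside through \<open>sob\<close>, and v gains inside through its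
  boosts and time derivative. Their suprema are available here, so \<open>smear_le_sup\<close>
  bounds the average without a Bernstein factor.\<close>

lemma pointwise_product:
  assumes q: "1 < q" and r: "1 < r" "r \<le> 5"
  obtains C where "C \<ge> 0"
    "\<And>a b \<kappa> t u v v' B V V' W x. \<lbrakk>localized1 b u; localized1 a v; a \<le> \<kappa> * b; 1 \<le> \<kappa>; continuous_on UNIV v'; \<And>n. continuous_on UNIV (B n);
       \<And>n y. B n y = y $ n *\<^sub>R v' y + t *\<^sub>R partial n v y;
       \<And>y. nv v y \<le> V; \<And>y. nv v' y \<le> V'; \<And>n y. nv (B n) y \<le> W n\<rbrakk> \<Longrightarrow>
     nv u x * nv v x \<le> ennreal (C * (\<kappa> * gdec (\<bar>t\<bar> / b))) * sob q r b u *
       (V + ennreal (a / b) * (\<Sum>n\<in>UNIV. W n) + ennreal a * V')"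
proof -
  obtain C1 where C1: "C1 \<ge> 0"
    "\<And>a b \<kappa> t v v' B x. \<lbrakk>localized1 a v; a \<le> \<kappa> * b; b > 0; 1 \<le> \<kappa>; continuous_on UNIV v'; \<And>n. continuous_on UNIV (B n);
       1 \<le> \<bar>t\<bar> / b; norm x \<le> b * sqrt (\<bar>t\<bar> / b); \<And>n y. B n y = y $ n *\<^sub>R v' y + t *\<^sub>R partial n v y\<rbrakk> \<Longrightarrow>
     nv v x \<le> ennreal (C1 * (\<kappa> * gdec (\<bar>t\<bar> / b))) * smear a (Lfun (a / b) a B v') x"
    by (rule inner_time_bound) (erule that, blast)
  obtain C2 where C2: "C2 \<ge> 0"
    "\<And>a v x. localized1 a v \<Longrightarrow> nv v x \<le> ennreal C2 * sob q r a v"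
    "\<And>a b \<kappa> T v x. \<lbrakk>localized1 a v; a \<le> \<kappa> * b; b > 0; 1 \<le> \<kappa>; T < 1 \<or> b * sqrt T \<le> norm x\<rbrakk> \<Longrightarrow>
      nv v x \<le> ennreal (C2 * (\<kappa> * gdec T)) * sob q r a v"
    by (rule sob_bounds[OF q r]) (erule that, blast+)
  obtain c where c: "c0 = ennreal c" "c \<ge> 1" by (rule c0_real)
  define C where "C = C2 * (1 + C1 * c)"
  show ?thesis
  proof (rule that[of C])
    show "C \<ge> 0" using C1(1) C2(1) c(2) by (simp add: C_def)
    fix a b \<kappa> t u v v' B V V' W and x :: "real^3"
    assume u: "localized1 b u" and v: "localized1 a v" and ab: "a \<le> \<kappa> * b" and \<kappa>: "1 \<le> \<kappa>"
      and cont: "continuous_on UNIV v'" "\<And>n. continuous_on UNIV (B n)"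
      and B: "\<And>n y. B n y = y $ n *\<^sub>R v' y + t *\<^sub>R partial n v y"
      and V: "\<And>y. nv v y \<le> V" "\<And>y. nv v' y \<le> V'" "\<And>n y. nv (B n) y \<le> W n"
    have a: "a > 0" using v by (simp add: localized1_def localized_def)
    have b: "b > 0" using u by (simp add: localized1_def localized_def)
    define k where "k = \<kappa> * gdec (\<bar>t\<bar> / b)"
    have k: "k \<ge> 0" using \<kappa> gdec_nonneg[of "\<bar>t\<bar> / b"] by (simp add: k_def)
    let ?S = "ennreal (a / b) * (\<Sum>n\<in>UNIV. W n) + ennreal a * V'"
    show "nv u x * nv v x \<le> ennreal (C * (\<kappa> * gdec (\<bar>t\<bar> / b))) * sob q r b u * (V + ennreal (a / b) * (\<Sum>n\<in>UNIV. W n) + ennreal a * V')"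
      unfolding k_def[symmetric] add.assoc
    proof (cases "\<bar>t\<bar> / b < 1 \<or> b * sqrt (\<bar>t\<bar> / b) \<le> norm x")
      case True
      have "nv u x \<le> ennreal (C2 * k) * sob q r b u"
        unfolding k_def by (rule C2(3)[OF u _ b \<kappa> True]) (use b \<kappa> in simp)
      also have "\<dots> \<le> ennreal (C * k) * sob q r b u"
        using C1(1) C2(1) c(2) k by (intro mult_right_mono ennreal_leI) (auto simp: C_def algebra_simps)
      finally show "nv u x * nv v x \<le> ennreal (C * k) * sob q r b u * (V + ?S)"
        by (intro mult_mono order_trans[OF V(1)]) auto
    next
      case False
      have "nv v x \<le> ennreal (C1 * k) * smear a (Lfun (a / b) a B v') x"
        unfolding k_def using False by (intro C1(2)[OF v ab b \<kappa> cont _ _ B]) auto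
      also have "\<dots> \<le> ennreal (C1 * k) * (c0 * ?S)"
      proof (intro mult_left_mono smear_le_sup a)
        show "Lfun (a / b) a B v' y \<le> ?S" for y
          unfolding Lfun_def by (intro add_mono mult_left_mono sum_mono V) simp_all
      qed simp
      finally have "nv u x * nv v x \<le> (ennreal C2 * sob q r b u) * (ennreal (C1 * k) * (c0 * ?S))"
        by (intro mult_mono C2(2)[OF u]) auto
      also have "\<dots> = ennreal (C2 * (C1 * c) * k) * sob q r b u * ?S"
      proof -
        have "ennreal (C2 * (C1 * c) * k) = ennreal C2 * (ennreal (C1 * k) * ennreal c)"
          using C1(1) C2(1) c(2) k by (simp add: ennreal_mult mult_ac)
        then show ?thesis unfolding c(1) by (simp only: mult_ac)
      qed
      also have "\<dots> \<le> ennreal (C * k) * sob q r b u * (V + ?S)"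
        using C2(1) k by (intro mult_mono ennreal_leI mult_right_mono) (auto simp: C_def algebra_simps)
      finally show "nv u x * nv v x \<le> ennreal (C * k) * sob q r b u * (V + ?S)" .
    qed
  qed
qed

end

section \<open>Norms in time\<close>

lemma sum3_le_Max:
  fixes F :: "3 \<Rightarrow> ennreal"
  shows "(\<Sum>n\<in>UNIV. F n) \<le> 3 * (MAX n. F n)"
proof -
  have "(\<Sum>n\<in>UNIV. F n) \<le> of_nat (card (UNIV :: 3 set)) * (MAX n. F n)"
    by (rule sum_bounded_above) simp
  then show ?thesis by simp
qed

text \<open>The maximum of nine functions is bounded by their sum; two applications of
  \<open>LM_sum3_le\<close> and the number of terms cost 16 * 16 * 9 = 2304.\<close>

lemma LM_Max_le:
  fixes F :: "3 \<Rightarrow> 3 \<Rightarrow> 'a \<Rightarrow> ennreal"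
  assumes [measurable]: "\<And>a b. F a b \<in> borel_measurable M" and p: "1 \<le> p"
  shows "LM M p (\<lambda>t. MAX (a, b)\<in>UNIV. F a b t) \<le> 2304 * (MAX (a, b)\<in>UNIV. LM M p (F a b))"
proof -
  have "(MAX (a, b)\<in>UNIV. F a b t) \<le> (\<Sum>a\<in>UNIV. \<Sum>b\<in>UNIV. F a b t)" for t
  proof (rule Max.boundedI)
    fix y assume "y \<in> (\<lambda>(a, b). F a b t) ` UNIV"
    then obtain a b where y: "y = F a b t" by auto
    have "F a b t \<le> (\<Sum>b\<in>UNIV. F a b t)" by (rule member_le_sum) auto
    also have "\<dots> \<le> (\<Sum>a\<in>UNIV. \<Sum>b\<in>UNIV. F a b t)"
      by (rule member_le_sum[of a UNIV "\<lambda>a. \<Sum>b\<in>UNIV. F a b t"]) (auto simp: sum_nonneg)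
    finally show "y \<le> (\<Sum>a\<in>UNIV. \<Sum>b\<in>UNIV. F a b t)" using y by simp
  qed auto
  then have "LM M p (\<lambda>t. MAX (a, b)\<in>UNIV. F a b t) \<le> LM M p (\<lambda>t. \<Sum>a\<in>UNIV. \<Sum>b\<in>UNIV. F a b t)"
    using p by (intro LM_mono) auto
  also have "\<dots> \<le> 16 * (\<Sum>a\<in>UNIV. LM M p (\<lambda>t. \<Sum>b\<in>UNIV. F a b t))"
    by (rule LM_sum3_le) (use p in auto)
  also have "\<dots> \<le> 16 * (\<Sum>a\<in>UNIV. 16 * (\<Sum>b\<in>UNIV. LM M p (F a b)))"
    by (intro mult_left_mono sum_mono LM_sum3_le p) auto
  also have "\<dots> \<le> 16 * (\<Sum>a\<in>(UNIV::3 set). 16 * (\<Sum>b\<in>(UNIV::3 set). (MAX (a, b)\<in>UNIV. LM M p (F a b))))"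
    by (intro mult_left_mono sum_mono Max_ge) (auto intro!: image_eqI[of _ _ "(_, _)"])
  also have "\<dots> = 2304 * (MAX (a, b)\<in>UNIV. LM M p (F a b))"
    by (simp add: mult.assoc[symmetric])
  finally show ?thesis .
qed

lemma mixed_norm_eq:
  assumes "0 < p"
  shows "mixed_norm I (ennreal p) e u = LM (lebesgue_on I) p (\<lambda>t. Lp_norm e lebesgue (nv (u t)))"
  unfolding mixed_norm_def using assms by (simp add: Lp_norm_ennreal)

lemma AE_le_mixed_norm_infty:
  "AE t in lebesgue_on I. Lp_norm e lebesgue (nv (u t)) \<le> mixed_norm I \<infinity> e u"
  unfolding mixed_norm_def Lp_norm_def[of \<infinity>] by (simp add: esssup_AE)

text \<open>Hoelder's inequality with exponents m and m / (m - 1), then the Cauchy-Schwarz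
  inequality for F G, since m / (m - 1) is half of 2 m / (m - 1).\<close>

lemma Hoelder_time:
  assumes [measurable]: "g \<in> borel_measurable M" "F \<in> borel_measurable M" "G \<in> borel_measurable M" and m: "1 < m"
  shows "(\<integral>\<^sup>+t. g t * (F t * G t) \<partial>M) \<le> LM M m g * (LM M (2 * m / (m - 1)) F * LM M (2 * m / (m - 1)) G)"
proof -
  let ?p = "2 * m / (m - 1)" and ?m = "m / (m - 1)"
  have "ennreal_rpow (ennreal_rpow (g t) m) (1 / m) * ennreal_rpow (ennreal_rpow (F t * G t) ?m) (1 - 1 / m) = g t * (F t * G t)" for t
  proof -
    have "?m * (1 - 1 / m) = 1" using m by (simp add: field_simps)
    then show ?thesis using m by (simp only: ennreal_rpow_rpow) simp
  qed
  then have "(\<integral>\<^sup>+t. g t * (F t * G t) \<partial>M) =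
      (\<integral>\<^sup>+t. ennreal_rpow (ennreal_rpow (g t) m) (1 / m) * ennreal_rpow (ennreal_rpow (F t * G t) ?m) (1 - 1 / m) \<partial>M)"
    by simp
  also have "\<dots> \<le> ennreal_rpow (\<integral>\<^sup>+t. ennreal_rpow (g t) m \<partial>M) (1 / m) * ennreal_rpow (\<integral>\<^sup>+t. ennreal_rpow (F t * G t) ?m \<partial>M) (1 - 1 / m)"
    by (rule nn_integral_Hoelder) (use m in auto)
  also have "(\<integral>\<^sup>+t. ennreal_rpow (F t * G t) ?m \<partial>M) =
      (\<integral>\<^sup>+t. ennreal_rpow (ennreal_rpow (F t) ?p) (1 / 2) * ennreal_rpow (ennreal_rpow (G t) ?p) (1 - 1 / 2) \<partial>M)"
  proof -
    have "?p * (1 / 2) = ?m" "?p * (1 - 1 / 2) = ?m" using m by (simp_all add: divide_simps)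
    then show ?thesis by (simp only: ennreal_rpow_rpow ennreal_rpow_mult)
  qed
  also have "ennreal_rpow (\<integral>\<^sup>+t. ennreal_rpow (g t) m \<partial>M) (1 / m) *
      ennreal_rpow (\<integral>\<^sup>+t. ennreal_rpow (ennreal_rpow (F t) ?p) (1 / 2) * ennreal_rpow (ennreal_rpow (G t) ?p) (1 - 1 / 2) \<partial>M) (1 - 1 / m)
    \<le> ennreal_rpow (\<integral>\<^sup>+t. ennreal_rpow (g t) m \<partial>M) (1 / m) *
      ennreal_rpow (ennreal_rpow (\<integral>\<^sup>+t. ennreal_rpow (F t) ?p \<partial>M) (1 / 2) * ennreal_rpow (\<integral>\<^sup>+t. ennreal_rpow (G t) ?p \<partial>M) (1 - 1 / 2)) (1 - 1 / m)"
    using m by (intro mult_left_mono ennreal_rpow_mono nn_integral_Hoelder) auto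
  also have "\<dots> = LM M m g * (LM M ?p F * LM M ?p G)"
  proof -
    have "1 / 2 * (1 - 1 / m) = 1 / ?p" "(1 - 1 / 2) * (1 - 1 / m) = 1 / ?p" using m by (auto simp: field_simps)
    then show ?thesis by (simp only: ennreal_rpow_mult ennreal_rpow_rpow)
  qed
  finally show ?thesis .
qed

lemma gdec_measurable [measurable]: "gdec \<in> borel_measurable borel"
  unfolding gdec_def by measurable

text \<open>m >= 40 makes the m-th power of \<open>gdec T\<close> at most T^(-2) for T >= 1, so it
  is dominated by 2 / (1 + T^2) everywhere. Substituting t = b T gives the factor b, whose m-th root
  remains. A constant of at least 1 exceeds its own m-th root, so it serves all m at once.\<close>

lemma gdec_integral:
  obtains J where "J \<ge> 0" "\<And>b m I. b > 0 \<Longrightarrow> 40 \<le> m \<Longrightarrow> I \<in> sets lebesgue \<Longrightarrow>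
    LM (lebesgue_on I) m (\<lambda>t. ennreal (gdec (\<bar>t\<bar> / b))) \<le> ennreal (J * b powr (1 / m))"
proof -
  have "integrable lborel (\<lambda>x::real. inverse (1 + x\<^sup>2))"
    using integrable_inverse_1_plus_square by (simp add: set_integrable_def)
  then have "integrable lborel (\<lambda>x::real. 2 * inverse (1 + x\<^sup>2))"
    by (rule integrable_mult_right)
  then have "(\<integral>\<^sup>+x. ennreal (2 * inverse (1 + x\<^sup>2)) \<partial>lborel) = ennreal (\<integral>x. 2 * inverse (1 + x\<^sup>2) \<partial>lborel)"
    by (rule nn_integral_eq_integral) simp
  then obtain J where J: "(\<integral>\<^sup>+x. ennreal (2 * inverse (1 + x\<^sup>2)) \<partial>lborel) = ennreal J" "J \<ge> 0"
    by (auto simp: integral_nonneg)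
  show ?thesis
  proof (rule that[of "max 1 J"])
    fix b m and I :: "real set" assume b: "b > (0::real)" and m: "40 \<le> (m::real)" and I: "I \<in> sets lebesgue"
    have pw: "ennreal_rpow (ennreal (gdec (\<bar>t\<bar> / b))) m \<le> ennreal (2 * inverse (1 + (t / b)\<^sup>2))" for t
    proof -
      have "gdec T powr m \<le> 2 * inverse (1 + T\<^sup>2)" if "T \<ge> 0" for T
      proof (cases "T < 1")
        case True
        then have "T\<^sup>2 \<le> 1" using that by (simp add: power_le_one)
        then have "1 \<le> 2 * inverse (1 + T\<^sup>2)" by (simp add: field_simps add_pos_nonneg)
        then show ?thesis using True by (simp add: gdec_def)
      next
        case False
        have "gdec T powr m = T powr (- m / 20)" using False by (simp add: gdec_def powr_powr)
        also have "\<dots> \<le> T powr (- 2)" using False m by (intro powr_mono) auto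
        also have "\<dots> = inverse (T\<^sup>2)" using False by (simp add: powr_minus powr_numeral)
        also have "\<dots> \<le> 2 * inverse (1 + T\<^sup>2)"
        proof -
          have "1 \<le> T\<^sup>2" using False by (simp add: one_le_power)
          moreover have "inverse y \<le> 2 * inverse (1 + y)" if "1 \<le> y" for y :: real
            using that by (simp add: field_simps)
          ultimately show ?thesis by blast
        qed
        finally show ?thesis .
      qed
      from this[of "\<bar>t\<bar> / b"] b show ?thesis
        by (simp add: ennreal_rpow_ennreal gdec_nonneg ennreal_leI power_divide)
    qed
    have "(\<integral>\<^sup>+t. ennreal_rpow (ennreal (gdec (\<bar>t\<bar> / b))) m \<partial>lebesgue_on I) \<le>
        (\<integral>\<^sup>+t. ennreal (2 * inverse (1 + (t / b)\<^sup>2)) \<partial>lebesgue_on I)"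
      by (intro nn_integral_mono pw)
    also have "\<dots> \<le> (\<integral>\<^sup>+t. ennreal (2 * inverse (1 + (t / b)\<^sup>2)) \<partial>lebesgue)"
      using I by (subst nn_integral_restrict_space) (auto intro!: nn_integral_mono simp: indicator_def)
    also have "\<dots> = (\<integral>\<^sup>+t. ennreal (2 * inverse (1 + (t / b)\<^sup>2)) \<partial>lborel)"
      by (simp add: nn_integral_completion)
    also have "\<dots> = ennreal b * (\<integral>\<^sup>+t. ennreal (2 * inverse (1 + t\<^sup>2)) \<partial>lborel)"
      by (subst nn_integral_real_affine[where c = b and t = 0]) (use b in auto)
    also have "\<dots> \<le> ennreal b * ennreal (max 1 J)" unfolding J(1) by (intro mult_left_mono ennreal_leI) auto
    finally have "LM (lebesgue_on I) m (\<lambda>t. ennreal (gdec (\<bar>t\<bar> / b))) \<le> ennreal_rpow (ennreal b * ennreal (max 1 J)) (1 / m)"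
      using m by (intro ennreal_rpow_mono) auto
    also have "\<dots> = ennreal (b powr (1 / m) * max 1 J powr (1 / m))"
      using b by (simp add: ennreal_rpow_mult ennreal_rpow_ennreal ennreal_mult)
    also have "\<dots> \<le> ennreal (max 1 J * b powr (1 / m))"
    proof (rule ennreal_leI)
      have "max 1 J powr (1 / m) \<le> max 1 J powr 1" using m by (intro powr_mono) auto
      then have "max 1 J powr (1 / m) \<le> max 1 J" by simp
      then show "b powr (1 / m) * max 1 J powr (1 / m) \<le> max 1 J * b powr (1 / m)"
        by (subst mult.commute) (rule mult_right_mono, auto)
    qed
    finally show "LM (lebesgue_on I) m (\<lambda>t. ennreal (gdec (\<bar>t\<bar> / b))) \<le> ennreal (max 1 J * b powr (1 / m))" .
  qed simp
qed

text \<open>In the applications \<open>H\<close> is the L^2 norm in space of the product, and the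
  constant \<open>A\<close> bounds the factor taken in L^\<infinity> of time.\<close>

lemma time_integral_bound:
  obtains J where "J \<ge> 0"
    "\<And>b m I H F G A k. \<lbrakk>b > 0; 40 \<le> m; I \<in> sets lebesgue; k \<ge> 0;
       F \<in> borel_measurable (lebesgue_on I); G \<in> borel_measurable (lebesgue_on I);
       AE t in lebesgue_on I. H t \<le> ennreal (k * gdec (\<bar>t\<bar> / b)) * (F t * G t) * A\<rbrakk> \<Longrightarrow>
     (\<integral>\<^sup>+t. H t \<partial>lebesgue_on I) \<le> ennreal (k * J) * ennreal (b powr (1 / m)) *
       (LM (lebesgue_on I) (2 * m / (m - 1)) F * LM (lebesgue_on I) (2 * m / (m - 1)) G) * A"
proof -
  obtain J where J: "J \<ge> 0" "\<And>b m I. b > 0 \<Longrightarrow> 40 \<le> m \<Longrightarrow> I \<in> sets lebesgue \<Longrightarrow>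
    LM (lebesgue_on I) m (\<lambda>t. ennreal (gdec (\<bar>t\<bar> / b))) \<le> ennreal (J * b powr (1 / m))"
    by (rule gdec_integral) (rule that)
  show ?thesis
  proof (rule that[OF J(1)])
    fix b m k :: real and I and H F G :: "real \<Rightarrow> ennreal" and A
    assume b: "b > 0" and m: "40 \<le> m" and I: "I \<in> sets lebesgue" and k: "k \<ge> 0"
      and [measurable]: "F \<in> borel_measurable (lebesgue_on I)" "G \<in> borel_measurable (lebesgue_on I)"
      and H: "AE t in lebesgue_on I. H t \<le> ennreal (k * gdec (\<bar>t\<bar> / b)) * (F t * G t) * A"
    let ?g = "\<lambda>t. ennreal (gdec (\<bar>t\<bar> / b))" and ?p = "2 * m / (m - 1)"
    have [measurable]: "?g \<in> borel_measurable (lebesgue_on I)"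
      by (rule borel_imp_lebesgue_on) measurable
    have "(\<integral>\<^sup>+t. H t \<partial>lebesgue_on I) \<le> (\<integral>\<^sup>+t. ennreal k * (?g t * (F t * G t)) * A \<partial>lebesgue_on I)"
      using H k by (intro nn_integral_mono_AE) (simp add: ennreal_mult gdec_nonneg mult.assoc)
    also have "\<dots> = ennreal k * (\<integral>\<^sup>+t. ?g t * (F t * G t) \<partial>lebesgue_on I) * A"
      by (simp add: nn_integral_cmult nn_integral_multc)
    also have "\<dots> \<le> ennreal k * (ennreal (J * b powr (1 / m)) * (LM (lebesgue_on I) ?p F * LM (lebesgue_on I) ?p G)) * A"
      using m by (intro mult_right_mono mult_left_mono order_trans[OF Hoelder_time[of _ _ _ _ m]] J b I) auto
    also have "\<dots> = ennreal (k * J) * ennreal (b powr (1 / m)) * (LM (lebesgue_on I) ?p F * LM (lebesgue_on I) ?p G) * A"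
      using k J(1) by (simp add: ennreal_mult mult.assoc)
    finally show "(\<integral>\<^sup>+t. H t \<partial>lebesgue_on I) \<le> ennreal (k * J) * ennreal (b powr (1 / m)) * (LM (lebesgue_on I) ?p F * LM (lebesgue_on I) ?p G) * A" .
  qed
qed

section \<open>The four estimates\<close>

lemma numeral_mult_mono:
  fixes x y :: ennreal
  assumes "(numeral m :: real) \<le> numeral n" "x \<le> y"
  shows "numeral m * x \<le> numeral n * y"
proof -
  have "(numeral m :: ennreal) \<le> numeral n"
    using ennreal_leI[OF assms(1)] by simp
  then show ?thesis using assms(2) by (intro mult_mono) auto
qed

lemma two_powi: "(2::real) powi n = 2 powr real_of_int n"
  by (simp add: powr_real_of_int')

lemma scale_ratio: "(2::real) powi (- m) / 2 powi (- j) = 2 powr real_of_int (j - m)"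
  unfolding two_powi powr_diff[symmetric] by simp

lemma mixed_norm_L2:
  "mixed_norm I 1 2 f = (\<integral>\<^sup>+t. Lq 2 (nv (f t)) \<partial>lebesgue_on I)"
  using mixed_norm_eq[of 1 I 2 f] Lp_norm_lebesgue[of 2] by (simp add: ennreal_1[symmetric] del: ennreal_1)

text \<open>The bracket with <Omega> in (1), (2) and (4), which is what \<open>sob\<close> becomes
  under the time norm; \<open>An\<close> below is the quantity A.\<close>

definition Sn :: "real set \<Rightarrow> real \<Rightarrow> int \<Rightarrow> (real \<Rightarrow> real^3 \<Rightarrow> complex) \<Rightarrow> ennreal" where
  "Sn I M k v = ennreal (2 powr (3 * real_of_int k / (2 * M))) * norm_Omega (mixed_norm I (ennreal (2 * M / (M - 1))) (ennreal (2 * M))) v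
     + ennreal (2 powr (3 * real_of_int k * (M - 1) / (4 * M))) * mixed_norm I (ennreal (2 * M / (M - 1))) (ennreal (4 * M / (M - 1))) v"

definition An :: "real set \<Rightarrow> int \<Rightarrow> int \<Rightarrow> (real \<Rightarrow> real^3 \<Rightarrow> complex) \<Rightarrow> ennreal" where
  "An I j m w = mixed_norm I \<infinity> 2 w + ennreal (2 powr real_of_int (j - m)) * norm_L (mixed_norm I \<infinity> 2) w
     + ennreal (2 powr real_of_int (- m)) * mixed_norm I \<infinity> 2 (dt w)"

lemma norm_L_ge: "N (boost n u) \<le> norm_L N u"
  unfolding norm_L_def by (rule max.coboundedI2) (auto intro!: Max_ge)

lemma Max_le_norm_L: "(MAX n. N (boost n u)) \<le> norm_L N u"
  unfolding norm_L_def by simp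

lemma norm_Omega_ge: "N u \<le> norm_Omega N u"
  unfolding norm_Omega_def by (simp add: add_increasing2)

context LP
begin

lemma piece_Car:
  assumes "is_interval I" "tempered_on I \<phi>"
  shows "Car I (LP_piece chi k \<phi>)" "Car I (Omega a b (LP_piece chi k \<phi>))"
  using Car_piece[OF real_interval_borel_measurable[OF assms(1)] assms(2)] Car_Omega by blast+

lemma piece_Car_time:
  assumes "is_interval I" "tempered_on I \<phi>" "time_regular I (LP_piece chi k \<phi>)"
  shows "Car I (dt (LP_piece chi k \<phi>))" "Car I (boost n (LP_piece chi k \<phi>))"
proof -
  note c = Car_piece[OF real_interval_borel_measurable[OF assms(1)] assms(2)]
  show d: "Car I (dt (LP_piece chi k \<phi>))" by (rule Car_dt[OF assms(1) c(1) assms(3)])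
  show "Car I (boost n (LP_piece chi k \<phi>))" by (rule Car_boost[OF d c(2)])
qed

lemma boost_eq: "boost n u t y = y $ n *\<^sub>R dt u t y + t *\<^sub>R partial n (u t) y"
  by (simp add: boost_def dx_def)

lemma Omega_eq_rotd: "Omega a b u t = rotd a b (u t)"
  by (simp add: Omega_def rotd_def dx_def fun_eq_iff)

text \<open>The time norm passes through the sum and the maximum over Omega in \<open>sob\<close> at
  a fixed cost: 4 * 2304 = 9216 is rounded up to 10000, and a further factor 4 gives 40000.\<close>

lemma sob_time:
  assumes M: "40 \<le> M" and I: "is_interval I" and \<phi>: "tempered_on I \<phi>" and v_def: "v = LP_piece chi k \<phi>"
  shows "(\<lambda>t. sob (2 * M) (4 * M / (M - 1)) (2 powi (- k)) (v t)) \<in> borel_measurable (lebesgue_on I)"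
    and "LM (lebesgue_on I) (2 * M / (M - 1)) (\<lambda>t. sob (2 * M) (4 * M / (M - 1)) (2 powi (- k)) (v t)) \<le> 40000 * Sn I M k v"
proof -
  let ?p = "2 * M / (M - 1)" and ?q = "2 * M" and ?r = "4 * M / (M - 1)"
  have p: "1 \<le> ?p" "0 < ?p" and q: "0 < ?q" and r: "0 < ?r" using M by (auto simp: field_simps)
  have Is: "I \<in> sets lebesgue" by (rule interval_sets_lebesgue[OF I])
  define c1 where "c1 = ennreal (2 powr (3 * real_of_int k / (2 * M)))"
  define c2 where "c2 = ennreal (2 powr (3 * real_of_int k * (M - 1) / (4 * M)))"
  have c1: "ennreal ((2 powi (- k)) powr (- 3 / ?q)) = c1"
    unfolding c1_def two_powi powr_powr by (simp add: mult.commute)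
  have c2: "ennreal ((2 powi (- k)) powr (- 3 / ?r)) = c2"
  proof -
    have "real_of_int (- k) * (- 3 / ?r) = 3 * real_of_int k * (M - 1) / (4 * M)"
      using M by (simp add: field_simps)
    then show ?thesis unfolding c2_def two_powi powr_powr by simp
  qed
  define V where "V t = Lp_norm (ennreal ?q) lebesgue (nv (v t))" for t
  define R where "R t = Lp_norm (ennreal ?r) lebesgue (nv (v t))" for t
  define W where "W a b t = Lp_norm (ennreal ?q) lebesgue (nv (Omega a b v t))" for a b t
  have [measurable]: "V \<in> borel_measurable (lebesgue_on I)" "R \<in> borel_measurable (lebesgue_on I)" "W a b \<in> borel_measurable (lebesgue_on I)" for a b
    unfolding V_def R_def W_def v_def
    by (intro Car_norm_measurable[OF Is] piece_Car[OF I \<phi>] disjI2; use q r in blast)+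
  have sob: "sob ?q ?r (2 powi (- k)) (v t) = c1 * (V t + (MAX (a, b)\<in>UNIV. W a b t)) + c2 * R t" for t
    unfolding sob_def c1 c2 V_def R_def W_def Omega_eq_rotd Lp_norm_lebesgue[OF q] Lp_norm_lebesgue[OF r] ..
  have [measurable]: "(\<lambda>t. MAX (a, b)\<in>UNIV. W a b t) \<in> borel_measurable (lebesgue_on I)"
  proof -
    have "(\<lambda>t. MAX ab\<in>UNIV. (case ab of (a, b) \<Rightarrow> W a b) t) \<in> borel_measurable (lebesgue_on I)"
      by (rule borel_measurable_Max) (auto split: prod.splits)
    then show ?thesis by (simp add: case_prod_beta)
  qed
  show "(\<lambda>t. sob ?q ?r (2 powi (- k)) (v t)) \<in> borel_measurable (lebesgue_on I)"
    unfolding sob by measurable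
  have mV: "LM (lebesgue_on I) ?p V = mixed_norm I (ennreal ?p) (ennreal ?q) v"
    unfolding V_def by (rule mixed_norm_eq[OF p(2), symmetric])
  have mR: "LM (lebesgue_on I) ?p R = mixed_norm I (ennreal ?p) (ennreal ?r) v"
    unfolding R_def by (rule mixed_norm_eq[OF p(2), symmetric])
  have mW: "LM (lebesgue_on I) ?p (W a b) = mixed_norm I (ennreal ?p) (ennreal ?q) (Omega a b v)" for a b
    unfolding W_def by (rule mixed_norm_eq[OF p(2), symmetric])
  have "LM (lebesgue_on I) ?p (\<lambda>t. sob ?q ?r (2 powi (- k)) (v t)) \<le>
      4 * (LM (lebesgue_on I) ?p (\<lambda>t. c1 * (V t + (MAX (a, b)\<in>UNIV. W a b t))) + LM (lebesgue_on I) ?p (\<lambda>t. c2 * R t))"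
    unfolding sob by (rule LM_add_le[OF _ _ p(1)]) measurable
  also have "\<dots> = 4 * (c1 * LM (lebesgue_on I) ?p (\<lambda>t. V t + (MAX (a, b)\<in>UNIV. W a b t)) + c2 * LM (lebesgue_on I) ?p R)"
    by (subst (1 2) LM_cmult[OF p(2)]) auto
  also have "\<dots> \<le> 4 * (c1 * (10000 * norm_Omega (mixed_norm I (ennreal ?p) (ennreal ?q)) v) + 10000 * (c2 * mixed_norm I (ennreal ?p) (ennreal ?r) v))"
  proof (intro mult_left_mono add_mono)
    have "LM (lebesgue_on I) ?p (\<lambda>t. V t + (MAX (a, b)\<in>UNIV. W a b t)) \<le>
        4 * (LM (lebesgue_on I) ?p V + LM (lebesgue_on I) ?p (\<lambda>t. MAX (a, b)\<in>UNIV. W a b t))"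
      by (rule LM_add_le[OF _ _ p(1)]) measurable
    also have "\<dots> \<le> 4 * (2304 * LM (lebesgue_on I) ?p V + 2304 * (MAX (a, b)\<in>UNIV. LM (lebesgue_on I) ?p (W a b)))"
      by (intro mult_left_mono add_mono LM_Max_le p ennreal_le_numeral_mult) auto
    also have "\<dots> = 9216 * norm_Omega (mixed_norm I (ennreal ?p) (ennreal ?q)) v"
      unfolding mV mW norm_Omega_def by (simp add: distrib_left mult.assoc[symmetric])
    also have "\<dots> \<le> 10000 * norm_Omega (mixed_norm I (ennreal ?p) (ennreal ?q)) v"
      by (intro numeral_mult_mono) auto
    finally show "LM (lebesgue_on I) ?p (\<lambda>t. V t + (MAX (a, b)\<in>UNIV. W a b t)) \<le> 10000 * norm_Omega (mixed_norm I (ennreal ?p) (ennreal ?q)) v" .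
    show "c2 * LM (lebesgue_on I) ?p R \<le> 10000 * (c2 * mixed_norm I (ennreal ?p) (ennreal ?r) v)"
      unfolding mR by (rule ennreal_le_numeral_mult)
  qed auto
  also have "\<dots> = 40000 * Sn I M k v"
  proof -
    have "Sn I M k v = c1 * norm_Omega (mixed_norm I (ennreal ?p) (ennreal ?q)) v + c2 * mixed_norm I (ennreal ?p) (ennreal ?r) v"
      by (simp only: Sn_def c1_def c2_def)
    then have "4 * (c1 * (10000 * norm_Omega (mixed_norm I (ennreal ?p) (ennreal ?q)) v) + 10000 * (c2 * mixed_norm I (ennreal ?p) (ennreal ?r) v))
        = (4 * 10000) * Sn I M k v"
      by (simp only: distrib_left mult_ac)
    then show ?thesis by simp
  qed
  finally show "LM (lebesgue_on I) ?p (\<lambda>t. sob ?q ?r (2 powi (- k)) (v t)) \<le> 40000 * Sn I M k v" .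
qed

text \<open>The maximum with 0 keeps the factor, later called \<kappa>, at least 1 also for negative
  C, as the estimates at a fixed time require.\<close>

lemma scale_le:
  assumes "j \<le> k + C" shows "2 powi (- k) \<le> 2 powr real_of_int (max C 0) * (2 powi (- j) :: real)"
  unfolding two_powi powr_add[symmetric] using assms by (intro powr_mono) auto

lemma one_le_kappa: "(1::real) \<le> 2 powr real_of_int (max C 0)"
  by (rule ge_one_powr_ge_zero) auto

lemma powi_pos: "(0::real) < 2 powi n"
  by simp

lemma powi_powr_inverse: "(2 powi (- j) :: real) powr (1 / M) = 2 powr (- real_of_int j / M)"
  unfolding two_powi powr_powr by simp

text \<open>The common end of (1) and (2). F and G bound the first two factors at each time. K is
  chosen before M and C; C enters through \<kappa> = 2^(max C 0), and the constant of the bound on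
  the first two factors through \<open>K0\<close>.\<close>

lemma L2_case:
  obtains K where "K \<ge> 0"
    "\<And>I \<phi> m j C M f h F G K0 w. \<lbrakk>is_interval I; tempered_on I \<phi>; w = LP_piece chi m \<phi>; time_regular I w; j \<le> m + C; 40 \<le> M; K0 \<ge> 0;
       F \<in> borel_measurable (lebesgue_on I); G \<in> borel_measurable (lebesgue_on I);
       \<And>t x. t \<in> I \<Longrightarrow> nv (f t) x * nv (h t) x \<le> ennreal K0 * (F t * G t);
       \<And>t x. t \<in> I \<Longrightarrow> 1 \<le> \<bar>t\<bar> / 2 powi (- j) \<Longrightarrow> 2 powi (- j) * sqrt (\<bar>t\<bar> / 2 powi (- j)) \<le> norm x \<Longrightarrow>
         nv (f t) x * nv (h t) x \<le> ennreal (2 powr real_of_int (max C 0) * gdec (\<bar>t\<bar> / 2 powi (- j))) * (ennreal K0 * (F t * G t))\<rbrakk> \<Longrightarrow>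
     mixed_norm I 1 2 (\<lambda>t x. f t x * h t x * w t x) \<le> ennreal (K * (2 powr real_of_int (max C 0) * K0)) * ennreal (2 powr (- real_of_int j / M)) *
       (LM (lebesgue_on I) (2 * M / (M - 1)) F * LM (lebesgue_on I) (2 * M / (M - 1)) G) * An I j m w"
proof -
  obtain K1 where K1: "K1 \<ge> 0"
    "\<And>a b \<kappa> t w w' B f h D. \<lbrakk>localized1 a w; a \<le> \<kappa> * b; b > 0; 1 \<le> \<kappa>; continuous_on UNIV w'; \<And>n. continuous_on UNIV (B n);
       \<And>n y. B n y = y $ n *\<^sub>R w' y + t *\<^sub>R partial n w y;
       \<And>x. nv f x * nv h x \<le> D;
       \<And>x. 1 \<le> \<bar>t\<bar> / b \<Longrightarrow> b * sqrt (\<bar>t\<bar> / b) \<le> norm x \<Longrightarrow> nv f x * nv h x \<le> ennreal (\<kappa> * gdec (\<bar>t\<bar> / b)) * D\<rbrakk> \<Longrightarrow>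
     Lq 2 (nv (\<lambda>x. f x * h x * w x)) \<le> ennreal (K1 * (\<kappa> * gdec (\<bar>t\<bar> / b))) * D *
       (Lq 2 (nv w) + ennreal (a / b) * (\<Sum>n\<in>UNIV. Lq 2 (nv (B n))) + ennreal a * Lq 2 (nv w'))"
    by (rule trilinear_L2) (erule that, blast)
  obtain J where J: "J \<ge> 0"
    "\<And>b m I H F G A k. \<lbrakk>b > 0; 40 \<le> m; I \<in> sets lebesgue; k \<ge> 0;
       F \<in> borel_measurable (lebesgue_on I); G \<in> borel_measurable (lebesgue_on I);
       AE t in lebesgue_on I. H t \<le> ennreal (k * gdec (\<bar>t\<bar> / b)) * (F t * G t) * A\<rbrakk> \<Longrightarrow>
     (\<integral>\<^sup>+t. H t \<partial>lebesgue_on I) \<le> ennreal (k * J) * ennreal (b powr (1 / m)) *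
       (LM (lebesgue_on I) (2 * m / (m - 1)) F * LM (lebesgue_on I) (2 * m / (m - 1)) G) * A"
    by (rule time_integral_bound) (erule that, blast)
  show ?thesis
  proof (rule that[of "3 * K1 * J"])
    show "0 \<le> 3 * K1 * J" using K1(1) J(1) by simp
    fix I \<phi> m j C f h and M :: real and F G :: "real \<Rightarrow> ennreal" and K0 :: real and w
    assume I: "is_interval I" and \<phi>: "tempered_on I \<phi>" and w: "w = LP_piece chi m \<phi>" and reg: "time_regular I w"
      and jm: "j \<le> m + C" and M: "40 \<le> M" and K0: "K0 \<ge> 0"
      and FG: "F \<in> borel_measurable (lebesgue_on I)" "G \<in> borel_measurable (lebesgue_on I)"
      and b1: "\<And>t x. t \<in> I \<Longrightarrow> nv (f t) x * nv (h t) x \<le> ennreal K0 * (F t * G t)"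
      and b2: "\<And>t x. t \<in> I \<Longrightarrow> 1 \<le> \<bar>t\<bar> / 2 powi (- j) \<Longrightarrow> 2 powi (- j) * sqrt (\<bar>t\<bar> / 2 powi (- j)) \<le> norm x \<Longrightarrow>
         nv (f t) x * nv (h t) x \<le> ennreal (2 powr real_of_int (max C 0) * gdec (\<bar>t\<bar> / 2 powi (- j))) * (ennreal K0 * (F t * G t))"
    define \<kappa> where "\<kappa> = (2::real) powr real_of_int (max C 0)"
    define b where "b = (2::real) powi (- j)"
    have \<kappa>: "1 \<le> \<kappa>" unfolding \<kappa>_def by (rule one_le_kappa)
    have b: "b > 0" unfolding b_def by simp
    have Is: "I \<in> sets lebesgue" by (rule interval_sets_lebesgue[OF I])
    note car = piece_Car_time[OF I \<phi>, of m, folded w, OF reg]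
    let ?A = "An I j m w"
    have aeB: "AE t in lebesgue_on I. \<forall>n. continuous_on UNIV (boost n w t)"
      using car(2) by (subst AE_all_countable) (auto simp: Car_def)
    have aeN: "AE t in lebesgue_on I. \<forall>n. Lp_norm 2 lebesgue (nv (boost n w t)) \<le> mixed_norm I \<infinity> 2 (boost n w)"
      by (subst AE_all_countable) (intro allI AE_le_mixed_norm_infty)
    have "AE t in lebesgue_on I. continuous_on UNIV (dt w t)" using car(1) by (simp add: Car_def)
    then have "AE t in lebesgue_on I. Lq 2 (nv (\<lambda>x. f t x * h t x * w t x)) \<le> ennreal (3 * K1 * (\<kappa> * K0) * gdec (\<bar>t\<bar> / b)) * (F t * G t) * ?A"
      using aeB aeN AE_le_mixed_norm_infty[of 2 w I] AE_le_mixed_norm_infty[of 2 "dt w" I] AE_space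
    proof eventually_elim
      case (elim t)
      then have t: "t \<in> I" by simp
      have n2: "Lq 2 (nv g) = Lp_norm 2 lebesgue (nv g)" for g
        using Lp_norm_lebesgue[of 2 "nv g"] by simp
      have "Lq 2 (nv (\<lambda>x. f t x * h t x * w t x)) \<le> ennreal (K1 * (\<kappa> * gdec (\<bar>t\<bar> / b))) * (ennreal K0 * (F t * G t)) *
          (Lq 2 (nv (w t)) + ennreal (2 powi (- m) / b) * (\<Sum>n\<in>UNIV. Lq 2 (nv (boost n w t))) + ennreal (2 powi (- m)) * Lq 2 (nv (dt w t)))"
      proof (rule K1(2))
        show "localized1 (2 powi (- m)) (w t)" unfolding w by (rule piece_localized1[OF \<phi> t])
        show "2 powi (- m) \<le> \<kappa> * b" unfolding \<kappa>_def b_def by (rule scale_le[OF jm])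
      qed (use elim b \<kappa> b1[OF t] b2[OF t] in \<open>auto simp: boost_eq \<kappa>_def[symmetric] b_def[symmetric]\<close>)
      also have "\<dots> \<le> ennreal (K1 * (\<kappa> * gdec (\<bar>t\<bar> / b))) * (ennreal K0 * (F t * G t)) * (3 * ?A)"
      proof (rule mult_left_mono)
        \<comment> \<open>Each of the three boosts is at most the maximum in \<open>norm_L\<close>;
          this is the factor 3 in front of \<open>?A\<close>.\<close>
        have "(\<Sum>n\<in>UNIV. Lq 2 (nv (boost n w t))) \<le> (\<Sum>n\<in>(UNIV :: 3 set). norm_L (mixed_norm I \<infinity> 2) w)"
          unfolding n2 using elim by (intro sum_mono order_trans[OF _ norm_L_ge]) auto
        also have "\<dots> = 3 * norm_L (mixed_norm I \<infinity> 2) w" by simp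
        finally have s3: "(\<Sum>n\<in>UNIV. Lq 2 (nv (boost n w t))) \<le> 3 * norm_L (mixed_norm I \<infinity> 2) w" .
        have "Lq 2 (nv (w t)) + ennreal (2 powi (- m) / b) * (\<Sum>n\<in>UNIV. Lq 2 (nv (boost n w t))) + ennreal (2 powi (- m)) * Lq 2 (nv (dt w t))
          \<le> 3 * mixed_norm I \<infinity> 2 w + ennreal (2 powr real_of_int (j - m)) * (3 * norm_L (mixed_norm I \<infinity> 2) w) + ennreal (2 powr real_of_int (- m)) * (3 * mixed_norm I \<infinity> 2 (dt w))"
          unfolding b_def scale_ratio unfolding two_powi[of "- m"]
        proof (intro add_mono mult_left_mono s3)
          show "Lq 2 (nv (w t)) \<le> 3 * mixed_norm I \<infinity> 2 w" "Lq 2 (nv (dt w t)) \<le> 3 * mixed_norm I \<infinity> 2 (dt w)"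
            unfolding n2 using elim by (auto intro: order_trans[OF _ ennreal_le_numeral_mult])
        qed auto
        also have "\<dots> = 3 * ?A" unfolding An_def by (simp add: distrib_left mult.left_commute)
        finally show "Lq 2 (nv (w t)) + ennreal (2 powi (- m) / b) * (\<Sum>n\<in>UNIV. Lq 2 (nv (boost n w t))) + ennreal (2 powi (- m)) * Lq 2 (nv (dt w t)) \<le> 3 * ?A" .
      qed simp
      also have "\<dots> = ennreal (3 * K1 * (\<kappa> * K0) * gdec (\<bar>t\<bar> / b)) * (F t * G t) * ?A"
      proof -
        have "ennreal (3 * K1 * (\<kappa> * K0) * gdec (\<bar>t\<bar> / b)) = ennreal (K1 * (\<kappa> * gdec (\<bar>t\<bar> / b))) * ennreal K0 * ennreal 3"
        proof -
          have x: "0 \<le> K1 * (\<kappa> * gdec (\<bar>t\<bar> / b))" using K1(1) \<kappa> gdec_nonneg[of "\<bar>t\<bar> / b"] by simp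
          have "3 * K1 * (\<kappa> * K0) * gdec (\<bar>t\<bar> / b) = K1 * (\<kappa> * gdec (\<bar>t\<bar> / b)) * K0 * 3" by simp
          also have "ennreal \<dots> = ennreal (K1 * (\<kappa> * gdec (\<bar>t\<bar> / b)) * K0) * ennreal 3"
            using x K0 by (intro ennreal_mult) auto
          also have "ennreal (K1 * (\<kappa> * gdec (\<bar>t\<bar> / b)) * K0) = ennreal (K1 * (\<kappa> * gdec (\<bar>t\<bar> / b))) * ennreal K0"
            by (rule ennreal_mult[OF x K0])
          finally show ?thesis .
        qed
        then show ?thesis by (simp add: mult_ac)
      qed
      finally show ?case .
    qed
    moreover have "0 \<le> 3 * K1 * (\<kappa> * K0)" using K1(1) \<kappa> K0 by simp
    ultimately have "(\<integral>\<^sup>+t. Lq 2 (nv (\<lambda>x. f t x * h t x * w t x)) \<partial>lebesgue_on I) \<le> ennreal (3 * K1 * (\<kappa> * K0) * J) * ennreal (b powr (1 / M)) *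
       (LM (lebesgue_on I) (2 * M / (M - 1)) F * LM (lebesgue_on I) (2 * M / (M - 1)) G) * ?A"
      by (intro J(2)[OF b M Is _ FG])
    moreover have "3 * K1 * (\<kappa> * K0) * J = 3 * K1 * J * (2 powr real_of_int (max C 0) * K0)" by (simp add: \<kappa>_def)
    ultimately show "mixed_norm I 1 2 (\<lambda>t x. f t x * h t x * w t x) \<le> ennreal (3 * K1 * J * (2 powr real_of_int (max C 0) * K0)) * ennreal (2 powr (- real_of_int j / M)) *
       (LM (lebesgue_on I) (2 * M / (M - 1)) F * LM (lebesgue_on I) (2 * M / (M - 1)) G) * An I j m w"
      unfolding mixed_norm_L2 b_def powi_powr_inverse by simp
  qed
qed

end

definition B1n :: "real set \<Rightarrow> real \<Rightarrow> int \<Rightarrow> int \<Rightarrow> (real \<Rightarrow> real^3 \<Rightarrow> complex) \<Rightarrow> ennreal" where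
  "B1n I M j k v = norm_Omega (mixed_norm I (ennreal (2 * M / (M - 1))) (ennreal (2 * M))) v
     + ennreal (2 powr real_of_int (j - k)) * norm_L (norm_Omega (mixed_norm I (ennreal (2 * M / (M - 1))) (ennreal (2 * M)))) v
     + ennreal (2 powr real_of_int (- k)) * norm_Omega (mixed_norm I (ennreal (2 * M / (M - 1))) (ennreal (2 * M))) (dt v)"

text \<open>One definition for two brackets: e = 4M/(M-1) gives B_2 and e = \<infinity> gives
  B_3.\<close>

definition Bn :: "real set \<Rightarrow> real \<Rightarrow> ennreal \<Rightarrow> int \<Rightarrow> int \<Rightarrow> (real \<Rightarrow> real^3 \<Rightarrow> complex) \<Rightarrow> ennreal" where
  "Bn I M e j k v = mixed_norm I (ennreal (2 * M / (M - 1))) e v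
     + ennreal (2 powr real_of_int (j - k)) * norm_L (mixed_norm I (ennreal (2 * M / (M - 1))) e) v
     + ennreal (2 powr real_of_int (- k)) * mixed_norm I (ennreal (2 * M / (M - 1))) e (dt v)"

lemma Lq_2_mult_le:
  assumes "\<And>x. nv f x \<le> D" "w \<in> borel_measurable borel"
  shows "Lq 2 (nv (\<lambda>x. f x * w x)) \<le> D * Lq 2 (nv w)"
proof -
  have "Lq 2 (nv (\<lambda>x. f x * w x)) \<le> Lq 2 (\<lambda>x. D * nv w x)"
    using assms(1) by (intro LM_mono) (auto simp: norm_mult ennreal_mult intro!: mult_right_mono)
  also have "\<dots> = D * Lq 2 (nv w)"
    using assms(2) by (intro LM_cmult) auto
  finally show ?thesis .
qed

context LP
begin

lemma sup_time:
  assumes M: "40 \<le> M" and I: "is_interval I" and u: "Car I u"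
  shows "(\<lambda>t. Lp_norm \<infinity> lebesgue (nv (u t))) \<in> borel_measurable (lebesgue_on I)"
    and "LM (lebesgue_on I) (2 * M / (M - 1)) (\<lambda>t. Lp_norm \<infinity> lebesgue (nv (u t))) = mixed_norm I (ennreal (2 * M / (M - 1))) \<infinity> u"
proof -
  show "(\<lambda>t. Lp_norm \<infinity> lebesgue (nv (u t))) \<in> borel_measurable (lebesgue_on I)"
    by (rule Car_norm_measurable[OF interval_sets_lebesgue[OF I] u]) simp
  have "0 < 2 * M / (M - 1)" using M by simp
  then show "LM (lebesgue_on I) (2 * M / (M - 1)) (\<lambda>t. Lp_norm \<infinity> lebesgue (nv (u t))) = mixed_norm I (ennreal (2 * M / (M - 1))) \<infinity> u"
    by (rule mixed_norm_eq[symmetric])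
qed

lemma piece_le_sup:
  assumes "tempered_on I \<phi>" "t \<in> I"
  shows "nv (LP_piece chi k \<phi> t) x \<le> Lp_norm \<infinity> lebesgue (nv (LP_piece chi k \<phi> t))"
  using piece_localized1[OF assms, of k] unfolding localized1_def localized_def by (intro nv_le_esssup) blast

lemma exponents:
  assumes "40 \<le> (M::real)" shows "1 < 2 * M" "1 < 4 * M / (M - 1)" "4 * M / (M - 1) \<le> 5"
  using assms by (auto simp: field_simps)

text \<open>The first factor is taken in the supremum norm. The second gains outside through
  \<open>sob\<close>, where j <= k + C bounds its scale 2^(-k) by a multiple of b = 2^(-j); the
  third gains inside, where j <= m + C does the same for 2^(-m).\<close>

lemma trilinear_estimate_1:
  assumes M: "40 \<le> M"
  obtains K where "K \<ge> 0"
    "\<And>I \<phi>1 \<phi>2 \<phi>3 j k m. \<lbrakk>is_interval I; tempered_on I \<phi>1; tempered_on I \<phi>2; tempered_on I \<phi>3;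
       time_regular I (LP_piece chi m \<phi>3); j \<le> k + C; j \<le> m + C\<rbrakk> \<Longrightarrow>
     mixed_norm I 1 2 (\<lambda>t x. LP_piece chi j \<phi>1 t x * LP_piece chi k \<phi>2 t x * LP_piece chi m \<phi>3 t x) \<le>
       ennreal K * ennreal (2 powr (- real_of_int j / M)) * mixed_norm I (ennreal (2 * M / (M - 1))) \<infinity> (LP_piece chi j \<phi>1)
       * Sn I M k (LP_piece chi k \<phi>2) * An I j m (LP_piece chi m \<phi>3)"
proof -
  obtain C2 where C2: "C2 \<ge> 0"
    "\<And>a v x. localized1 a v \<Longrightarrow> nv v x \<le> ennreal C2 * sob (2 * M) (4 * M / (M - 1)) a v"
    "\<And>a b \<kappa> T v x. \<lbrakk>localized1 a v; a \<le> \<kappa> * b; b > 0; 1 \<le> \<kappa>; T < 1 \<or> b * sqrt T \<le> norm x\<rbrakk> \<Longrightarrow>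
      nv v x \<le> ennreal (C2 * (\<kappa> * gdec T)) * sob (2 * M) (4 * M / (M - 1)) a v"
    by (rule sob_bounds[OF exponents[OF M]]) (erule that, blast+)
  obtain K1 where K1: "K1 \<ge> 0"
    "\<And>I \<phi> m j C M f h F G K0 w. \<lbrakk>is_interval I; tempered_on I \<phi>; w = LP_piece chi m \<phi>; time_regular I w; j \<le> m + C; 40 \<le> M; K0 \<ge> 0;
       F \<in> borel_measurable (lebesgue_on I); G \<in> borel_measurable (lebesgue_on I);
       \<And>t x. t \<in> I \<Longrightarrow> nv (f t) x * nv (h t) x \<le> ennreal K0 * (F t * G t);
       \<And>t x. t \<in> I \<Longrightarrow> 1 \<le> \<bar>t\<bar> / 2 powi (- j) \<Longrightarrow> 2 powi (- j) * sqrt (\<bar>t\<bar> / 2 powi (- j)) \<le> norm x \<Longrightarrow>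
         nv (f t) x * nv (h t) x \<le> ennreal (2 powr real_of_int (max C 0) * gdec (\<bar>t\<bar> / 2 powi (- j))) * (ennreal K0 * (F t * G t))\<rbrakk> \<Longrightarrow>
     mixed_norm I 1 2 (\<lambda>t x. f t x * h t x * w t x) \<le> ennreal (K1 * (2 powr real_of_int (max C 0) * K0)) * ennreal (2 powr (- real_of_int j / M)) *
       (LM (lebesgue_on I) (2 * M / (M - 1)) F * LM (lebesgue_on I) (2 * M / (M - 1)) G) * An I j m w"
    by (rule L2_case) (erule that, blast)
  define \<kappa> where "\<kappa> = (2::real) powr real_of_int (max C 0)"
  have \<kappa>: "1 \<le> \<kappa>" unfolding \<kappa>_def by (rule one_le_kappa)
  show ?thesis
  proof (rule that[of "K1 * (\<kappa> * C2) * 40000"])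
    show "0 \<le> K1 * (\<kappa> * C2) * 40000" using K1(1) C2(1) \<kappa> by simp
    fix I \<phi>1 \<phi>2 \<phi>3 j k m
    assume I: "is_interval I" and \<phi>1: "tempered_on I \<phi>1" and \<phi>2: "tempered_on I \<phi>2" and \<phi>3: "tempered_on I \<phi>3"
      and reg: "time_regular I (LP_piece chi m \<phi>3)" and jk: "j \<le> k + C" and jm: "j \<le> m + C"
    define u where "u = LP_piece chi j \<phi>1"
    define v where "v = LP_piece chi k \<phi>2"
    define F where "F t = Lp_norm \<infinity> lebesgue (nv (u t))" for t
    define G where "G t = sob (2 * M) (4 * M / (M - 1)) (2 powi (- k)) (v t)" for t
    have uF: "nv (u t) x \<le> F t" if "t \<in> I" for t x
      unfolding u_def F_def by (rule piece_le_sup[OF \<phi>1 that])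
    have mF: "F \<in> borel_measurable (lebesgue_on I)" "LM (lebesgue_on I) (2 * M / (M - 1)) F = mixed_norm I (ennreal (2 * M / (M - 1))) \<infinity> u"
      unfolding F_def u_def by (rule sup_time[OF M I piece_Car(1)[OF I \<phi>1]])+
    have mG: "G \<in> borel_measurable (lebesgue_on I)" "LM (lebesgue_on I) (2 * M / (M - 1)) G \<le> 40000 * Sn I M k v"
      unfolding G_def by (rule sob_time[OF M I \<phi>2 v_def])+
    have "mixed_norm I 1 2 (\<lambda>t x. u t x * v t x * LP_piece chi m \<phi>3 t x) \<le> ennreal (K1 * (\<kappa> * C2)) * ennreal (2 powr (- real_of_int j / M)) *
       (LM (lebesgue_on I) (2 * M / (M - 1)) F * LM (lebesgue_on I) (2 * M / (M - 1)) G) * An I j m (LP_piece chi m \<phi>3)"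
      unfolding \<kappa>_def
    proof (rule K1(2)[OF I \<phi>3 refl reg jm M C2(1) mF(1) mG(1)])
      fix t x assume t: "t \<in> I"
      have vl: "localized1 (2 powi (- k)) (v t)" unfolding v_def by (rule piece_localized1[OF \<phi>2 t])
      have "nv (u t) x * nv (v t) x \<le> F t * (ennreal C2 * G t)"
        unfolding G_def by (intro mult_mono uF t C2(2)[OF vl]) auto
      then show "nv (u t) x * nv (v t) x \<le> ennreal C2 * (F t * G t)" by (simp add: mult_ac)
      assume x: "2 powi (- j) * sqrt (\<bar>t\<bar> / 2 powi (- j)) \<le> norm x"
      have "nv (v t) x \<le> ennreal (C2 * (\<kappa> * gdec (\<bar>t\<bar> / 2 powi (- j)))) * G t"
        unfolding G_def \<kappa>_def by (rule C2(3)[OF vl scale_le[OF jk] _ one_le_kappa]) (use x in auto)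
      then have "nv (u t) x * nv (v t) x \<le> F t * (ennreal (C2 * (\<kappa> * gdec (\<bar>t\<bar> / 2 powi (- j)))) * G t)"
        by (intro mult_mono uF t) auto
      also have "ennreal (C2 * (\<kappa> * gdec (\<bar>t\<bar> / 2 powi (- j)))) = ennreal C2 * ennreal (\<kappa> * gdec (\<bar>t\<bar> / 2 powi (- j)))"
        using C2(1) \<kappa> gdec_nonneg by (intro ennreal_mult) auto
      finally show "nv (u t) x * nv (v t) x \<le> ennreal (2 powr real_of_int (max C 0) * gdec (\<bar>t\<bar> / 2 powi (- j))) * (ennreal C2 * (F t * G t))"
        unfolding \<kappa>_def by (simp add: mult_ac)
    qed
    also have "\<dots> \<le> ennreal (K1 * (\<kappa> * C2)) * ennreal (2 powr (- real_of_int j / M)) *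
       (mixed_norm I (ennreal (2 * M / (M - 1))) \<infinity> u * (40000 * Sn I M k v)) * An I j m (LP_piece chi m \<phi>3)"
      unfolding mF(2) by (intro mult_right_mono mult_left_mono mG(2)) auto
    also have "\<dots> = ennreal (K1 * (\<kappa> * C2) * 40000) * ennreal (2 powr (- real_of_int j / M)) * mixed_norm I (ennreal (2 * M / (M - 1))) \<infinity> u * Sn I M k v * An I j m (LP_piece chi m \<phi>3)"
    proof -
      have "ennreal (K1 * (\<kappa> * C2) * 40000) = ennreal (K1 * (\<kappa> * C2)) * 40000"
        using K1(1) C2(1) \<kappa> by (subst ennreal_mult) auto
      then show ?thesis by (simp only: mult_ac)
    qed
    finally show "mixed_norm I 1 2 (\<lambda>t x. LP_piece chi j \<phi>1 t x * LP_piece chi k \<phi>2 t x * LP_piece chi m \<phi>3 t x) \<le>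
       ennreal (K1 * (\<kappa> * C2) * 40000) * ennreal (2 powr (- real_of_int j / M)) * mixed_norm I (ennreal (2 * M / (M - 1))) \<infinity> (LP_piece chi j \<phi>1)
       * Sn I M k (LP_piece chi k \<phi>2) * An I j m (LP_piece chi m \<phi>3)"
      unfolding u_def v_def .
  qed
qed

text \<open>The first two factors exchange their roles. The one that gains outside now has the scale
  b itself, so j and k need not be compared.\<close>

lemma trilinear_estimate_2:
  assumes M: "40 \<le> M"
  obtains K where "K \<ge> 0"
    "\<And>I \<phi>1 \<phi>2 \<phi>3 j k m. \<lbrakk>is_interval I; tempered_on I \<phi>1; tempered_on I \<phi>2; tempered_on I \<phi>3;
       time_regular I (LP_piece chi m \<phi>3); j \<le> m + C\<rbrakk> \<Longrightarrow>
     mixed_norm I 1 2 (\<lambda>t x. LP_piece chi j \<phi>1 t x * LP_piece chi k \<phi>2 t x * LP_piece chi m \<phi>3 t x) \<le>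
       ennreal K * ennreal (2 powr (- real_of_int j / M)) * Sn I M j (LP_piece chi j \<phi>1)
       * mixed_norm I (ennreal (2 * M / (M - 1))) \<infinity> (LP_piece chi k \<phi>2) * An I j m (LP_piece chi m \<phi>3)"
proof -
  obtain C2 where C2: "C2 \<ge> 0"
    "\<And>a v x. localized1 a v \<Longrightarrow> nv v x \<le> ennreal C2 * sob (2 * M) (4 * M / (M - 1)) a v"
    "\<And>a b \<kappa> T v x. \<lbrakk>localized1 a v; a \<le> \<kappa> * b; b > 0; 1 \<le> \<kappa>; T < 1 \<or> b * sqrt T \<le> norm x\<rbrakk> \<Longrightarrow>
      nv v x \<le> ennreal (C2 * (\<kappa> * gdec T)) * sob (2 * M) (4 * M / (M - 1)) a v"
    by (rule sob_bounds[OF exponents[OF M]]) (erule that, blast+)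
  obtain K1 where K1: "K1 \<ge> 0"
    "\<And>I \<phi> m j C M f h F G K0 w. \<lbrakk>is_interval I; tempered_on I \<phi>; w = LP_piece chi m \<phi>; time_regular I w; j \<le> m + C; 40 \<le> M; K0 \<ge> 0;
       F \<in> borel_measurable (lebesgue_on I); G \<in> borel_measurable (lebesgue_on I);
       \<And>t x. t \<in> I \<Longrightarrow> nv (f t) x * nv (h t) x \<le> ennreal K0 * (F t * G t);
       \<And>t x. t \<in> I \<Longrightarrow> 1 \<le> \<bar>t\<bar> / 2 powi (- j) \<Longrightarrow> 2 powi (- j) * sqrt (\<bar>t\<bar> / 2 powi (- j)) \<le> norm x \<Longrightarrow>
         nv (f t) x * nv (h t) x \<le> ennreal (2 powr real_of_int (max C 0) * gdec (\<bar>t\<bar> / 2 powi (- j))) * (ennreal K0 * (F t * G t))\<rbrakk> \<Longrightarrow>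
     mixed_norm I 1 2 (\<lambda>t x. f t x * h t x * w t x) \<le> ennreal (K1 * (2 powr real_of_int (max C 0) * K0)) * ennreal (2 powr (- real_of_int j / M)) *
       (LM (lebesgue_on I) (2 * M / (M - 1)) F * LM (lebesgue_on I) (2 * M / (M - 1)) G) * An I j m w"
    by (rule L2_case) (erule that, blast)
  define \<kappa> where "\<kappa> = (2::real) powr real_of_int (max C 0)"
  have \<kappa>: "1 \<le> \<kappa>" unfolding \<kappa>_def by (rule one_le_kappa)
  show ?thesis
  proof (rule that[of "K1 * (\<kappa> * C2) * 40000"])
    show "0 \<le> K1 * (\<kappa> * C2) * 40000" using K1(1) C2(1) \<kappa> by simp
    fix I \<phi>1 \<phi>2 \<phi>3 j k m
    assume I: "is_interval I" and \<phi>1: "tempered_on I \<phi>1" and \<phi>2: "tempered_on I \<phi>2" and \<phi>3: "tempered_on I \<phi>3"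
      and reg: "time_regular I (LP_piece chi m \<phi>3)" and jm: "j \<le> m + C"
    define u where "u = LP_piece chi j \<phi>1"
    define v where "v = LP_piece chi k \<phi>2"
    define F where "F t = sob (2 * M) (4 * M / (M - 1)) (2 powi (- j)) (u t)" for t
    define G where "G t = Lp_norm \<infinity> lebesgue (nv (v t))" for t
    have vG: "nv (v t) x \<le> G t" if "t \<in> I" for t x
      unfolding v_def G_def by (rule piece_le_sup[OF \<phi>2 that])
    have mG: "G \<in> borel_measurable (lebesgue_on I)" "LM (lebesgue_on I) (2 * M / (M - 1)) G = mixed_norm I (ennreal (2 * M / (M - 1))) \<infinity> v"
      unfolding G_def v_def by (rule sup_time[OF M I piece_Car(1)[OF I \<phi>2]])+
    have mF: "F \<in> borel_measurable (lebesgue_on I)" "LM (lebesgue_on I) (2 * M / (M - 1)) F \<le> 40000 * Sn I M j u"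
      unfolding F_def by (rule sob_time[OF M I \<phi>1 u_def])+
    have "mixed_norm I 1 2 (\<lambda>t x. u t x * v t x * LP_piece chi m \<phi>3 t x) \<le> ennreal (K1 * (\<kappa> * C2)) * ennreal (2 powr (- real_of_int j / M)) *
       (LM (lebesgue_on I) (2 * M / (M - 1)) F * LM (lebesgue_on I) (2 * M / (M - 1)) G) * An I j m (LP_piece chi m \<phi>3)"
      unfolding \<kappa>_def
    proof (rule K1(2)[OF I \<phi>3 refl reg jm M C2(1) mF(1) mG(1)])
      fix t x assume t: "t \<in> I"
      have ul: "localized1 (2 powi (- j)) (u t)" unfolding u_def by (rule piece_localized1[OF \<phi>1 t])
      have "nv (u t) x * nv (v t) x \<le> (ennreal C2 * F t) * G t"
        unfolding F_def by (intro mult_mono vG t C2(2)[OF ul]) auto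
      then show "nv (u t) x * nv (v t) x \<le> ennreal C2 * (F t * G t)" by (simp add: mult_ac)
      assume x: "2 powi (- j) * sqrt (\<bar>t\<bar> / 2 powi (- j)) \<le> norm x"
      have "nv (u t) x \<le> ennreal (C2 * (\<kappa> * gdec (\<bar>t\<bar> / 2 powi (- j)))) * F t"
        unfolding F_def by (rule C2(3)[OF ul _ _ \<kappa>]) (use x \<kappa> in auto)
      then have "nv (u t) x * nv (v t) x \<le> (ennreal (C2 * (\<kappa> * gdec (\<bar>t\<bar> / 2 powi (- j)))) * F t) * G t"
        by (intro mult_mono vG t) auto
      also have "ennreal (C2 * (\<kappa> * gdec (\<bar>t\<bar> / 2 powi (- j)))) = ennreal C2 * ennreal (\<kappa> * gdec (\<bar>t\<bar> / 2 powi (- j)))"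
        using C2(1) \<kappa> gdec_nonneg by (intro ennreal_mult) auto
      finally show "nv (u t) x * nv (v t) x \<le> ennreal (2 powr real_of_int (max C 0) * gdec (\<bar>t\<bar> / 2 powi (- j))) * (ennreal C2 * (F t * G t))"
        unfolding \<kappa>_def by (simp add: mult_ac)
    qed
    also have "\<dots> \<le> ennreal (K1 * (\<kappa> * C2)) * ennreal (2 powr (- real_of_int j / M)) *
       ((40000 * Sn I M j u) * mixed_norm I (ennreal (2 * M / (M - 1))) \<infinity> v) * An I j m (LP_piece chi m \<phi>3)"
      unfolding mG(2) by (intro mult_right_mono mult_left_mono mF(2)) auto
    also have "\<dots> = ennreal (K1 * (\<kappa> * C2) * 40000) * ennreal (2 powr (- real_of_int j / M)) * Sn I M j u * mixed_norm I (ennreal (2 * M / (M - 1))) \<infinity> v * An I j m (LP_piece chi m \<phi>3)"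
    proof -
      have "ennreal (K1 * (\<kappa> * C2) * 40000) = ennreal (K1 * (\<kappa> * C2)) * 40000"
        using K1(1) C2(1) \<kappa> by (subst ennreal_mult) auto
      then show ?thesis by (simp only: mult_ac)
    qed
    finally show "mixed_norm I 1 2 (\<lambda>t x. LP_piece chi j \<phi>1 t x * LP_piece chi k \<phi>2 t x * LP_piece chi m \<phi>3 t x) \<le>
       ennreal (K1 * (\<kappa> * C2) * 40000) * ennreal (2 powr (- real_of_int j / M)) * Sn I M j (LP_piece chi j \<phi>1)
       * mixed_norm I (ennreal (2 * M / (M - 1))) \<infinity> (LP_piece chi k \<phi>2) * An I j m (LP_piece chi m \<phi>3)"
      unfolding u_def v_def .
  qed
qed

text \<open>The common end of (3) and (4): the gain sits entirely in the first two factors, and the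
  third enters by its L^2 norm, uniformly in time.\<close>

lemma product_case:
  obtains J where "J \<ge> 0"
    "\<And>I \<phi> m j M f h F G k w. \<lbrakk>is_interval I; tempered_on I \<phi>; w = LP_piece chi m \<phi>; 40 \<le> M; k \<ge> 0;
       F \<in> borel_measurable (lebesgue_on I); G \<in> borel_measurable (lebesgue_on I);
       AE t in lebesgue_on I. \<forall>x. nv (f t) x * nv (h t) x \<le> ennreal (k * gdec (\<bar>t\<bar> / 2 powi (- j))) * (F t * G t)\<rbrakk> \<Longrightarrow>
     mixed_norm I 1 2 (\<lambda>t x. f t x * h t x * w t x) \<le> ennreal (k * J) * ennreal (2 powr (- real_of_int j / M)) *
       (LM (lebesgue_on I) (2 * M / (M - 1)) F * LM (lebesgue_on I) (2 * M / (M - 1)) G) * mixed_norm I \<infinity> 2 w"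
proof -
  obtain J where J: "J \<ge> 0"
    "\<And>b m I H F G A k. \<lbrakk>b > 0; 40 \<le> m; I \<in> sets lebesgue; k \<ge> 0;
       F \<in> borel_measurable (lebesgue_on I); G \<in> borel_measurable (lebesgue_on I);
       AE t in lebesgue_on I. H t \<le> ennreal (k * gdec (\<bar>t\<bar> / b)) * (F t * G t) * A\<rbrakk> \<Longrightarrow>
     (\<integral>\<^sup>+t. H t \<partial>lebesgue_on I) \<le> ennreal (k * J) * ennreal (b powr (1 / m)) *
       (LM (lebesgue_on I) (2 * m / (m - 1)) F * LM (lebesgue_on I) (2 * m / (m - 1)) G) * A"
    by (rule time_integral_bound) (erule that, blast)
  show ?thesis
  proof (rule that[OF J(1)])
    fix I \<phi> m j f h and M :: real and F G :: "real \<Rightarrow> ennreal" and k :: real and w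
    assume I: "is_interval I" and \<phi>: "tempered_on I \<phi>" and w: "w = LP_piece chi m \<phi>" and M: "40 \<le> M" and k: "k \<ge> 0"
      and FG: "F \<in> borel_measurable (lebesgue_on I)" "G \<in> borel_measurable (lebesgue_on I)"
      and ae: "AE t in lebesgue_on I. \<forall>x. nv (f t) x * nv (h t) x \<le> ennreal (k * gdec (\<bar>t\<bar> / 2 powi (- j))) * (F t * G t)"
    have "AE t in lebesgue_on I. Lq 2 (nv (\<lambda>x. f t x * h t x * w t x)) \<le> ennreal (k * gdec (\<bar>t\<bar> / 2 powi (- j))) * (F t * G t) * mixed_norm I \<infinity> 2 w"
      using ae AE_le_mixed_norm_infty[of 2 w I] AE_space
    proof eventually_elim
      case (elim t)
      then have t: "t \<in> I" by simp
      have wm: "w t \<in> borel_measurable borel"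
        using piece_localized1[OF \<phi> t, of m] unfolding w localized1_def localized_def
        by (intro borel_measurable_continuous_onI) blast
      have "Lq 2 (nv (\<lambda>x. f t x * h t x * w t x)) \<le> (ennreal (k * gdec (\<bar>t\<bar> / 2 powi (- j))) * (F t * G t)) * Lq 2 (nv (w t))"
        using elim(1) by (intro Lq_2_mult_le wm) (auto simp: norm_mult ennreal_mult)
      also have "\<dots> \<le> (ennreal (k * gdec (\<bar>t\<bar> / 2 powi (- j))) * (F t * G t)) * mixed_norm I \<infinity> 2 w"
        using elim(2) Lp_norm_lebesgue[of 2 "nv (w t)"] by (intro mult_left_mono) auto
      finally show ?case .
    qed
    from J(2)[OF powi_pos M interval_sets_lebesgue[OF I] k FG this]
    show "mixed_norm I 1 2 (\<lambda>t x. f t x * h t x * w t x) \<le> ennreal (k * J) * ennreal (2 powr (- real_of_int j / M)) *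
       (LM (lebesgue_on I) (2 * M / (M - 1)) F * LM (lebesgue_on I) (2 * M / (M - 1)) G) * mixed_norm I \<infinity> 2 w"
      unfolding mixed_norm_L2 powi_powr_inverse .
  qed
qed

text \<open>The derivative terms of the brackets B_1, B_2, B_3 under the time norm. The constant is
  192 = 4 * 16 * 3: a sum of two terms, a sum of three boosts, and three times their
  maximum.\<close>

lemma LM_derivatives_le:
  assumes M: "40 \<le> M" and I: "is_interval I" and e: "e = \<infinity> \<or> (\<exists>q>0. e = ennreal q)"
    and \<phi>: "tempered_on I \<phi>" and v: "v = LP_piece chi k \<phi>" and reg: "time_regular I v"
  shows "(\<lambda>t. ennreal c * (\<Sum>n\<in>UNIV. Lp_norm e lebesgue (nv (boost n v t))) + ennreal d * Lp_norm e lebesgue (nv (dt v t))) \<in> borel_measurable (lebesgue_on I)" (is ?A)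
    and "LM (lebesgue_on I) (2 * M / (M - 1)) (\<lambda>t. ennreal c * (\<Sum>n\<in>UNIV. Lp_norm e lebesgue (nv (boost n v t))) + ennreal d * Lp_norm e lebesgue (nv (dt v t)))
      \<le> 192 * (ennreal c * (MAX n. mixed_norm I (ennreal (2 * M / (M - 1))) e (boost n v)) + ennreal d * mixed_norm I (ennreal (2 * M / (M - 1))) e (dt v))" (is ?B)
proof -
  let ?p = "2 * M / (M - 1)"
  have p: "1 \<le> ?p" "0 < ?p" using M by (auto simp: field_simps)
  note car = piece_Car_time[OF I \<phi>, of k, folded v, OF reg]
  have Is: "I \<in> sets lebesgue" by (rule interval_sets_lebesgue[OF I])
  define W where "W n t = Lp_norm e lebesgue (nv (boost n v t))" for n t
  define V where "V t = Lp_norm e lebesgue (nv (dt v t))" for t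
  have [measurable]: "W n \<in> borel_measurable (lebesgue_on I)" "V \<in> borel_measurable (lebesgue_on I)" for n
    unfolding W_def V_def by (intro Car_norm_measurable[OF Is _ e] car)+
  have mW: "LM (lebesgue_on I) ?p (W n) = mixed_norm I (ennreal ?p) e (boost n v)" for n
    unfolding W_def by (rule mixed_norm_eq[OF p(2), symmetric])
  have mV: "LM (lebesgue_on I) ?p V = mixed_norm I (ennreal ?p) e (dt v)"
    unfolding V_def by (rule mixed_norm_eq[OF p(2), symmetric])
  show ?A unfolding W_def[symmetric] V_def[symmetric] by measurable
  have "LM (lebesgue_on I) ?p (\<lambda>t. ennreal c * (\<Sum>n\<in>UNIV. W n t) + ennreal d * V t) \<le>
      4 * (LM (lebesgue_on I) ?p (\<lambda>t. ennreal c * (\<Sum>n\<in>UNIV. W n t)) + LM (lebesgue_on I) ?p (\<lambda>t. ennreal d * V t))"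
    by (rule LM_add_le[OF _ _ p(1)]) measurable
  also have "\<dots> = 4 * (ennreal c * LM (lebesgue_on I) ?p (\<lambda>t. \<Sum>n\<in>UNIV. W n t) + ennreal d * LM (lebesgue_on I) ?p V)"
    by (subst (1 2) LM_cmult[OF p(2)]) auto
  also have "\<dots> \<le> 4 * (ennreal c * (48 * (MAX n. LM (lebesgue_on I) ?p (W n))) + 48 * (ennreal d * LM (lebesgue_on I) ?p V))"
  proof (intro mult_left_mono add_mono ennreal_le_numeral_mult)
    have "LM (lebesgue_on I) ?p (\<lambda>t. \<Sum>n\<in>UNIV. W n t) \<le> 16 * (\<Sum>n\<in>UNIV. LM (lebesgue_on I) ?p (W n))"
      by (rule LM_sum3_le[OF _ p(1)]) measurable
    also have "\<dots> \<le> 16 * (3 * (MAX n. LM (lebesgue_on I) ?p (W n)))"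
      by (intro mult_left_mono sum3_le_Max) simp
    finally show "LM (lebesgue_on I) ?p (\<lambda>t. \<Sum>n\<in>UNIV. W n t) \<le> 48 * (MAX n. LM (lebesgue_on I) ?p (W n))"
      by (simp add: mult.assoc[symmetric])
  qed auto
  also have "\<dots> = (4 * 48) * (ennreal c * (MAX n. LM (lebesgue_on I) ?p (W n)) + ennreal d * LM (lebesgue_on I) ?p V)"
    by (simp only: distrib_left mult_ac)
  finally show ?B unfolding mW mV unfolding W_def V_def by simp
qed

text \<open>The second factor gains in both regions by \<open>pointwise_Lq\<close>: outside through
  <Omega>, inside through boosts and time derivative in L^(2M) with the Bernstein weight
  2^(3k/(2M)). The first factor is taken in the supremum norm.\<close>

lemma trilinear_estimate_3:
  assumes M: "40 \<le> M"
  obtains K where "K \<ge> 0"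
    "\<And>I \<phi>1 \<phi>2 \<phi>3 j k m. \<lbrakk>is_interval I; tempered_on I \<phi>1; tempered_on I \<phi>2; tempered_on I \<phi>3;
       time_regular I (LP_piece chi k \<phi>2); j \<le> k + C\<rbrakk> \<Longrightarrow>
     mixed_norm I 1 2 (\<lambda>t x. LP_piece chi j \<phi>1 t x * LP_piece chi k \<phi>2 t x * LP_piece chi m \<phi>3 t x) \<le>
       ennreal K * ennreal (2 powr (- real_of_int j / M)) * mixed_norm I (ennreal (2 * M / (M - 1))) \<infinity> (LP_piece chi j \<phi>1)
       * (ennreal (2 powr (3 * real_of_int k / (2 * M))) * B1n I M j k (LP_piece chi k \<phi>2)
          + ennreal (2 powr (3 * real_of_int k * (M - 1) / (4 * M))) * Bn I M (ennreal (4 * M / (M - 1))) j k (LP_piece chi k \<phi>2))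
       * mixed_norm I \<infinity> 2 (LP_piece chi m \<phi>3)"
proof -
  obtain C3 where C3: "C3 \<ge> 0"
    "\<And>a b \<kappa> t v v' B x. \<lbrakk>localized1 a v; a \<le> \<kappa> * b; b > 0; 1 \<le> \<kappa>; continuous_on UNIV v'; \<And>n. continuous_on UNIV (B n);
       \<And>n y. B n y = y $ n *\<^sub>R v' y + t *\<^sub>R partial n v y\<rbrakk> \<Longrightarrow>
     nv v x \<le> ennreal (C3 * (\<kappa> * gdec (\<bar>t\<bar> / b))) * (sob (2 * M) (4 * M / (M - 1)) a v +
       ennreal (a powr (- 3 / (2 * M))) * (ennreal (a / b) * (\<Sum>n\<in>UNIV. Lq (2 * M) (nv (B n))) + ennreal a * Lq (2 * M) (nv v')))"
    by (rule pointwise_Lq[OF exponents[OF M]]) (erule that, blast)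
  obtain J where J: "J \<ge> 0"
    "\<And>I \<phi> m j M f h F G k w. \<lbrakk>is_interval I; tempered_on I \<phi>; w = LP_piece chi m \<phi>; 40 \<le> M; k \<ge> 0;
       F \<in> borel_measurable (lebesgue_on I); G \<in> borel_measurable (lebesgue_on I);
       AE t in lebesgue_on I. \<forall>x. nv (f t) x * nv (h t) x \<le> ennreal (k * gdec (\<bar>t\<bar> / 2 powi (- j))) * (F t * G t)\<rbrakk> \<Longrightarrow>
     mixed_norm I 1 2 (\<lambda>t x. f t x * h t x * w t x) \<le> ennreal (k * J) * ennreal (2 powr (- real_of_int j / M)) *
       (LM (lebesgue_on I) (2 * M / (M - 1)) F * LM (lebesgue_on I) (2 * M / (M - 1)) G) * mixed_norm I \<infinity> 2 w"
    by (rule product_case) (erule that, blast)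
  define \<kappa> where "\<kappa> = (2::real) powr real_of_int (max C 0)"
  have \<kappa>: "1 \<le> \<kappa>" unfolding \<kappa>_def by (rule one_le_kappa)
  let ?p = "2 * M / (M - 1)" and ?q = "2 * M"
  have p: "1 \<le> ?p" "0 < ?p" and q: "0 < ?q" using M by (auto simp: field_simps)
  show ?thesis
  proof (rule that[of "C3 * \<kappa> * J * 160000"])
    show "0 \<le> C3 * \<kappa> * J * 160000" using J(1) C3(1) \<kappa> by simp
    fix I \<phi>1 \<phi>2 \<phi>3 j k m
    assume I: "is_interval I" and \<phi>1: "tempered_on I \<phi>1" and \<phi>2: "tempered_on I \<phi>2" and \<phi>3: "tempered_on I \<phi>3"
      and reg: "time_regular I (LP_piece chi k \<phi>2)" and jk: "j \<le> k + C"
    define u where "u = LP_piece chi j \<phi>1"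
    define v where "v = LP_piece chi k \<phi>2"
    have reg': "time_regular I v" using reg by (simp add: v_def)
    define F where "F t = Lp_norm \<infinity> lebesgue (nv (u t))" for t
    define c1 where "c1 = ennreal (2 powr (3 * real_of_int k / (2 * M)))"
    define c2 where "c2 = ennreal (2 powr (3 * real_of_int k * (M - 1) / (4 * M)))"
    define Y where "Y t = ennreal (2 powr real_of_int (j - k)) * (\<Sum>n\<in>UNIV. Lp_norm (ennreal ?q) lebesgue (nv (boost n v t)))
      + ennreal (2 powr real_of_int (- k)) * Lp_norm (ennreal ?q) lebesgue (nv (dt v t))" for t
    define G where "G t = sob (2 * M) (4 * M / (M - 1)) (2 powi (- k)) (v t) + c1 * Y t" for t
    have uF: "nv (u t) x \<le> F t" if "t \<in> I" for t x
      unfolding u_def F_def by (rule piece_le_sup[OF \<phi>1 that])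
    have mF: "F \<in> borel_measurable (lebesgue_on I)" "LM (lebesgue_on I) ?p F = mixed_norm I (ennreal ?p) \<infinity> u"
      unfolding F_def u_def by (rule sup_time[OF M I piece_Car(1)[OF I \<phi>1]])+
    note mS = sob_time[OF M I \<phi>2 v_def]
    have eq: "ennreal ?q = \<infinity> \<or> (\<exists>q>0. ennreal ?q = ennreal q)" using q by blast
    note mY = LM_derivatives_le[OF M I eq \<phi>2 v_def reg', of "2 powr real_of_int (j - k)" "2 powr real_of_int (- k)", folded Y_def]
    have [measurable]: "Y \<in> borel_measurable (lebesgue_on I)" using mY(1) unfolding Y_def[abs_def] .
    note [measurable] = mS(1)
    have mG: "G \<in> borel_measurable (lebesgue_on I)" unfolding G_def by measurable
    note car = piece_Car_time[OF I \<phi>2, of k, folded v_def, OF reg']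
    have aeB: "AE t in lebesgue_on I. \<forall>n. continuous_on UNIV (boost n v t)"
      using car(2) by (subst AE_all_countable) (auto simp: Car_def)
    have aeV: "AE t in lebesgue_on I. continuous_on UNIV (dt v t)" using car(1) by (simp add: Car_def)
    have e1: "ennreal ((2 powi (- k)) powr (- 3 / (2 * M))) = c1"
      unfolding c1_def two_powi powr_powr by (simp add: mult.commute)
    have "AE t in lebesgue_on I. \<forall>x. nv (u t) x * nv (v t) x \<le> ennreal (C3 * \<kappa> * gdec (\<bar>t\<bar> / 2 powi (- j))) * (F t * G t)"
      using aeB aeV AE_space
    proof eventually_elim
      case (elim t)
      then have t: "t \<in> I" by simp
      have "nv (v t) x \<le> ennreal (C3 * (\<kappa> * gdec (\<bar>t\<bar> / 2 powi (- j)))) * (sob (2 * M) (4 * M / (M - 1)) (2 powi (- k)) (v t) +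
          ennreal ((2 powi (- k)) powr (- 3 / (2 * M))) * (ennreal (2 powi (- k) / 2 powi (- j)) * (\<Sum>n\<in>UNIV. Lq (2 * M) (nv (boost n v t))) + ennreal (2 powi (- k)) * Lq (2 * M) (nv (dt v t))))" for x
      proof (rule C3(2))
        show "localized1 (2 powi (- k)) (v t)" unfolding v_def by (rule piece_localized1[OF \<phi>2 t])
        show "2 powi (- k) \<le> \<kappa> * 2 powi (- j)" unfolding \<kappa>_def by (rule scale_le[OF jk])
      qed (use elim \<kappa> in \<open>auto simp: boost_eq\<close>)
      then have vG: "nv (v t) x \<le> ennreal (C3 * (\<kappa> * gdec (\<bar>t\<bar> / 2 powi (- j)))) * G t" for x
        unfolding G_def Y_def e1 scale_ratio Lp_norm_lebesgue[OF q] unfolding two_powi[of "- k"] by simp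
      show ?case
      proof
        fix x
        have "nv (u t) x * nv (v t) x \<le> F t * (ennreal (C3 * (\<kappa> * gdec (\<bar>t\<bar> / 2 powi (- j)))) * G t)"
          by (intro mult_mono uF t vG) auto
        then show "nv (u t) x * nv (v t) x \<le> ennreal (C3 * \<kappa> * gdec (\<bar>t\<bar> / 2 powi (- j))) * (F t * G t)"
          by (simp add: mult_ac)
      qed
    qed
    then have "mixed_norm I 1 2 (\<lambda>t x. u t x * v t x * LP_piece chi m \<phi>3 t x) \<le> ennreal (C3 * \<kappa> * J) * ennreal (2 powr (- real_of_int j / M)) *
       (LM (lebesgue_on I) ?p F * LM (lebesgue_on I) ?p G) * mixed_norm I \<infinity> 2 (LP_piece chi m \<phi>3)"
      using C3(1) \<kappa> by (intro J(2)[OF I \<phi>3 refl M _ mF(1) mG]) auto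
    also have "\<dots> \<le> ennreal (C3 * \<kappa> * J) * ennreal (2 powr (- real_of_int j / M)) *
       (mixed_norm I (ennreal ?p) \<infinity> u * (160000 * (c1 * B1n I M j k v + c2 * Bn I M (ennreal (4 * M / (M - 1))) j k v))) * mixed_norm I \<infinity> 2 (LP_piece chi m \<phi>3)"
    proof (intro mult_right_mono mult_left_mono mult_mono)
      let ?O = "norm_Omega (mixed_norm I (ennreal ?p) (ennreal ?q))"
      let ?X = "ennreal (2 powr real_of_int (j - k)) * (MAX n. mixed_norm I (ennreal ?p) (ennreal ?q) (boost n v)) + ennreal (2 powr real_of_int (- k)) * mixed_norm I (ennreal ?p) (ennreal ?q) (dt v)"
      \<comment> \<open>The derivative terms of the inner region come without Omega;
        \<open>norm_Omega_ge\<close> places them below the corresponding terms of B_1.\<close>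
      have X: "?O v + ?X \<le> B1n I M j k v"
        unfolding B1n_def add.assoc
      proof (intro add_left_mono add_mono mult_left_mono norm_Omega_ge)
        have "(MAX n. mixed_norm I (ennreal ?p) (ennreal ?q) (boost n v)) \<le> (MAX n. ?O (boost n v))"
        proof (rule Max.boundedI)
          fix a assume "a \<in> range (\<lambda>n. mixed_norm I (ennreal ?p) (ennreal ?q) (boost n v))"
          then obtain n where a: "a = mixed_norm I (ennreal ?p) (ennreal ?q) (boost n v)" by blast
          have "a \<le> ?O (boost n v)" unfolding a by (rule norm_Omega_ge)
          also have "\<dots> \<le> (MAX n. ?O (boost n v))" by (rule Max_ge) auto
          finally show "a \<le> (MAX n. ?O (boost n v))" .
        qed auto
        also have "\<dots> \<le> norm_L ?O v" by (rule Max_le_norm_L)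
        finally show "(MAX n. mixed_norm I (ennreal ?p) (ennreal ?q) (boost n v)) \<le> norm_L ?O v" .
      qed auto
      have R: "mixed_norm I (ennreal ?p) (ennreal (4 * M / (M - 1))) v \<le> Bn I M (ennreal (4 * M / (M - 1))) j k v"
        unfolding Bn_def add.assoc by (simp add: add_increasing2)
      have "LM (lebesgue_on I) ?p G \<le> 4 * (LM (lebesgue_on I) ?p (\<lambda>t. sob (2 * M) (4 * M / (M - 1)) (2 powi (- k)) (v t)) + LM (lebesgue_on I) ?p (\<lambda>t. c1 * Y t))"
        unfolding G_def[abs_def] by (rule LM_add_le[OF _ _ p(1)]) measurable
      also have "LM (lebesgue_on I) ?p (\<lambda>t. c1 * Y t) = c1 * LM (lebesgue_on I) ?p Y"
        by (rule LM_cmult[OF p(2)]) measurable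
      also have "4 * (LM (lebesgue_on I) ?p (\<lambda>t. sob (2 * M) (4 * M / (M - 1)) (2 powi (- k)) (v t)) + c1 * LM (lebesgue_on I) ?p Y)
          \<le> 4 * (40000 * Sn I M k v + c1 * (40000 * ?X))"
      proof (intro mult_left_mono add_mono mS(2))
        have "LM (lebesgue_on I) ?p Y \<le> 192 * ?X" using mY(2) unfolding Y_def[abs_def] .
        \<comment> \<open>192 is raised to 40000, the constant of \<open>sob_time\<close>, so that
          all terms share the factor 4 * 40000.\<close>
        also have "\<dots> \<le> 40000 * ?X" by (rule numeral_mult_mono) auto
        finally show "LM (lebesgue_on I) ?p Y \<le> 40000 * ?X" .
      qed auto
      \<comment> \<open>The <Omega> part of \<open>Sn\<close> joins the derivative terms under the
        common weight \<open>c1\<close>; its part in L^(4M/(M-1)) remains under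
        \<open>c2\<close>.\<close>
      also have "\<dots> = (4 * 40000) * (c1 * (?O v + ?X) + c2 * mixed_norm I (ennreal ?p) (ennreal (4 * M / (M - 1))) v)"
        unfolding Sn_def c1_def[symmetric] c2_def[symmetric] by (simp only: distrib_left mult_ac add_ac)
      also have "\<dots> \<le> (4 * 40000) * (c1 * B1n I M j k v + c2 * Bn I M (ennreal (4 * M / (M - 1))) j k v)"
        by (intro mult_left_mono add_mono X R) auto
      finally show "LM (lebesgue_on I) ?p G \<le> 160000 * (c1 * B1n I M j k v + c2 * Bn I M (ennreal (4 * M / (M - 1))) j k v)"
        by simp
      show "LM (lebesgue_on I) ?p F \<le> mixed_norm I (ennreal ?p) \<infinity> u" using mF(2) by simp
    qed auto
    also have "\<dots> = ennreal (C3 * \<kappa> * J * 160000) * ennreal (2 powr (- real_of_int j / M)) * mixed_norm I (ennreal ?p) \<infinity> u *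
        (c1 * B1n I M j k v + c2 * Bn I M (ennreal (4 * M / (M - 1))) j k v) * mixed_norm I \<infinity> 2 (LP_piece chi m \<phi>3)"
    proof -
      have "ennreal (C3 * \<kappa> * J * 160000) = ennreal (C3 * \<kappa> * J) * 160000"
        using J(1) C3(1) \<kappa> by (subst ennreal_mult) auto
      then show ?thesis by (simp only: mult_ac)
    qed
    finally show "mixed_norm I 1 2 (\<lambda>t x. LP_piece chi j \<phi>1 t x * LP_piece chi k \<phi>2 t x * LP_piece chi m \<phi>3 t x) \<le>
       ennreal (C3 * \<kappa> * J * 160000) * ennreal (2 powr (- real_of_int j / M)) * mixed_norm I (ennreal (2 * M / (M - 1))) \<infinity> (LP_piece chi j \<phi>1)
       * (ennreal (2 powr (3 * real_of_int k / (2 * M))) * B1n I M j k (LP_piece chi k \<phi>2)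
          + ennreal (2 powr (3 * real_of_int k * (M - 1) / (4 * M))) * Bn I M (ennreal (4 * M / (M - 1))) j k (LP_piece chi k \<phi>2))
       * mixed_norm I \<infinity> 2 (LP_piece chi m \<phi>3)"
      unfolding u_def v_def c1_def c2_def .
  qed
qed

text \<open>The first factor gains outside at its own scale b, the second inside by
  \<open>pointwise_product\<close>, where j <= k + C bounds its scale by a multiple of b.\<close>

lemma trilinear_estimate_4:
  assumes M: "40 \<le> M"
  obtains K where "K \<ge> 0"
    "\<And>I \<phi>1 \<phi>2 \<phi>3 j k m. \<lbrakk>is_interval I; tempered_on I \<phi>1; tempered_on I \<phi>2; tempered_on I \<phi>3;
       time_regular I (LP_piece chi k \<phi>2); j \<le> k + C\<rbrakk> \<Longrightarrow>
     mixed_norm I 1 2 (\<lambda>t x. LP_piece chi j \<phi>1 t x * LP_piece chi k \<phi>2 t x * LP_piece chi m \<phi>3 t x) \<le>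
       ennreal K * ennreal (2 powr (- real_of_int j / M)) * Sn I M j (LP_piece chi j \<phi>1)
       * Bn I M \<infinity> j k (LP_piece chi k \<phi>2) * mixed_norm I \<infinity> 2 (LP_piece chi m \<phi>3)"
proof -
  obtain C3 where C3: "C3 \<ge> 0"
    "\<And>a b \<kappa> t u v v' B V V' W x. \<lbrakk>localized1 b u; localized1 a v; a \<le> \<kappa> * b; 1 \<le> \<kappa>; continuous_on UNIV v'; \<And>n. continuous_on UNIV (B n);
       \<And>n y. B n y = y $ n *\<^sub>R v' y + t *\<^sub>R partial n v y;
       \<And>y. nv v y \<le> V; \<And>y. nv v' y \<le> V'; \<And>n y. nv (B n) y \<le> W n\<rbrakk> \<Longrightarrow>
     nv u x * nv v x \<le> ennreal (C3 * (\<kappa> * gdec (\<bar>t\<bar> / b))) * sob (2 * M) (4 * M / (M - 1)) b u *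
       (V + ennreal (a / b) * (\<Sum>n\<in>UNIV. W n) + ennreal a * V')"
    by (rule pointwise_product[OF exponents[OF M]]) (erule that, blast)
  obtain J where J: "J \<ge> 0"
    "\<And>I \<phi> m j M f h F G k w. \<lbrakk>is_interval I; tempered_on I \<phi>; w = LP_piece chi m \<phi>; 40 \<le> M; k \<ge> 0;
       F \<in> borel_measurable (lebesgue_on I); G \<in> borel_measurable (lebesgue_on I);
       AE t in lebesgue_on I. \<forall>x. nv (f t) x * nv (h t) x \<le> ennreal (k * gdec (\<bar>t\<bar> / 2 powi (- j))) * (F t * G t)\<rbrakk> \<Longrightarrow>
     mixed_norm I 1 2 (\<lambda>t x. f t x * h t x * w t x) \<le> ennreal (k * J) * ennreal (2 powr (- real_of_int j / M)) *
       (LM (lebesgue_on I) (2 * M / (M - 1)) F * LM (lebesgue_on I) (2 * M / (M - 1)) G) * mixed_norm I \<infinity> 2 w"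
    by (rule product_case) (erule that, blast)
  define \<kappa> where "\<kappa> = (2::real) powr real_of_int (max C 0)"
  have \<kappa>: "1 \<le> \<kappa>" unfolding \<kappa>_def by (rule one_le_kappa)
  let ?p = "2 * M / (M - 1)"
  have p: "1 \<le> ?p" "0 < ?p" using M by (auto simp: field_simps)
  show ?thesis
  proof (rule that[of "C3 * \<kappa> * J * (40000 * 768)"])
    show "0 \<le> C3 * \<kappa> * J * (40000 * 768)" using J(1) C3(1) \<kappa> by simp
    fix I \<phi>1 \<phi>2 \<phi>3 j k m
    assume I: "is_interval I" and \<phi>1: "tempered_on I \<phi>1" and \<phi>2: "tempered_on I \<phi>2" and \<phi>3: "tempered_on I \<phi>3"
      and reg: "time_regular I (LP_piece chi k \<phi>2)" and jk: "j \<le> k + C"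
    define u where "u = LP_piece chi j \<phi>1"
    define v where "v = LP_piece chi k \<phi>2"
    have reg': "time_regular I v" using reg by (simp add: v_def)
    define F where "F t = sob (2 * M) (4 * M / (M - 1)) (2 powi (- j)) (u t)" for t
    define V where "V t = Lp_norm \<infinity> lebesgue (nv (v t))" for t
    define Y where "Y t = ennreal (2 powr real_of_int (j - k)) * (\<Sum>n\<in>UNIV. Lp_norm \<infinity> lebesgue (nv (boost n v t)))
      + ennreal (2 powr real_of_int (- k)) * Lp_norm \<infinity> lebesgue (nv (dt v t))" for t
    define G where "G t = V t + Y t" for t
    have mF: "F \<in> borel_measurable (lebesgue_on I)" "LM (lebesgue_on I) ?p F \<le> 40000 * Sn I M j u"
      unfolding F_def by (rule sob_time[OF M I \<phi>1 u_def])+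
    have mV: "V \<in> borel_measurable (lebesgue_on I)" "LM (lebesgue_on I) ?p V = mixed_norm I (ennreal ?p) \<infinity> v"
      unfolding V_def v_def by (rule sup_time[OF M I piece_Car(1)[OF I \<phi>2]])+
    have mY: "Y \<in> borel_measurable (lebesgue_on I)" "LM (lebesgue_on I) ?p Y \<le> 192 * (ennreal (2 powr real_of_int (j - k)) * (MAX n. mixed_norm I (ennreal ?p) \<infinity> (boost n v)) + ennreal (2 powr real_of_int (- k)) * mixed_norm I (ennreal ?p) \<infinity> (dt v))"
      unfolding Y_def by (rule LM_derivatives_le[OF M I disjI1[OF refl] \<phi>2 v_def reg'])+
    note [measurable] = mV(1) mY(1)
    have mG: "G \<in> borel_measurable (lebesgue_on I)" unfolding G_def by measurable
    note car = piece_Car_time[OF I \<phi>2, of k, folded v_def, OF reg']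
    have aeB: "AE t in lebesgue_on I. \<forall>n. continuous_on UNIV (boost n v t)"
      using car(2) by (subst AE_all_countable) (auto simp: Car_def)
    have aeV: "AE t in lebesgue_on I. continuous_on UNIV (dt v t)" using car(1) by (simp add: Car_def)
    have "AE t in lebesgue_on I. \<forall>x. nv (u t) x * nv (v t) x \<le> ennreal (C3 * \<kappa> * gdec (\<bar>t\<bar> / 2 powi (- j))) * (F t * G t)"
      using aeB aeV AE_space
    proof eventually_elim
      case (elim t)
      then have t: "t \<in> I" by simp
      show ?case
      proof
        fix x
        have "nv (u t) x * nv (v t) x \<le> ennreal (C3 * (\<kappa> * gdec (\<bar>t\<bar> / 2 powi (- j)))) * sob (2 * M) (4 * M / (M - 1)) (2 powi (- j)) (u t) *
           (V t + ennreal (2 powi (- k) / 2 powi (- j)) * (\<Sum>n\<in>UNIV. Lp_norm \<infinity> lebesgue (nv (boost n v t))) + ennreal (2 powi (- k)) * Lp_norm \<infinity> lebesgue (nv (dt v t)))"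
        proof (rule C3(2))
          show "localized1 (2 powi (- j)) (u t)" unfolding u_def by (rule piece_localized1[OF \<phi>1 t])
          show "localized1 (2 powi (- k)) (v t)" unfolding v_def by (rule piece_localized1[OF \<phi>2 t])
          show "2 powi (- k) \<le> \<kappa> * 2 powi (- j)" unfolding \<kappa>_def by (rule scale_le[OF jk])
          show "nv (v t) y \<le> V t" for y unfolding v_def V_def by (rule piece_le_sup[OF \<phi>2 t])
          show "nv (dt v t) y \<le> Lp_norm \<infinity> lebesgue (nv (dt v t))" for y by (rule nv_le_esssup) (use elim in blast)
          show "nv (boost n v t) y \<le> Lp_norm \<infinity> lebesgue (nv (boost n v t))" for n y by (rule nv_le_esssup) (use elim in blast)
        qed (use elim \<kappa> in \<open>auto simp: boost_eq\<close>)
        then show "nv (u t) x * nv (v t) x \<le> ennreal (C3 * \<kappa> * gdec (\<bar>t\<bar> / 2 powi (- j))) * (F t * G t)"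
          unfolding scale_ratio F_def G_def Y_def unfolding two_powi[of "- k"] by (simp add: mult.assoc add.assoc)
      qed
    qed
    then have "mixed_norm I 1 2 (\<lambda>t x. u t x * v t x * LP_piece chi m \<phi>3 t x) \<le> ennreal (C3 * \<kappa> * J) * ennreal (2 powr (- real_of_int j / M)) *
       (LM (lebesgue_on I) ?p F * LM (lebesgue_on I) ?p G) * mixed_norm I \<infinity> 2 (LP_piece chi m \<phi>3)"
      using C3(1) \<kappa> by (intro J(2)[OF I \<phi>3 refl M _ mF(1) mG]) auto
    also have "\<dots> \<le> ennreal (C3 * \<kappa> * J) * ennreal (2 powr (- real_of_int j / M)) *
       ((40000 * Sn I M j u) * (768 * Bn I M \<infinity> j k v)) * mixed_norm I \<infinity> 2 (LP_piece chi m \<phi>3)"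
    proof (intro mult_right_mono mult_left_mono mult_mono mF(2))
      let ?X = "ennreal (2 powr real_of_int (j - k)) * (MAX n. mixed_norm I (ennreal ?p) \<infinity> (boost n v)) + ennreal (2 powr real_of_int (- k)) * mixed_norm I (ennreal ?p) \<infinity> (dt v)"
      have X: "mixed_norm I (ennreal ?p) \<infinity> v + ?X \<le> Bn I M \<infinity> j k v"
        unfolding Bn_def add.assoc
        by (intro add_left_mono add_right_mono mult_left_mono Max_le_norm_L) auto
      have "LM (lebesgue_on I) ?p G \<le> 4 * (LM (lebesgue_on I) ?p V + LM (lebesgue_on I) ?p Y)"
        unfolding G_def[abs_def] by (rule LM_add_le[OF _ _ p(1)]) measurable
      also have "\<dots> \<le> 4 * (192 * mixed_norm I (ennreal ?p) \<infinity> v + 192 * ?X)"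
        unfolding mV(2) by (intro mult_left_mono add_mono mY(2) ennreal_le_numeral_mult) auto
      also have "\<dots> = (4 * 192) * (mixed_norm I (ennreal ?p) \<infinity> v + ?X)"
        by (simp only: distrib_left mult_ac)
      also have "\<dots> \<le> (4 * 192) * Bn I M \<infinity> j k v" by (intro mult_left_mono X) auto
      finally show "LM (lebesgue_on I) ?p G \<le> 768 * Bn I M \<infinity> j k v" by simp
    qed auto
    also have "\<dots> = ennreal (C3 * \<kappa> * J * (40000 * 768)) * ennreal (2 powr (- real_of_int j / M)) * Sn I M j u *
        Bn I M \<infinity> j k v * mixed_norm I \<infinity> 2 (LP_piece chi m \<phi>3)"
    proof -
      have "ennreal (C3 * \<kappa> * J * (40000 * 768)) = ennreal (C3 * \<kappa> * J) * (40000 * 768)"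
        using J(1) C3(1) \<kappa> by (subst ennreal_mult) auto
      then show ?thesis by (simp only: mult_ac)
    qed
    finally show "mixed_norm I 1 2 (\<lambda>t x. LP_piece chi j \<phi>1 t x * LP_piece chi k \<phi>2 t x * LP_piece chi m \<phi>3 t x) \<le>
       ennreal (C3 * \<kappa> * J * (40000 * 768)) * ennreal (2 powr (- real_of_int j / M)) * Sn I M j (LP_piece chi j \<phi>1)
       * Bn I M \<infinity> j k (LP_piece chi k \<phi>2) * mixed_norm I \<infinity> 2 (LP_piece chi m \<phi>3)"
      unfolding u_def v_def .
  qed
qed

end

theorem lemma5p3:
  fixes chi :: "real^3 \<Rightarrow> real"
  assumes "LP_cutoff chi"
  shows "\<exists>M\<^sub>0::real. \<forall>M\<ge>M\<^sub>0. \<forall>C::int. \<exists>K::real. \<forall>I \<phi>1 \<phi>2 \<phi>3. \<forall>j k m :: int.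
    is_interval I \<and> tempered_on I \<phi>1 \<and> tempered_on I \<phi>2 \<and> tempered_on I \<phi>3 \<and>
    time_regular I (LP_piece chi k \<phi>2) \<and> time_regular I (LP_piece chi m \<phi>3) \<longrightarrow>
    (let u = LP_piece chi j \<phi>1; v = LP_piece chi k \<phi>2; w = LP_piece chi m \<phi>3;
         p = ennreal (2 * M / (M - 1)); q = ennreal (2 * M); r = ennreal (4 * M / (M - 1));
         lhs = mixed_norm I 1 2 (\<lambda>t x. u t x * v t x * w t x);
         A = mixed_norm I \<infinity> 2 w
             + ennreal (2 powr (j - m)) * norm_L (mixed_norm I \<infinity> 2) w
             + ennreal (2 powr (- m)) * mixed_norm I \<infinity> 2 (dt w);
         B1 = norm_Omega (mixed_norm I p q) v
             + ennreal (2 powr (j - k)) * norm_L (norm_Omega (mixed_norm I p q)) v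
             + ennreal (2 powr (- k)) * norm_Omega (mixed_norm I p q) (dt v);
         B2 = mixed_norm I p r v
             + ennreal (2 powr (j - k)) * norm_L (mixed_norm I p r) v
             + ennreal (2 powr (- k)) * mixed_norm I p r (dt v);
         B3 = mixed_norm I p \<infinity> v
             + ennreal (2 powr (j - k)) * norm_L (mixed_norm I p \<infinity>) v
             + ennreal (2 powr (- k)) * mixed_norm I p \<infinity> (dt v)
     in
      (j \<le> k + C \<and> j \<le> m + C \<longrightarrow>
        lhs \<le> ennreal K * ennreal (2 powr (- j / M)) * mixed_norm I p \<infinity> u
              * (ennreal (2 powr (3 * k / (2 * M))) * norm_Omega (mixed_norm I p q) v
                 + ennreal (2 powr (3 * k * (M - 1) / (4 * M))) * mixed_norm I p r v)
              * A) \<and>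
      (j \<le> m + C \<longrightarrow>
        lhs \<le> ennreal K * ennreal (2 powr (- j / M))
              * (ennreal (2 powr (3 * j / (2 * M))) * norm_Omega (mixed_norm I p q) u
                 + ennreal (2 powr (3 * j * (M - 1) / (4 * M))) * mixed_norm I p r u)
              * mixed_norm I p \<infinity> v * A) \<and>
      (j \<le> k + C \<longrightarrow>
        lhs \<le> ennreal K * ennreal (2 powr (- j / M)) * mixed_norm I p \<infinity> u
              * (ennreal (2 powr (3 * k / (2 * M))) * B1
                 + ennreal (2 powr (3 * k * (M - 1) / (4 * M))) * B2)
              * mixed_norm I \<infinity> 2 w) \<and>
      (j \<le> k + C \<longrightarrow>
        lhs \<le> ennreal K * ennreal (2 powr (- j / M))
              * (ennreal (2 powr (3 * j / (2 * M))) * norm_Omega (mixed_norm I p q) u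
                 + ennreal (2 powr (3 * j * (M - 1) / (4 * M))) * mixed_norm I p r u)
              * B3 * mixed_norm I \<infinity> 2 w))"
proof -
  interpret LP chi by unfold_locales (rule assms)
  show ?thesis
  \<comment> \<open>40 = 2 * 20: \<open>gdec\<close> decays like T^(-1/20), and its M-th power is
    compared with T^(-2).\<close>
  proof (rule exI[of _ "40::real"], intro allI impI, goal_cases)
    case (1 M C)
    then have M: "40 \<le> M" .
    obtain K1 where K1: "K1 \<ge> 0"
      "\<And>I \<phi>1 \<phi>2 \<phi>3 j k m. \<lbrakk>is_interval I; tempered_on I \<phi>1; tempered_on I \<phi>2; tempered_on I \<phi>3;
       time_regular I (LP_piece chi m \<phi>3); j \<le> k + C; j \<le> m + C\<rbrakk> \<Longrightarrow>
     mixed_norm I 1 2 (\<lambda>t x. LP_piece chi j \<phi>1 t x * LP_piece chi k \<phi>2 t x * LP_piece chi m \<phi>3 t x) \<le>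
       ennreal K1 * ennreal (2 powr (- real_of_int j / M)) * mixed_norm I (ennreal (2 * M / (M - 1))) \<infinity> (LP_piece chi j \<phi>1)
       * Sn I M k (LP_piece chi k \<phi>2) * An I j m (LP_piece chi m \<phi>3)"
      by (rule trilinear_estimate_1[OF M]) (erule that, blast)
    obtain K2 where K2: "K2 \<ge> 0"
      "\<And>I \<phi>1 \<phi>2 \<phi>3 j k m. \<lbrakk>is_interval I; tempered_on I \<phi>1; tempered_on I \<phi>2; tempered_on I \<phi>3;
       time_regular I (LP_piece chi m \<phi>3); j \<le> m + C\<rbrakk> \<Longrightarrow>
     mixed_norm I 1 2 (\<lambda>t x. LP_piece chi j \<phi>1 t x * LP_piece chi k \<phi>2 t x * LP_piece chi m \<phi>3 t x) \<le>
       ennreal K2 * ennreal (2 powr (- real_of_int j / M)) * Sn I M j (LP_piece chi j \<phi>1)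
       * mixed_norm I (ennreal (2 * M / (M - 1))) \<infinity> (LP_piece chi k \<phi>2) * An I j m (LP_piece chi m \<phi>3)"
      by (rule trilinear_estimate_2[OF M]) (erule that, blast)
    obtain K3 where K3: "K3 \<ge> 0"
      "\<And>I \<phi>1 \<phi>2 \<phi>3 j k m. \<lbrakk>is_interval I; tempered_on I \<phi>1; tempered_on I \<phi>2; tempered_on I \<phi>3;
       time_regular I (LP_piece chi k \<phi>2); j \<le> k + C\<rbrakk> \<Longrightarrow>
     mixed_norm I 1 2 (\<lambda>t x. LP_piece chi j \<phi>1 t x * LP_piece chi k \<phi>2 t x * LP_piece chi m \<phi>3 t x) \<le>
       ennreal K3 * ennreal (2 powr (- real_of_int j / M)) * mixed_norm I (ennreal (2 * M / (M - 1))) \<infinity> (LP_piece chi j \<phi>1)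
       * (ennreal (2 powr (3 * real_of_int k / (2 * M))) * B1n I M j k (LP_piece chi k \<phi>2)
          + ennreal (2 powr (3 * real_of_int k * (M - 1) / (4 * M))) * Bn I M (ennreal (4 * M / (M - 1))) j k (LP_piece chi k \<phi>2))
       * mixed_norm I \<infinity> 2 (LP_piece chi m \<phi>3)"
      by (rule trilinear_estimate_3[OF M]) (erule that, blast)
    obtain K4 where K4: "K4 \<ge> 0"
      "\<And>I \<phi>1 \<phi>2 \<phi>3 j k m. \<lbrakk>is_interval I; tempered_on I \<phi>1; tempered_on I \<phi>2; tempered_on I \<phi>3;
       time_regular I (LP_piece chi k \<phi>2); j \<le> k + C\<rbrakk> \<Longrightarrow>
     mixed_norm I 1 2 (\<lambda>t x. LP_piece chi j \<phi>1 t x * LP_piece chi k \<phi>2 t x * LP_piece chi m \<phi>3 t x) \<le>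
       ennreal K4 * ennreal (2 powr (- real_of_int j / M)) * Sn I M j (LP_piece chi j \<phi>1)
       * Bn I M \<infinity> j k (LP_piece chi k \<phi>2) * mixed_norm I \<infinity> 2 (LP_piece chi m \<phi>3)"
      by (rule trilinear_estimate_4[OF M]) (erule that, blast)
    \<comment> \<open>The four constants are obtained for given M and C, before the interval, the
      functions and the frequencies are fixed, so their maximum is admissible.\<close>
    define K where "K = max (max K1 K2) (max K3 K4)"
    have K: "K1 \<le> K" "K2 \<le> K" "K3 \<le> K" "K4 \<le> K"
      unfolding K_def by auto
    have enlarge: "X \<le> ennreal K * a * b * c * d" if "X \<le> ennreal L * a * b * c * d" "L \<le> K" for X a b c d L
      by (rule order_trans[OF that(1)]) (intro mult_right_mono ennreal_leI that(2), auto)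
    note defs = Sn_def An_def B1n_def Bn_def of_int_mult of_int_minus of_int_numeral
    show ?case
    proof (rule exI[of _ K], intro allI impI, elim conjE, unfold Let_def, intro conjI impI, goal_cases)
      case (1 I \<phi>1 \<phi>2 \<phi>3 j k m)
      then show ?case using enlarge[OF K1(2)[of I \<phi>1 \<phi>2 \<phi>3 m j k] K(1)] unfolding defs by simp
    next
      case (2 I \<phi>1 \<phi>2 \<phi>3 j k m)
      then show ?case using enlarge[OF K2(2)[of I \<phi>1 \<phi>2 \<phi>3 m j k] K(2)] unfolding defs by simp
    next
      case (3 I \<phi>1 \<phi>2 \<phi>3 j k m)
      then show ?case using enlarge[OF K3(2)[of I \<phi>1 \<phi>2 \<phi>3 k j m] K(3)] unfolding defs by simp
    next
      case (4 I \<phi>1 \<phi>2 \<phi>3 j k m)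
      then show ?case using enlarge[OF K4(2)[of I \<phi>1 \<phi>2 \<phi>3 k j m] K(4)] unfolding defs by simp
    qed
  qed
qed

end
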